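(* Let $N\ge1$, $1<p<\infty$, and let $\Lambda\in M_p(\mathbb R^N)$ satisfy $\operatorname{supp}\Lambda\subseteq[-M,M]^N$ for some $M>0$. For $\phi\in M_p^{(w)}(\mathbb Z^N)$ define $$W_{\phi,\Lambda}(\xi)=\sum_{n\in\mathbb Z^N}\phi(n)\Lambda(\xi-n),\qquad \xi\in\mathbb R^N.$$ Then there is a constant $C_\Lambda$ depending on $\Lambda$ (with $p$ and $N$ fixed) but not on $\phi$ such that, for every $\phi\in M_p^{(w)}(\mathbb Z^N)$, $W_{\phi,\Lambda}\in M_p^{(w)}(\mathbb R^N)$ and $$N_p^{(w)}(W_{\phi,\Lambda})\le C_\Lambda\,N_p^{(w)}(\phi)\,\|\Lambda\|_{M_p(\mathbb R^N)}.$$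
   Context: Let $G$ be a locally compact abelian group with Haar measure $\mu$ and dual group $\hat G$ (here $G=\mathbb R^N$, $\hat G=\mathbb R^N$, or $G=\mathbb T^N\cong[0,1)^N$, $\hat G=\mathbb Z^N$, with Lebesgue measure; on $\mathbb R^N$ the Fourier transform is $\hat f(\xi)=\int f(x)e^{-2\pi i\xi\cdot x}dx$). $M_p(\hat G)$ is the space of (strong) $L^p$ multipliers: those $\phi\in L^\infty(\hat G)$ for which there is a bounded operator $T_\phi:L^p(G)\to L^p(G)$ with $(T_\phi f)^\wedge=\phi\hat f$ for all $f\in L^2\cap L^p(G)$; $\|\phi\|_{M_p(\hat G)}$ is the operator norm of $T_\phi$. $M_p^{(w)}(\hat G)$ is the space of multipliers of weak type $(p,p)$: those $\phi\in L^\infty(\hat G)$ for which there is a translation-invariant operator $T_\phi:L^p(G)\to L^{p,\infty}(G)$ with $(T_\phi f)^\wedge=\phi\hat f$ for all $f\in L^2\cap L^p(G)$ and a constant $K$ with $\mu\{x\in G:|T_\phi f(x)|>t\}\le\frac{K^p}{t^p}\|f\|_p^p$ for all $f\in L^p(G)$, $t>0$; $N_p^{(w)}(\phi)$ is the smallest such $K$. *)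

theory Defs
  imports "HOL-Analysis.Analysis"
begin

(* Elements of L^p are represented by Borel functions; identities between them are stated
   almost everywhere. *)

definition Lp :: "'a measure \<Rightarrow> real \<Rightarrow> ('a \<Rightarrow> complex) set" where
  "Lp M p = {f. f \<in> borel_measurable M \<and> integrable M (\<lambda>x. norm (f x) powr p)}"

definition Lp_norm :: "'a measure \<Rightarrow> real \<Rightarrow> ('a \<Rightarrow> complex) \<Rightarrow> real" where
  "Lp_norm M p f = (LINT x|M. norm (f x) powr p) powr (1 / p)"

definition Linf :: "'a measure \<Rightarrow> ('a \<Rightarrow> complex) set" where
  "Linf M = {f. f \<in> borel_measurable M \<and> (\<exists>B. AE x in M. norm (f x) \<le> B)}"

definition weak_Lp :: "'a measure \<Rightarrow> real \<Rightarrow> ('a \<Rightarrow> complex) set" where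
  "weak_Lp M p = {f. f \<in> borel_measurable M \<and>
     (\<exists>A\<ge>0. \<forall>t>0. emeasure M {x \<in> space M. norm (f x) > t} \<le> ennreal (A powr p / t powr p))}"

(* The data of a locally compact abelian group G entering the definition of a multiplier.
   transform G f g means that f is in L^2(G) and g represents its (Plancherel) Fourier transform. *)
record ('a, 'b) lca =
  haar :: "'a measure"
  diff :: "'a \<Rightarrow> 'a \<Rightarrow> 'a"
  dual_haar :: "'b measure"
  transform :: "('a \<Rightarrow> complex) \<Rightarrow> ('b \<Rightarrow> complex) \<Rightarrow> bool"

definition fourier_R :: "(real^'n \<Rightarrow> complex) \<Rightarrow> real^'n \<Rightarrow> complex" where
  "fourier_R f \<xi> = (LINT x|lborel. f x * cis (- 2 * pi * (\<xi> \<bullet> x)))"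

(* The Fourier transform on L^2(R^N): the L^2 limit, as R tends to infinity, of the transforms of
   the truncations of f to balls of radius R, which are integrable. *)
definition plancherel_R :: "(real^'n \<Rightarrow> complex) \<Rightarrow> (real^'n \<Rightarrow> complex) \<Rightarrow> bool" where
  "plancherel_R f g \<longleftrightarrow> f \<in> Lp lborel 2 \<and> g \<in> Lp lborel 2 \<and>
     ((\<lambda>R. \<integral>\<^sup>+ \<xi>. ennreal ((norm (fourier_R (\<lambda>x. if norm x \<le> R then f x else 0) \<xi> - g \<xi>))\<^sup>2)
            \<partial>lborel) \<longlongrightarrow> 0) at_top"

definition Euclid :: "(real^'n, real^'n) lca" where
  "Euclid = \<lparr> haar = lborel, diff = (-), dual_haar = lborel, transform = plancherel_R \<rparr>"

definition of_int_vec :: "int^'n \<Rightarrow> real^'n" where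
  "of_int_vec n = (\<chi> i. of_int (n $ i))"

(* [0,1)^N with Lebesgue measure; the values of a function outside this set play no role. *)
definition torus_measure :: "(real^'n) measure" where
  "torus_measure = restrict_space lborel {x. \<forall>i. 0 \<le> x $ i \<and> x $ i < 1}"

definition fourier_T :: "(real^'n \<Rightarrow> complex) \<Rightarrow> int^'n \<Rightarrow> complex" where
  "fourier_T f n = (LINT x|torus_measure. f x * cis (- 2 * pi * (of_int_vec n \<bullet> x)))"

definition Torus :: "(real^'n, int^'n) lca" where
  "Torus = \<lparr> haar = torus_measure, diff = (\<lambda>x y. \<chi> i. frac (x $ i - y $ i)),
     dual_haar = count_space UNIV,
     transform = (\<lambda>f g. f \<in> Lp torus_measure 2 \<and> g = fourier_T f) \<rparr>"

(* T is linear on L^p(G), and T f has transform phi times that of f for f in both L^2 and L^p. *)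
definition realizes :: "('a, 'b) lca \<Rightarrow> real \<Rightarrow> ('b \<Rightarrow> complex) \<Rightarrow>
    (('a \<Rightarrow> complex) \<Rightarrow> ('a \<Rightarrow> complex)) \<Rightarrow> bool" where
  "realizes G p \<phi> T \<longleftrightarrow>
     (\<forall>f\<in>Lp (haar G) p. \<forall>g\<in>Lp (haar G) p. \<forall>a b.
        AE x in haar G. T (\<lambda>x. a * f x + b * g x) x = a * T f x + b * T g x) \<and>
     (\<forall>f\<in>Lp (haar G) 2 \<inter> Lp (haar G) p.
        \<exists>h. transform G f h \<and> transform G (T f) (\<lambda>\<xi>. \<phi> \<xi> * h \<xi>))"

definition strong_bound :: "('a, 'b) lca \<Rightarrow> real \<Rightarrow> (('a \<Rightarrow> complex) \<Rightarrow> ('a \<Rightarrow> complex)) \<Rightarrow>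
    real \<Rightarrow> bool" where
  "strong_bound G p T K \<longleftrightarrow> 0 \<le> K \<and>
     (\<forall>f\<in>Lp (haar G) p. T f \<in> Lp (haar G) p \<and>
        Lp_norm (haar G) p (T f) \<le> K * Lp_norm (haar G) p f)"

definition Mp :: "('a, 'b) lca \<Rightarrow> real \<Rightarrow> ('b \<Rightarrow> complex) set" where
  "Mp G p = {\<phi> \<in> Linf (dual_haar G). \<exists>T K. realizes G p \<phi> T \<and> strong_bound G p T K}"

(* For 1 < p < infinity the operator T is determined by phi up to null sets, so that this is the
   operator norm of T; the same remark applies to Mpw_norm. *)
definition Mp_norm :: "('a, 'b) lca \<Rightarrow> real \<Rightarrow> ('b \<Rightarrow> complex) \<Rightarrow> real" where
  "Mp_norm G p \<phi> = Inf {K. \<exists>T. realizes G p \<phi> T \<and> strong_bound G p T K}"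

definition translation_invariant :: "('a, 'b) lca \<Rightarrow> real \<Rightarrow>
    (('a \<Rightarrow> complex) \<Rightarrow> ('a \<Rightarrow> complex)) \<Rightarrow> bool" where
  "translation_invariant G p T \<longleftrightarrow>
     (\<forall>f\<in>Lp (haar G) p. \<forall>y\<in>space (haar G).
        AE x in haar G. T (\<lambda>x. f (diff G x y)) x = T f (diff G x y))"

definition weak_bound :: "('a, 'b) lca \<Rightarrow> real \<Rightarrow> (('a \<Rightarrow> complex) \<Rightarrow> ('a \<Rightarrow> complex)) \<Rightarrow>
    real \<Rightarrow> bool" where
  "weak_bound G p T K \<longleftrightarrow> 0 \<le> K \<and>
     (\<forall>f\<in>Lp (haar G) p. T f \<in> weak_Lp (haar G) p \<and>
        (\<forall>t>0. emeasure (haar G) {x \<in> space (haar G). norm (T f x) > t}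
               \<le> ennreal (K powr p / t powr p * Lp_norm (haar G) p f powr p)))"

definition Mpw :: "('a, 'b) lca \<Rightarrow> real \<Rightarrow> ('b \<Rightarrow> complex) set" where
  "Mpw G p = {\<phi> \<in> Linf (dual_haar G).
     \<exists>T K. realizes G p \<phi> T \<and> translation_invariant G p T \<and> weak_bound G p T K}"

definition Mpw_norm :: "('a, 'b) lca \<Rightarrow> real \<Rightarrow> ('b \<Rightarrow> complex) \<Rightarrow> real" where
  "Mpw_norm G p \<phi> =
     Inf {K. \<exists>T. realizes G p \<phi> T \<and> translation_invariant G p T \<and> weak_bound G p T K}"

(* The support of an L^infinity class: the complement of the largest open set on which it
   vanishes almost everywhere. *)
definition ess_support :: "(real^'n \<Rightarrow> complex) \<Rightarrow> (real^'n) set" where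
  "ess_support f = - \<Union>{U. open U \<and> (AE x in lborel. x \<in> U \<longrightarrow> f x = 0)}"

(* For almost every argument the sum below has only finitely many nonzero terms when the
   essential support of Lambda is bounded. *)
definition W :: "(int^'n \<Rightarrow> complex) \<Rightarrow> (real^'n \<Rightarrow> complex) \<Rightarrow> real^'n \<Rightarrow> complex" where
  "W \<phi> \<Lambda> \<xi> = (\<Sum>\<^sub>\<infinity>n\<in>UNIV. \<phi> n * \<Lambda> (\<xi> - of_int_vec n))"

end

theory Submission
  imports Defs
begin

text \<open>
  Let \<open>\<kappa>\<close> be the inverse Fourier transform of \<open>\<Lambda>\<close>, let \<open>S\<close> be an operator on the torus with multiplier \<open>\<phi>\<close>, and
  write \<open>e(t)\<close> for \<open>exp(2\<pi>it)\<close>. To a function \<open>f\<close> on \<open>\<real>\<^sup>N\<close> associate the functions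
  \<open>F(y,\<theta>) = \<Sum>k. f(\<theta>+k) \<kappa>(y-\<theta>-k)\<close> on the torus, one for each \<open>y\<close>. If \<open>h\<close> is the Fourier transform of \<open>f\<close>, the
  coefficient of \<open>F(y,\<theta>)\<close> of frequency \<open>n\<close> in \<open>\<theta>\<close> is \<open>\<integral> h(\<xi>+n) \<Lambda>(\<xi>) e(\<xi>\<cdot>y) d\<xi>\<close>. Applying \<open>S\<close> in the variable \<open>\<theta>\<close>
  multiplies it by \<open>\<phi>(n)\<close>, and putting \<open>\<theta> = y\<close> afterwards multiplies it by \<open>e(n\<cdot>y)\<close> and sums over \<open>n\<close>. The result is
  \<open>\<integral> W(\<eta>) h(\<eta>) e(\<eta>\<cdot>y) d\<eta>\<close>. Hence the operator with multiplier \<open>W\<close> is: apply \<open>S\<close> to \<open>F(y,\<theta>)\<close> in \<open>\<theta>\<close>, and evaluate on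
  the diagonal.

  The diagonal is a null set, and a weak-type bound for each \<open>y\<close> says nothing about it directly. But \<open>F\<close> is band-limited
  in \<open>y\<close>, with the fixed band \<open>[-M,M]\<^sup>N\<close>, so its value at \<open>y = x\<close> is a combination of the values at the points \<open>y = m/q\<close> of a
  finer lattice, \<open>q > 8M\<close>, with coefficients \<open>kernel(qx-m)\<close> that decay quadratically in each coordinate
  (\<^verbatim>\<open>kernel_sampling\<close>, \<^verbatim>\<open>scaled_sampling\<close>). This leads to the definition
  \<open>TW f(x) = \<Sum>m. kernel(qx-m) \<cdot> S(F(m/q,\<cdot>))(x mod \<int>\<^sup>N)\<close>, which involves only countably many functions on the torus.

  For the weak-type bound put \<open>x = u + j\<close> with \<open>u\<close> in the unit cell, and \<open>m = l + qj\<close>. The coefficients are then bounded by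
  a summable function of \<open>l\<close> alone. If \<open>\<bar>TW f(x)\<bar> > t\<close>, then \<open>S(F(l/q+j,\<cdot>))\<close> is large at \<open>u\<close> for some \<open>l\<close>, with thresholds
  in \<open>l\<close> that may be prescribed by any summable weight; the weak type of \<open>S\<close> is applied to each pair \<open>(l,j)\<close>. The bounds
  are summable over \<open>l\<close> for a suitable weight, because \<open>p > 1\<close> (\<^verbatim>\<open>not_dominated_measure\<close>, \<^verbatim>\<open>TW_weak\<close>). The sum over \<open>j\<close> is
  controlled by \<open>\<Sum>j. \<parallel>F(l/q+j,\<cdot>)\<parallel>\<^sup>p \<le> (c \<parallel>\<Lambda>\<parallel>)\<^sup>p \<parallel>f\<parallel>\<^sup>p\<close>, in which \<open>\<parallel>\<Lambda>\<parallel>\<close> is the strong multiplier norm. For fixed \<open>\<theta>\<close> this is a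
  bound on \<open>\<ell>\<^sup>p\<close> for the convolution with samples of \<open>\<kappa>\<close>. It holds because an operator with multiplier \<open>\<Lambda>\<close> maps
  \<open>\<Sum>k. a(k) \<Psi>(x-k)\<close> to \<open>\<Sum>k. a(k) \<kappa>(x-k)\<close> if \<open>\<Psi>\<close> is an integrable function with transform 1 on the support of \<open>\<Lambda>\<close>, and
  because sampling a band-limited function is bounded from \<open>L\<^sup>p\<close> to \<open>\<ell>\<^sup>p\<close> (\<^verbatim>\<open>discrete_convolution_finite\<close>,
  \<^verbatim>\<open>discrete_convolution\<close>).

  That \<open>TW\<close> has the multiplier \<open>W\<close> is seen by pairing with square-integrable functions of bounded support
  (\<^verbatim>\<open>TW_pairing\<close>): Parseval's identity on the torus for each \<open>m\<close> makes the computation of the first paragraph rigorous, and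
  the sampling formula carries out the sum over \<open>m\<close>. Parseval's identity comes from the Stone-Weierstrass theorem
  (\<^verbatim>\<open>parseval_torus\<close>). Plancherel's theorem on \<open>\<real>\<^sup>N\<close> follows from it by periodization, and the Plancherel transform is
  characterized by its pairings (\<^verbatim>\<open>plancherel_L2c\<close>, \<^verbatim>\<open>plancherel_R_from_pairing\<close>). On \<open>L\<^sup>2 \<inter> L\<^sup>p\<close> the multiplier determines
  the operator up to null sets, hence \<open>TW\<close> commutes with translations there, and on all of \<open>L\<^sup>p\<close> by density and the weak
  bound (\<^verbatim>\<open>TW_translate\<close>).

  The constant so obtained depends on \<open>N\<close>, \<open>p\<close> and \<open>q\<close> only. It serves all admissible bounds of \<open>\<phi>\<close> and of \<open>\<Lambda>\<close> at once, which
  gives the inequality between the infima.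
\<close>

section \<open>Lebesgue spaces over an arbitrary measure\<close>

lemma borel_measurable_cnj [measurable (raw)]:
  "f \<in> borel_measurable M \<Longrightarrow> (\<lambda>x. cnj (f x)) \<in> borel_measurable M"
  by (rule measurable_compose[OF _ borel_measurable_continuous_onI[OF continuous_on_cnj[OF continuous_on_id]]])

lemma Lp_2_iff: "f \<in> Lp M 2 \<longleftrightarrow> f \<in> borel_measurable M \<and> integrable M (\<lambda>x. (norm (f x))\<^sup>2)"
  by (simp add: Lp_def)

lemma Lp_measurable: "f \<in> Lp M p \<Longrightarrow> f \<in> borel_measurable M"
  by (simp add: Lp_def)

lemma Lp_integrable: "f \<in> Lp M p \<Longrightarrow> integrable M (\<lambda>x. norm (f x) powr p)"
  by (simp add: Lp_def)

lemma Lp_bounded_by: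
  assumes "g \<in> Lp M p" "f \<in> borel_measurable M" "AE x in M. norm (f x) \<le> norm (g x)" "p > 0"
  shows "f \<in> Lp M p"
proof -
  have "integrable M (\<lambda>x. norm (f x) powr p)"
    by (rule Bochner_Integration.integrable_bound[OF Lp_integrable[OF assms(1)]])
       (use assms in \<open>auto intro!: powr_mono2 elim!: eventually_mono\<close>)
  then show ?thesis using assms by (simp add: Lp_def)
qed

lemma powr_add_le:
  fixes a b p :: real
  assumes "p > 0" "a \<ge> 0" "b \<ge> 0"
  shows "(a + b) powr p \<le> 2 powr p * (a powr p + b powr p)"
proof -
  have "(a + b) powr p \<le> (2 * max a b) powr p"
    using assms by (intro powr_mono2) auto
  also have "\<dots> = 2 powr p * max a b powr p" using assms by (simp add: powr_mult)
  also have "max a b powr p \<le> a powr p + b powr p" by (simp add: max_def)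
  finally show ?thesis by simp
qed

lemma Lp_add:
  assumes "f \<in> Lp M p" "g \<in> Lp M p" "p > 0"
  shows "(\<lambda>x. f x + g x) \<in> Lp M p"
proof -
  have [measurable]: "f \<in> borel_measurable M" "g \<in> borel_measurable M"
    using assms by (auto intro: Lp_measurable)
  have "integrable M (\<lambda>x. 2 powr p * (norm (f x) powr p + norm (g x) powr p))"
    using assms by (intro integrable_mult_right Bochner_Integration.integrable_add Lp_integrable)
  then have "integrable M (\<lambda>x. norm (f x + g x) powr p)"
  proof (rule Bochner_Integration.integrable_bound, goal_cases)
    case 2
    have "norm (f x + g x) powr p \<le> 2 powr p * (norm (f x) powr p + norm (g x) powr p)" for x
      using powr_mono2[OF less_imp_le[OF assms(3)] norm_ge_zero norm_triangle_ineq[of "f x" "g x"]]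
        powr_add_le[OF assms(3), of "norm (f x)" "norm (g x)"] by auto
    then show ?case by auto
  qed simp
  then show ?thesis by (simp add: Lp_def)
qed

lemma Lp_cmult:
  assumes "f \<in> Lp M p"
  shows "(\<lambda>x. c * f x) \<in> Lp M p"
  using assms unfolding Lp_def by (auto simp: norm_mult powr_mult)

lemma Lp_lincomb:
  assumes "f \<in> Lp M p" "g \<in> Lp M p" "p > 0"
  shows "(\<lambda>x. a * f x + b * g x) \<in> Lp M p"
  using assms by (intro Lp_add Lp_cmult)

lemma Lp_diff:
  assumes "f \<in> Lp M p" "g \<in> Lp M p" "p > 0"
  shows "(\<lambda>x. f x - g x) \<in> Lp M p"
  using Lp_lincomb[OF assms, of 1 "-1"] by simp

lemma Lp_sum:
  assumes "finite A" "\<And>i. i \<in> A \<Longrightarrow> f i \<in> Lp M p" "p > 0"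
  shows "(\<lambda>x. \<Sum>i\<in>A. f i x) \<in> Lp M p"
  using assms
proof (induction A rule: finite_induct)
  case empty
  then show ?case by (simp add: Lp_def)
next
  case (insert i A)
  then show ?case by (simp add: Lp_add)
qed

lemma Lp_norm_powr:
  assumes "p > 0"
  shows "Lp_norm M p f powr p = (LINT x|M. norm (f x) powr p)"
  using assms by (simp add: Lp_norm_def powr_powr Bochner_Integration.integral_nonneg)

lemma Lp_2_mult_integrable:
  assumes "f \<in> Lp M 2" "g \<in> Lp M 2"
  shows "integrable M (\<lambda>x. norm (f x) * norm (g x))" "integrable M (\<lambda>x. f x * cnj (g x))"
    "integrable M (\<lambda>x. f x * g x)"
proof -
  have [measurable]: "f \<in> borel_measurable M" "g \<in> borel_measurable M"
    using assms by (auto intro: Lp_measurable)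
  have i: "integrable M (\<lambda>x. (norm (f x))\<^sup>2 + (norm (g x))\<^sup>2)"
    using assms by (simp add: Lp_2_iff)
  have le: "norm (f x) * norm (g x) \<le> (norm (f x))\<^sup>2 + (norm (g x))\<^sup>2" for x
    using sum_squares_bound[of "norm (f x)" "norm (g x)"]
      mult_nonneg_nonneg[OF norm_ge_zero[of "f x"] norm_ge_zero[of "g x"]] by linarith
  show "integrable M (\<lambda>x. norm (f x) * norm (g x))"
    by (rule Bochner_Integration.integrable_bound[OF i]) (use le in \<open>auto simp: abs_mult\<close>)
  then show "integrable M (\<lambda>x. f x * cnj (g x))"
    by (rule Bochner_Integration.integrable_bound) (simp_all add: norm_mult)
  show "integrable M (\<lambda>x. f x * g x)"
    by (rule Bochner_Integration.integrable_bound[OF \<open>integrable M (\<lambda>x. norm (f x) * norm (g x))\<close>])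
       (simp_all add: norm_mult)
qed

lemma Cauchy_Schwarz_norm_integral:
  assumes "f \<in> Lp M 2" "g \<in> Lp M 2"
  shows "(LINT x|M. norm (f x) * norm (g x)) \<le>
    sqrt (LINT x|M. (norm (f x))\<^sup>2) * sqrt (LINT x|M. (norm (g x))\<^sup>2)"
proof -
  have [measurable]: "f \<in> borel_measurable M" "g \<in> borel_measurable M"
    using assms by (auto intro: Lp_measurable)
  define a b where "a = (LINT x|M. (norm (f x))\<^sup>2)" and "b = (LINT x|M. (norm (g x))\<^sup>2)"
  have ia: "integrable M (\<lambda>x. (norm (f x))\<^sup>2)" "integrable M (\<lambda>x. (norm (g x))\<^sup>2)"
    using assms by (auto simp: Lp_2_iff)
  have ab: "a \<ge> 0" "b \<ge> 0" by (auto simp: a_def b_def)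
  consider "a = 0" | "b = 0" | "a > 0" "b > 0" using ab by linarith
  then have "(LINT x|M. norm (f x) * norm (g x)) \<le> sqrt a * sqrt b"
  proof cases
    case 1
    then have "AE x in M. (norm (f x))\<^sup>2 = 0"
      using integral_nonneg_eq_0_iff_AE[OF ia(1)] by (simp add: a_def)
    then have "AE x in M. norm (f x) * norm (g x) = 0" by eventually_elim auto
    then show ?thesis using 1 by (simp add: integral_eq_zero_AE)
  next
    case 2
    then have "AE x in M. (norm (g x))\<^sup>2 = 0"
      using integral_nonneg_eq_0_iff_AE[OF ia(2)] by (simp add: b_def)
    then have "AE x in M. norm (f x) * norm (g x) = 0" by eventually_elim auto
    then show ?thesis using 2 by (simp add: integral_eq_zero_AE)
  next
    case 3
    (* with this choice the two terms of the bound are equal *)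
    define t where "t = sqrt b / sqrt a"
    have t: "t > 0" using 3 by (simp add: t_def)
    have "(LINT x|M. norm (f x) * norm (g x)) \<le>
        (LINT x|M. (t / 2) * (norm (f x))\<^sup>2 + (1 / (2 * t)) * (norm (g x))\<^sup>2)"
    proof (rule integral_mono[OF Lp_2_mult_integrable(1)[OF assms]])
      show "integrable M (\<lambda>x. (t / 2) * (norm (f x))\<^sup>2 + (1 / (2 * t)) * (norm (g x))\<^sup>2)"
        using ia by auto
      fix x
      have "0 \<le> (t * norm (f x) - norm (g x))\<^sup>2 / (2 * t)" using t by simp
      also have "\<dots> = (t / 2) * (norm (f x))\<^sup>2 + (1 / (2 * t)) * (norm (g x))\<^sup>2 - norm (f x) * norm (g x)"
        using t by (simp add: power2_eq_square field_simps)
      finally show "norm (f x) * norm (g x) \<le> (t / 2) * (norm (f x))\<^sup>2 + (1 / (2 * t)) * (norm (g x))\<^sup>2"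
        by simp
    qed
    also have "\<dots> = (t / 2) * a + (1 / (2 * t)) * b"
      using ia by (simp add: a_def b_def)
    also have "\<dots> = sqrt a * sqrt b"
    proof -
      define \<alpha> \<beta> where "\<alpha> = sqrt a" and "\<beta> = sqrt b"
      have "a = \<alpha> * \<alpha>" "b = \<beta> * \<beta>" "\<alpha> > 0" "\<beta> > 0" using 3 by (auto simp: \<alpha>_def \<beta>_def)
      then have "t / 2 * a + 1 / (2 * t) * b = \<alpha> * \<beta>"
        unfolding t_def by (simp add: \<alpha>_def[symmetric] \<beta>_def[symmetric] field_simps)
      then show ?thesis by (simp add: \<alpha>_def \<beta>_def)
    qed
    finally show ?thesis .
  qed
  then show ?thesis by (simp add: a_def b_def)
qed

lemma Cauchy_Schwarz_integral:
  assumes "f \<in> Lp M 2" "g \<in> Lp M 2"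
  shows "norm (LINT x|M. f x * cnj (g x)) \<le>
    sqrt (LINT x|M. (norm (f x))\<^sup>2) * sqrt (LINT x|M. (norm (g x))\<^sup>2)"
proof -
  have "norm (LINT x|M. f x * cnj (g x)) \<le> (LINT x|M. norm (f x * cnj (g x)))"
    by (rule integral_norm_bound)
  then show ?thesis using Cauchy_Schwarz_norm_integral[OF assms] by (simp add: norm_mult)
qed

lemma integral_norm_add_square:
  assumes "f \<in> Lp M 2" "g \<in> Lp M 2"
  shows "(LINT x|M. (norm (f x + c * g x))\<^sup>2) = (LINT x|M. (norm (f x))\<^sup>2)
     + (norm c)\<^sup>2 * (LINT x|M. (norm (g x))\<^sup>2) + 2 * Re (cnj c * (LINT x|M. f x * cnj (g x)))"
proof -
  have eq: "(norm (f x + c * g x))\<^sup>2 = (norm (f x))\<^sup>2 + (norm c)\<^sup>2 * (norm (g x))\<^sup>2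
      + 2 * Re (cnj c * (f x * cnj (g x)))" for x
  proof -
    have "norm (u + w)^2 = norm u^2 + norm w^2 + 2 * Re (u * cnj w)" for u w :: complex
      unfolding cmod_power2 by (simp add: power2_eq_square algebra_simps)
    from this[of "f x" "c * g x"] show ?thesis by (simp add: norm_mult power_mult_distrib mult_ac)
  qed
  have i: "integrable M (\<lambda>x. (norm (f x))\<^sup>2)" "integrable M (\<lambda>x. (norm (g x))\<^sup>2)"
    "integrable M (\<lambda>x. cnj c * (f x * cnj (g x)))"
    using assms Lp_2_mult_integrable(2)[OF assms] by (auto simp: Lp_2_iff)
  have "(LINT x|M. (norm (f x + c * g x))\<^sup>2) = (LINT x|M. (norm (f x))\<^sup>2)
     + (norm c)\<^sup>2 * (LINT x|M. (norm (g x))\<^sup>2) + 2 * (LINT x|M. Re (cnj c * (f x * cnj (g x))))"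
  proof -
    have add: "(LINT x|M. A x + k * B x + 2 * D x) =
        (LINT x|M. A x) + k * (LINT x|M. B x) + 2 * (LINT x|M. D x)"
      if "integrable M A" "integrable M B" "integrable M D" for A B D :: "'a \<Rightarrow> real" and k
      using that by simp
    show ?thesis unfolding eq by (rule add[OF i(1,2) integrable_Re[OF i(3)]])
  qed
  also have "(LINT x|M. Re (cnj c * (f x * cnj (g x)))) = Re (LINT x|M. cnj c * (f x * cnj (g x)))"
    using i by (intro integral_Re)
  finally show ?thesis by simp
qed

text \<open>A map that preserves the norms of all combinations preserves inner products, by the
  polarization identity with the two coefficients 1 and \<open>\<i>\<close>.\<close>

lemma polarization:
  assumes "f \<in> Lp M 2" "g \<in> Lp M 2" "F \<in> Lp N 2" "G \<in> Lp N 2"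
    and eq: "\<And>a b. (LINT x|M. (norm (a * f x + b * g x))\<^sup>2) = (LINT x|N. (norm (a * F x + b * G x))\<^sup>2)"
  shows "(LINT x|M. f x * cnj (g x)) = (LINT x|N. F x * cnj (G x))"
proof -
  have "Re (cnj c * (LINT x|M. f x * cnj (g x))) = Re (cnj c * (LINT x|N. F x * cnj (G x)))" for c
    using integral_norm_add_square[OF assms(1,2), of c] integral_norm_add_square[OF assms(3,4), of c]
      eq[of 1 c] eq[of 1 0] eq[of 0 1] by simp
  from this[of 1] this[of \<i>] show ?thesis by (simp add: complex_eq_iff)
qed

text \<open>The graph of a convex function lies above its tangents; at \<open>x = 0\<close>, an end point of the domain of convexity that is
  used, the inequality is checked by hand.\<close>

lemma powr_tangent:
  fixes x y p :: real
  assumes "p \<ge> 1" "x \<ge> 0" "y > 0"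
  shows "x powr p \<ge> y powr p + p * y powr (p - 1) * (x - y)"
proof (cases "x = 0")
  case True
  have "y powr (p - 1) * y = y powr p" using assms by (simp add: powr_mult_base mult.commute)
  then have "y powr p + p * y powr (p - 1) * (x - y) = (1 - p) * y powr p"
    using True by (simp add: algebra_simps)
  also have "\<dots> \<le> 0" using assms by (simp add: mult_nonpos_nonneg)
  finally show ?thesis using True by simp
next
  case False
  have "convex_on {0<..} (\<lambda>x. x powr p)" using assms by (simp add: powr_convex)
  then have "x powr p - y powr p \<ge> p * y powr (p - 1) * (x - y)"
  proof (rule convex_on_imp_above_tangent)
    show "((\<lambda>x. x powr p) has_real_derivative p * y powr (p - 1)) (at y within {0<..})"
      using assms by (auto intro!: derivative_eq_intros)
    show "y \<in> interior {0<..}" using assms by (simp add: interior_open)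
  qed (use assms False in \<open>auto simp: is_interval_connected\<close>)
  then show ?thesis by simp
qed

text \<open>Jensen's inequality for the measure with density \<open>w\<close>, whose total mass need not be 1. It is
  obtained by integrating the tangent inequality at the mean value.\<close>

lemma weighted_power_mean:
  fixes w g :: "'a \<Rightarrow> real"
  assumes "p \<ge> 1" and w: "integrable M w" "\<And>x. x \<in> space M \<Longrightarrow> w x \<ge> 0"
    and g: "\<And>x. x \<in> space M \<Longrightarrow> g x \<ge> 0"
    and i: "integrable M (\<lambda>x. w x * g x)" "integrable M (\<lambda>x. w x * g x powr p)"
  shows "(LINT x|M. w x * g x) powr p \<le> (LINT x|M. w x) powr (p - 1) * (LINT x|M. w x * g x powr p)"
proof (cases "(LINT x|M. w x * g x) = 0")
  case True
  have "0 \<le> (LINT x|M. w x * g x powr p)" using w by (intro Bochner_Integration.integral_nonneg) auto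
  then show ?thesis using True by simp
next
  case False
  define S A where "S = (LINT x|M. w x)" and "A = (LINT x|M. w x * g x)"
  have A: "A > 0" using False w g unfolding A_def
    by (metis (no_types, lifting) Bochner_Integration.integral_nonneg less_eq_real_def mult_nonneg_nonneg)
  have "S \<noteq> 0"
  proof
    assume "S = 0"
    then have "AE x in M. w x = 0" using integral_nonneg_eq_0_iff_AE[OF w(1)] w(2) by (auto simp: S_def)
    then have "AE x in M. w x * g x = 0" by eventually_elim auto
    then have "A = 0" unfolding A_def by (simp add: integral_eq_zero_AE)
    then show False using A by simp
  qed
  moreover have "S \<ge> 0" unfolding S_def using w by (intro Bochner_Integration.integral_nonneg) auto
  ultimately have S: "S > 0" by simp
  define y where "y = A / S"
  have y: "y > 0" using A S by (simp add: y_def)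
  have "(LINT x|M. (y powr p - p * y powr (p - 1) * y) * w x + p * y powr (p - 1) * (w x * g x)) \<le>
     (LINT x|M. w x * g x powr p)"
  proof (rule integral_mono[OF _ i(2)])
    fix x assume x: "x \<in> space M"
    have "w x * (y powr p + p * y powr (p - 1) * (g x - y)) \<le> w x * g x powr p"
      using w(2)[OF x] powr_tangent[OF assms(1) g[OF x] y] by (intro mult_left_mono) auto
    then show "(y powr p - p * y powr (p - 1) * y) * w x + p * y powr (p - 1) * (w x * g x) \<le> w x * g x powr p"
      by (simp add: algebra_simps)
  qed (use w i in auto)
  also have "(LINT x|M. (y powr p - p * y powr (p - 1) * y) * w x + p * y powr (p - 1) * (w x * g x))
     = (y powr p - p * y powr (p - 1) * y) * S + p * y powr (p - 1) * A"
    using w i by (simp add: S_def A_def)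
  also have "\<dots> = y powr p * S" using S by (simp add: y_def algebra_simps)
  finally have *: "y powr p * S \<le> (LINT x|M. w x * g x powr p)" .
  have "A powr p = S powr (p - 1) * (y powr p * S)"
  proof -
    have "A powr p = (S * y) powr p" using S by (simp add: y_def)
    also have "\<dots> = S powr (p - 1 + 1) * y powr p" using S y by (simp add: powr_mult)
    also have "\<dots> = S powr (p - 1) * S * y powr p" using S by (subst powr_add) simp
    finally show ?thesis by simp
  qed
  also have "\<dots> \<le> S powr (p - 1) * (LINT x|M. w x * g x powr p)"
    using * by (intro mult_left_mono) auto
  finally show ?thesis by (simp add: A_def S_def)
qed

section \<open>The unit cell and the unfolding of integrals\<close>

text \<open>Sums over \<open>\<int>\<^sup>N\<close> are written as integrals with respect to the counting measure, so that every
  exchange of sums and integrals is an instance of Fubini's theorem.\<close>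

abbreviation lattice :: "(int^'n) measure" where
  "lattice \<equiv> count_space UNIV"

definition cell :: "(real^'n) set" where
  "cell = {x. \<forall>i. 0 \<le> x $ i \<and> x $ i < 1}"

definition floor_vec :: "real^'n \<Rightarrow> int^'n" where
  "floor_vec x = (\<chi> i. \<lfloor>x $ i\<rfloor>)"

definition frac_vec :: "real^'n \<Rightarrow> real^'n" where
  "frac_vec x = (\<chi> i. frac (x $ i))"

lemma of_int_vec_nth [simp]: "of_int_vec n $ i = of_int (n $ i)"
  by (simp add: of_int_vec_def)

lemma of_int_vec_simps [simp]:
  "of_int_vec 0 = 0" "of_int_vec (a + b) = of_int_vec a + of_int_vec b"
  "of_int_vec (- a) = - of_int_vec a" "of_int_vec (a - b) = of_int_vec a - of_int_vec b"
  by (simp_all add: vec_eq_iff)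

lemma floor_plus_frac: "of_int_vec (floor_vec x) + frac_vec x = x"
  by (simp add: vec_eq_iff floor_vec_def frac_vec_def frac_def)

lemma frac_vec_in_cell: "frac_vec x \<in> cell"
  by (simp add: cell_def frac_vec_def frac_lt_1)

lemma floor_frac_unique:
  assumes "u \<in> cell"
  shows "floor_vec (of_int_vec k + u) = k" "frac_vec (of_int_vec k + u) = u"
proof -
  have "\<lfloor>of_int (k $ i) + u $ i\<rfloor> = k $ i" for i
    using assms by (intro floor_unique) (auto simp: cell_def)
  then show "floor_vec (of_int_vec k + u) = k" "frac_vec (of_int_vec k + u) = u"
    by (simp_all add: vec_eq_iff floor_vec_def frac_vec_def frac_def)
qed

lemma cell_borel [measurable]: "cell \<in> sets borel"
  unfolding cell_def by measurable

lemma floor_vec_measurable: "(\<lambda>x::real^'n. of_int_vec (floor_vec x)) \<in> borel_measurable borel"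
proof (subst borel_measurable_euclidean_space, intro ballI)
  fix b :: "real^'n" assume "b \<in> Basis"
  then obtain i where "b = axis i 1" by (auto simp: Basis_vec_def)
  then have "of_int_vec (floor_vec x) \<bullet> b = of_int \<lfloor>x $ i\<rfloor>" for x
    by (simp add: inner_axis floor_vec_def)
  then show "(\<lambda>x. of_int_vec (floor_vec x) \<bullet> b) \<in> borel_measurable borel" by simp
qed

lemma frac_vec_measurable [measurable]: "(frac_vec :: real^'n \<Rightarrow> _) \<in> borel_measurable borel"
proof -
  have "frac_vec = (\<lambda>x::real^'n. x - of_int_vec (floor_vec x))"
    using floor_plus_frac by (metis add_diff_cancel_left')
  moreover have "(\<lambda>x::real^'n. x - of_int_vec (floor_vec x)) \<in> borel_measurable borel"
    by (intro borel_measurable_diff floor_vec_measurable) simp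
  ultimately show ?thesis by simp
qed

lemma space_torus [simp]: "space torus_measure = cell"
  by (simp add: torus_measure_def cell_def space_restrict_space)

lemma torus_measure_eq: "torus_measure = restrict_space lborel cell"
  by (simp add: torus_measure_def cell_def)

lemma measurable_torusI: "f \<in> measurable borel N \<Longrightarrow> f \<in> measurable torus_measure N"
  unfolding torus_measure_eq by (rule measurable_restrict_space1) simp

lemma measurable_torus_ident [measurable]: "(\<lambda>x. x) \<in> measurable torus_measure borel"
  by (rule measurable_torusI) simp

lemma frac_vec_measurable_torus: "frac_vec \<in> measurable borel torus_measure"
  unfolding torus_measure_eq
  by (rule measurable_restrict_space2) (auto simp: frac_vec_in_cell)

lemma emeasure_cell: "emeasure lborel (cell :: (real^'n) set) = 1"
proof (rule antisym)
  have b: "(\<Prod>b\<in>Basis. ((1::real^'n) - 0) \<bullet> b) = 1"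
    by (intro prod.neutral) (auto simp: Basis_vec_def inner_axis)
  have "emeasure lborel (cell :: (real^'n) set) \<le> emeasure lborel (cbox (0::real^'n) 1)"
    by (intro emeasure_mono) (auto simp: cell_def mem_box_cart less_imp_le)
  also have "\<dots> = 1"
    using b by (subst emeasure_lborel_cbox) (auto simp: Basis_vec_def inner_axis)
  finally show "emeasure lborel (cell :: (real^'n) set) \<le> 1" .
  have "1 = emeasure lborel (box (0::real^'n) 1)"
    using b by (subst emeasure_lborel_box) (auto simp: Basis_vec_def inner_axis)
  also have "\<dots> \<le> emeasure lborel (cell :: (real^'n) set)"
    by (intro emeasure_mono) (auto simp: cell_def mem_box_cart less_imp_le)
  finally show "1 \<le> emeasure lborel (cell :: (real^'n) set)" .
qed

lemma emeasure_torus: "emeasure torus_measure (cell :: (real^'n) set) = 1"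
  unfolding torus_measure_eq by (subst emeasure_restrict_space) (auto simp: emeasure_cell)

lemma finite_measure_torus: "finite_measure (torus_measure :: (real^'n) measure)"
  by (rule finite_measureI) (simp add: emeasure_torus)

interpretation torus: finite_measure "torus_measure :: (real^'n) measure"
  by (rule finite_measure_torus)

interpretation lattice: sigma_finite_measure "lattice :: (int^'n) measure"
  by (rule sigma_finite_measure_count_space_countable) auto

lemma measure_torus [simp]: "measure torus_measure (cell :: (real^'n) set) = 1"
  by (simp add: measure_def emeasure_torus)

lemma nn_integral_torus:
  "(\<integral>\<^sup>+x. f x \<partial>torus_measure) = (\<integral>\<^sup>+x. f x * indicator cell x \<partial>lborel)"
  unfolding torus_measure_eq by (rule nn_integral_restrict_space) simp

lemma integral_torus:
  fixes f :: "real^'n \<Rightarrow> 'b::{banach, second_countable_topology}"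
  shows "(LINT x|torus_measure. f x) = (LINT x|lborel. indicator cell x *\<^sub>R f x)"
  unfolding torus_measure_eq by (rule integral_restrict_space) simp

lemma measurable_lattice_pair:
  assumes "\<And>k. (\<lambda>x. f (k, x)) \<in> measurable N K"
  shows "f \<in> measurable (lattice \<Otimes>\<^sub>M N) K"
  using assms by (intro measurable_pair_measure_countable1) auto

lemma measurable_lattice_split:
  assumes "\<And>k. (\<lambda>x. f k x) \<in> measurable N K"
  shows "(\<lambda>(k, x). f k x) \<in> measurable (lattice \<Otimes>\<^sub>M N) K" "(\<lambda>(x, k). f k x) \<in> measurable (N \<Otimes>\<^sub>M lattice) K"
proof -
  show 1: "(\<lambda>(k, x). f k x) \<in> measurable (lattice \<Otimes>\<^sub>M N) K"
    by (rule measurable_lattice_pair) (use assms in simp)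
  show "(\<lambda>(x, k). f k x) \<in> measurable (N \<Otimes>\<^sub>M lattice) K"
    using measurable_compose[OF measurable_pair_swap' 1] by (simp add: case_prod_beta')
qed

lemma nn_integral_lattice_swap:
  assumes "sigma_finite_measure N" "\<And>k. f k \<in> borel_measurable N"
  shows "(\<integral>\<^sup>+k. \<integral>\<^sup>+x. f k x \<partial>N \<partial>lattice) = (\<integral>\<^sup>+x. \<integral>\<^sup>+k. f k x \<partial>lattice \<partial>N)"
proof -
  interpret N: sigma_finite_measure N by fact
  interpret pair_sigma_finite N lattice ..
  show ?thesis
    using Fubini[OF measurable_lattice_split(2)[of f, OF assms(2)]] by simp
qed

lemma borel_measurable_nn_integral_lattice [measurable (raw)]:
  assumes "\<And>k. f k \<in> borel_measurable N"
  shows "(\<lambda>x. \<integral>\<^sup>+k. f k x \<partial>lattice) \<in> borel_measurable N"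
  using lattice.borel_measurable_nn_integral[OF measurable_lattice_split(2)[of f, OF assms]] by simp

lemma borel_measurable_integral_lattice [measurable (raw)]:
  fixes f :: "int^'n \<Rightarrow> _ \<Rightarrow> _::{banach, second_countable_topology}"
  assumes "\<And>k. f k \<in> borel_measurable N"
  shows "(\<lambda>x. LINT k|lattice. f k x) \<in> borel_measurable N"
  using lattice.borel_measurable_lebesgue_integral[OF measurable_lattice_split(2)[of f, OF assms]] by simp

lemma nn_integral_translate:
  fixes f :: "real^'n \<Rightarrow> ennreal"
  assumes "f \<in> borel_measurable borel"
  shows "(\<integral>\<^sup>+x. f (a + x) \<partial>lborel) = (\<integral>\<^sup>+x. f x \<partial>lborel)"
  using assms by (subst (2) lborel_distr_plus[of a, symmetric]) (simp add: nn_integral_distr)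

lemma distr_lborel_minus: "distr lborel borel (\<lambda>x::real^'n. x - y) = lborel"
proof -
  have "(\<lambda>x::real^'n. x - y) = (+) (- y)" by (simp add: fun_eq_iff)
  then show ?thesis using lborel_distr_plus[of "- y"] by simp
qed

lemma integral_translate:
  fixes f :: "real^'n \<Rightarrow> 'b::{banach, second_countable_topology}"
  assumes [measurable]: "f \<in> borel_measurable borel"
  shows "(LINT x|lborel. f (x - y)) = (LINT x|lborel. f x)" "integrable lborel (\<lambda>x. f (x - y)) \<longleftrightarrow> integrable lborel f"
  by (subst (2) distr_lborel_minus[of y, symmetric], simp add: integral_distr)
     (subst (2) distr_lborel_minus[of y, symmetric], simp add: integrable_distr_eq)

lemma AE_translate:
  fixes P :: "real^'n \<Rightarrow> bool"
  assumes "AE x in lborel. P x" shows "AE x in lborel. P (x - y)"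
proof -
  have "AE x in distr lborel borel (\<lambda>x::real^'n. x - y). P x" unfolding distr_lborel_minus by (rule assms)
  then show ?thesis by (rule AE_distrD[rotated]) simp
qed

lemma Lp_translate:
  fixes f :: "real^'n \<Rightarrow> complex"
  assumes "f \<in> Lp lborel r" shows "(\<lambda>x. f (x - y)) \<in> Lp lborel r"
    "(LINT x|lborel. norm (f (x - y)) powr r) = (LINT x|lborel. norm (f x) powr r)"
proof -
  have [measurable]: "f \<in> borel_measurable borel" using Lp_measurable[OF assms] by simp
  show "(\<lambda>x. f (x - y)) \<in> Lp lborel r"
    "(LINT x|lborel. norm (f (x - y)) powr r) = (LINT x|lborel. norm (f x) powr r)"
    using integral_translate[of "\<lambda>x. norm (f x) powr r" y] assms by (simp_all add: Lp_def)
qed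

text \<open>The translates of the cell by lattice vectors are a partition of the space, which is what makes integrals unfold.\<close>

lemma cell_tiling: "(\<integral>\<^sup>+k. indicator cell (x - of_int_vec k) \<partial>lattice) = 1"
proof -
  have "indicator cell (x - of_int_vec k) = (indicator {floor_vec x} k :: ennreal)" for k
  proof (cases "x - of_int_vec k \<in> cell")
    case True
    then have "floor_vec x = k" using floor_frac_unique(1)[of "x - of_int_vec k" k] by simp
    then show ?thesis using True by simp
  next
    case False
    have "x - of_int_vec (floor_vec x) \<in> cell"
      using frac_vec_in_cell[of x] floor_plus_frac[of x] by (metis add_diff_cancel_left')
    then show ?thesis using False by (auto simp: indicator_def)
  qed
  then show ?thesis by simp
qed

lemma nn_integral_unfold:
  fixes f :: "real^'n \<Rightarrow> ennreal"
  assumes [measurable]: "f \<in> borel_measurable borel"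
  shows "(\<integral>\<^sup>+x. f x \<partial>lborel) = (\<integral>\<^sup>+k. \<integral>\<^sup>+u. f (of_int_vec k + u) \<partial>torus_measure \<partial>lattice)"
proof -
  have "(\<integral>\<^sup>+u. f (of_int_vec k + u) \<partial>torus_measure) = (\<integral>\<^sup>+x. f x * indicator cell (x - of_int_vec k) \<partial>lborel)" for k
    using nn_integral_translate[of "\<lambda>x. f x * indicator cell (x - of_int_vec k)" "of_int_vec k"]
    by (simp add: nn_integral_torus)
  then have "(\<integral>\<^sup>+k. \<integral>\<^sup>+u. f (of_int_vec k + u) \<partial>torus_measure \<partial>lattice)
     = (\<integral>\<^sup>+x. \<integral>\<^sup>+k. f x * indicator cell (x - of_int_vec k) \<partial>lattice \<partial>lborel)"
    by (simp add: nn_integral_lattice_swap sigma_finite_lborel)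
  also have "\<dots> = (\<integral>\<^sup>+x. f x \<partial>lborel)"
    by (simp add: nn_integral_cmult cell_tiling)
  finally show ?thesis ..
qed

text \<open>Stated as an image measure, unfolding makes Fubini's theorem on the product available for every integrable
  function.\<close>

lemma lborel_unfold:
  "(lborel :: (real^'n) measure) = distr (lattice \<Otimes>\<^sub>M torus_measure) borel (\<lambda>(k, u). of_int_vec k + u)"
proof (rule measure_eqI)
  fix A assume "A \<in> sets (lborel :: (real^'n) measure)"
  then have [measurable]: "A \<in> sets borel" by simp
  have m: "(\<lambda>(k, u). of_int_vec k + u) \<in> measurable (lattice \<Otimes>\<^sub>M torus_measure) (borel :: (real^'n) measure)"
    by (intro measurable_lattice_split) measurable
  have "emeasure (distr (lattice \<Otimes>\<^sub>M torus_measure) borel (\<lambda>(k, u). of_int_vec k + u)) A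
     = (\<integral>\<^sup>+x. indicator A x \<partial>distr (lattice \<Otimes>\<^sub>M torus_measure) borel (\<lambda>(k, u). of_int_vec k + u))"
    by simp
  also have "\<dots> = (\<integral>\<^sup>+z. (case z of (k, u) \<Rightarrow> indicator A (of_int_vec k + u)) \<partial>(lattice \<Otimes>\<^sub>M torus_measure))"
    by (subst nn_integral_distr[OF m]) (auto simp: case_prod_beta')
  also have "\<dots> = (\<integral>\<^sup>+k. \<integral>\<^sup>+u. indicator A (of_int_vec k + u) \<partial>torus_measure \<partial>lattice)"
    by (subst torus.nn_integral_fst[symmetric]) (auto intro!: measurable_lattice_split)
  also have "\<dots> = emeasure lborel A"
    by (subst nn_integral_unfold[symmetric]) auto
  finally show "emeasure lborel A = emeasure (distr (lattice \<Otimes>\<^sub>M torus_measure) borel (\<lambda>(k, u). of_int_vec k + u)) A" ..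
qed simp

lemma unfold_map_measurable:
  "(\<lambda>(k, u). of_int_vec k + u) \<in> measurable (lattice \<Otimes>\<^sub>M torus_measure) (borel :: (real^'n) measure)"
  by (intro measurable_lattice_split) measurable

lemma integral_swap:
  fixes f :: "'a \<Rightarrow> 'b \<Rightarrow> 'c::{banach, second_countable_topology}"
  assumes "sigma_finite_measure M" "sigma_finite_measure N"
    and m: "(\<lambda>(x, y). f x y) \<in> borel_measurable (M \<Otimes>\<^sub>M N)"
    and fin: "(\<integral>\<^sup>+x. \<integral>\<^sup>+y. ennreal (norm (f x y)) \<partial>N \<partial>M) < \<infinity>"
  shows "(LINT x|M. LINT y|N. f x y) = (LINT y|N. LINT x|M. f x y)"
proof -
  interpret M: sigma_finite_measure M by fact
  interpret N: sigma_finite_measure N by fact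
  interpret pair_sigma_finite M N ..
  have i: "integrable (M \<Otimes>\<^sub>M N) (\<lambda>(x, y). f x y)"
  proof (rule integrableI_bounded[OF m])
    show "(\<integral>\<^sup>+ z. ennreal (norm (case z of (x, y) \<Rightarrow> f x y)) \<partial>(M \<Otimes>\<^sub>M N)) < \<infinity>"
      using fin m by (subst N.nn_integral_fst[symmetric]) (auto simp: case_prod_beta')
  qed
  show "(LINT x|M. LINT y|N. f x y) = (LINT y|N. LINT x|M. f x y)"
    using Fubini_integral[OF i] by simp
qed

lemma integral_unfold:
  fixes f :: "real^'n \<Rightarrow> 'b::{banach, second_countable_topology}"
  assumes "integrable lborel f"
  shows "(LINT x|lborel. f x) = (LINT u|torus_measure. LINT k|lattice. f (of_int_vec k + u))"
    and "(LINT x|lborel. f x) = (LINT k|lattice. LINT u|torus_measure. f (of_int_vec k + u))"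
    and "AE u in torus_measure. integrable lattice (\<lambda>k. f (of_int_vec k + u))"
    and "integrable torus_measure (\<lambda>u. LINT k|lattice. f (of_int_vec k + u))"
    and "integrable torus_measure (\<lambda>u. f (of_int_vec k + u))"
proof -
  interpret pair_sigma_finite lattice torus_measure ..
  have [measurable]: "f \<in> borel_measurable borel" using assms by auto
  have i: "integrable (lattice \<Otimes>\<^sub>M torus_measure) (\<lambda>(k, u). f (of_int_vec k + u))"
    using assms unfolding lborel_unfold
    by (subst (asm) integrable_distr_eq[OF unfold_map_measurable]) (auto simp: case_prod_beta')
  have e: "(LINT x|lborel. f x) = (LINT z|(lattice \<Otimes>\<^sub>M torus_measure). (case z of (k, u) \<Rightarrow> f (of_int_vec k + u)))"
    by (subst lborel_unfold, subst integral_distr[OF unfold_map_measurable]) (auto simp: case_prod_beta')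
  show "(LINT x|lborel. f x) = (LINT u|torus_measure. LINT k|lattice. f (of_int_vec k + u))"
    using e integral_snd[OF i] by simp
  show "(LINT x|lborel. f x) = (LINT k|lattice. LINT u|torus_measure. f (of_int_vec k + u))"
    using e integral_fst[OF i] by simp
  show "AE u in torus_measure. integrable lattice (\<lambda>k. f (of_int_vec k + u))"
    "integrable torus_measure (\<lambda>u. LINT k|lattice. f (of_int_vec k + u))"
    using integrable_snd[OF i] AE_integrable_snd[OF i] by simp_all
  show "integrable torus_measure (\<lambda>u. f (of_int_vec k + u))"
    using AE_integrable_fst[OF i] by (simp add: AE_count_space)
qed

text \<open>A null set of the torus remains null when it is extended periodically, being a countable union of translates.\<close>

lemma AE_foldI:
  fixes P :: "real^'n \<Rightarrow> bool"
  assumes "AE u in torus_measure. \<forall>k. P (of_int_vec k + u)"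
  shows "AE x in lborel. P x"
proof -
  obtain N where N: "{u \<in> space torus_measure. \<not> (\<forall>k. P (of_int_vec k + u))} \<subseteq> N"
    "emeasure torus_measure N = 0" "N \<in> sets torus_measure"
    using AE_E[OF assms] by blast
  have A [measurable]: "frac_vec -` N \<in> sets borel"
    using measurable_sets[OF frac_vec_measurable_torus N(3)] by simp
  have "emeasure lborel (frac_vec -` N) = (\<integral>\<^sup>+x. indicator (frac_vec -` N) x \<partial>lborel)" by simp
  also have "\<dots> = (\<integral>\<^sup>+k. \<integral>\<^sup>+u. indicator (frac_vec -` N) (of_int_vec k + u) \<partial>torus_measure \<partial>lattice)"
    by (rule nn_integral_unfold) simp
  also have "\<dots> = (\<integral>\<^sup>+k. \<integral>\<^sup>+u. indicator N u \<partial>torus_measure \<partial>(lattice::(int^'n) measure))"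
    by (intro nn_integral_cong) (auto simp: indicator_def floor_frac_unique)
  also have "\<dots> = 0" using N by simp
  finally have "frac_vec -` N \<in> null_sets lborel" by auto
  moreover have "{x. \<not> P x} \<subseteq> frac_vec -` N"
  proof
    fix x assume "x \<in> {x. \<not> P x}"
    then have "\<not> P (of_int_vec (floor_vec x) + frac_vec x)" by (simp add: floor_plus_frac)
    then show "x \<in> frac_vec -` N" using N(1) frac_vec_in_cell[of x] by auto
  qed
  ultimately show ?thesis by (intro AE_I[of _ _ "frac_vec -` N"]) auto
qed

section \<open>Characters\<close>

text \<open>The exponential \<open>e(t)\<close> of analytic number theory, in which lattice frequencies have period 1.\<close>

definition ee :: "real \<Rightarrow> complex" where
  "ee t = cis (2 * pi * t)"

lemma ee_simps [simp]: "ee 0 = 1" "norm (ee t) = 1" "cnj (ee t) = ee (- t)" "ee t \<noteq> 0"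
  by (simp_all add: ee_def cis_cnj)

lemma ee_add: "ee (a + b) = ee a * ee b"
  by (simp add: ee_def cis_mult algebra_simps)

lemma ee_of_int [simp]: "ee (of_int n) = 1"
  by (simp add: ee_def cis_multiple_2pi)

lemma continuous_ee: "continuous_on A ee"
  unfolding ee_def by (intro continuous_intros)

lemma continuous_on_ee [continuous_intros]:
  "continuous_on A f \<Longrightarrow> continuous_on A (\<lambda>x. ee (f x))"
  by (rule continuous_on_compose2[OF continuous_ee[of UNIV]]) auto

lemma measurable_ee [measurable (raw)]:
  "f \<in> borel_measurable M \<Longrightarrow> (\<lambda>x. ee (f x)) \<in> borel_measurable M"
  by (rule measurable_compose[OF _ borel_measurable_continuous_onI[OF continuous_ee]])

lemma inner_of_int_vec: "of_int_vec a \<bullet> of_int_vec b = of_int (\<Sum>i\<in>UNIV. a $ i * b $ i)"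
  by (simp add: inner_vec_def)

lemma ee_lattice [simp]: "ee (of_int_vec a \<bullet> of_int_vec b) = 1"
  unfolding inner_of_int_vec by (rule ee_of_int)

lemma fourier_R_eq: "fourier_R f \<xi> = (LINT x|lborel. f x * ee (- (\<xi> \<bullet> x)))"
  by (simp add: fourier_R_def ee_def algebra_simps)

lemma fourier_T_eq: "fourier_T f n = (LINT x|torus_measure. f x * ee (- (of_int_vec n \<bullet> x)))"
  by (simp add: fourier_T_def ee_def algebra_simps)

lemma Basis_vec_real: "(Basis :: (real^'n) set) = range (\<lambda>i. axis i 1)"
  by (auto simp: Basis_vec_def)

text \<open>Lebesgue measure on \<open>\<real>\<^sup>N\<close> is a product measure, so integrals of product functions factor.\<close>

lemma integral_torus_prod:
  fixes f :: "'n::finite \<Rightarrow> real \<Rightarrow> complex"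
  assumes i: "\<And>i. integrable lborel (\<lambda>t. indicator {0..<1} t *\<^sub>R f i t)"
    and [measurable]: "\<And>i. f i \<in> borel_measurable borel"
  shows "(LINT x|torus_measure. (\<Prod>i\<in>UNIV. f i (x $ i))) = (\<Prod>i\<in>UNIV. (LINT t|lborel. indicator {0..<1} t *\<^sub>R f i t))"
proof -
  define g where "g i t = indicator {0..<1} t *\<^sub>R f i t" for i t
  define ix where "ix b = (THE i. b = axis i (1::real))" for b :: "real^'n"
  have ix [simp]: "ix (axis i 1) = i" for i
    unfolding ix_def by (rule the_equality) (auto simp: axis_eq_axis)
  have [measurable]: "g i \<in> borel_measurable borel" for i unfolding g_def by measurable
  interpret product_sigma_finite "\<lambda>_::real^'n. lborel :: real measure" ..
  have *: "(\<Prod>i\<in>UNIV. g i (x $ i)) = (\<Prod>b\<in>Basis. g (ix b) (x \<bullet> b))" for x :: "real^'n"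
    unfolding Basis_vec_real by (subst prod.reindex) (auto simp: inj_on_def axis_eq_axis inner_axis)
  have "(LINT x|torus_measure. (\<Prod>i\<in>UNIV. f i (x $ i))) = (LINT x|lborel. (\<Prod>i\<in>UNIV. g i (x $ i)))"
  proof (unfold integral_torus, intro Bochner_Integration.integral_cong refl)
    fix x :: "real^'n"
    show "indicator cell x *\<^sub>R (\<Prod>i\<in>UNIV. f i (x $ i)) = (\<Prod>i\<in>UNIV. g i (x $ i))"
    proof (cases "x \<in> cell")
      case True
      then show ?thesis by (auto simp: cell_def g_def)
    next
      case False
      then obtain i where "x $ i \<notin> {0..<1}" by (auto simp: cell_def)
      then have "g i (x $ i) = 0" by (simp add: g_def)
      then show ?thesis using False by (metis (no_types, lifting) UNIV_I finite indicator_simps(2) prod_zero scaleR_zero_left)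
    qed
  qed
  also have "\<dots> = (LINT h|Pi\<^sub>M Basis (\<lambda>_. lborel). (\<Prod>b\<in>Basis. g (ix b) (h b)))"
    unfolding * by (subst lborel_eq, subst integral_distr)
      (auto intro!: Bochner_Integration.integral_cong prod.cong simp: inner_sum_left inner_Basis if_distrib cong: if_cong)
  also have "\<dots> = (\<Prod>b\<in>Basis. (LINT t|lborel. g (ix b) t))"
    by (rule product_integral_prod) (use i in \<open>auto simp: g_def\<close>)
  also have "\<dots> = (\<Prod>i\<in>UNIV. (LINT t|lborel. g i t))"
    unfolding Basis_vec_real by (subst prod.reindex) (auto simp: inj_on_def axis_eq_axis)
  finally show ?thesis by (simp add: g_def)
qed

lemma ee_sum: "finite A \<Longrightarrow> ee (sum f A) = (\<Prod>i\<in>A. ee (f i))"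
  by (induction A rule: finite_induct) (auto simp: ee_add)

lemma ee_inner: "ee (x \<bullet> y) = (\<Prod>i\<in>UNIV. ee (x $ i * y $ i))"
  by (simp add: inner_vec_def ee_sum)

lemma has_vector_derivative_ee [derivative_intros]:
  "((\<lambda>t. ee (a * t)) has_vector_derivative (2 * pi * a) *\<^sub>R (\<i> * ee (a * t))) (at t within S)"
proof -
  have "((\<lambda>z. exp (\<i> * complex_of_real (2 * pi * a) * z)) has_field_derivative
      \<i> * complex_of_real (2 * pi * a) * exp (\<i> * complex_of_real (2 * pi * a) * of_real t)) (at (of_real t))"
    by (auto intro!: derivative_eq_intros)
  from has_vector_derivative_real_field[OF this, of S]
  have "((\<lambda>t. cis (2 * pi * (a * t))) has_vector_derivative (2 * pi * a) *\<^sub>R (\<i> * cis (2 * pi * (a * t)))) (at t within S)"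
    by (simp add: cis_conv_exp scaleR_conv_of_real mult_ac)
  then show ?thesis by (simp add: ee_def)
qed

lemma integral_indicator_Ico:
  fixes f :: "real \<Rightarrow> complex"
  assumes "a \<le> b" and F: "\<And>t. t \<in> {a..b} \<Longrightarrow> (F has_vector_derivative f t) (at t within {a..b})"
    and c: "continuous_on {a..b} f"
  shows "integrable lborel (\<lambda>t. indicator {a..b} t *\<^sub>R f t)"
    and "(LINT t|lborel. indicator {a..b} t *\<^sub>R f t) = F b - F a"
proof -
  have s: "set_integrable lborel {a..b} f" using c by (rule borel_integrable_atLeastAtMost')
  then show "integrable lborel (\<lambda>t. indicator {a..b} t *\<^sub>R f t)" by (simp add: set_integrable_def)
  show "(LINT t|lborel. indicator {a..b} t *\<^sub>R f t) = F b - F a"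
    by (rule integral_FTC_atLeastAtMost) (use assms in auto)
qed

lemma AE_Ico_Icc: "AE t in lborel. indicator {a..<b} t *\<^sub>R f t = indicator {a..b::real} t *\<^sub>R (f t :: complex)"
  by (rule AE_mp[OF AE_lborel_singleton[of b]]) (auto simp: indicator_def)

lemma integral_ee_01: "(LINT t|lborel. indicator {0..<1} t *\<^sub>R ee (of_int n * t)) = (if n = 0 then 1 else 0)"
proof -
  have "(LINT t|lborel. indicator {0..<1} t *\<^sub>R ee (of_int n * t)) = (LINT t|lborel. indicator {0..1} t *\<^sub>R ee (of_int n * t))"
    by (intro integral_cong_AE AE_Ico_Icc) auto
  also have "\<dots> = (if n = 0 then 1 else 0)"
  proof (cases "n = 0")
    case False
    have "(LINT t|lborel. indicator {0..1} t *\<^sub>R ee (of_int n * t)) =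
       (\<lambda>t. (1 / (2 * pi * of_int n)) *\<^sub>R (- \<i> * ee (of_int n * t))) 1 -
       (\<lambda>t. (1 / (2 * pi * of_int n)) *\<^sub>R (- \<i> * ee (of_int n * t))) 0"
    proof (rule integral_indicator_Ico(2))
      show "((\<lambda>t. (1 / (2 * pi * of_int n)) *\<^sub>R (- \<i> * ee (of_int n * t))) has_vector_derivative ee (of_int n * t)) (at t within {0..1})" for t
        using False
        by (intro has_vector_derivative_eq_rhs[OF has_vector_derivative_scaleR[OF DERIV_const has_vector_derivative_mult_right[OF has_vector_derivative_ee]]])
           (auto simp: scaleR_conv_of_real field_simps)
    qed (auto intro!: continuous_intros)
    also have "\<dots> = 0" using ee_of_int[of n] by simp
    finally show ?thesis using False by simp
  qed simp
  finally show ?thesis .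
qed

text \<open>Orthogonality of characters. The integral factors over the coordinates, and the product vanishes as soon as one
  coordinate of the frequency is not 0.\<close>

lemma integral_ee_torus:
  "(LINT x|torus_measure. ee (of_int_vec n \<bullet> x)) = (if n = (0::int^'n) then 1 else 0)"
proof -
  have i: "integrable lborel (\<lambda>t. indicator {0..<1} t *\<^sub>R ee (real_of_int (n $ i) * t))" for i
  proof (rule Bochner_Integration.integrable_bound[of _ "indicator {0..<1} :: real \<Rightarrow> real"])
    show "integrable lborel (indicator {0..<1} :: real \<Rightarrow> real)" by (rule integrable_real_indicator) auto
  qed (auto simp: indicator_def)
  have "(LINT x|torus_measure. ee (of_int_vec n \<bullet> x)) = (\<Prod>i\<in>UNIV. if n $ i = 0 then 1 else 0)"
    unfolding ee_inner of_int_vec_nth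
    by (subst integral_torus_prod[where f = "\<lambda>i t. ee (of_int (n $ i) * t)"]) (auto intro!: i simp: integral_ee_01)
  also have "\<dots> = (if n = 0 then 1 else 0)"
    by (auto simp: vec_eq_iff)
  finally show ?thesis .
qed

section \<open>Parseval's identity on the torus\<close>

inductive trig_poly :: "(real^'n \<Rightarrow> complex) \<Rightarrow> bool" where
  char: "trig_poly (\<lambda>x. c * ee (of_int_vec n \<bullet> x))"
| add: "trig_poly f \<Longrightarrow> trig_poly g \<Longrightarrow> trig_poly (\<lambda>x. f x + g x)"

lemma trig_poly_const: "trig_poly (\<lambda>x. c)"
  using trig_poly.char[of c 0] by simp

lemma trig_poly_char_mult: "trig_poly f \<Longrightarrow> trig_poly (\<lambda>x. c * ee (of_int_vec n \<bullet> x) * f x)"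
proof (induction rule: trig_poly.induct)
  case (char d m)
  show ?case using trig_poly.char[of "c * d" "n + m"] by (simp add: inner_add_left ee_add mult_ac)
next
  case (add f g)
  then show ?case using trig_poly.add by (simp add: distrib_left)
qed

lemma trig_poly_mult: "trig_poly f \<Longrightarrow> trig_poly g \<Longrightarrow> trig_poly (\<lambda>x. f x * g x)"
proof (induction rule: trig_poly.induct)
  case (char c n)
  then show ?case by (rule trig_poly_char_mult)
next
  case (add f g)
  then show ?case using trig_poly.add by (simp add: distrib_right)
qed

lemma trig_poly_sum: "finite A \<Longrightarrow> (\<And>i. i \<in> A \<Longrightarrow> trig_poly (f i)) \<Longrightarrow> trig_poly (\<lambda>x. \<Sum>i\<in>A. f i x)"
  by (induction A rule: finite_induct) (auto intro: trig_poly_const trig_poly.add)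

lemma trig_poly_expansion:
  assumes "trig_poly P"
  shows "\<exists>A c. finite A \<and> (\<forall>n. n \<notin> A \<longrightarrow> c n = 0) \<and> P = (\<lambda>x. \<Sum>n\<in>A. c n * ee (of_int_vec n \<bullet> x))"
  using assms
proof (induction rule: trig_poly.induct)
  case (char c n)
  show ?case by (rule exI[of _ "{n}"], rule exI[of _ "\<lambda>m. if m = n then c else 0"]) auto
next
  case (add f g)
  then obtain A c B d where *: "finite A" "\<And>n. n \<notin> A \<Longrightarrow> c n = 0" "f = (\<lambda>x. \<Sum>n\<in>A. c n * ee (of_int_vec n \<bullet> x))"
    "finite B" "\<And>n. n \<notin> B \<Longrightarrow> d n = 0" "g = (\<lambda>x. \<Sum>n\<in>B. d n * ee (of_int_vec n \<bullet> x))" by blast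
  have "f = (\<lambda>x. \<Sum>n\<in>A\<union>B. c n * ee (of_int_vec n \<bullet> x))" "g = (\<lambda>x. \<Sum>n\<in>A\<union>B. d n * ee (of_int_vec n \<bullet> x))"
    using * by (auto intro!: sum.mono_neutral_left)
  then show ?case using *
    by (intro exI[of _ "A \<union> B"] exI[of _ "\<lambda>n. c n + d n"]) (auto simp: distrib_right sum.distrib)
qed

lemma trig_poly_measurable: "trig_poly P \<Longrightarrow> P \<in> borel_measurable torus_measure"
  by (induction rule: trig_poly.induct) (auto intro!: measurable_torusI)

lemma torus_bounded_Lp:
  fixes f :: "real^'n \<Rightarrow> complex"
  assumes "f \<in> borel_measurable torus_measure" "AE x in torus_measure. norm (f x) \<le> B" "p > 0"
  shows "f \<in> Lp torus_measure p"
proof -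
  have "(\<lambda>x::real^'n. complex_of_real B) \<in> Lp torus_measure p" by (simp add: Lp_def)
  then show ?thesis by (rule Lp_bounded_by) (use assms in \<open>auto elim!: eventually_mono\<close>)
qed

lemma trig_poly_bounded: "trig_poly P \<Longrightarrow> \<exists>B. \<forall>x. norm (P x) \<le> B"
proof (induction rule: trig_poly.induct)
  case (char c n)
  show ?case by (intro exI[of _ "norm c"]) (simp add: norm_mult)
next
  case (add f g)
  then obtain B C where "\<forall>x. norm (f x) \<le> B" "\<forall>x. norm (g x) \<le> C" by blast
  then have "\<forall>x. norm (f x + g x) \<le> B + C" by (auto intro: norm_triangle_mono)
  then show ?case by blast
qed

lemma trig_poly_Lp:
  assumes "trig_poly P" "p > 0" shows "P \<in> Lp torus_measure p"
proof -
  obtain B where "\<forall>x. norm (P x) \<le> B" using trig_poly_bounded[OF assms(1)] by blast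
  then show ?thesis using assms by (intro torus_bounded_Lp[of _ B] trig_poly_measurable) auto
qed

text \<open>Membership in the \<open>L\<^sup>2\<close>-closure of the trigonometric polynomials. The closure is shown below to contain, in turn,
  continuous functions, indicators of closed sets, of Borel sets, and all of \<open>L\<^sup>2\<close>.\<close>

definition trig_approx :: "(real^'n \<Rightarrow> complex) \<Rightarrow> bool" where
  "trig_approx f \<longleftrightarrow> f \<in> Lp torus_measure 2 \<and>
     (\<forall>\<epsilon>>0. \<exists>P. trig_poly P \<and> (LINT x|torus_measure. (norm (f x - P x))\<^sup>2) < \<epsilon>)"

lemma trig_approx_Lp: "trig_approx f \<Longrightarrow> f \<in> Lp torus_measure 2"
  by (simp add: trig_approx_def)

lemma norm_add_square_le: "(norm (a + b :: complex))\<^sup>2 \<le> 2 * (norm a)\<^sup>2 + 2 * (norm b)\<^sup>2"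
proof -
  have "(norm (a + b))\<^sup>2 \<le> (norm a + norm b)\<^sup>2" by (intro power_mono norm_triangle_ineq) simp
  also have "\<dots> \<le> 2 * (norm a)\<^sup>2 + 2 * (norm b)\<^sup>2"
    using sum_squares_bound[of "norm a" "norm b"] by (simp add: power2_sum)
  finally show ?thesis .
qed

lemma integral_norm_add_square_le:
  assumes "f \<in> Lp M 2" "g \<in> Lp M 2"
  shows "(LINT x|M. (norm (f x + g x))\<^sup>2) \<le> 2 * (LINT x|M. (norm (f x))\<^sup>2) + 2 * (LINT x|M. (norm (g x))\<^sup>2)"
proof -
  have i: "integrable M (\<lambda>x. (norm (f x))\<^sup>2)" "integrable M (\<lambda>x. (norm (g x))\<^sup>2)"
    "integrable M (\<lambda>x. (norm (f x + g x))\<^sup>2)"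
    using assms Lp_add[OF assms] by (auto simp: Lp_2_iff)
  have "(LINT x|M. (norm (f x + g x))\<^sup>2) \<le> (LINT x|M. 2 * (norm (f x))\<^sup>2 + 2 * (norm (g x))\<^sup>2)"
    using i by (intro integral_mono) (auto simp: norm_add_square_le)
  then show ?thesis using i by simp
qed

lemma trig_approx_limit:
  assumes g: "g \<in> Lp torus_measure 2"
    and lim: "\<And>\<epsilon>. \<epsilon> > 0 \<Longrightarrow> \<exists>f. trig_approx f \<and> (LINT x|torus_measure. (norm (g x - f x))\<^sup>2) < \<epsilon>"
  shows "trig_approx g"
  unfolding trig_approx_def
proof (intro conjI g allI impI)
  fix \<epsilon> :: real assume "\<epsilon> > 0"
  then obtain f where f: "trig_approx f" "(LINT x|torus_measure. (norm (g x - f x))\<^sup>2) < \<epsilon> / 4"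
    using lim[of "\<epsilon> / 4"] by auto
  then obtain P where P: "trig_poly P" "(LINT x|torus_measure. (norm (f x - P x))\<^sup>2) < \<epsilon> / 4"
    using \<open>\<epsilon> > 0\<close> unfolding trig_approx_def by (metis zero_less_divide_iff zero_less_numeral)
  have "(\<lambda>x. g x - f x) \<in> Lp torus_measure 2" "(\<lambda>x. f x - P x) \<in> Lp torus_measure 2"
    using f(1) g trig_poly_Lp[OF P(1), of 2] by (auto intro!: Lp_diff simp: trig_approx_def)
  from integral_norm_add_square_le[OF this] f P
  have "(LINT x|torus_measure. (norm (g x - P x))\<^sup>2) < \<epsilon>" by simp
  then show "\<exists>P. trig_poly P \<and> (LINT x|torus_measure. (norm (g x - P x))\<^sup>2) < \<epsilon>" using P by blast
qed

lemma trig_approx_add: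
  assumes "trig_approx f" "trig_approx g" shows "trig_approx (\<lambda>x. f x + g x)"
  unfolding trig_approx_def
proof (intro conjI allI impI)
  have L: "f \<in> Lp torus_measure 2" "g \<in> Lp torus_measure 2" using assms by (auto simp: trig_approx_def)
  then show "(\<lambda>x. f x + g x) \<in> Lp torus_measure 2" by (intro Lp_add) auto
  fix \<epsilon> :: real assume "\<epsilon> > 0"
  then have "\<epsilon> / 4 > 0" by simp
  then obtain P Q where P: "trig_poly P" "(LINT x|torus_measure. (norm (f x - P x))\<^sup>2) < \<epsilon> / 4"
    and Q: "trig_poly Q" "(LINT x|torus_measure. (norm (g x - Q x))\<^sup>2) < \<epsilon> / 4"
    using assms unfolding trig_approx_def by meson
  have "(\<lambda>x. f x - P x) \<in> Lp torus_measure 2" "(\<lambda>x. g x - Q x) \<in> Lp torus_measure 2"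
    using L trig_poly_Lp[OF P(1), of 2] trig_poly_Lp[OF Q(1), of 2] by (auto intro!: Lp_diff)
  from integral_norm_add_square_le[OF this] P Q
  have "(LINT x|torus_measure. (norm ((f x + g x) - (P x + Q x)))\<^sup>2) < \<epsilon>" by (simp add: algebra_simps)
  then show "\<exists>P. trig_poly P \<and> (LINT x|torus_measure. (norm (f x + g x - P x))\<^sup>2) < \<epsilon>"
    using trig_poly.add[OF P(1) Q(1)] by (intro exI[of _ "\<lambda>x. P x + Q x"]) simp
qed

lemma trig_poly_trig_approx: "trig_poly P \<Longrightarrow> trig_approx P"
  unfolding trig_approx_def using trig_poly_Lp[of P 2] by (auto intro!: exI[of _ P])

lemma trig_approx_cmult:
  assumes "trig_approx f" shows "trig_approx (\<lambda>x. c * f x)"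
proof (cases "c = 0")
  case True
  then show ?thesis using trig_poly_trig_approx[OF trig_poly_const[of 0]] by simp
next
  case False
  show ?thesis unfolding trig_approx_def
  proof (intro conjI allI impI)
    show "(\<lambda>x. c * f x) \<in> Lp torus_measure 2" using assms by (auto simp: trig_approx_def intro: Lp_cmult)
    fix \<epsilon> :: real assume "\<epsilon> > 0"
    then have "\<epsilon> / (norm c)\<^sup>2 > 0" using False by simp
    then obtain P where P: "trig_poly P" "(LINT x|torus_measure. (norm (f x - P x))\<^sup>2) < \<epsilon> / (norm c)\<^sup>2"
      using assms unfolding trig_approx_def by meson
    have "(LINT x|torus_measure. (norm (c * f x - c * P x))\<^sup>2) = (LINT x|torus_measure. (norm c)\<^sup>2 * (norm (f x - P x))\<^sup>2)"
      by (simp add: norm_mult power_mult_distrib flip: right_diff_distrib)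
    also have "\<dots> < \<epsilon>" using P(2) False by (simp add: field_simps)
    finally show "\<exists>P. trig_poly P \<and> (LINT x|torus_measure. (norm (c * f x - P x))\<^sup>2) < \<epsilon>"
      using trig_poly_mult[OF trig_poly_const[of c] P(1)] by blast
  qed
qed

lemma trig_approx_sum: "finite A \<Longrightarrow> (\<And>i. i \<in> A \<Longrightarrow> trig_approx (f i)) \<Longrightarrow> trig_approx (\<lambda>x. \<Sum>i\<in>A. f i x)"
  by (induction A rule: finite_induct)
     (auto intro: trig_approx_add trig_poly_trig_approx trig_poly_const)

lemma trig_approx_cong:
  fixes f :: "real^'n \<Rightarrow> complex"
  assumes "trig_approx f" "\<And>x. x \<in> cell \<Longrightarrow> f x = g x" shows "trig_approx g"
proof (rule trig_approx_limit)
  have "f \<in> Lp torus_measure 2" using assms by (simp add: trig_approx_def)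
  moreover have "f \<in> borel_measurable torus_measure \<longleftrightarrow> g \<in> borel_measurable torus_measure"
    by (rule measurable_cong) (simp add: assms(2))
  moreover have "integrable torus_measure (\<lambda>x. norm (f x) powr 2) \<longleftrightarrow> integrable torus_measure (\<lambda>x. norm (g x) powr 2)"
    by (rule Bochner_Integration.integrable_cong) (simp_all add: assms(2))
  ultimately show "g \<in> Lp torus_measure 2" by (simp add: Lp_def)
  fix \<epsilon> :: real assume "\<epsilon> > 0"
  have "(LINT x|torus_measure. (norm (g x - f x))\<^sup>2) = (LINT x|(torus_measure :: (real^'n) measure). 0)"
    by (intro Bochner_Integration.integral_cong) (auto simp: assms(2))
  then show "\<exists>f. trig_approx f \<and> (LINT x|torus_measure. (norm (g x - f x))\<^sup>2) < \<epsilon>"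
    using assms(1) \<open>\<epsilon> > 0\<close> by auto
qed

text \<open>The closure is stable under dominated pointwise limits, the only kind of limit needed to pass from
  continuous to arbitrary functions.\<close>

lemma trig_approx_dominated:
  fixes s :: "nat \<Rightarrow> real^'n \<Rightarrow> complex"
  assumes s: "\<And>i::nat. trig_approx (s i)" and B: "B \<in> Lp torus_measure 2"
    and bd: "\<And>i x. x \<in> cell \<Longrightarrow> norm (s i x) \<le> norm (B x)"
    and lim: "\<And>x. x \<in> cell \<Longrightarrow> (\<lambda>i. s i x) \<longlonglongrightarrow> f x"
  shows "trig_approx f"
proof (rule trig_approx_limit)
  have [measurable]: "s i \<in> borel_measurable torus_measure" "B \<in> borel_measurable torus_measure" for i
    using Lp_measurable[OF trig_approx_Lp[OF s[of i]]] Lp_measurable[OF B] by blast+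
  have fm [measurable]: "f \<in> borel_measurable torus_measure"
    by (rule borel_measurable_LIMSEQ_metric[of s]) (simp_all add: lim)
  have fb: "norm (f x) \<le> norm (B x)" if "x \<in> cell" for x
    using bd[OF that] tendsto_norm[OF lim[OF that]] by (intro LIMSEQ_le_const2) auto
  show L: "f \<in> Lp torus_measure 2"
    by (rule Lp_bounded_by[OF B]) (auto simp: fb)
  have "(\<lambda>i. LINT x|torus_measure. (norm (f x - s i x))\<^sup>2) \<longlonglongrightarrow> (LINT x|(torus_measure :: (real^'n) measure). (0::real))"
  proof (rule integral_dominated_convergence)
    show "integrable torus_measure (\<lambda>x. 4 * (norm (B x))\<^sup>2)" using B by (auto simp: Lp_2_iff)
    show "AE x in torus_measure. (\<lambda>i. (norm (f x - s i x))\<^sup>2) \<longlonglongrightarrow> 0"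
    proof (intro AE_I2)
      fix x :: "real^'n" assume "x \<in> space torus_measure"
      then have "(\<lambda>i. (norm (f x - s i x))\<^sup>2) \<longlonglongrightarrow> (norm (f x - f x))\<^sup>2"
        by (intro tendsto_intros lim) simp
      then show "(\<lambda>i. (norm (f x - s i x))\<^sup>2) \<longlonglongrightarrow> 0" by simp
    qed
    fix i
    have "(norm (f x - s i x))\<^sup>2 \<le> 4 * (norm (B x))\<^sup>2" if "x \<in> cell" for x
    proof -
      have "norm (f x - s i x) \<le> 2 * norm (B x)"
        using norm_triangle_ineq4[of "f x" "s i x"] fb[OF that] bd[OF that, of i] by simp
      then have "(norm (f x - s i x))\<^sup>2 \<le> (2 * norm (B x))\<^sup>2" by (intro power_mono) auto
      then show ?thesis by (simp add: power_mult_distrib)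
    qed
    then show "AE x in torus_measure. norm ((norm (f x - s i x))\<^sup>2) \<le> 4 * (norm (B x))\<^sup>2" by auto
  qed auto
  then have l: "(\<lambda>i. LINT x|torus_measure. (norm (f x - s i x))\<^sup>2) \<longlonglongrightarrow> 0" by simp
  fix \<epsilon> :: real assume "\<epsilon> > 0"
  then have "\<forall>\<^sub>F i in sequentially. (LINT x|torus_measure. (norm (f x - s i x))\<^sup>2) < \<epsilon>"
    using order_tendstoD(2)[OF l] by blast
  then show "\<exists>g. trig_approx g \<and> (LINT x|torus_measure. (norm (f x - g x))\<^sup>2) < \<epsilon>"
    using s unfolding eventually_sequentially by blast
qed

text \<open>The torus as a compact subset of \<open>\<complex>\<^sup>N\<close>: continuous functions of \<open>circle_map x\<close> are exactly the
  continuous periodic functions of \<open>x\<close>, and polynomials become trigonometric polynomials.\<close>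

definition circle_map :: "real^'n \<Rightarrow> complex^'n" where
  "circle_map x = (\<chi> i. ee (x $ i))"

lemma continuous_circle_map: "continuous_on A circle_map"
  unfolding circle_map_def by (intro continuous_intros)

lemma circle_map_range: "range circle_map = circle_map ` cbox 0 (1 :: real^'n)"
proof -
  have "circle_map x = circle_map (frac_vec x)" for x :: "real^'n"
  proof -
    have "ee (x $ i) = ee (frac (x $ i))" for i
      using ee_add[of "frac (x $ i)" "of_int \<lfloor>x $ i\<rfloor>"] by (simp add: frac_def)
    then show ?thesis by (simp add: circle_map_def frac_vec_def vec_eq_iff)
  qed
  moreover have "frac_vec x \<in> cbox 0 (1 :: real^'n)" for x
    using frac_vec_in_cell[of x] by (auto simp: cell_def mem_box_cart less_imp_le)
  ultimately show ?thesis by blast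
qed

lemma compact_circle_map: "compact (range (circle_map :: real^'n \<Rightarrow> _))"
  unfolding circle_map_range by (intro compact_continuous_image continuous_circle_map compact_cbox)

lemma circle_map_expansion:
  "circle_map x = (\<Sum>i\<in>UNIV. Re (ee (x $ i)) *\<^sub>R axis i 1 + Im (ee (x $ i)) *\<^sub>R axis i \<i>)"
  by (simp add: vec_eq_iff circle_map_def axis_def if_distrib complex_eq_iff cong: if_cong)

lemma trig_poly_Re_Im_ee: "trig_poly (\<lambda>x. complex_of_real (Re (ee (x $ i))))"
  "trig_poly (\<lambda>x. complex_of_real (Im (ee (x $ i))))"
proof -
  have a: "of_int_vec (axis i k) \<bullet> x = of_int k * x $ i" for k x
  proof -
    have "of_int_vec (axis i k) = axis i (of_int k)" by (auto simp: vec_eq_iff axis_def)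
    then show ?thesis by (simp add: inner_axis')
  qed
  have "complex_of_real (Re (ee (x $ i))) = 1/2 * ee (of_int_vec (axis i 1) \<bullet> x) + 1/2 * ee (of_int_vec (axis i (-1)) \<bullet> x)" for x
    unfolding a by (simp add: complex_eq_iff ee_def)
  then show "trig_poly (\<lambda>x. complex_of_real (Re (ee (x $ i))))"
    by (simp only: trig_poly.add trig_poly.char)
  have "complex_of_real (Im (ee (x $ i))) = (-\<i>/2) * ee (of_int_vec (axis i 1) \<bullet> x) + (\<i>/2) * ee (of_int_vec (axis i (-1)) \<bullet> x)" for x
    unfolding a by (simp add: complex_eq_iff ee_def)
  then show "trig_poly (\<lambda>x. complex_of_real (Im (ee (x $ i))))"
    by (simp only: trig_poly.add trig_poly.char)
qed

lemma polynomial_circle_map: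
  "real_polynomial_function p \<Longrightarrow> trig_poly (\<lambda>x. complex_of_real (p (circle_map x)))"
proof (induction rule: real_polynomial_function.induct)
  case (linear f)
  then interpret bounded_linear f .
  have "complex_of_real (f (circle_map x)) = (\<Sum>i\<in>UNIV. of_real (f (axis i 1)) * of_real (Re (ee (x $ i)))
     + of_real (f (axis i \<i>)) * of_real (Im (ee (x $ i))))" for x
    unfolding circle_map_expansion by (simp add: sum scaleR add mult.commute)
  then show ?case
    by (simp add: trig_poly_sum trig_poly.add trig_poly_mult trig_poly_const trig_poly_Re_Im_ee)
next
  case (const c)
  then show ?case by (rule trig_poly_const)
next
  case (add f g)
  then show ?case using trig_poly.add by simp
next
  case (mult f g)
  then show ?case using trig_poly_mult by simp
qed

lemma circle_map_measurable [measurable]: "circle_map \<in> borel_measurable borel"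
  by (rule borel_measurable_continuous_onI[OF continuous_circle_map])

lemma trig_approx_continuous:
  fixes g :: "complex^'n \<Rightarrow> real"
  assumes "continuous_on UNIV g"
  shows "trig_approx (\<lambda>x. complex_of_real (g (circle_map x)))"
proof (rule trig_approx_limit)
  have "bounded (g ` range (circle_map :: real^'n \<Rightarrow> _))"
    by (intro compact_imp_bounded compact_continuous_image compact_circle_map continuous_on_subset[OF assms]) auto
  then obtain B where B: "\<And>x. norm (g (circle_map x)) \<le> B" unfolding bounded_iff by auto
  have gm [measurable]: "g \<in> borel_measurable borel" using assms by (rule borel_measurable_continuous_onI)
  show L: "(\<lambda>x. complex_of_real (g (circle_map x))) \<in> Lp torus_measure 2"
    using B by (intro torus_bounded_Lp[of _ B] measurable_torusI) auto
  fix \<epsilon> :: real assume "\<epsilon> > 0"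
  (* the bound by 1 allows the square of the error to be estimated by the error itself *)
  obtain h where h: "real_polynomial_function h" "\<And>x. x \<in> range circle_map \<Longrightarrow> \<bar>g x - h x\<bar> < min 1 (\<epsilon> / 2)"
    by (rule Stone_Weierstrass_real_polynomial_function[OF compact_circle_map continuous_on_subset[OF assms], of "min 1 (\<epsilon>/2)"])
       (use \<open>\<epsilon> > 0\<close> in auto)
  have P: "trig_poly (\<lambda>x. complex_of_real (h (circle_map x)))" by (rule polynomial_circle_map[OF h(1)])
  have le: "(norm (complex_of_real (g (circle_map x)) - of_real (h (circle_map x))))\<^sup>2 \<le> \<epsilon> / 2" for x :: "real^'n"
  proof -
    have a: "\<bar>g (circle_map x) - h (circle_map x)\<bar> < min 1 (\<epsilon> / 2)" using h(2) by auto
    have "norm (complex_of_real (g (circle_map x)) - of_real (h (circle_map x))) = \<bar>g (circle_map x) - h (circle_map x)\<bar>"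
      by (metis norm_of_real of_real_diff)
    moreover have "\<bar>g (circle_map x) - h (circle_map x)\<bar>\<^sup>2 \<le> 1 * \<bar>g (circle_map x) - h (circle_map x)\<bar>"
      unfolding power2_eq_square using a by (intro mult_right_mono) auto
    ultimately show ?thesis using a by simp
  qed
  have "(\<lambda>x. complex_of_real (g (circle_map x)) - of_real (h (circle_map x))) \<in> Lp torus_measure 2"
    using L trig_poly_Lp[OF P, of 2] by (intro Lp_diff) auto
  then have "(LINT x|torus_measure. (norm (complex_of_real (g (circle_map x)) - of_real (h (circle_map x))))\<^sup>2) \<le> (LINT x|(torus_measure::(real^'n) measure). \<epsilon> / 2)"
    using le by (intro integral_mono) (auto simp: Lp_2_iff)
  also have "\<dots> < \<epsilon>" using \<open>\<epsilon> > 0\<close> by simp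
  finally show "\<exists>f. trig_approx f \<and> (LINT x|torus_measure. (norm (complex_of_real (g (circle_map x)) - f x))\<^sup>2) < \<epsilon>"
    using trig_poly_trig_approx[OF P] by (intro exI[of _ "\<lambda>x. complex_of_real (h (circle_map x))"]) simp
qed

lemma trig_approx_indicator_closed:
  fixes C :: "(complex^'n) set"
  assumes "closed C"
  shows "trig_approx (\<lambda>x. complex_of_real (indicator C (circle_map x)))"
proof (cases "C = {}")
  case True
  then show ?thesis using trig_poly_trig_approx[OF trig_poly_const[of 0]] by simp
next
  case False
  (* continuous functions that decrease to the indicator of the closed set *)
  define g where "g k z = max 0 (1 - real k * infdist z C)" for k and z :: "complex^'n"
  show ?thesis
  proof (rule trig_approx_dominated[of "\<lambda>k x. complex_of_real (g k (circle_map x))" "\<lambda>_. 1"])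
    show "trig_approx (\<lambda>x. complex_of_real (g k (circle_map x)))" for k
      unfolding g_def by (rule trig_approx_continuous) (intro continuous_intros)
    show "(\<lambda>_. 1) \<in> Lp torus_measure 2" by (simp add: Lp_def)
    show "norm (complex_of_real (g k (circle_map x))) \<le> norm (1::complex)" for k x
      using infdist_nonneg[of "circle_map x" C] by (auto simp: g_def)
    fix x :: "real^'n"
    have "(\<lambda>k. g k z) \<longlonglongrightarrow> indicator C z" for z
    proof (cases "z \<in> C")
      case True
      then show ?thesis by (simp add: g_def)
    next
      case zC: False
      then have d: "infdist z C > 0"
        using assms False in_closed_iff_infdist_zero infdist_nonneg less_eq_real_def by metis
      obtain K :: nat where K: "real K > 1 / infdist z C" using reals_Archimedean2 by blast
      have "g k z = 0" if "k \<ge> K" for k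
      proof -
        have "1 / infdist z C < real k" using K that by (meson less_le_trans of_nat_le_iff)
        then have "1 < real k * infdist z C" using d by (simp add: field_simps)
        then show ?thesis by (simp add: g_def)
      qed
      then show ?thesis using zC by (intro tendsto_eventually eventually_sequentiallyI[of K]) auto
    qed
    then show "(\<lambda>k. complex_of_real (g k (circle_map x))) \<longlonglongrightarrow> complex_of_real (indicator C (circle_map x))"
      by (intro tendsto_of_real)
  qed
qed

text \<open>Dynkin's lemma: the sets with approximable indicator are closed under complements and disjoint unions, and
  the closed sets form a generator that is stable under intersections.\<close>

lemma trig_approx_indicator_borel:
  fixes B :: "(complex^'n) set"
  assumes "B \<in> sets borel"
  shows "trig_approx (\<lambda>x. complex_of_real (indicator B (circle_map x)))"
proof -
  have b: "B \<in> sigma_sets UNIV {S. closed S}"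
    using assms unfolding borel_eq_closed by simp
  have i: "Int_stable {S :: (complex^'n) set. closed S}" by (auto simp: Int_stable_def)
  have p: "{S :: (complex^'n) set. closed S} \<subseteq> Pow UNIV" by auto
  show ?thesis
    using i p b
  proof (induction rule: sigma_sets_induct_disjoint)
    case (basic A)
    then show ?case using trig_approx_indicator_closed by auto
  next
    case empty
    then show ?case using trig_poly_trig_approx[OF trig_poly_const[of 0]] by simp
  next
    case (compl A)
    have "trig_approx (\<lambda>x. 1 + (- 1) * complex_of_real (indicator A (circle_map x)))"
      by (rule trig_approx_add[OF trig_poly_trig_approx[OF trig_poly_const] trig_approx_cmult[OF compl(2)]])
    moreover have "1 + (- 1) * complex_of_real (indicator A z) = complex_of_real (indicator (UNIV - A) z)" for z
      by (simp add: indicator_def)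
    ultimately show ?case by simp
  next
    case (union A)
    show ?case
    proof (rule trig_approx_dominated[of "\<lambda>k x. complex_of_real (indicator (\<Union>i<k. A i) (circle_map x))" "\<lambda>_. 1"])
      show "trig_approx (\<lambda>x. complex_of_real (indicator (\<Union>i<k. A i) (circle_map x)))" for k
      proof -
        have "complex_of_real (indicator (\<Union>i<k. A i) z) = (\<Sum>i<k. complex_of_real (indicator (A i) z))" for z
          using disjoint_family_on_mono[OF subset_UNIV union(1)]
          by (simp add: indicator_UN_disjoint flip: of_real_sum)
        then show ?thesis using union(3) by (simp add: trig_approx_sum)
      qed
      show "(\<lambda>_. 1) \<in> Lp torus_measure 2" by (simp add: Lp_def)
      show "norm (complex_of_real (indicator (\<Union>i<k. A i) (circle_map x))) \<le> norm (1::complex)" for k x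
        by (auto simp: indicator_def)
      show "(\<lambda>k. complex_of_real (indicator (\<Union>i<k. A i) (circle_map x))) \<longlonglongrightarrow> complex_of_real (indicator (\<Union>i. A i) (circle_map x))" for x
        by (intro tendsto_of_real LIMSEQ_indicator_UN)
    qed
  qed
qed

text \<open>A Borel inverse on \<open>[0,1)\<close> of \<open>t \<mapsto> ee t\<close>. The value on the cut, where the argument is not continuous, is fixed
  separately so that measurability follows from continuity off the cut.\<close>

definition circle_arg :: "complex \<Rightarrow> real" where
  "circle_arg z = frac ((indicator (- \<real>\<^sub>\<le>\<^sub>0) z * Arg z + indicator \<real>\<^sub>\<le>\<^sub>0 z * pi) / (2 * pi))"

lemma circle_arg_measurable [measurable]: "circle_arg \<in> borel_measurable borel"
proof -
  have [measurable]: "(\<real>\<^sub>\<le>\<^sub>0 :: complex set) \<in> sets borel" by (intro borel_closed closed_nonpos_Reals_complex)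
  have "(\<lambda>z. indicator (- \<real>\<^sub>\<le>\<^sub>0) z *\<^sub>R Arg z) \<in> borel_measurable borel"
    by (rule borel_measurable_continuous_on_indicator[OF _ continuous_on_Arg])
       (rule borel_comp, measurable)
  then have [measurable]: "(\<lambda>z. indicator (- \<real>\<^sub>\<le>\<^sub>0) z * Arg z) \<in> borel_measurable borel" by simp
  show ?thesis unfolding circle_arg_def frac_def by measurable
qed

lemma Arg_ee_nonpos:
  assumes "ee t \<in> \<real>\<^sub>\<le>\<^sub>0" shows "Arg (ee t) = pi"
proof -
  have *: "Re (ee t) \<le> 0" "Im (ee t) = 0" using assms by (auto simp: complex_nonpos_Reals_iff)
  moreover have "Re (ee t) \<noteq> 0" using * ee_simps(4)[of t] by (auto simp: complex_eq_iff)
  ultimately show ?thesis by (simp add: Arg_eq_pi)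
qed

lemma circle_arg_ee:
  assumes "0 \<le> t" "t < 1" shows "circle_arg (ee t) = t"
proof -
  consider "t < 1/2" | "t = 1/2" | "t > 1/2" by linarith
  then show ?thesis
  proof cases
    case 1
    have "2 * pi * t < pi" "- pi < 0" "0 \<le> 2 * pi * t" using assms(1) 1 by simp_all
    then have "2 * pi * t \<in> {- pi<..pi}" unfolding greaterThanAtMost_iff by linarith
    then have a: "Arg (ee t) = 2 * pi * t" unfolding ee_def by (rule Arg_cis)
    have "ee t \<notin> \<real>\<^sub>\<le>\<^sub>0" using Arg_ee_nonpos[of t] a 1 by auto
    then have "circle_arg (ee t) = frac t" by (simp add: circle_arg_def a)
    then show ?thesis using assms by (simp add: frac_eq)
  next
    case 2
    have t: "2 * pi * t = pi" using 2 by simp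
    have e: "ee t = -1" unfolding ee_def t by simp
    have "circle_arg (- 1) = frac (1 / 2)" by (simp add: circle_arg_def)
    also have "frac (1 / 2 :: real) = 1 / 2" by (simp add: frac_eq)
    finally show ?thesis unfolding e using 2 by simp
  next
    case 3
    have b: "- pi < 2 * pi * t - 2 * pi" "2 * pi * t - 2 * pi \<le> 0"
    proof -
      have "pi * 1 < pi * (2 * t)" using 3 by (intro mult_strict_left_mono) auto
      then show "- pi < 2 * pi * t - 2 * pi" by (simp add: mult_ac)
      have "(2 * pi) * t \<le> (2 * pi) * 1" using assms by (intro mult_left_mono) auto
      then show "2 * pi * t - 2 * pi \<le> 0" by simp
    qed
    have "ee t = ee (t - 1)" using ee_add[of "t - 1" 1] ee_of_int[of 1] by simp
    also have "\<dots> = cis (2 * pi * t - 2 * pi)" by (simp add: ee_def right_diff_distrib)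
    finally have "ee t = cis (2 * pi * t - 2 * pi)" .
    moreover have "Arg (cis (2 * pi * t - 2 * pi)) = 2 * pi * t - 2 * pi"
      using b pi_gt_zero by (intro Arg_cis) simp
    ultimately have a: "Arg (ee t) = 2 * pi * t - 2 * pi" by simp
    have "ee t \<notin> \<real>\<^sub>\<le>\<^sub>0" using Arg_ee_nonpos[of t] a b pi_gt_zero by auto
    then have "circle_arg (ee t) = frac (t - 1)" by (simp add: circle_arg_def a diff_divide_distrib)
    also have "frac (t - 1) = t" using assms by (simp add: frac_unique_iff)
    finally show ?thesis .
  qed
qed

text \<open>The map \<open>circle_map\<close> is injective on the cell with a Borel inverse, so every Borel subset of the cell is the
  preimage of a Borel set.\<close>

lemma trig_approx_indicator:
  fixes A :: "(real^'n) set"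
  assumes "A \<in> sets torus_measure"
  shows "trig_approx (\<lambda>x. complex_of_real (indicator A x))"
proof -
  define G :: "complex^'n \<Rightarrow> real^'n" where "G z = (\<chi> i. circle_arg (z $ i))" for z
  have Gm: "G \<in> borel_measurable borel"
  proof (subst borel_measurable_euclidean_space, intro ballI)
    fix b :: "real^'n" assume "b \<in> Basis"
    then obtain i where "b = axis i 1" by (auto simp: Basis_vec_def)
    then have *: "(\<lambda>x. G x \<bullet> b) = (\<lambda>x. circle_arg (x $ i))" by (simp add: inner_axis G_def fun_eq_iff)
    have "(\<lambda>x::complex^'n. x $ i) \<in> borel_measurable borel"
      by (intro borel_measurable_continuous_onI continuous_intros)
    then show "(\<lambda>x. G x \<bullet> b) \<in> borel_measurable borel" unfolding * by measurable
  qed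
  have "A \<in> sets borel" using assms unfolding torus_measure_eq by (subst (asm) sets_restrict_space_iff) auto
  then have B: "G -` A \<in> sets borel" using measurable_sets[OF Gm] by simp
  show ?thesis
  proof (rule trig_approx_cong[OF trig_approx_indicator_borel[OF B]])
    fix x :: "real^'n" assume "x \<in> cell"
    then have "G (circle_map x) = x" by (auto simp: G_def circle_map_def vec_eq_iff cell_def circle_arg_ee)
    then show "complex_of_real (indicator (G -` A) (circle_map x)) = complex_of_real (indicator A x)"
      by (simp add: indicator_def)
  qed
qed

lemma trig_approx_L2:
  fixes f :: "real^'n \<Rightarrow> complex"
  assumes f: "f \<in> Lp torus_measure 2"
  shows "trig_approx f"
proof -
  have fm: "f \<in> borel_measurable torus_measure" using f by (rule Lp_measurable)
  obtain s where s: "\<And>i. simple_function torus_measure (s i)"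
    and lim: "\<And>x. x \<in> cell \<Longrightarrow> (\<lambda>i. s i x) \<longlonglongrightarrow> f x"
    and bd: "\<And>i x. x \<in> cell \<Longrightarrow> dist (s i x) 0 \<le> 2 * dist (f x) 0"
    using borel_measurable_implies_sequence_metric[OF fm, of 0] unfolding space_torus by metis
  show ?thesis
  proof (rule trig_approx_dominated[of s "\<lambda>x. 2 * f x"])
    show "(\<lambda>x. 2 * f x) \<in> Lp torus_measure 2" using f by (rule Lp_cmult)
    show "norm (s i x) \<le> norm (2 * f x)" if "x \<in> cell" for i x using bd[OF that] by (simp add: norm_mult)
    fix i
    have fin: "finite (s i ` cell)" using simple_functionD(1)[OF s[of i]] by simp
    have "trig_approx (\<lambda>x. \<Sum>y\<in>s i ` cell. y * complex_of_real (indicator (s i -` {y} \<inter> cell) x))"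
      using simple_functionD(2)[OF s[of i]] by (intro trig_approx_sum fin trig_approx_cmult trig_approx_indicator) simp
    then show "trig_approx (s i)"
    proof (rule trig_approx_cong)
      fix x :: "real^'n" assume x: "x \<in> cell"
      have "(\<Sum>y\<in>s i ` cell. y * complex_of_real (indicator (s i -` {y} \<inter> cell) x)) = (\<Sum>y\<in>s i ` cell. if y = s i x then y else 0)"
        by (intro sum.cong) (auto simp: indicator_def x)
      also have "\<dots> = s i x" using fin x by simp
      finally show "(\<Sum>y\<in>s i ` cell. y * complex_of_real (indicator (s i -` {y} \<inter> cell) x)) = s i x" .
    qed
  qed (use lim in auto)
qed

lemma trig_char_Lp: "(\<lambda>x. ee (of_int_vec n \<bullet> x)) \<in> Lp torus_measure 2"
  using trig_poly_Lp[OF trig_poly.char[of 1 n], of 2] by simp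

lemma fourier_T_inner: "fourier_T f n = (LINT x|torus_measure. f x * cnj (ee (of_int_vec n \<bullet> x)))"
  by (simp add: fourier_T_eq)

lemma torus_L2_integrable:
  assumes "f \<in> Lp torus_measure 2"
  shows "integrable torus_measure (\<lambda>x. f x * ee (- (of_int_vec n \<bullet> x)))" "integrable torus_measure f"
proof -
  show "integrable torus_measure (\<lambda>x. f x * ee (- (of_int_vec n \<bullet> x)))"
    using Lp_2_mult_integrable(2)[OF assms trig_char_Lp[of n]] by simp
  show "integrable torus_measure f"
    using Lp_2_mult_integrable(2)[OF assms trig_char_Lp[of 0]] by simp
qed

lemma fourier_T_lincomb:
  assumes "f \<in> Lp torus_measure 2" "g \<in> Lp torus_measure 2"
  shows "fourier_T (\<lambda>x. a * f x + b * g x) n = a * fourier_T f n + b * fourier_T g n"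
proof -
  have "(a * f x + b * g x) * ee (- (of_int_vec n \<bullet> x)) =
      a * (f x * ee (- (of_int_vec n \<bullet> x))) + b * (g x * ee (- (of_int_vec n \<bullet> x)))" for x
    by (simp add: algebra_simps)
  then show ?thesis unfolding fourier_T_eq
    using torus_L2_integrable(1)[OF assms(1), of n] torus_L2_integrable(1)[OF assms(2), of n] by simp
qed

lemma fourier_T_char: "fourier_T (\<lambda>x. ee (of_int_vec m \<bullet> x)) n = (if m = n then 1 else 0)"
  using integral_ee_torus[of "m - n"] by (simp add: fourier_T_eq inner_diff_left flip: ee_add)

lemma fourier_T_trig_sum:
  assumes "finite A"
  shows "fourier_T (\<lambda>x. \<Sum>n\<in>A. c n * ee (of_int_vec n \<bullet> x)) m = (if m \<in> A then c m else 0)"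
  using assms
proof (induction A rule: finite_induct)
  case empty
  then show ?case by (simp add: fourier_T_eq)
next
  case (insert k A)
  have t: "trig_poly (\<lambda>x. \<Sum>n\<in>A. c n * ee (of_int_vec n \<bullet> x))"
    by (intro trig_poly_sum insert trig_poly.char)
  show ?case
    using fourier_T_lincomb[OF trig_char_Lp[of k] trig_poly_Lp[OF t], of "c k" 1 m] insert
    by (auto simp: fourier_T_char)
qed

text \<open>The identity behind Bessel's inequality: the error is smallest when the coefficients are the Fourier coefficients.
  It is proved by adding one frequency at a time.\<close>

lemma torus_approximation_error:
  assumes "finite A" and f: "f \<in> Lp torus_measure 2"
  shows "(LINT x|torus_measure. (norm (f x - (\<Sum>n\<in>A. c n * ee (of_int_vec n \<bullet> x))))\<^sup>2)
     = (LINT x|torus_measure. (norm (f x))\<^sup>2) - (\<Sum>n\<in>A. (norm (fourier_T f n))\<^sup>2)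
       + (\<Sum>n\<in>A. (norm (c n - fourier_T f n))\<^sup>2)"
  using assms(1)
proof (induction A rule: finite_induct)
  case (insert k A)
  define S where "S x = (\<Sum>n\<in>A. c n * ee (of_int_vec n \<bullet> x))" for x
  have t: "trig_poly S" unfolding S_def by (intro trig_poly_sum insert trig_poly.char)
  have L: "S \<in> Lp torus_measure 2" by (rule trig_poly_Lp[OF t]) simp
  have L': "(\<lambda>x. f x - S x) \<in> Lp torus_measure 2" by (rule Lp_diff[OF f L]) simp
  have ft: "(LINT x|torus_measure. (f x - S x) * cnj (ee (of_int_vec k \<bullet> x))) = fourier_T f k"
    using fourier_T_lincomb[OF f L, of 1 "-1" k] fourier_T_trig_sum[OF insert(1), of c k] insert(2)
    by (simp add: fourier_T_inner S_def)
  have "(LINT x|torus_measure. (norm (f x - (\<Sum>n\<in>insert k A. c n * ee (of_int_vec n \<bullet> x))))\<^sup>2)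
      = (LINT x|torus_measure. (norm ((f x - S x) + (- c k) * ee (of_int_vec k \<bullet> x)))\<^sup>2)"
    using insert by (simp add: S_def algebra_simps)
  also have "\<dots> = (LINT x|torus_measure. (norm (f x - S x))\<^sup>2) + (norm (c k))\<^sup>2 * 1
      + 2 * Re (cnj (- c k) * fourier_T f k)"
    unfolding integral_norm_add_square[OF L' trig_char_Lp] ft by simp
  also have "\<dots> = (LINT x|torus_measure. (norm (f x - S x))\<^sup>2) +
      (norm (c k - fourier_T f k))\<^sup>2 - (norm (fourier_T f k))\<^sup>2"
    unfolding cmod_power2 by (simp add: power2_eq_square algebra_simps)
  finally show ?case using insert by (simp add: S_def[symmetric])
qed simp

text \<open>Bessel's inequality gives one direction. For the other, a good approximation by a trigonometric polynomial
  only improves when its coefficients are replaced by the Fourier coefficients.\<close>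

theorem parseval_torus:
  assumes f: "f \<in> Lp torus_measure 2"
  shows "fourier_T f \<in> Lp lattice 2"
    and "(LINT n|lattice. (norm (fourier_T f n))\<^sup>2) = (LINT x|torus_measure. (norm (f x))\<^sup>2)"
proof -
  define S where "S = (LINT x|torus_measure. (norm (f x))\<^sup>2)"
  define a where "a n = (norm (fourier_T f n))\<^sup>2" for n
  have bessel: "sum a A \<le> S" if "finite A" for A
  proof -
    have "0 \<le> (LINT x|torus_measure. (norm (f x - (\<Sum>n\<in>A. fourier_T f n * ee (of_int_vec n \<bullet> x))))\<^sup>2)"
      by (intro Bochner_Integration.integral_nonneg) simp
    then show ?thesis using torus_approximation_error[OF that f, of "fourier_T f"] by (simp add: S_def a_def)
  qed
  have sm: "a summable_on UNIV"
    by (rule nonneg_bdd_above_summable_on) (use bessel in \<open>auto intro!: bdd_aboveI[of _ S] simp: a_def\<close>)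
  have le: "infsum a UNIV \<le> S" by (rule infsum_le_finite_sums[OF sm]) (auto intro: bessel)
  have ge: "S \<le> infsum a UNIV"
  proof (rule field_le_epsilon)
    fix \<epsilon> :: real assume "\<epsilon> > 0"
    then obtain P where P: "trig_poly P" "(LINT x|torus_measure. (norm (f x - P x))\<^sup>2) < \<epsilon>"
      using trig_approx_L2[OF f] unfolding trig_approx_def by blast
    obtain A c where A: "finite A" "P = (\<lambda>x. \<Sum>n\<in>A. c n * ee (of_int_vec n \<bullet> x))"
      using trig_poly_expansion[OF P(1)] by blast
    have "S - sum a A \<le> S - sum a A + (\<Sum>n\<in>A. (norm (c n - fourier_T f n))\<^sup>2)" by (simp add: sum_nonneg)
    also have "\<dots> < \<epsilon>" using torus_approximation_error[OF A(1) f, of c] P(2) by (simp add: A(2) S_def a_def)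
    finally have "S \<le> sum a A + \<epsilon>" by simp
    also have "sum a A \<le> infsum a UNIV" by (rule finite_sum_le_infsum[OF sm A(1)]) (auto simp: a_def)
    finally show "S \<le> infsum a UNIV + \<epsilon>" by simp
  qed
  have abs: "Infinite_Set_Sum.abs_summable_on a UNIV"
    using sm by (subst abs_summable_equivalent[symmetric]) (simp add: a_def[abs_def])
  then show "fourier_T f \<in> Lp lattice 2"
    by (simp add: Lp_2_iff Infinite_Set_Sum.abs_summable_on_def a_def)
  have "(LINT n|lattice. a n) = infsum a UNIV"
    using infsetsum_infsum[OF abs] by (simp add: infsetsum_def)
  then show "(LINT n|lattice. (norm (fourier_T f n))\<^sup>2) = (LINT x|torus_measure. (norm (f x))\<^sup>2)"
    using le ge by (simp add: a_def S_def)
qed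

theorem parseval_torus_inner:
  assumes f: "f \<in> Lp torus_measure 2" and g: "g \<in> Lp torus_measure 2"
  shows "(LINT n|lattice. fourier_T f n * cnj (fourier_T g n)) = (LINT x|torus_measure. f x * cnj (g x))"
proof (rule polarization[OF parseval_torus(1)[OF f] parseval_torus(1)[OF g] f g])
  fix a b
  show "(LINT x|lattice. (norm (a * fourier_T f x + b * fourier_T g x))\<^sup>2) =
      (LINT x|torus_measure. (norm (a * f x + b * g x))\<^sup>2)"
    using parseval_torus(2)[OF Lp_lincomb[OF f g, of a b]] by (simp add: fourier_T_lincomb[OF f g])
qed

lemma fourier_T_unique:
  assumes f: "f \<in> Lp torus_measure 2" and g: "g \<in> Lp torus_measure 2"
    and eq: "\<And>n. fourier_T f n = fourier_T g n"
  shows "AE x in torus_measure. f x = g x"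
proof -
  have d: "(\<lambda>x. f x - g x) \<in> Lp torus_measure 2" by (rule Lp_diff[OF f g]) simp
  have "fourier_T (\<lambda>x. f x - g x) n = 0" for n
    using fourier_T_lincomb[OF f g, of 1 "-1" n] eq by simp
  then have "(LINT x|torus_measure. (norm (f x - g x))\<^sup>2) = 0"
    using parseval_torus(2)[OF d] by simp
  then have "AE x in torus_measure. (norm (f x - g x))\<^sup>2 = 0"
    using d by (subst (asm) integral_nonneg_eq_0_iff_AE) (auto simp: Lp_2_iff)
  then show ?thesis by eventually_elim simp
qed

(* As a default rule this competes with the rules for functions on the whole space; measurability on
   the torus is obtained from measurability there by restriction. *)
declare measurable_torus_ident [measurable del]

section \<open>Plancherel's theorem on Euclidean space\<close>

definition trunc :: "real \<Rightarrow> (real^'n \<Rightarrow> complex) \<Rightarrow> real^'n \<Rightarrow> complex" where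
  "trunc R f x = (if norm x \<le> R then f x else 0)"

text \<open>The usual space \<open>L\<^sup>2\<^sub>c\<close> of square-integrable functions with bounded support. Its members are integrable, so their Fourier
  transforms are given by the integral; they serve as test functions.\<close>

definition L2c :: "(real^'n \<Rightarrow> complex) \<Rightarrow> bool" where
  "L2c f \<longleftrightarrow> f \<in> Lp lborel 2 \<and> (\<exists>R. \<forall>x. norm x > R \<longrightarrow> f x = 0)"

lemma bounded_support_Lp:
  fixes f :: "real^'n \<Rightarrow> complex"
  assumes "f \<in> borel_measurable borel" "\<And>x. norm (f x) \<le> C" "\<And>x. norm x > R \<Longrightarrow> f x = 0" "r > 0"
  shows "f \<in> Lp lborel r"
proof -
  have "integrable lborel (\<lambda>x. norm (f x) powr r)"
  proof (rule Bochner_Integration.integrable_bound[of _ "\<lambda>x. C powr r * indicator (cball (0::real^'n) R) x"])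
    show "integrable lborel (\<lambda>x. C powr r * indicator (cball (0::real^'n) R) x)"
      by (intro integrable_mult_right integrable_real_indicator emeasure_lborel_cball_finite) simp
    have "norm (f x) powr r \<le> C powr r * indicator (cball 0 R) x" for x
      using assms(2)[of x] assms(3)[of x] assms(4) by (cases "norm x > R") (auto intro!: powr_mono2)
    then show "AE x in lborel. norm (norm (f x) powr r) \<le> norm (C powr r * indicator (cball (0::real^'n) R) x)"
      by auto
  qed (use assms(1) in measurable)
  then show ?thesis using assms(1) by (simp add: Lp_def)
qed

lemma L2c_Lp: "L2c f \<Longrightarrow> f \<in> Lp lborel 2"
  by (simp add: L2c_def)

lemma L2c_measurable: "L2c f \<Longrightarrow> f \<in> borel_measurable borel"
  using Lp_measurable[of f lborel 2] by (simp add: L2c_def)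

lemma trunc_measurable [measurable (raw)]:
  assumes [measurable]: "f \<in> borel_measurable borel"
  shows "trunc R f \<in> borel_measurable borel"
  unfolding trunc_def[abs_def] by measurable

lemma trunc_Lp:
  assumes "f \<in> Lp lborel p" "p > 0" shows "trunc R f \<in> Lp lborel p"
  by (rule Lp_bounded_by[OF assms(1)]) (use assms Lp_measurable[OF assms(1)] in \<open>auto simp: trunc_def\<close>)

lemma L2c_trunc: "f \<in> Lp lborel 2 \<Longrightarrow> L2c (trunc R f)"
  unfolding L2c_def by (auto intro!: trunc_Lp exI[of _ R] simp: trunc_def)

lemma L2c_lincomb:
  assumes "L2c f" "L2c g" shows "L2c (\<lambda>x. a * f x + b * g x)"
proof -
  obtain R S where "\<forall>x. norm x > R \<longrightarrow> f x = 0" "\<forall>x. norm x > S \<longrightarrow> g x = 0"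
    using assms by (auto simp: L2c_def)
  then have "\<forall>x. norm x > max R S \<longrightarrow> a * f x + b * g x = 0" by auto
  moreover have "(\<lambda>x. a * f x + b * g x) \<in> Lp lborel 2" using assms by (intro Lp_lincomb L2c_Lp) auto
  ultimately show ?thesis unfolding L2c_def by blast
qed

lemma L2c_integrable:
  fixes f :: "real^'n \<Rightarrow> complex"
  assumes "L2c f" shows "integrable lborel f"
proof -
  obtain R where R: "\<forall>x. norm x > R \<longrightarrow> f x = 0" using assms by (auto simp: L2c_def)
  have "(\<lambda>x::real^'n. complex_of_real (indicator (cball 0 R) x)) \<in> Lp lborel 2"
    by (rule bounded_support_Lp[of _ 1 R]) (auto simp: indicator_def)
  from Lp_2_mult_integrable(3)[OF L2c_Lp[OF assms] this]
  show ?thesis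
  proof (rule Bochner_Integration.integrable_cong[THEN iffD1, rotated -1])
    fix x show "f x * complex_of_real (indicator (cball 0 R) x) = f x"
      using R by (auto simp: indicator_def)
  qed simp
qed

lemma integrable_mult_ee:
  assumes "integrable M f" "g \<in> borel_measurable M"
  shows "integrable M (\<lambda>x. f x * ee (g x))"
  by (rule Bochner_Integration.integrable_bound[OF assms(1)]) (use assms in \<open>auto simp: norm_mult\<close>)

lemma fourier_R_measurable [measurable (raw)]:
  assumes [measurable]: "f \<in> borel_measurable borel"
  shows "fourier_R f \<in> borel_measurable borel"
proof -
  have "(\<lambda>(\<xi>, x). f x * ee (- (\<xi> \<bullet> x))) \<in> borel_measurable (borel \<Otimes>\<^sub>M (lborel :: (real^'a) measure))"
    by measurable
  from lborel.borel_measurable_lebesgue_integral[OF this]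
  show ?thesis unfolding fourier_R_eq by simp
qed

lemma fourier_R_measurable_compose [measurable (raw)]:
  assumes "f \<in> borel_measurable borel" "g \<in> borel_measurable M"
  shows "(\<lambda>x. fourier_R f (g x)) \<in> borel_measurable M"
  by (rule measurable_compose[OF assms(2) fourier_R_measurable[OF assms(1)]])

lemma fourier_R_lincomb:
  assumes "integrable lborel f" "integrable lborel g"
  shows "fourier_R (\<lambda>x. a * f x + b * g x) \<xi> = a * fourier_R f \<xi> + b * fourier_R g \<xi>"
proof -
  have "(a * f x + b * g x) * ee (- (\<xi> \<bullet> x)) = a * (f x * ee (- (\<xi> \<bullet> x))) + b * (g x * ee (- (\<xi> \<bullet> x)))" for x
    by (simp add: algebra_simps)
  then show ?thesis unfolding fourier_R_eq
    using integrable_mult_ee[OF assms(1)] integrable_mult_ee[OF assms(2)] by simp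
qed

lemma finite_lattice_box: "finite {k :: int^'n. \<forall>i. \<bar>k $ i\<bar> \<le> m}"
proof (rule finite_subset)
  show "{k :: int^'n. \<forall>i. \<bar>k $ i\<bar> \<le> m} \<subseteq> vec_lambda ` (PiE UNIV (\<lambda>_. {-m..m}))"
  proof
    fix k :: "int^'n" assume "k \<in> {k. \<forall>i. \<bar>k $ i\<bar> \<le> m}"
    then have "\<bar>k $ i\<bar> \<le> m" for i by simp
    then have "vec_nth k \<in> PiE UNIV (\<lambda>_. {-m..m})" by (auto simp: abs_le_iff minus_le_iff)
    then show "k \<in> vec_lambda ` (PiE UNIV (\<lambda>_. {-m..m}))" by (metis image_eqI vec_nth_inverse)
  qed
qed (auto intro!: finite_PiE)

lemma finite_lattice_near: "finite {k :: int^'n. \<exists>u\<in>cell. norm (of_int_vec k + u) \<le> R}"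
proof (rule finite_subset[OF _ finite_lattice_box[of "\<lceil>R\<rceil> + 1"]])
  show "{k :: int^'n. \<exists>u\<in>cell. norm (of_int_vec k + u) \<le> R} \<subseteq> {k. \<forall>i. \<bar>k $ i\<bar> \<le> \<lceil>R\<rceil> + 1}"
  proof safe
    fix k :: "int^'n" and u :: "real^'n" and i assume u: "u \<in> cell" "norm (of_int_vec k + u) \<le> R"
    have "\<bar>of_int (k $ i) + u $ i\<bar> \<le> R" using component_le_norm_cart[of "of_int_vec k + u" i] u by simp
    moreover have "0 \<le> u $ i" "u $ i < 1" using u by (auto simp: cell_def)
    ultimately have "\<bar>of_int (k $ i)\<bar> \<le> R + 1" by linarith
    then show "\<bar>k $ i\<bar> \<le> \<lceil>R\<rceil> + 1" by linarith
  qed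
qed

lemma integral_lattice_finite:
  fixes f :: "int^'n \<Rightarrow> 'b::{banach, second_countable_topology}"
  assumes "finite J" "\<And>k. k \<notin> J \<Longrightarrow> f k = 0"
  shows "(LINT k|lattice. f k) = (\<Sum>k\<in>J. f k)" "integrable lattice f"
proof -
  have "has_bochner_integral lattice (\<lambda>k. \<Sum>j\<in>J. indicator {j} k *\<^sub>R f j) (\<Sum>j\<in>J. measure lattice {j} *\<^sub>R f j)"
    by (intro has_bochner_integral_sum has_bochner_integral_indicator) auto
  moreover have "(\<Sum>j\<in>J. indicator {j} k *\<^sub>R f j) = f k" for k
  proof -
    have "(\<Sum>j\<in>J. indicator {j} k *\<^sub>R f j) = (\<Sum>j\<in>J. if j = k then f k else 0)"
      by (intro sum.cong) (auto simp: indicator_def)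
    then show ?thesis using assms by simp
  qed
  ultimately have "has_bochner_integral lattice f (\<Sum>j\<in>J. f j)" by (simp add: measure_def)
  then show "(LINT k|lattice. f k) = (\<Sum>k\<in>J. f k)" "integrable lattice f"
    by (auto simp: has_bochner_integral_iff)
qed

lemma nn_integral_lattice_finite:
  fixes f :: "int^'n \<Rightarrow> ennreal"
  assumes "finite J" "\<And>k. k \<notin> J \<Longrightarrow> f k = 0"
  shows "(\<integral>\<^sup>+k. f k \<partial>lattice) = (\<Sum>k\<in>J. f k)"
proof -
  have "(\<integral>\<^sup>+k. f k \<partial>lattice) = (\<integral>\<^sup>+k. f k * indicator J k \<partial>lattice)"
    using assms by (intro nn_integral_cong) (auto simp: indicator_def)
  also have "\<dots> = (\<integral>\<^sup>+k. f k \<partial>count_space J)" by (simp add: nn_integral_count_space_indicator)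
  also have "\<dots> = (\<Sum>k\<in>J. f k)" by (rule nn_integral_count_space_finite[OF assms(1)])
  finally show ?thesis .
qed

text \<open>The Fourier transform at the points \<open>n + s\<close> consists of the Fourier coefficients of the
  periodization of \<open>f\<close> twisted by the character of frequency \<open>s\<close> (the Zak transform). Parseval on the torus in
  the variable \<open>u\<close>, and orthogonality of characters in the variable \<open>s\<close>, give Plancherel's identity.\<close>

definition zak :: "(real^'n \<Rightarrow> complex) \<Rightarrow> real^'n \<Rightarrow> real^'n \<Rightarrow> complex" where
  "zak f s u = (LINT k|lattice. f (of_int_vec k + u) * ee (- (s \<bullet> (of_int_vec k + u))))"

lemma zak_measurable [measurable (raw)]:
  assumes [measurable]: "f \<in> borel_measurable borel"
  shows "zak f s \<in> borel_measurable borel"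
  unfolding zak_def[abs_def] by measurable

lemma fourier_R_zak:
  fixes f :: "real^'n \<Rightarrow> complex"
  assumes "integrable lborel f"
  shows "fourier_R f (of_int_vec n + s) = fourier_T (zak f s) n"
proof -
  define g where "g x = f x * ee (- ((of_int_vec n + s) \<bullet> x))" for x
  have [measurable]: "f \<in> borel_measurable borel" using assms by auto
  have "integrable lborel g" unfolding g_def by (intro integrable_mult_ee assms) measurable
  then have "fourier_R f (of_int_vec n + s) = (LINT u|torus_measure. LINT k|lattice. g (of_int_vec k + u))"
    unfolding fourier_R_eq g_def[symmetric] by (rule integral_unfold)
  also have "\<dots> = (LINT u|torus_measure. LINT k|lattice.
      f (of_int_vec k + u) * ee (- (s \<bullet> (of_int_vec k + u))) * ee (- (of_int_vec n \<bullet> u)))"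
  proof (intro Bochner_Integration.integral_cong refl)
    fix k and u :: "real^'n"
    have "ee (- ((of_int_vec n + s) \<bullet> (of_int_vec k + u))) =
      ee (- (s \<bullet> (of_int_vec k + u)) + (of_int_vec (- n) \<bullet> of_int_vec k + - (of_int_vec n \<bullet> u)))"
      by (rule arg_cong[of _ _ ee]) (simp add: inner_simps)
    also have "\<dots> = ee (- (s \<bullet> (of_int_vec k + u))) * ee (- (of_int_vec n \<bullet> u))"
      by (simp only: ee_add ee_lattice mult_1)
    finally show "g (of_int_vec k + u) = f (of_int_vec k + u) * ee (- (s \<bullet> (of_int_vec k + u))) * ee (- (of_int_vec n \<bullet> u))"
      by (simp add: g_def)
  qed
  finally show ?thesis by (simp add: fourier_T_eq zak_def)
qed

lemma nn_integral_square:
  assumes "f \<in> Lp M 2"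
  shows "(\<integral>\<^sup>+x. ennreal ((norm (f x))\<^sup>2) \<partial>M) = ennreal (LINT x|M. (norm (f x))\<^sup>2)"
  using assms by (intro nn_integral_eq_integral) (auto simp: Lp_2_iff)

lemma Lp_2_I_nn:
  assumes "f \<in> borel_measurable M" "(\<integral>\<^sup>+x. ennreal ((norm (f x))\<^sup>2) \<partial>M) \<le> ennreal C" "C \<ge> 0"
  shows "f \<in> Lp M 2" "(LINT x|M. (norm (f x))\<^sup>2) \<le> C"
proof -
  have [measurable]: "f \<in> borel_measurable M" by fact
  have "integrable M (\<lambda>x. (norm (f x))\<^sup>2)"
    by (rule integrableI_bounded) (use assms in \<open>auto intro: le_less_trans\<close>)
  then show L: "f \<in> Lp M 2" using assms by (simp add: Lp_2_iff)
  show "(LINT x|M. (norm (f x))\<^sup>2) \<le> C"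
    using assms(2,3) unfolding nn_integral_square[OF L] by (simp add: ennreal_le_iff)
qed

lemma torus_translate_Lp:
  assumes "f \<in> Lp lborel 2" shows "(\<lambda>u. f (of_int_vec k + u)) \<in> Lp torus_measure 2"
proof -
  have [measurable]: "f \<in> borel_measurable borel" using Lp_measurable[OF assms] by simp
  have "(\<lambda>u. f (of_int_vec k + u)) \<in> borel_measurable torus_measure"
    by (rule measurable_torusI) measurable
  moreover have "integrable torus_measure (\<lambda>u. (norm (f (of_int_vec k + u)))\<^sup>2)"
    using integral_unfold(5)[of "\<lambda>x. (norm (f x))\<^sup>2" k] assms by (simp add: Lp_2_iff)
  ultimately show ?thesis by (simp add: Lp_2_iff)
qed

lemma plancherel_nn:
  fixes f :: "real^'n \<Rightarrow> complex"
  assumes "L2c f"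
  shows "(\<integral>\<^sup>+\<xi>. ennreal ((norm (fourier_R f \<xi>))\<^sup>2) \<partial>lborel) = (\<integral>\<^sup>+x. ennreal ((norm (f x))\<^sup>2) \<partial>lborel)"
proof -
  obtain R where R: "\<And>x. norm x > R \<Longrightarrow> f x = 0" using assms by (auto simp: L2c_def)
  (* the finitely many cells that meet the support of \<open>f\<close> *)
  define J where "J = {k :: int^'n. \<exists>u\<in>cell. norm (of_int_vec k + u) \<le> R}"
  have J: "finite J" "f (of_int_vec k + u) = 0" if "k \<notin> J" "u \<in> cell" for k u
    using that R finite_lattice_near[of R] by (force simp: J_def)+
  have fJ: "finite J" using finite_lattice_near[of R] by (simp add: J_def)
  have fm [measurable]: "f \<in> borel_measurable borel" using assms by (rule L2c_measurable)
  have zs: "zak f s u = (\<Sum>k\<in>J. f (of_int_vec k + u) * ee (- (s \<bullet> (of_int_vec k + u))))" if "u \<in> cell" for s u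
    unfolding zak_def by (rule integral_lattice_finite(1)[OF fJ]) (simp add: J(2) that)
  have zL: "zak f s \<in> Lp torus_measure 2" for s
  proof -
    have "(\<lambda>u. \<Sum>k\<in>J. f (of_int_vec k + u) * ee (- (s \<bullet> (of_int_vec k + u)))) \<in> Lp torus_measure 2"
    proof (intro Lp_sum fJ)
      fix k
      show "(\<lambda>u. f (of_int_vec k + u) * ee (- (s \<bullet> (of_int_vec k + u)))) \<in> Lp torus_measure 2"
      proof (rule Lp_bounded_by[OF torus_translate_Lp[OF L2c_Lp[OF assms], of k]])
        show "(\<lambda>u. f (of_int_vec k + u) * ee (- (s \<bullet> (of_int_vec k + u)))) \<in> borel_measurable torus_measure"
          by (rule measurable_torusI) measurable
      qed (auto simp: norm_mult)
    qed auto
    then show ?thesis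
      by (rule Lp_bounded_by)
         (auto simp: zs intro!: measurable_torusI zak_measurable fm)
  qed
  (* for fixed \<open>u\<close>, \<open>zak f s u\<close> is up to a factor of modulus 1 a trigonometric polynomial in \<open>s\<close> *)
  have sq: "(\<integral>\<^sup>+s. ennreal ((norm (zak f s u))\<^sup>2) \<partial>torus_measure) = (\<integral>\<^sup>+k. ennreal ((norm (f (of_int_vec k + u)))\<^sup>2) \<partial>lattice)"
    if u: "u \<in> cell" for u
  proof -
    define c where "c n = f (of_int_vec (- n) + u)" for n
    have "norm (zak f s u) = norm (0 - (\<Sum>n\<in>uminus ` J. c n * ee (of_int_vec n \<bullet> s)))" for s
    proof -
      have "zak f s u = ee (- (s \<bullet> u)) * (\<Sum>k\<in>J. f (of_int_vec k + u) * ee (of_int_vec (- k) \<bullet> s))"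
      proof -
        have "ee (- (s \<bullet> (of_int_vec k + u))) = ee (- (s \<bullet> u)) * ee (of_int_vec (- k) \<bullet> s)" for k
          by (simp add: inner_simps inner_commute add.commute flip: ee_add)
        then show ?thesis unfolding zs[OF u] sum_distrib_left by (simp add: mult_ac)
      qed
      also have "(\<Sum>k\<in>J. f (of_int_vec k + u) * ee (of_int_vec (- k) \<bullet> s)) = (\<Sum>n\<in>uminus ` J. c n * ee (of_int_vec n \<bullet> s))"
        by (subst sum.reindex) (auto simp: c_def add.commute)
      finally show ?thesis by (simp add: norm_mult)
    qed
    then have "(\<integral>\<^sup>+s. ennreal ((norm (zak f s u))\<^sup>2) \<partial>torus_measure) =
       (\<integral>\<^sup>+s. ennreal ((norm (0 - (\<Sum>n\<in>uminus ` J. c n * ee (of_int_vec n \<bullet> s))))\<^sup>2) \<partial>torus_measure)" by simp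
    also have "\<dots> = ennreal (LINT s|torus_measure. (norm (0 - (\<Sum>n\<in>uminus ` J. c n * ee (of_int_vec n \<bullet> s))))\<^sup>2)"
      by (intro nn_integral_square Lp_diff trig_poly_Lp trig_poly_const trig_poly_sum trig_poly.char) (auto simp: fJ)
    also have "(LINT s|torus_measure. (norm (0 - (\<Sum>n\<in>uminus ` J. c n * ee (of_int_vec n \<bullet> s))))\<^sup>2) = (\<Sum>n\<in>uminus ` J. (norm (c n))\<^sup>2)"
      by (subst torus_approximation_error) (auto simp: fJ fourier_T_eq Lp_def)
    also have "\<dots> = (\<Sum>k\<in>J. (norm (f (of_int_vec k + u)))\<^sup>2)"
      by (subst sum.reindex) (auto simp: c_def add.commute)
    also have "ennreal \<dots> = (\<integral>\<^sup>+k. ennreal ((norm (f (of_int_vec k + u)))\<^sup>2) \<partial>lattice)"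
      by (subst nn_integral_lattice_finite[OF fJ]) (auto simp: J(2) u sum_ennreal)
    finally show ?thesis .
  qed
  have zm: "(\<lambda>(s, u). ennreal ((norm (zak f s u))\<^sup>2)) \<in> borel_measurable (torus_measure \<Otimes>\<^sub>M torus_measure)"
  proof -
    have "(\<lambda>z. zak f (fst z) (snd z)) \<in> borel_measurable (torus_measure \<Otimes>\<^sub>M torus_measure)"
    proof -
      have [measurable]: "fst \<in> borel_measurable (torus_measure \<Otimes>\<^sub>M torus_measure :: ((real^'n) \<times> (real^'n)) measure)"
        "snd \<in> borel_measurable (torus_measure \<Otimes>\<^sub>M torus_measure :: ((real^'n) \<times> (real^'n)) measure)"
        by (rule measurable_compose[OF measurable_fst measurable_torus_ident],
            rule measurable_compose[OF measurable_snd measurable_torus_ident])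
      show ?thesis unfolding zak_def by measurable
    qed
    then show ?thesis by (simp add: case_prod_beta')
  qed
  interpret pair_sigma_finite "torus_measure :: (real^'n) measure" "torus_measure :: (real^'n) measure" ..
  have "(\<integral>\<^sup>+\<xi>. ennreal ((norm (fourier_R f \<xi>))\<^sup>2) \<partial>lborel)
     = (\<integral>\<^sup>+n. \<integral>\<^sup>+s. ennreal ((norm (fourier_R f (of_int_vec n + s)))\<^sup>2) \<partial>torus_measure \<partial>lattice)"
    by (rule nn_integral_unfold) measurable
  also have "\<dots> = (\<integral>\<^sup>+s. \<integral>\<^sup>+n. ennreal ((norm (fourier_R f (of_int_vec n + s)))\<^sup>2) \<partial>lattice \<partial>torus_measure)"
    by (rule nn_integral_lattice_swap[OF torus.sigma_finite_measure_axioms], rule measurable_torusI) measurable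
  also have "\<dots> = (\<integral>\<^sup>+s. \<integral>\<^sup>+u. ennreal ((norm (zak f s u))\<^sup>2) \<partial>torus_measure \<partial>torus_measure)"
    unfolding fourier_R_zak[OF L2c_integrable[OF assms]]
    by (simp add: nn_integral_square[OF zL] nn_integral_square[OF parseval_torus(1)[OF zL]] parseval_torus(2)[OF zL])
  also have "\<dots> = (\<integral>\<^sup>+u. \<integral>\<^sup>+s. ennreal ((norm (zak f s u))\<^sup>2) \<partial>torus_measure \<partial>torus_measure)"
    using Fubini[OF zm] by simp
  also have "\<dots> = (\<integral>\<^sup>+u. \<integral>\<^sup>+k. ennreal ((norm (f (of_int_vec k + u)))\<^sup>2) \<partial>lattice \<partial>torus_measure)"
    by (intro nn_integral_cong sq) simp
  also have "\<dots> = (\<integral>\<^sup>+k. \<integral>\<^sup>+u. ennreal ((norm (f (of_int_vec k + u)))\<^sup>2) \<partial>torus_measure \<partial>lattice)"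
    by (rule nn_integral_lattice_swap[OF torus.sigma_finite_measure_axioms, symmetric], rule measurable_torusI) measurable
  also have "\<dots> = (\<integral>\<^sup>+x. ennreal ((norm (f x))\<^sup>2) \<partial>lborel)"
    by (rule nn_integral_unfold[symmetric]) measurable
  finally show ?thesis .
qed

theorem plancherel_L2c:
  assumes "L2c f"
  shows "fourier_R f \<in> Lp lborel 2"
    and "(LINT \<xi>|lborel. (norm (fourier_R f \<xi>))\<^sup>2) = (LINT x|lborel. (norm (f x))\<^sup>2)"
proof -
  have e: "(\<integral>\<^sup>+\<xi>. ennreal ((norm (fourier_R f \<xi>))\<^sup>2) \<partial>lborel) = ennreal (LINT x|lborel. (norm (f x))\<^sup>2)"
    using plancherel_nn[OF assms] nn_integral_square[OF L2c_Lp[OF assms]] by simp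
  have m: "fourier_R f \<in> borel_measurable lborel" using L2c_measurable[OF assms] by simp
  show L: "fourier_R f \<in> Lp lborel 2"
    by (rule Lp_2_I_nn(1)[OF m eq_refl[OF e]]) simp
  show "(LINT \<xi>|lborel. (norm (fourier_R f \<xi>))\<^sup>2) = (LINT x|lborel. (norm (f x))\<^sup>2)"
    using e unfolding nn_integral_square[OF L] by (subst (asm) ennreal_inj) auto
qed

theorem plancherel_L2c_inner:
  assumes "L2c f" "L2c g"
  shows "(LINT \<xi>|lborel. fourier_R f \<xi> * cnj (fourier_R g \<xi>)) = (LINT x|lborel. f x * cnj (g x))"
proof (rule polarization[OF plancherel_L2c(1)[OF assms(1)] plancherel_L2c(1)[OF assms(2)] L2c_Lp[OF assms(1)] L2c_Lp[OF assms(2)]])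
  fix a b
  show "(LINT x|lborel. (norm (a * fourier_R f x + b * fourier_R g x))\<^sup>2) =
      (LINT x|lborel. (norm (a * f x + b * g x))\<^sup>2)"
    using plancherel_L2c(2)[OF L2c_lincomb[OF assms, of a b]]
    by (simp add: fourier_R_lincomb L2c_integrable assms)
qed

text \<open>The next lemmas concern the relation \<^const>\<open>plancherel_R\<close>. Pairing with functions of bounded support
  determines both sides of the relation, and conversely the pairing identity implies the relation.\<close>

lemma plancherel_R_eq: "plancherel_R f g \<longleftrightarrow> f \<in> Lp lborel 2 \<and> g \<in> Lp lborel 2 \<and>
     ((\<lambda>R. LINT \<xi>|lborel. (norm (fourier_R (trunc R f) \<xi> - g \<xi>))\<^sup>2) \<longlongrightarrow> 0) at_top"
proof (cases "f \<in> Lp lborel 2 \<and> g \<in> Lp lborel 2")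
  case True
  have "(\<integral>\<^sup>+ \<xi>. ennreal ((norm (fourier_R (trunc R f) \<xi> - g \<xi>))\<^sup>2) \<partial>lborel) =
      ennreal (LINT \<xi>|lborel. (norm (fourier_R (trunc R f) \<xi> - g \<xi>))\<^sup>2)" for R
    using True by (intro nn_integral_square Lp_diff plancherel_L2c L2c_trunc) auto
  moreover have "((\<lambda>R. ennreal (LINT \<xi>|lborel. (norm (fourier_R (trunc R f) \<xi> - g \<xi>))\<^sup>2)) \<longlongrightarrow> ennreal 0) at_top
    \<longleftrightarrow> ((\<lambda>R. LINT \<xi>|lborel. (norm (fourier_R (trunc R f) \<xi> - g \<xi>))\<^sup>2) \<longlongrightarrow> 0) at_top"
    by (intro tendsto_ennreal_iff) auto
  ultimately show ?thesis using True by (simp add: plancherel_R_def trunc_def[abs_def])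
qed (auto simp: plancherel_R_def)

text \<open>The form in which the Cauchy-Schwarz inequality turns convergence in \<open>L\<^sup>2\<close> into convergence of pairings.\<close>

lemma tendsto_zero_by_square:
  fixes a :: "real \<Rightarrow> complex"
  assumes le: "\<And>R. norm (a R) \<le> sqrt (e R) * C" and "(e \<longlongrightarrow> 0) at_top"
  shows "(a \<longlongrightarrow> 0) at_top"
proof (rule Lim_null_comparison)
  show "\<forall>\<^sub>F R in at_top. norm (a R) \<le> sqrt (e R) * C" using le by simp
  have "((\<lambda>R. sqrt (e R) * C) \<longlongrightarrow> sqrt 0 * C) at_top" by (intro tendsto_intros assms)
  then show "((\<lambda>R. sqrt (e R) * C) \<longlongrightarrow> 0) at_top" by simp
qed

text \<open>Both sides are limits of the corresponding expressions for the truncations of \<open>u\<close>; the left-hand side does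
  not change once the truncation contains the support of \<open>w\<close>.\<close>

lemma plancherel_pairing:
  assumes P: "plancherel_R u v" and w: "L2c w"
  shows "(LINT x|lborel. u x * cnj (w x)) = (LINT \<xi>|lborel. v \<xi> * cnj (fourier_R w \<xi>))"
proof -
  have u: "u \<in> Lp lborel 2" and v: "v \<in> Lp lborel 2"
    and lim: "((\<lambda>R. LINT \<xi>|lborel. (norm (fourier_R (trunc R u) \<xi> - v \<xi>))\<^sup>2) \<longlongrightarrow> 0) at_top"
    using P by (auto simp: plancherel_R_eq)
  obtain R0 where R0: "\<And>x. norm x > R0 \<Longrightarrow> w x = 0" using w by (auto simp: L2c_def)
  have L: "fourier_R (trunc R u) \<in> Lp lborel 2" "fourier_R w \<in> Lp lborel 2" for R
    using plancherel_L2c(1)[OF L2c_trunc[OF u]] plancherel_L2c(1)[OF w] by auto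
  define a where "a R = (LINT \<xi>|lborel. (fourier_R (trunc R u) \<xi> - v \<xi>) * cnj (fourier_R w \<xi>))" for R
  have "(a \<longlongrightarrow> 0) at_top"
  proof (rule tendsto_zero_by_square[OF _ lim])
    show "norm (a R) \<le> sqrt (LINT \<xi>|lborel. (norm (fourier_R (trunc R u) \<xi> - v \<xi>))\<^sup>2)
        * sqrt (LINT \<xi>|lborel. (norm (fourier_R w \<xi>))\<^sup>2)" for R
      unfolding a_def by (intro Cauchy_Schwarz_integral Lp_diff L v) simp
  qed
  moreover have "a R = (LINT x|lborel. u x * cnj (w x)) - (LINT \<xi>|lborel. v \<xi> * cnj (fourier_R w \<xi>))" if "R \<ge> R0" for R
  proof -
    have "a R = (LINT \<xi>|lborel. fourier_R (trunc R u) \<xi> * cnj (fourier_R w \<xi>)) - (LINT \<xi>|lborel. v \<xi> * cnj (fourier_R w \<xi>))"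
      unfolding a_def left_diff_distrib
      by (intro Bochner_Integration.integral_diff Lp_2_mult_integrable L v)
    also have "(LINT \<xi>|lborel. fourier_R (trunc R u) \<xi> * cnj (fourier_R w \<xi>)) = (LINT x|lborel. trunc R u x * cnj (w x))"
      by (rule plancherel_L2c_inner[OF L2c_trunc[OF u] w])
    also have "\<dots> = (LINT x|lborel. u x * cnj (w x))"
      using that R0 by (intro Bochner_Integration.integral_cong) (auto simp: trunc_def)
    finally show ?thesis .
  qed
  then have "\<forall>\<^sub>F R in at_top. a R = (LINT x|lborel. u x * cnj (w x)) - (LINT \<xi>|lborel. v \<xi> * cnj (fourier_R w \<xi>))"
    using eventually_ge_at_top[of R0] by (rule eventually_mono[rotated])
  then have "(a \<longlongrightarrow> (LINT x|lborel. u x * cnj (w x)) - (LINT \<xi>|lborel. v \<xi> * cnj (fourier_R w \<xi>))) at_top"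
    by (rule tendsto_eventually)
  ultimately have "0 = (LINT x|lborel. u x * cnj (w x)) - (LINT \<xi>|lborel. v \<xi> * cnj (fourier_R w \<xi>))"
    by (rule tendsto_unique[rotated 1]) simp
  then show ?thesis by simp
qed

lemma AE_zero_from_truncations:
  assumes "\<And>N::nat. AE x in lborel. norm (x::real^'n) \<le> real N \<longrightarrow> P x"
  shows "AE x in lborel. P x"
proof -
  have "AE x in lborel. \<forall>N::nat. norm (x::real^'n) \<le> real N \<longrightarrow> P x"
    unfolding AE_all_countable using assms by blast
  then show ?thesis
  proof eventually_elim
    fix x :: "real^'n" assume "\<forall>N::nat. norm x \<le> real N \<longrightarrow> P x"
    moreover obtain N :: nat where "norm x \<le> real N" using real_arch_simple by blast
    ultimately show "P x" by blast
  qed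
qed

lemma L2_zero_AE:
  assumes "f \<in> Lp M 2" "(LINT x|M. (norm (f x))\<^sup>2) \<le> 0"
  shows "AE x in M. f x = 0"
proof -
  have "(LINT x|M. (norm (f x))\<^sup>2) = 0" using assms(2) by (intro antisym Bochner_Integration.integral_nonneg) auto
  then have "AE x in M. (norm (f x))\<^sup>2 = 0"
    using assms(1) by (subst (asm) integral_nonneg_eq_0_iff_AE) (auto simp: Lp_2_iff)
  then show ?thesis by eventually_elim simp
qed

text \<open>The truncations of \<open>d\<close> are themselves admissible test functions.\<close>

lemma weakly_zero_AE:
  assumes d: "\<And>R. trunc R d \<in> Lp lborel 2"
    and z: "\<And>w. L2c w \<Longrightarrow> (LINT x|lborel. d x * cnj (w x)) = 0"
  shows "AE x in lborel. d x = 0"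
proof (rule AE_zero_from_truncations)
  fix N :: nat
  have n: "L2c (trunc (real N) d)" using d by (auto simp: L2c_def trunc_def intro!: exI[of _ "real N"])
  have "(LINT x|lborel. d x * cnj (trunc (real N) d x)) = (LINT x|lborel. of_real ((norm (trunc (real N) d x))\<^sup>2))"
    by (intro Bochner_Integration.integral_cong) (auto simp: trunc_def complex_norm_square simp del: of_real_power)
  also have "\<dots> = complex_of_real (LINT x|lborel. (norm (trunc (real N) d x))\<^sup>2)"
    by (rule integral_complex_of_real)
  finally have "(LINT x|lborel. (norm (trunc (real N) d x))\<^sup>2) = 0"
    using z[OF n] by simp
  then have "AE x in lborel. trunc (real N) d x = 0" by (intro L2_zero_AE d) simp
  then show "AE x in lborel. norm x \<le> real N \<longrightarrow> d x = 0" by eventually_elim (auto simp: trunc_def)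
qed

lemma L2c_pairing_integrable:
  assumes d: "\<And>R. trunc R d \<in> Lp lborel 2" and w: "L2c w"
  shows "integrable lborel (\<lambda>x. d x * cnj (w x))"
proof -
  obtain R where R: "\<And>x. norm x > R \<Longrightarrow> w x = 0" using w by (auto simp: L2c_def)
  have *: "(\<lambda>x. d x * cnj (w x)) = (\<lambda>x. trunc R d x * cnj (w x))" using R by (force simp: trunc_def fun_eq_iff)
  show ?thesis unfolding * using Lp_2_mult_integrable(2)[OF d[of R] L2c_Lp[OF w]] by simp
qed

lemma weakly_equal_AE:
  assumes d: "\<And>R. trunc R d \<in> Lp lborel 2" and e: "\<And>R. trunc R e \<in> Lp lborel 2"
    and z: "\<And>w. L2c w \<Longrightarrow> (LINT x|lborel. d x * cnj (w x)) = (LINT x|lborel. e x * cnj (w x))"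
  shows "AE x in lborel. d x = e x"
proof -
  have "AE x in lborel. d x - e x = 0"
  proof (rule weakly_zero_AE)
    have "trunc R (\<lambda>x. d x - e x) = (\<lambda>x. trunc R d x - trunc R e x)" for R by (auto simp: trunc_def)
    then show "trunc R (\<lambda>x. d x - e x) \<in> Lp lborel 2" for R using Lp_diff[OF d e] by simp
    show "(LINT x|lborel. (d x - e x) * cnj (w x)) = 0" if "L2c w" for w
      unfolding left_diff_distrib
      using z[OF that] L2c_pairing_integrable[OF d that] L2c_pairing_integrable[OF e that] by simp
  qed
  then show ?thesis by eventually_elim simp
qed

lemma plancherel_R_unique_source:
  fixes u v :: "real^'n \<Rightarrow> complex"
  assumes "plancherel_R u v" "plancherel_R u' v'" "AE \<xi> in lborel. v \<xi> = v' \<xi>"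
  shows "AE x in lborel. u x = u' x"
proof (rule weakly_equal_AE)
  have L: "u \<in> Lp lborel 2" "u' \<in> Lp lborel 2" "v \<in> Lp lborel 2" "v' \<in> Lp lborel 2"
    using assms by (auto simp: plancherel_R_def)
  show "trunc R u \<in> Lp lborel 2" "trunc R u' \<in> Lp lborel 2" for R using L by (auto intro: trunc_Lp)
  fix w :: "real^'n \<Rightarrow> complex" assume w: "L2c w"
  have [measurable]: "v \<in> borel_measurable borel" "v' \<in> borel_measurable borel" "w \<in> borel_measurable borel"
    using L(3,4)[THEN Lp_measurable] L2c_measurable[OF w] by auto
  have "(LINT \<xi>|lborel. v \<xi> * cnj (fourier_R w \<xi>)) = (LINT \<xi>|lborel. v' \<xi> * cnj (fourier_R w \<xi>))"
    by (rule integral_cong_AE) (use assms(3) in auto)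
  then show "(LINT x|lborel. u x * cnj (w x)) = (LINT x|lborel. u' x * cnj (w x))"
    using plancherel_pairing[OF assms(1) w] plancherel_pairing[OF assms(2) w] by simp
qed

lemma fourier_R_trunc_tendsto:
  assumes f: "integrable lborel f"
  shows "(\<lambda>N. fourier_R (trunc (real N) f) \<xi>) \<longlonglongrightarrow> fourier_R f \<xi>"
  unfolding fourier_R_eq
proof (rule integral_dominated_convergence)
  have [measurable]: "f \<in> borel_measurable borel" using f by auto
  show "integrable lborel (\<lambda>x. norm (f x))" using f by simp
  show "(\<lambda>x. f x * ee (- (\<xi> \<bullet> x))) \<in> borel_measurable lborel" by measurable
  show "(\<lambda>x. trunc (real N) f x * ee (- (\<xi> \<bullet> x))) \<in> borel_measurable lborel" for N by measurable
  show "AE x in lborel. norm (trunc (real N) f x * ee (- (\<xi> \<bullet> x))) \<le> norm (f x)" for N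
    by (auto simp: trunc_def norm_mult)
  show "AE x in lborel. (\<lambda>N. trunc (real N) f x * ee (- (\<xi> \<bullet> x))) \<longlonglongrightarrow> f x * ee (- (\<xi> \<bullet> x))"
  proof (rule AE_I2)
    fix x :: "real^'a"
    obtain N0 :: nat where N0: "norm x \<le> real N0" using real_arch_simple by blast
    have "\<forall>\<^sub>F N in sequentially. trunc (real N) f x * ee (- (\<xi> \<bullet> x)) = f x * ee (- (\<xi> \<bullet> x))"
      using N0 by (intro eventually_sequentiallyI[of N0]) (auto simp: trunc_def)
    then show "(\<lambda>N. trunc (real N) f x * ee (- (\<xi> \<bullet> x))) \<longlonglongrightarrow> f x * ee (- (\<xi> \<bullet> x))"
      by (rule tendsto_eventually)
  qed
qed

text \<open>The transforms of the truncations converge to \<open>h\<close> in \<open>L\<^sup>2\<close> and pointwise to the integral. Fatou's lemma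
  shows that the two limits agree.\<close>

lemma plancherel_R_integrable:
  assumes P: "plancherel_R f h" and f: "integrable lborel f"
  shows "AE \<xi> in lborel. h \<xi> = fourier_R f \<xi>"
proof -
  have L: "f \<in> Lp lborel 2" "h \<in> Lp lborel 2"
    and lim: "((\<lambda>R. LINT \<xi>|lborel. (norm (fourier_R (trunc R f) \<xi> - h \<xi>))\<^sup>2) \<longlongrightarrow> 0) at_top"
    using P by (auto simp: plancherel_R_eq)
  have [measurable]: "f \<in> borel_measurable borel" "h \<in> borel_measurable borel" using L[THEN Lp_measurable] by auto
  have lim': "(\<lambda>N. LINT \<xi>|lborel. (norm (fourier_R (trunc (real N) f) \<xi> - h \<xi>))\<^sup>2) \<longlonglongrightarrow> 0"
    by (rule filterlim_compose[OF lim filterlim_real_sequentially])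
  have "(\<integral>\<^sup>+\<xi>. ennreal ((norm (fourier_R f \<xi> - h \<xi>))\<^sup>2) \<partial>lborel) =
      (\<integral>\<^sup>+\<xi>. liminf (\<lambda>N. ennreal ((norm (fourier_R (trunc (real N) f) \<xi> - h \<xi>))\<^sup>2)) \<partial>lborel)"
    by (intro nn_integral_cong lim_imp_Liminf[symmetric] tendsto_ennrealI tendsto_intros fourier_R_trunc_tendsto f) simp
  also have "\<dots> \<le> liminf (\<lambda>N. \<integral>\<^sup>+\<xi>. ennreal ((norm (fourier_R (trunc (real N) f) \<xi> - h \<xi>))\<^sup>2) \<partial>lborel)"
    by (rule nn_integral_liminf) measurable
  also have "\<dots> = liminf (\<lambda>N. ennreal (LINT \<xi>|lborel. (norm (fourier_R (trunc (real N) f) \<xi> - h \<xi>))\<^sup>2))"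
    by (subst nn_integral_square) (auto intro!: Lp_diff plancherel_L2c(1) L2c_trunc L)
  also have "\<dots> = ennreal 0"
    by (intro lim_imp_Liminf tendsto_ennrealI lim') simp
  finally have *: "(\<integral>\<^sup>+\<xi>. ennreal ((norm (fourier_R f \<xi> - h \<xi>))\<^sup>2) \<partial>lborel) \<le> ennreal 0" .
  have m: "(\<lambda>\<xi>. fourier_R f \<xi> - h \<xi>) \<in> borel_measurable lborel" by measurable
  have "AE \<xi> in lborel. fourier_R f \<xi> - h \<xi> = 0"
    by (rule L2_zero_AE[OF Lp_2_I_nn[OF m *]]) simp_all
  then show ?thesis by eventually_elim simp
qed

text \<open>The pairing identity forces \<open>u\<close> to be square integrable: test it with truncations of \<open>u\<close> itself.\<close>

lemma pairing_imp_L2: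
  fixes u v :: "real^'n \<Rightarrow> complex"
  assumes um: "u \<in> borel_measurable borel" and v: "v \<in> Lp lborel 2"
    and pair: "\<And>w. L2c w \<Longrightarrow> (LINT x|lborel. u x * cnj (w x)) = (LINT \<xi>|lborel. v \<xi> * cnj (fourier_R w \<xi>))"
  shows "u \<in> Lp lborel 2" "(LINT x|lborel. (norm (u x))\<^sup>2) \<le> (LINT \<xi>|lborel. (norm (v \<xi>))\<^sup>2)"
proof -
  note [measurable] = um
  define B where "B = (LINT \<xi>|lborel. (norm (v \<xi>))\<^sup>2)"
  define w where "w N x = (if norm x \<le> real N \<and> norm (u x) \<le> real N then u x else 0)" for N x
  have wm [measurable]: "w N \<in> borel_measurable borel" for N unfolding w_def[abs_def] by measurable
  have n: "L2c (w N)" for N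
  proof -
    have "w N \<in> Lp lborel 2" by (rule bounded_support_Lp[of _ "real N" "real N"]) (auto simp: w_def)
    then show ?thesis unfolding L2c_def by (auto simp: w_def intro!: exI[of _ "real N"])
  qed
  have le: "(LINT x|lborel. (norm (w N x))\<^sup>2) \<le> B" for N
  proof -
    define A where "A = (LINT x|lborel. (norm (w N x))\<^sup>2)"
    have A0: "A \<ge> 0" by (simp add: A_def)
    have "(LINT x|lborel. u x * cnj (w N x)) = (LINT x|lborel. complex_of_real ((norm (w N x))\<^sup>2))"
      by (intro Bochner_Integration.integral_cong) (auto simp: w_def complex_norm_square simp del: of_real_power)
    also have "\<dots> = complex_of_real A" unfolding A_def by (rule integral_complex_of_real)
    finally have "A = norm (LINT \<xi>|lborel. v \<xi> * cnj (fourier_R (w N) \<xi>))" using A0 pair[OF n] by simp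
    also have "\<dots> \<le> sqrt B * sqrt A"
      using Cauchy_Schwarz_integral[OF v plancherel_L2c(1)[OF n], of N] plancherel_L2c(2)[OF n, of N]
      by (simp add: A_def B_def)
    finally have "sqrt A * sqrt A \<le> sqrt B * sqrt A" using A0 by simp
    moreover have "B \<ge> 0" by (simp add: B_def)
    ultimately have "A \<le> B"
      using A0 mult_right_le_imp_le[of "sqrt A" "sqrt A" "sqrt B"] by (cases "A = 0") auto
    then show ?thesis by (simp add: A_def)
  qed
  have "(\<integral>\<^sup>+x. ennreal ((norm (u x))\<^sup>2) \<partial>lborel) = (\<integral>\<^sup>+x. liminf (\<lambda>N. ennreal ((norm (w N x))\<^sup>2)) \<partial>lborel)"
  proof (intro nn_integral_cong lim_imp_Liminf[symmetric] tendsto_ennrealI tendsto_intros)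
    fix x :: "real^'n"
    obtain N0 :: nat where N0: "max (norm x) (norm (u x)) \<le> real N0" using real_arch_simple by blast
    have "\<forall>\<^sub>F N in sequentially. w N x = u x"
      using N0 by (intro eventually_sequentiallyI[of N0]) (auto simp: w_def)
    then show "(\<lambda>N. w N x) \<longlonglongrightarrow> u x" by (rule tendsto_eventually)
  qed simp
  also have "\<dots> \<le> liminf (\<lambda>N. \<integral>\<^sup>+x. ennreal ((norm (w N x))\<^sup>2) \<partial>lborel)"
    by (rule nn_integral_liminf) measurable
  also have "\<dots> \<le> liminf (\<lambda>N::nat. ennreal B)"
    by (intro Liminf_mono always_eventually allI) (simp add: nn_integral_square[OF L2c_Lp[OF n]] ennreal_leI le)
  also have "\<dots> = ennreal B" by (simp add: Liminf_const)
  finally have *: "(\<integral>\<^sup>+x. ennreal ((norm (u x))\<^sup>2) \<partial>lborel) \<le> ennreal B" .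
  have "u \<in> borel_measurable lborel" "B \<ge> 0" by (simp_all add: B_def)
  from Lp_2_I_nn[OF this(1) * this(2)]
  show "u \<in> Lp lborel 2" "(LINT x|lborel. (norm (u x))\<^sup>2) \<le> (LINT \<xi>|lborel. (norm (v \<xi>))\<^sup>2)"
    by (simp_all add: B_def)
qed

lemma trunc_L2_tendsto:
  assumes f: "f \<in> Lp lborel 2"
  shows "((\<lambda>R. LINT x|lborel. (norm (trunc R f x))\<^sup>2) \<longlongrightarrow> (LINT x|lborel. (norm (f x))\<^sup>2)) at_top"
proof (rule integral_dominated_convergence_at_top)
  have [measurable]: "f \<in> borel_measurable borel" using Lp_measurable[OF f] by simp
  show "integrable lborel (\<lambda>x. (norm (f x))\<^sup>2)" using f by (simp add: Lp_2_iff)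
  show "(\<lambda>x. (norm (trunc R f x))\<^sup>2) \<in> borel_measurable lborel" for R by measurable
  show "(\<lambda>x. (norm (f x))\<^sup>2) \<in> borel_measurable lborel" by measurable
  show "\<forall>\<^sub>F R in at_top. AE x in lborel. norm ((norm (trunc R f x))\<^sup>2) \<le> (norm (f x))\<^sup>2"
    by (auto simp: trunc_def)
  show "AE x in lborel. ((\<lambda>R. (norm (trunc R f x))\<^sup>2) \<longlongrightarrow> (norm (f x))\<^sup>2) at_top"
  proof (rule AE_I2)
    fix x :: "real^'a"
    have "\<forall>\<^sub>F R in at_top. (norm (trunc R f x))\<^sup>2 = (norm (f x))\<^sup>2"
      using eventually_ge_at_top[of "norm x"] by eventually_elim (simp add: trunc_def)
    then show "((\<lambda>R. (norm (trunc R f x))\<^sup>2) \<longlongrightarrow> (norm (f x))\<^sup>2) at_top" by (rule tendsto_eventually)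
  qed
qed

lemma trunc_L2_remainder:
  assumes f: "f \<in> Lp lborel 2"
  shows "(LINT x|lborel. (norm (f x - trunc R f x))\<^sup>2) =
    (LINT x|lborel. (norm (f x))\<^sup>2) - (LINT x|lborel. (norm (trunc R f x))\<^sup>2)"
proof -
  have "(norm (f x - trunc R f x))\<^sup>2 = (norm (f x))\<^sup>2 - (norm (trunc R f x))\<^sup>2" for x by (auto simp: trunc_def)
  then show ?thesis using f trunc_Lp[OF f, of R] by (simp add: Lp_2_iff)
qed

text \<open>Fubini's theorem, with the inverse transform written as the reflected transform.\<close>

lemma inverse_fourier_pairing:
  fixes v w :: "real^'n \<Rightarrow> complex"
  assumes v: "integrable lborel v" and w: "integrable lborel w"
  shows "(LINT x|lborel. fourier_R v (- x) * cnj (w x)) = (LINT \<xi>|lborel. v \<xi> * cnj (fourier_R w \<xi>))"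
proof -
  have [measurable]: "v \<in> borel_measurable borel" "w \<in> borel_measurable borel" using v w by auto
  have "(LINT x|lborel. fourier_R v (- x) * cnj (w x)) = (LINT x|lborel. LINT \<xi>|lborel. v \<xi> * ee (\<xi> \<bullet> x) * cnj (w x))"
    by (simp add: fourier_R_eq inner_commute)
  also have "\<dots> = (LINT \<xi>|lborel. LINT x|lborel. v \<xi> * ee (\<xi> \<bullet> x) * cnj (w x))"
  proof (rule integral_swap[OF sigma_finite_lborel sigma_finite_lborel])
    show "(\<lambda>(x, \<xi>). v \<xi> * ee (\<xi> \<bullet> x) * cnj (w x)) \<in> borel_measurable (lborel \<Otimes>\<^sub>M lborel)" by measurable
    have "(\<integral>\<^sup>+x. \<integral>\<^sup>+\<xi>. ennreal (norm (v \<xi> * ee (\<xi> \<bullet> x) * cnj (w x))) \<partial>lborel \<partial>lborel)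
      = (\<integral>\<^sup>+x. (\<integral>\<^sup>+\<xi>. ennreal (norm (v \<xi>)) \<partial>lborel) * ennreal (norm (w x)) \<partial>lborel)"
      by (simp add: norm_mult ennreal_mult nn_integral_multc)
    also have "\<dots> = (\<integral>\<^sup>+\<xi>. ennreal (norm (v \<xi>)) \<partial>lborel) * (\<integral>\<^sup>+x. ennreal (norm (w x)) \<partial>lborel)"
      by (simp add: nn_integral_cmult)
    also have "\<dots> < \<infinity>" using v w by (simp add: integrable_iff_bounded ennreal_mult_less_top)
    finally show "(\<integral>\<^sup>+x. \<integral>\<^sup>+\<xi>. ennreal (norm (v \<xi> * ee (\<xi> \<bullet> x) * cnj (w x))) \<partial>lborel \<partial>lborel) < \<infinity>" .
  qed
  also have "\<dots> = (LINT \<xi>|lborel. v \<xi> * cnj (fourier_R w \<xi>))"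
  proof (intro Bochner_Integration.integral_cong refl)
    fix \<xi> :: "real^'n"
    have "(LINT x|lborel. v \<xi> * ee (\<xi> \<bullet> x) * cnj (w x)) = (LINT x|lborel. v \<xi> * cnj (w x * ee (- (\<xi> \<bullet> x))))"
      by (simp add: mult_ac)
    also have "\<dots> = v \<xi> * cnj (fourier_R w \<xi>)"
      unfolding fourier_R_eq by (simp del: complex_cnj_mult ee_simps)
    finally show "(LINT x|lborel. v \<xi> * ee (\<xi> \<bullet> x) * cnj (w x)) = v \<xi> * cnj (fourier_R w \<xi>)" .
  qed
  finally show ?thesis .
qed

lemma nn_integral_lborel_uminus:
  fixes f :: "real^'n \<Rightarrow> ennreal"
  assumes [measurable]: "f \<in> borel_measurable borel"
  shows "(\<integral>\<^sup>+x. f (- x) \<partial>lborel) = (\<integral>\<^sup>+x. f x \<partial>lborel)"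
proof -
  have l: "lborel = distr lborel borel (uminus :: real^'n \<Rightarrow> _)"
    using lborel_affine[of "-1" "0 :: real^'n"] by (simp add: density_1)
  show ?thesis by (subst (2) l) (simp add: nn_integral_distr)
qed

text \<open>The converse of \<^verbatim>\<open>plancherel_pairing\<close>: the pairing identity alone forces \<open>v\<close> to be the transform of \<open>u\<close>. Norms agree because \<open>v\<close> is a limit of truncations, and the inverse
  transforms of these converge to \<open>u\<close>. Once the norms agree, expanding the square shows that the transforms of
  the truncations of \<open>u\<close> converge to \<open>v\<close>.\<close>

theorem plancherel_R_from_pairing:
  fixes u v :: "real^'n \<Rightarrow> complex"
  assumes um: "u \<in> borel_measurable borel" and v: "v \<in> Lp lborel 2"
    and pair: "\<And>w. L2c w \<Longrightarrow> (LINT x|lborel. u x * cnj (w x)) = (LINT \<xi>|lborel. v \<xi> * cnj (fourier_R w \<xi>))"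
  shows "plancherel_R u v"
proof -
  define A B where "A = (LINT x|lborel. (norm (u x))\<^sup>2)" and "B = (LINT \<xi>|lborel. (norm (v \<xi>))\<^sup>2)"
  have u: "u \<in> Lp lborel 2" and AB: "A \<le> B" using pairing_imp_L2[OF um v pair] by (auto simp: A_def B_def)
  define b where "b R = (LINT \<xi>|lborel. (norm (trunc R v \<xi>))\<^sup>2)" for R
  have b: "(b \<longlongrightarrow> B) at_top" unfolding b_def B_def by (rule trunc_L2_tendsto[OF v])
  have low: "A \<ge> b R - 2 * (sqrt (b R) * sqrt (B - b R))" for R
  proof -
    (* the inverse transform of the truncation of \<open>v\<close>; it has squared norm \<open>b R\<close>, and by pairing_imp_L2
       its squared distance from \<open>u\<close> is at most \<open>B - b R\<close> *)
    define z where "z x = fourier_R (trunc R v) (- x)" for x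
    have n: "L2c (trunc R v)" by (rule L2c_trunc[OF v])
    have zm [measurable]: "z \<in> borel_measurable borel"
      unfolding z_def by (rule measurable_compose[OF _ fourier_R_measurable[OF L2c_measurable[OF n]]]) simp
    have "(\<integral>\<^sup>+x. ennreal ((norm (z x))\<^sup>2) \<partial>lborel) = ennreal (b R)"
      unfolding z_def b_def
      using nn_integral_lborel_uminus[of "\<lambda>x. ennreal ((norm (fourier_R (trunc R v) x))\<^sup>2)"]
        plancherel_nn[OF n] nn_integral_square[OF L2c_Lp[OF n]] fourier_R_measurable[OF L2c_measurable[OF n]] by simp
    moreover have b0: "b R \<ge> 0" by (simp add: b_def)
    ultimately have z: "z \<in> Lp lborel 2" and zn: "(LINT x|lborel. (norm (z x))\<^sup>2) = b R"
    proof -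
      assume *: "(\<integral>\<^sup>+x. ennreal ((norm (z x))\<^sup>2) \<partial>lborel) = ennreal (b R)"
      show L: "z \<in> Lp lborel 2" by (rule Lp_2_I_nn(1)[OF _ eq_refl[OF *] b0]) simp
      show "(LINT x|lborel. (norm (z x))\<^sup>2) = b R" using * b0 unfolding nn_integral_square[OF L] by simp
    qed
    have pz: "(LINT x|lborel. z x * cnj (w x)) = (LINT \<xi>|lborel. trunc R v \<xi> * cnj (fourier_R w \<xi>))" if "L2c w" for w
      unfolding z_def by (rule inverse_fourier_pairing[OF L2c_integrable[OF n] L2c_integrable[OF that]])
    have d: "(LINT x|lborel. (norm (u x - z x))\<^sup>2) \<le> (LINT \<xi>|lborel. (norm (v \<xi> - trunc R v \<xi>))\<^sup>2)"
    proof (rule pairing_imp_L2(2))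
      show "(\<lambda>x. u x - z x) \<in> borel_measurable borel" using um by measurable
      show "(\<lambda>\<xi>. v \<xi> - trunc R v \<xi>) \<in> Lp lborel 2" by (intro Lp_diff v trunc_Lp) auto
      fix w :: "real^'n \<Rightarrow> complex" assume w: "L2c w"
      have t: "trunc R v \<in> Lp lborel 2" by (rule trunc_Lp[OF v]) simp
      note W = L2c_Lp[OF w] plancherel_L2c(1)[OF w]
      show "(LINT x|lborel. (u x - z x) * cnj (w x)) = (LINT \<xi>|lborel. (v \<xi> - trunc R v \<xi>) * cnj (fourier_R w \<xi>))"
        unfolding left_diff_distrib using pair[OF w] pz[OF w]
          Lp_2_mult_integrable(2)[OF u W(1)] Lp_2_mult_integrable(2)[OF z W(1)]
          Lp_2_mult_integrable(2)[OF v W(2)] Lp_2_mult_integrable(2)[OF t W(2)] by simp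
    qed
    also have "\<dots> = B - b R" unfolding trunc_L2_remainder[OF v] by (simp add: B_def b_def)
    finally have d: "(LINT x|lborel. (norm (u x - z x))\<^sup>2) \<le> B - b R" .
    have L: "(\<lambda>x. u x - z x) \<in> Lp lborel 2" by (intro Lp_diff u z) simp
    have "A = b R + (LINT x|lborel. (norm (u x - z x))\<^sup>2) + 2 * Re (LINT x|lborel. z x * cnj (u x - z x))"
      using integral_norm_add_square[OF z L, of 1] zn by (simp add: A_def)
    moreover have "\<bar>Re (LINT x|lborel. z x * cnj (u x - z x))\<bar> \<le> sqrt (b R) * sqrt (B - b R)"
    proof -
      have "\<bar>Re (LINT x|lborel. z x * cnj (u x - z x))\<bar> \<le> norm (LINT x|lborel. z x * cnj (u x - z x))" by (rule abs_Re_le_cmod)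
      also have "\<dots> \<le> sqrt (b R) * sqrt (LINT x|lborel. (norm (u x - z x))\<^sup>2)"
        using Cauchy_Schwarz_integral[OF z L] zn by simp
      also have "\<dots> \<le> sqrt (b R) * sqrt (B - b R)" using d b0 by (intro mult_left_mono) auto
      finally show ?thesis .
    qed
    moreover have "0 \<le> (LINT x|lborel. (norm (u x - z x))\<^sup>2)" by simp
    ultimately show ?thesis by linarith
  qed
  have "((\<lambda>R. b R - 2 * (sqrt (b R) * sqrt (B - b R))) \<longlongrightarrow> B - 2 * (sqrt B * sqrt (B - B))) at_top"
    by (intro tendsto_intros b)
  then have "B \<le> A" using low by (intro tendsto_upperbound[of _ B at_top]) auto
  then have AB: "A = B" using AB by simp
  have "(LINT \<xi>|lborel. (norm (fourier_R (trunc R u) \<xi> - v \<xi>))\<^sup>2) = A - (LINT x|lborel. (norm (trunc R u x))\<^sup>2)" for R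
  proof -
    define a where "a = (LINT x|lborel. (norm (trunc R u x))\<^sup>2)"
    have n: "L2c (trunc R u)" by (rule L2c_trunc[OF u])
    have "(LINT \<xi>|lborel. v \<xi> * cnj (fourier_R (trunc R u) \<xi>)) = (LINT x|lborel. complex_of_real ((norm (trunc R u x))\<^sup>2))"
      unfolding pair[OF n, symmetric]
      by (intro Bochner_Integration.integral_cong) (auto simp: trunc_def complex_norm_square simp del: of_real_power)
    also have "\<dots> = complex_of_real a" unfolding a_def by (rule integral_complex_of_real)
    finally have "(LINT \<xi>|lborel. (norm (v \<xi> + (- 1) * fourier_R (trunc R u) \<xi>))\<^sup>2) = B + a - 2 * a"
      using integral_norm_add_square[OF v plancherel_L2c(1)[OF n], of "-1"] plancherel_L2c(2)[OF n]
      by (simp add: B_def a_def)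
    then show ?thesis using AB by (simp add: norm_minus_commute a_def)
  qed
  moreover have "((\<lambda>R. A - (LINT x|lborel. (norm (trunc R u x))\<^sup>2)) \<longlongrightarrow> A - A) at_top"
    unfolding A_def by (intro tendsto_intros trunc_L2_tendsto u)
  ultimately show ?thesis unfolding plancherel_R_eq using u v by simp
qed

section \<open>Summable weights on the lattice\<close>

text \<open>A product weight is used rather than a radial one: sums over the lattice then factor, and products of one-dimensional
  kernels are bounded by it directly.\<close>

definition decay :: "real^'n \<Rightarrow> real" where
  "decay x = (\<Prod>i\<in>UNIV. 1 / (1 + (x $ i)\<^sup>2))"

lemma decay_pos: "decay x > 0"
  unfolding decay_def by (intro prod_pos) (auto intro!: divide_pos_pos add_pos_nonneg)

lemma decay_le_1: "decay x \<le> 1"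
  unfolding decay_def by (intro prod_le_1) (auto simp: divide_le_eq_1 intro: add_pos_nonneg)

lemma decay_measurable [measurable]: "decay \<in> borel_measurable borel"
  unfolding decay_def[abs_def] by measurable

lemma abs_summable_int:
  fixes f :: "int \<Rightarrow> real"
  assumes "summable (\<lambda>n. norm (f (int n)))" "summable (\<lambda>n. norm (f (- int n)))"
  shows "integrable (count_space UNIV) f"
proof -
  have "Infinite_Set_Sum.abs_summable_on f (range int)"
    by (rule abs_summable_on_reindex) (use assms in \<open>simp add: abs_summable_on_nat_iff'\<close>)
  moreover have "Infinite_Set_Sum.abs_summable_on f (range (\<lambda>n. - int n))"
    by (rule abs_summable_on_reindex) (use assms in \<open>simp add: abs_summable_on_nat_iff'\<close>)
  ultimately have "Infinite_Set_Sum.abs_summable_on f (range int \<union> range (\<lambda>n. - int n))"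
    by (rule abs_summable_on_union)
  moreover have "range int \<union> range (\<lambda>n. - int n) = UNIV"
  proof -
    have "k \<in> range int \<union> range (\<lambda>n. - int n)" for k :: int
    proof -
      have "k = int (nat k) \<or> k = - int (nat (- k))" by arith
      then show ?thesis by blast
    qed
    then show ?thesis by auto
  qed
  ultimately show ?thesis by (simp add: Infinite_Set_Sum.abs_summable_on_def)
qed

text \<open>The sum factors over the coordinates, and each factor behaves like the sum of \<open>k\<^sup>-\<^sup>2\<^sup>s\<close>.\<close>

lemma integrable_decay_powr:
  assumes "s > 1 / 2"
  shows "integrable lattice (\<lambda>k::int^'n. decay (of_int_vec k) powr s)"
proof -
  define f where "f k = (1 / (1 + (real_of_int k)\<^sup>2)) powr s" for k
  have s: "summable (\<lambda>n. f (int n))"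
  proof (rule summable_comparison_test'[of "\<lambda>n. real n powr (- 2 * s)" 1])
    show "summable (\<lambda>n. real n powr (- 2 * s))" unfolding summable_real_powr_iff using assms by simp
    fix n :: nat assume n: "n \<ge> 1"
    have "f (int n) \<le> (1 / (real n)\<^sup>2) powr s"
      unfolding f_def using n assms by (intro powr_mono2) (auto intro!: divide_left_mono simp: add_pos_nonneg)
    also have "1 / (real n)\<^sup>2 = real n powr (- 2)" using n by (simp add: powr_minus_divide)
    also have "(real n powr (- 2)) powr s = real n powr (- 2 * s)" by (simp add: powr_powr)
    finally show "norm (f (int n)) \<le> real n powr (- 2 * s)" by (simp add: f_def)
  qed
  have f: "integrable (count_space UNIV) f"
    by (rule abs_summable_int) (use s in \<open>simp_all add: f_def\<close>)
  have "Infinite_Set_Sum.abs_summable_on (\<lambda>g::'n \<Rightarrow> int. \<Prod>i\<in>UNIV. f (g i)) (PiE UNIV (\<lambda>_. UNIV))"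
    by (rule abs_summable_on_prod_PiE) (use f in \<open>auto simp: Infinite_Set_Sum.abs_summable_on_def\<close>)
  then have "Infinite_Set_Sum.abs_summable_on (\<lambda>g::'n \<Rightarrow> int. \<Prod>i\<in>UNIV. f (g i)) UNIV" by (simp add: PiE_UNIV_domain)
  moreover have "bij_betw vec_nth (UNIV :: (int^'n) set) UNIV"
    by (rule bij_betwI[of _ _ _ vec_lambda]) auto
  ultimately have "Infinite_Set_Sum.abs_summable_on (\<lambda>k::int^'n. \<Prod>i\<in>UNIV. f (k $ i)) UNIV"
    using abs_summable_on_reindex_bij_betw[of vec_nth UNIV UNIV "\<lambda>g::'n \<Rightarrow> int. \<Prod>i\<in>UNIV. f (g i)"] by simp
  moreover have "(\<Prod>i\<in>UNIV. f (k $ i)) = decay (of_int_vec k) powr s" for k :: "int^'n"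
    unfolding f_def decay_def by (subst prod_powr_distrib) auto
  ultimately show ?thesis by (simp add: Infinite_Set_Sum.abs_summable_on_def)
qed

lemma integrable_decay: "integrable lattice (\<lambda>k::int^'n. decay (of_int_vec k))"
  using integrable_decay_powr[of 1] by (simp add: abs_of_pos[OF decay_pos])

text \<open>A bounded shift costs only a constant: \<open>1 + b\<^sup>2 \<le> 2 (1 + a\<^sup>2) (1 + (a - b)\<^sup>2)\<close> in each coordinate.\<close>

lemma decay_shift:
  fixes x y :: "real^'n"
  assumes "\<And>i. \<bar>x $ i\<bar> \<le> r"
  shows "decay (x - y) \<le> (2 * (1 + r\<^sup>2)) ^ CARD('n) * decay y"
proof -
  have "1 / (1 + ((x - y) $ i)\<^sup>2) \<le> 2 * (1 + r\<^sup>2) * (1 / (1 + (y $ i)\<^sup>2))" for i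
  proof -
    define a b where "a = x $ i" and "b = y $ i"
    have ar: "a\<^sup>2 \<le> r\<^sup>2" using assms[of i] by (simp add: a_def abs_le_square_iff[symmetric])
    have "b\<^sup>2 \<le> 2 * a\<^sup>2 + 2 * (a - b)\<^sup>2"
      using zero_le_power2[of "2 * a - b"] by (simp add: power2_eq_square algebra_simps)
    then have "1 + b\<^sup>2 \<le> 2 * (1 + r\<^sup>2) + 2 * (1 + r\<^sup>2) * (a - b)\<^sup>2"
    proof -
      have "0 \<le> r\<^sup>2 * (a - b)\<^sup>2" by simp
      moreover have "2 * (1 + r\<^sup>2) + 2 * (1 + r\<^sup>2) * (a - b)\<^sup>2 = 2 + 2 * r\<^sup>2 + 2 * (a - b)\<^sup>2 + 2 * (r\<^sup>2 * (a - b)\<^sup>2)"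
        by (simp add: algebra_simps)
      ultimately show ?thesis using \<open>b\<^sup>2 \<le> 2 * a\<^sup>2 + 2 * (a - b)\<^sup>2\<close> ar by linarith
    qed
    then have "1 + b\<^sup>2 \<le> 2 * (1 + r\<^sup>2) * (1 + (a - b)\<^sup>2)" by (simp add: algebra_simps)
    moreover have "1 + b\<^sup>2 > 0" "1 + (a - b)\<^sup>2 > 0" by (auto intro: add_pos_nonneg)
    ultimately show ?thesis by (simp add: a_def b_def field_simps)
  qed
  then have "decay (x - y) \<le> (\<Prod>i\<in>(UNIV::'n set). 2 * (1 + r\<^sup>2) * (1 / (1 + (y $ i)\<^sup>2)))"
    unfolding decay_def by (intro prod_mono) auto
  also have "\<dots> = (2 * (1 + r\<^sup>2)) ^ CARD('n) * decay y"
    unfolding decay_def by (simp only: prod.distrib prod_constant power_mult_distrib)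
  finally show ?thesis .
qed

lemma decay_minus: "decay (- x) = decay x"
  by (simp add: decay_def)

text \<open>A bound for the sum of \<open>decay\<close> over every translate of the lattice; the factor pays for moving the translate to
  the lattice itself.\<close>

definition decay_sum :: "'n::finite itself \<Rightarrow> real" where
  "decay_sum _ = 4 ^ CARD('n) * (LINT k|lattice. decay (of_int_vec (k :: int^'n)))"

lemma decay_sum_nonneg: "decay_sum TYPE('n::finite) \<ge> 0"
  unfolding decay_sum_def by (intro mult_nonneg_nonneg Bochner_Integration.integral_nonneg) (auto intro: less_imp_le decay_pos)

lemma bij_lattice_shift: "bij_betw (\<lambda>k::int^'n. k - a) UNIV UNIV" "bij_betw (\<lambda>k::int^'n. a - k) UNIV UNIV"
  "bij_betw (\<lambda>k::int^'n. a + k) UNIV UNIV" "bij_betw (\<lambda>k::int^'n. - k) UNIV UNIV"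
proof -
  show "bij_betw (\<lambda>k::int^'n. k - a) UNIV UNIV" by (rule bij_betwI[of _ _ _ "\<lambda>k. k + a"]) auto
  show "bij_betw (\<lambda>k::int^'n. a - k) UNIV UNIV" by (rule bij_betwI[of _ _ _ "\<lambda>k. a - k"]) auto
  show "bij_betw (\<lambda>k::int^'n. a + k) UNIV UNIV" by (rule bij_betwI[of _ _ _ "\<lambda>k. k - a"]) auto
  show "bij_betw (\<lambda>k::int^'n. - k) UNIV UNIV" by (rule bij_betwI[of _ _ _ "\<lambda>k. - k"]) auto
qed

lemma decay_lattice_sum:
  fixes x :: "real^'n"
  shows "integrable lattice (\<lambda>k. decay (x - of_int_vec k))"
    "(LINT k|lattice. decay (x - of_int_vec k)) \<le> decay_sum TYPE('n)"
proof -
  define c :: "int^'n" where "c = floor_vec x"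
  have le: "decay (x - of_int_vec k) \<le> 4 ^ CARD('n) * decay (of_int_vec (k - c))" for k
  proof -
    have "decay (frac_vec x - of_int_vec (k - c)) \<le> (2 * (1 + 1\<^sup>2)) ^ CARD('n) * decay (of_int_vec (k - c))"
    proof (rule decay_shift)
      fix i
      have "0 \<le> frac_vec x $ i" "frac_vec x $ i < 1" using frac_vec_in_cell[of x] by (auto simp: cell_def)
      then show "\<bar>frac_vec x $ i\<bar> \<le> 1" by simp
    qed
    moreover have "frac_vec x - of_int_vec (k - c) = x - of_int_vec k"
      using floor_plus_frac[of x] by (simp add: c_def algebra_simps)
    ultimately show ?thesis by (simp del: of_int_vec_simps)
  qed
  have i: "integrable lattice (\<lambda>k. decay (of_int_vec (k - c)))"
    "(LINT k|lattice. decay (of_int_vec (k - c))) = (LINT k|lattice. decay (of_int_vec (k::int^'n)))"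
    using integrable_bij_count_space[OF bij_lattice_shift(1)[of c], of "\<lambda>k. decay (of_int_vec k)"]
      integral_bij_count_space[OF bij_lattice_shift(1)[of c], of "\<lambda>k. decay (of_int_vec k)"] integrable_decay by simp_all
  have i': "integrable lattice (\<lambda>k. 4 ^ CARD('n) * decay (of_int_vec (k - c)))" using i(1) by simp
  show 1: "integrable lattice (\<lambda>k. decay (x - of_int_vec k))"
    by (rule Bochner_Integration.integrable_bound[OF i'])
       (use le in \<open>auto intro!: AE_I2 simp: abs_of_pos[OF decay_pos] abs_mult simp del: of_int_vec_simps\<close>)
  have "(LINT k|lattice. decay (x - of_int_vec k)) \<le> (LINT k|lattice. 4 ^ CARD('n) * decay (of_int_vec (k - c)))"
    by (rule integral_mono[OF 1 i']) (rule le)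
  then show "(LINT k|lattice. decay (x - of_int_vec k)) \<le> decay_sum TYPE('n)"
    using i by (simp add: decay_sum_def)
qed

section \<open>A kernel that reproduces band-limited functions\<close>

text \<open>The function equals 1 on \<open>[3/8, 5/8]\<close> and vanishes outside \<open>[1/4, 3/4]\<close>, inside the unit interval. It is continuous and
  piecewise affine, which suffices for quadratic decay of its transform.\<close>

definition trapezoid :: "real \<Rightarrow> real" where
  "trapezoid t = max 0 (min 1 (min (8 * t - 2) (6 - 8 * t)))"

definition kernel1 :: "real \<Rightarrow> complex" where
  "kernel1 z = (LINT t|lborel. indicator {0..<1} t *\<^sub>R (of_real (trapezoid t) * ee (z * t)))"

lemma trapezoid_bounds: "0 \<le> trapezoid t" "trapezoid t \<le> 1"
  by (auto simp: trapezoid_def)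

lemma trapezoid_continuous: "continuous_on A trapezoid"
  unfolding trapezoid_def by (intro continuous_intros)

lemma trapezoid_measurable [measurable]: "trapezoid \<in> borel_measurable borel"
  by (rule borel_measurable_continuous_onI[OF trapezoid_continuous])

lemma kernel1_integrable: "integrable lborel (\<lambda>t. indicator {0..<1} t *\<^sub>R (complex_of_real (trapezoid t) * ee (z * t)))"
proof (rule Bochner_Integration.integrable_bound[of _ "indicator {0..<1} :: real \<Rightarrow> real"])
  show "integrable lborel (indicator {0..<1} :: real \<Rightarrow> real)" by (rule integrable_real_indicator) auto
qed (auto simp: indicator_def norm_mult trapezoid_bounds)

lemma norm_kernel1_le_1: "norm (kernel1 z) \<le> 1"
proof -
  have "norm (kernel1 z) \<le> (LINT t|lborel. norm (indicator {0..<1} t *\<^sub>R (complex_of_real (trapezoid t) * ee (z * t))))"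
    unfolding kernel1_def by (rule integral_norm_bound)
  also have "\<dots> \<le> (LINT t|lborel. indicator {0..<1::real} t)"
    by (intro integral_mono integrable_norm kernel1_integrable integrable_real_indicator)
       (auto simp: indicator_def norm_mult trapezoid_bounds)
  finally have "norm (kernel1 z) \<le> (LINT t|lborel. indicator {0..<1::real} t)" .
  then show ?thesis by simp
qed

lemma affine_ee_integral:
  fixes a b z \<alpha> \<beta> :: real
  assumes "a \<le> b" "z \<noteq> 0"
  defines "w \<equiv> 2 * pi * z"
  defines "F \<equiv> \<lambda>t. (- \<i> * of_real ((\<alpha> + \<beta> * t) / w) + of_real (\<beta> / w\<^sup>2)) * ee (z * t)"
  shows "integrable lborel (\<lambda>t. indicator {a..b} t *\<^sub>R (of_real (\<alpha> + \<beta> * t) * ee (z * t)))"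
    "(LINT t|lborel. indicator {a..b} t *\<^sub>R (of_real (\<alpha> + \<beta> * t) * ee (z * t))) = F b - F a"
proof -
  have w: "w \<noteq> 0" unfolding w_def using assms(2) by simp
  have "(F has_vector_derivative of_real (\<alpha> + \<beta> * t) * ee (z * t)) (at t within {a..b})" for t
  proof -
    have 1: "((\<lambda>t. - \<i> * complex_of_real ((\<alpha> + \<beta> * t) / w) + of_real (\<beta> / w\<^sup>2)) has_vector_derivative - \<i> * of_real (\<beta> / w)) (at t within {a..b})"
    proof -
      have "((\<lambda>t. (\<alpha> + \<beta> * t) / w) has_real_derivative \<beta> / w) (at t within {a..b})"
        by (auto intro!: derivative_eq_intros simp: w)
      then have "((\<lambda>t. complex_of_real ((\<alpha> + \<beta> * t) / w)) has_vector_derivative of_real (\<beta> / w)) (at t within {a..b})"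
        by (intro has_vector_derivative_of_real) (simp add: has_real_derivative_iff_has_vector_derivative)
      from has_vector_derivative_add[OF has_vector_derivative_mult_right[OF this, of "- \<i>"] has_vector_derivative_const[of "of_real (\<beta> / w\<^sup>2)"]]
      show ?thesis by simp
    qed
    have 2: "((\<lambda>t. ee (z * t)) has_vector_derivative w *\<^sub>R (\<i> * ee (z * t))) (at t within {a..b})"
      unfolding w_def by (rule has_vector_derivative_ee)
    have "(F has_vector_derivative (- \<i> * complex_of_real ((\<alpha> + \<beta> * t) / w) + of_real (\<beta> / w\<^sup>2)) * (w *\<^sub>R (\<i> * ee (z * t)))
         + (- \<i> * of_real (\<beta> / w)) * ee (z * t)) (at t within {a..b})"
      unfolding F_def by (rule has_vector_derivative_mult[OF 1 2])
    also have "(- \<i> * complex_of_real ((\<alpha> + \<beta> * t) / w) + of_real (\<beta> / w\<^sup>2)) * (w *\<^sub>R (\<i> * ee (z * t)))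
         + (- \<i> * of_real (\<beta> / w)) * ee (z * t) = of_real (\<alpha> + \<beta> * t) * ee (z * t)"
      using w by (simp add: scaleR_conv_of_real field_simps power2_eq_square)
    finally show ?thesis .
  qed
  note F = this
  have c: "continuous_on {a..b} (\<lambda>t. complex_of_real (\<alpha> + \<beta> * t) * ee (z * t))"
    by (intro continuous_intros)
  show "integrable lborel (\<lambda>t. indicator {a..b} t *\<^sub>R (of_real (\<alpha> + \<beta> * t) * ee (z * t)))"
    "(LINT t|lborel. indicator {a..b} t *\<^sub>R (of_real (\<alpha> + \<beta> * t) * ee (z * t))) = F b - F a"
    by (rule integral_indicator_Ico[OF assms(1) F c])+
qed

text \<open>Integration over the three affine pieces leaves boundary terms of orders \<open>1/z\<close> and \<open>1/z\<^sup>2\<close>. Those of order \<open>1/z\<close>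
  cancel because the trapezoid is continuous and vanishes at the ends.\<close>

lemma norm_kernel1_decay:
  assumes "z \<noteq> 0" shows "norm (kernel1 z) \<le> 1 / z\<^sup>2"
proof -
  define w where "w = 2 * pi * z"
  define g where "g \<alpha> \<beta> t = complex_of_real (\<alpha> + \<beta> * t) * ee (z * t)" for \<alpha> \<beta> t
  have ab: "(1/4::real) \<le> 3/8" "(3/8::real) \<le> 5/8" "(5/8::real) \<le> 3/4" by auto
  note I1 = affine_ee_integral[OF ab(1) assms, of "-2" 8, folded w_def]
  note I2 = affine_ee_integral[OF ab(2) assms, of 1 0, folded w_def]
  note I3 = affine_ee_integral[OF ab(3) assms, of 6 "-8", folded w_def]
  have "kernel1 z = (LINT t|lborel. indicator {1/4..3/8} t *\<^sub>R g (-2) 8 t + indicator {3/8..5/8} t *\<^sub>R g 1 0 t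
     + indicator {5/8..3/4} t *\<^sub>R g 6 (-8) t)"
    unfolding kernel1_def
  proof (rule integral_cong_AE)
    have "AE t in lborel. t \<noteq> 3/8 \<and> t \<noteq> (5/8 :: real)"
      using AE_lborel_singleton[of "3/8"] AE_lborel_singleton[of "5/8"] by eventually_elim auto
    then show "AE t in lborel. indicator {0..<1} t *\<^sub>R (complex_of_real (trapezoid t) * ee (z * t)) =
      indicator {1/4..3/8} t *\<^sub>R g (-2) 8 t + indicator {3/8..5/8} t *\<^sub>R g 1 0 t + indicator {5/8..3/4} t *\<^sub>R g 6 (-8) t"
    proof eventually_elim
      case (elim t)
      consider "t < 1/4" | "1/4 \<le> t" "t < 3/8" | "3/8 < t" "t < 5/8" | "5/8 < t" "t \<le> 3/4" | "t > 3/4"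
        using elim by linarith
      then show ?case by cases (auto simp: indicator_def trapezoid_def g_def max_def min_def)
    qed
  qed (auto simp: g_def)
  also have "\<dots> = (LINT t|lborel. indicator {1/4..3/8} t *\<^sub>R g (-2) 8 t) + (LINT t|lborel. indicator {3/8..5/8} t *\<^sub>R g 1 0 t)
     + (LINT t|lborel. indicator {5/8..3/4} t *\<^sub>R g 6 (-8) t)"
    using I1(1) I2(1) I3(1) by (simp add: g_def)
  also have "\<dots> = of_real (8 / w\<^sup>2) * (ee (z * (3/8)) - ee (z * (1/4)) - ee (z * (3/4)) + ee (z * (5/8)))"
    unfolding g_def I1(2) I2(2) I3(2) by (simp add: algebra_simps)
  also have "norm \<dots> \<le> 8 / w\<^sup>2 * 4"
  proof -
    have "norm (ee (z * (3/8)) - ee (z * (1/4)) - ee (z * (3/4)) + ee (z * (5/8))) \<le> 1 + 1 + 1 + 1"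
      by (rule order_trans[OF norm_triangle_ineq] order_trans[OF norm_triangle_ineq4] add_mono
            | rule order_trans[OF norm_triangle_ineq4])+ simp_all
    then have "8 / w\<^sup>2 * norm (ee (z * (3/8)) - ee (z * (1/4)) - ee (z * (3/4)) + ee (z * (5/8))) \<le> 8 / w\<^sup>2 * 4"
      by (intro mult_left_mono) auto
    moreover have "\<bar>8 / w\<^sup>2\<bar> = 8 / w\<^sup>2" by simp
    ultimately show ?thesis unfolding norm_mult norm_of_real by simp
  qed
  also have "8 / w\<^sup>2 * 4 \<le> 1 / z\<^sup>2"
  proof -
    have "pi\<^sup>2 \<ge> 3\<^sup>2" using pi_gt3 by (intro power_mono) auto
    then have "32 * z\<^sup>2 \<le> (4 * pi\<^sup>2) * z\<^sup>2" by (intro mult_right_mono) auto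
    then show ?thesis using assms by (simp add: w_def power_mult_distrib field_simps)
  qed
  finally show ?thesis .
qed

lemma norm_kernel1: "norm (kernel1 z) \<le> 2 * (1 / (1 + z\<^sup>2))"
proof (cases "\<bar>z\<bar> \<le> 1")
  case True
  then have "z\<^sup>2 \<le> 1" by (simp add: abs_square_le_1)
  then have "1 \<le> 2 * (1 / (1 + z\<^sup>2))" by (simp add: field_simps add_pos_nonneg)
  then show ?thesis using norm_kernel1_le_1[of z] by linarith
next
  case False
  then have "z\<^sup>2 \<ge> 1" "z \<noteq> 0" using abs_square_le_1[of z] by auto
  then have "1 / z\<^sup>2 \<le> 2 * (1 / (1 + z\<^sup>2))" by (simp add: field_simps add_pos_nonneg)
  then show ?thesis using norm_kernel1_decay[OF \<open>z \<noteq> 0\<close>] by linarith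
qed

definition centre :: "real^'n" where
  "centre = (\<chi> i. 1 / 2)"

definition bump :: "real^'n \<Rightarrow> complex" where
  "bump \<eta> = (\<Prod>i\<in>UNIV. of_real (trapezoid (\<eta> $ i)))"

text \<open>The inverse Fourier transform of \<open>bump\<close>, translated so that it is centred at the origin of frequency
  space. The bump itself is supported inside the unit cell, so that its Fourier series is the sampling
  expansion below.\<close>

definition kernel :: "real^'n \<Rightarrow> complex" where
  "kernel z = ee (- (centre \<bullet> z)) * (LINT \<eta>|torus_measure. bump \<eta> * ee (\<eta> \<bullet> z))"

lemma bump_measurable [measurable]: "bump \<in> borel_measurable borel"
  unfolding bump_def[abs_def] by measurable

lemma norm_bump_le_1: "norm (bump \<eta>) \<le> 1"
  unfolding bump_def prod_norm[symmetric] by (intro prod_le_1) (auto simp: trapezoid_bounds)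

lemma kernel_eq: "kernel z = ee (- (centre \<bullet> z)) * (\<Prod>i\<in>UNIV. kernel1 (z $ i))"
proof -
  have "(LINT \<eta>|torus_measure. bump \<eta> * ee (\<eta> \<bullet> z)) = (LINT \<eta>|torus_measure. (\<Prod>i\<in>UNIV. of_real (trapezoid (\<eta> $ i)) * ee (z $ i * \<eta> $ i)))"
    unfolding bump_def ee_inner by (simp add: prod.distrib mult.commute)
  also have "\<dots> = (\<Prod>i\<in>UNIV. kernel1 (z $ i))"
    unfolding kernel1_def
    by (rule integral_torus_prod[where f = "\<lambda>i t. of_real (trapezoid t) * ee (z $ i * t)"])
       (auto intro: kernel1_integrable)
  finally show ?thesis by (simp add: kernel_def)
qed

lemma norm_kernel: "norm (kernel (z::real^'n)) \<le> 2 ^ CARD('n) * decay z"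
proof -
  have "norm (kernel z) = (\<Prod>i\<in>UNIV. norm (kernel1 (z $ i)))"
    unfolding kernel_eq norm_mult by (simp add: prod_norm)
  also have "\<dots> \<le> (\<Prod>i\<in>(UNIV::'n set). 2 * (1 / (1 + (z $ i)\<^sup>2)))"
    by (intro prod_mono) (auto intro: norm_kernel1[simplified])
  also have "\<dots> = 2 ^ CARD('n) * decay z" unfolding decay_def by (simp only: prod.distrib prod_constant)
  finally show ?thesis .
qed

lemma kernel_measurable [measurable]: "kernel \<in> borel_measurable borel"
proof -
  have "(\<lambda>(z, \<eta>). bump \<eta> * ee (\<eta> \<bullet> z)) \<in> borel_measurable (borel \<Otimes>\<^sub>M (torus_measure :: (real^'n) measure))"
  proof -
    have [measurable]: "snd \<in> borel_measurable (borel \<Otimes>\<^sub>M torus_measure :: ((real^'n) \<times> (real^'n)) measure)"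
      by (rule measurable_compose[OF measurable_snd measurable_torus_ident])
    show ?thesis by measurable
  qed
  from torus.borel_measurable_lebesgue_integral[OF this]
  have [measurable]: "(\<lambda>z. LINT \<eta>|torus_measure. bump \<eta> * ee (\<eta> \<bullet> (z::real^'n))) \<in> borel_measurable borel" by simp
  show "(kernel :: real^'n \<Rightarrow> _) \<in> borel_measurable borel" unfolding kernel_def[abs_def] by measurable
qed

lemma kernel_lattice_sum:
  fixes y :: "real^'n"
  shows "integrable lattice (\<lambda>m. kernel (y - of_int_vec m))"
    "(LINT m|lattice. norm (kernel (y - of_int_vec m))) \<le> 2 ^ CARD('n) * decay_sum TYPE('n)"
proof -
  have i: "integrable lattice (\<lambda>m. 2 ^ CARD('n) * decay (y - of_int_vec m))"
    using decay_lattice_sum(1)[of y] by simp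
  show 1: "integrable lattice (\<lambda>m. kernel (y - of_int_vec m))"
    by (rule Bochner_Integration.integrable_bound[OF i])
       (auto intro!: order_trans[OF norm_kernel] mult_left_mono)
  have "(LINT m|lattice. norm (kernel (y - of_int_vec m))) \<le> (LINT m|lattice. 2 ^ CARD('n) * decay (y - of_int_vec m))"
    using 1 i by (intro integral_mono norm_kernel) auto
  also have "\<dots> \<le> 2 ^ CARD('n) * decay_sum TYPE('n)"
    using decay_lattice_sum(2)[of y] by simp
  finally show "(LINT m|lattice. norm (kernel (y - of_int_vec m))) \<le> 2 ^ CARD('n) * decay_sum TYPE('n)" .
qed

text \<open>Fourier series identify functions only up to null sets; on open sets where both sides are continuous this is enough.\<close>

lemma open_AE_eq_imp_eq:
  fixes f g :: "real^'n \<Rightarrow> complex"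
  assumes "open U" "continuous_on U f" "continuous_on U g"
    and "AE x in lborel. x \<in> U \<longrightarrow> f x = g x" "x \<in> U"
  shows "f x = g x"
proof (rule ccontr)
  assume "f x \<noteq> g x"
  define V where "V = {y \<in> U. f y - g y \<noteq> 0}"
  have "open (U \<inter> (\<lambda>y. f y - g y) -` (- {0}))"
    using assms by (intro continuous_open_preimage continuous_intros) auto
  then have "open V" by (simp add: V_def Int_def vimage_def)
  moreover have "x \<in> V" using assms \<open>f x \<noteq> g x\<close> by (simp add: V_def)
  moreover have "negligible V"
  proof -
    have "AE y in lborel. y \<notin> V" using assms(4) by eventually_elim (auto simp: V_def)
    moreover have "V \<in> sets lborel" using \<open>open V\<close> by simp
    ultimately have "V \<in> null_sets lborel" by (simp add: AE_iff_null_sets)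
    then show ?thesis by (simp add: negligible_iff_null_sets null_sets_completionI)
  qed
  ultimately show False using open_not_negligible[of V] by blast
qed

lemma continuous_lattice_series:
  fixes a :: "int^'n \<Rightarrow> complex"
  assumes "integrable lattice a"
  shows "continuous_on UNIV (\<lambda>\<eta>. LINT m|lattice. a m * ee (of_int_vec m \<bullet> \<eta>))"
proof (rule continuous_on_sequentiallyI)
  fix u :: "nat \<Rightarrow> real^'n" and \<eta> assume u: "u \<longlonglongrightarrow> \<eta>"
  show "(\<lambda>k. LINT m|lattice. a m * ee (of_int_vec m \<bullet> u k)) \<longlonglongrightarrow> (LINT m|lattice. a m * ee (of_int_vec m \<bullet> \<eta>))"
  proof (rule integral_dominated_convergence)
    show "integrable lattice (\<lambda>m. norm (a m))" using assms by simp
    show "AE m in lattice. (\<lambda>k. a m * ee (of_int_vec m \<bullet> u k)) \<longlonglongrightarrow> a m * ee (of_int_vec m \<bullet> \<eta>)"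
    proof (rule AE_I2)
      fix m :: "int^'n"
      have "(\<lambda>k. ee (of_int_vec m \<bullet> u k)) \<longlonglongrightarrow> ee (of_int_vec m \<bullet> \<eta>)"
        by (rule continuous_on_tendsto_compose[OF continuous_ee[of UNIV]]) (auto intro!: tendsto_intros u)
      then show "(\<lambda>k. a m * ee (of_int_vec m \<bullet> u k)) \<longlonglongrightarrow> a m * ee (of_int_vec m \<bullet> \<eta>)" by (rule tendsto_mult_left)
    qed
  qed (auto simp: norm_mult)
qed

text \<open>The values of \<open>kernel\<close> at lattice translates of \<open>y\<close> are the Fourier coefficients of the bump
  multiplied by the character of frequency \<open>y\<close>. They are summable, so the Fourier series converges to that function, and where the
  bump equals 1 what remains is the character itself.\<close>

theorem kernel_sampling:
  fixes \<eta> y :: "real^'n"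
  assumes \<eta>: "\<And>i. \<bar>\<eta> $ i\<bar> < 1 / 8"
  shows "(LINT m|lattice. kernel (y - of_int_vec m) * ee (\<eta> \<bullet> of_int_vec m)) = ee (\<eta> \<bullet> y)"
proof -
  (* the coefficients of the function \<open>D\<close>: the factor undoes the centring in the definition of the kernel *)
  define a where "a m = ee (centre \<bullet> (y - of_int_vec m)) * kernel (y - of_int_vec m)" for m
  define D where "D \<zeta> = bump \<zeta> * ee (\<zeta> \<bullet> y)" for \<zeta> :: "real^'n"
  define A where "A \<zeta> = (LINT m|lattice. a m * ee (of_int_vec m \<bullet> \<zeta>))" for \<zeta> :: "real^'n"
  have a: "integrable lattice a"
    by (rule Bochner_Integration.integrable_bound[OF kernel_lattice_sum(1)[of y]]) (auto simp: a_def norm_mult)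
  have a': "(\<integral>\<^sup>+m. ennreal (norm (a m)) \<partial>lattice) < \<infinity>" using a by (simp add: integrable_iff_bounded)
  have [measurable]: "D \<in> borel_measurable borel" unfolding D_def[abs_def] by measurable
  have cA: "continuous_on UNIV A" unfolding A_def[abs_def] by (rule continuous_lattice_series[OF a])
  then have [measurable]: "A \<in> borel_measurable borel" by (rule borel_measurable_continuous_onI)
  have DL: "D \<in> Lp torus_measure 2"
    by (rule torus_bounded_Lp[of _ 1]) (auto intro!: measurable_torusI simp: D_def norm_mult norm_bump_le_1)
  have AL: "A \<in> Lp torus_measure 2"
  proof (rule torus_bounded_Lp[of _ "LINT m|lattice. norm (a m)"])
    have "norm (A \<zeta>) \<le> (LINT m|lattice. norm (a m * ee (of_int_vec m \<bullet> \<zeta>)))" for \<zeta>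
      unfolding A_def by (rule integral_norm_bound)
    then show "AE \<zeta> in torus_measure. norm (A \<zeta>) \<le> (LINT m|lattice. norm (a m))" by (simp add: norm_mult)
  qed (auto intro!: measurable_torusI)
  have "fourier_T D n = fourier_T A n" for n
  proof -
    have "fourier_T D n = (LINT \<zeta>|torus_measure. bump \<zeta> * ee (\<zeta> \<bullet> (y - of_int_vec n)))"
      unfolding fourier_T_eq D_def
      by (intro Bochner_Integration.integral_cong refl) (simp add: inner_simps inner_commute mult.assoc flip: ee_add)
    also have "\<dots> = a n"
      unfolding a_def kernel_def by (simp add: mult.assoc[symmetric] flip: ee_add)
    also have "a n = (LINT m|lattice. LINT \<zeta>|torus_measure. a m * ee (of_int_vec m \<bullet> \<zeta>) * ee (- (of_int_vec n \<bullet> \<zeta>)))"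
    proof -
      have "(LINT \<zeta>|torus_measure. a m * ee (of_int_vec m \<bullet> \<zeta>) * ee (- (of_int_vec n \<bullet> \<zeta>))) = (if m = n then a n else 0)" for m
        using integral_ee_torus[of "m - n"] by (simp add: mult.assoc inner_diff_left flip: ee_add)
      moreover have "(LINT m|lattice. (if m = n then a n else 0)) = a n"
        by (subst integral_lattice_finite(1)[of "{n}"]) auto
      ultimately show ?thesis by simp
    qed
    also have "\<dots> = (LINT \<zeta>|torus_measure. LINT m|lattice. a m * ee (of_int_vec m \<bullet> \<zeta>) * ee (- (of_int_vec n \<bullet> \<zeta>)))"
    proof (rule integral_swap[OF lattice.sigma_finite_measure_axioms torus.sigma_finite_measure_axioms])
      show "(\<lambda>(m, \<zeta>). a m * ee (of_int_vec m \<bullet> \<zeta>) * ee (- (of_int_vec n \<bullet> \<zeta>))) \<in> borel_measurable (lattice \<Otimes>\<^sub>M torus_measure)"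
        by (intro measurable_lattice_split measurable_torusI) measurable
    qed (use a' in \<open>simp add: norm_mult emeasure_torus\<close>)
    also have "\<dots> = fourier_T A n" unfolding fourier_T_eq A_def by simp
    finally show ?thesis .
  qed
  from fourier_T_unique[OF DL AL this] have AE: "AE \<zeta> in lborel. \<zeta> \<in> cell \<longrightarrow> D \<zeta> = A \<zeta>"
    unfolding torus_measure_eq by (subst (asm) AE_restrict_space_iff) auto
  define U where "U = {\<zeta> :: real^'n. \<forall>i. 3 / 8 < \<zeta> $ i \<and> \<zeta> $ i < 5 / 8}"
  have U_eq: "U = box (\<chi> i. 3 / 8) (\<chi> i. 5 / 8)" by (auto simp: U_def mem_box_cart)
  have bump: "bump \<zeta> = 1" if "\<zeta> \<in> U" for \<zeta>
    unfolding bump_def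
  proof (intro prod.neutral ballI)
    fix i
    have "3 / 8 < \<zeta> $ i" "\<zeta> $ i < 5 / 8" using that by (auto simp: U_def)
    then show "complex_of_real (trapezoid (\<zeta> $ i)) = 1" by (simp add: trapezoid_def)
  qed
  have e: "ee ((\<eta> + centre) \<bullet> y) = A (\<eta> + centre)"
  proof (rule open_AE_eq_imp_eq[of U])
    show "open U" unfolding U_eq by (rule open_box)
    show "continuous_on U (\<lambda>\<zeta>. ee (\<zeta> \<bullet> y))" by (intro continuous_intros)
    show "continuous_on U A" using cA by (rule continuous_on_subset) simp
    show "AE \<zeta> in lborel. \<zeta> \<in> U \<longrightarrow> ee (\<zeta> \<bullet> y) = A \<zeta>"
      using AE
    proof eventually_elim
      case (elim \<zeta>)
      show ?case
      proof
        assume "\<zeta> \<in> U"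
        then have *: "3 / 8 < \<zeta> $ i \<and> \<zeta> $ i < 5 / 8" for i by (simp add: U_def)
        have "0 \<le> \<zeta> $ i \<and> \<zeta> $ i < 1" for i using *[of i] by linarith
        then have "\<zeta> \<in> cell" by (simp add: cell_def)
        then show "ee (\<zeta> \<bullet> y) = A \<zeta>" using elim bump[OF \<open>\<zeta> \<in> U\<close>] by (simp add: D_def)
      qed
    qed
    have "3 / 8 < \<eta> $ i + 1 / 2 \<and> \<eta> $ i + 1 / 2 < 5 / 8" for i using \<eta>[of i] unfolding abs_less_iff by linarith
    then show "\<eta> + centre \<in> U" by (simp add: U_def centre_def)
  qed
  have "A (\<eta> + centre) = ee (centre \<bullet> y) * (LINT m|lattice. kernel (y - of_int_vec m) * ee (\<eta> \<bullet> of_int_vec m))"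
  proof -
    have "a m * ee (of_int_vec m \<bullet> (\<eta> + centre)) = ee (centre \<bullet> y) * (kernel (y - of_int_vec m) * ee (\<eta> \<bullet> of_int_vec m))" for m
    proof -
      have "ee (centre \<bullet> (y - of_int_vec m)) * ee (of_int_vec m \<bullet> (\<eta> + centre)) = ee (centre \<bullet> y) * ee (\<eta> \<bullet> of_int_vec m)"
        by (simp add: inner_simps inner_commute flip: ee_add)
      then show ?thesis by (simp add: a_def mult_ac)
    qed
    then show ?thesis by (simp add: A_def)
  qed
  moreover have "ee ((\<eta> + centre) \<bullet> y) = ee (centre \<bullet> y) * ee (\<eta> \<bullet> y)"
    by (simp add: inner_simps add.commute flip: ee_add)
  ultimately show ?thesis using e by simp
qed

lemma decay_integrable: "integrable lborel (decay :: real^'n \<Rightarrow> real)"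
proof (rule integrableI_bounded)
  have "(\<integral>\<^sup>+x. ennreal (norm (decay (x::real^'n))) \<partial>lborel) = (\<integral>\<^sup>+k. \<integral>\<^sup>+u. ennreal (decay (of_int_vec k + u)) \<partial>torus_measure \<partial>(lattice :: (int^'n) measure))"
    by (subst nn_integral_unfold) (auto simp: abs_of_pos[OF decay_pos])
  also have "\<dots> = (\<integral>\<^sup>+u. \<integral>\<^sup>+k. ennreal (decay (of_int_vec k + u)) \<partial>(lattice :: (int^'n) measure) \<partial>torus_measure)"
    by (rule nn_integral_lattice_swap[OF torus.sigma_finite_measure_axioms], rule measurable_torusI) measurable
  also have "\<dots> \<le> (\<integral>\<^sup>+u. ennreal (decay_sum TYPE('n)) \<partial>(torus_measure :: (real^'n) measure))"
  proof (rule nn_integral_mono)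
    fix u :: "real^'n"
    have eq: "decay (- u - of_int_vec k) = decay (of_int_vec k + u)" for k
      using decay_minus[of "of_int_vec k + u"] by (simp add: algebra_simps)
    have "(\<integral>\<^sup>+k. ennreal (decay (of_int_vec k + u)) \<partial>lattice) = ennreal (LINT k|lattice. decay (- u - of_int_vec k))"
      unfolding eq[symmetric] by (rule nn_integral_eq_integral[OF decay_lattice_sum(1)]) (simp add: less_imp_le[OF decay_pos])
    also have "\<dots> \<le> ennreal (decay_sum TYPE('n))" by (rule ennreal_leI[OF decay_lattice_sum(2)])
    finally show "(\<integral>\<^sup>+k. ennreal (decay (of_int_vec k + u)) \<partial>lattice) \<le> ennreal (decay_sum TYPE('n))" .
  qed
  also have "\<dots> < \<infinity>" by (simp add: emeasure_torus)
  finally show "(\<integral>\<^sup>+x. ennreal (norm (decay (x::real^'n))) \<partial>lborel) < \<infinity>" .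
qed simp

lemma kernel_integrable: "integrable lborel (kernel :: real^'n \<Rightarrow> complex)"
proof (rule Bochner_Integration.integrable_bound)
  show "integrable lborel (\<lambda>x. 2 ^ CARD('n) * decay (x::real^'n))" using decay_integrable by simp
qed (auto intro!: order_trans[OF norm_kernel])

text \<open>Integrating the sampling formula over a period gives the Fourier transform of the kernel.\<close>

lemma fourier_R_kernel:
  fixes \<eta> :: "real^'n"
  assumes \<eta>: "\<And>i. \<bar>\<eta> $ i\<bar> < 1 / 8"
  shows "fourier_R kernel \<eta> = 1"
proof -
  have "fourier_R kernel \<eta> = (LINT u|torus_measure. LINT k|lattice. kernel (of_int_vec k + u) * ee (- (\<eta> \<bullet> (of_int_vec k + u))))"
    unfolding fourier_R_eq by (rule integral_unfold(1)) (intro integrable_mult_ee kernel_integrable, measurable)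
  also have "\<dots> = (LINT u|(torus_measure :: (real^'n) measure). 1)"
  proof (intro Bochner_Integration.integral_cong refl)
    fix u :: "real^'n"
    have "(LINT k|lattice. kernel (of_int_vec k + u) * ee (- (\<eta> \<bullet> (of_int_vec k + u)))) =
       (LINT m|lattice. kernel (of_int_vec (- m) + u) * ee (- (\<eta> \<bullet> (of_int_vec (- m) + u))))"
      by (rule integral_bij_count_space[OF bij_lattice_shift(4), symmetric])
    also have "\<dots> = (LINT m|lattice. kernel (u - of_int_vec m) * ee (\<eta> \<bullet> of_int_vec m) * ee (- (\<eta> \<bullet> u)))"
      by (intro Bochner_Integration.integral_cong refl) (simp add: inner_simps mult.assoc flip: ee_add)
    also have "\<dots> = 1" using kernel_sampling[OF \<eta>, of u] by (simp flip: ee_add)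
    finally show "(LINT k|lattice. kernel (of_int_vec k + u) * ee (- (\<eta> \<bullet> (of_int_vec k + u)))) = 1" .
  qed
  finally show ?thesis by simp
qed

lemma integral_scale:
  fixes f :: "real^'n \<Rightarrow> complex"
  assumes "q > 0" and [measurable]: "f \<in> borel_measurable borel"
  shows "(LINT x|lborel. of_real (q ^ CARD('n)) * f (q *\<^sub>R x)) = (LINT x|lborel. f x)"
proof -
  have l: "lborel = density (distr lborel borel (\<lambda>x::real^'n. q *\<^sub>R x)) (\<lambda>_. ennreal (q ^ CARD('n)))"
    using lborel_affine[of q "0 :: real^'n"] assms by (simp add: ennreal_power)
  show ?thesis
    by (subst (2) l, subst integral_density)
       (use assms in \<open>auto simp: integral_distr scaleR_conv_of_real\<close>)
qed

definition scaled_kernel :: "real \<Rightarrow> real^'n \<Rightarrow> complex" where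
  "scaled_kernel q x = of_real (q ^ CARD('n)) * kernel (q *\<^sub>R x)"

lemma scaled_kernel_measurable [measurable]: "scaled_kernel q \<in> borel_measurable borel"
  unfolding scaled_kernel_def[abs_def] by measurable

lemma norm_scaled_kernel:
  assumes "q \<ge> 1" shows "norm (scaled_kernel q (x::real^'n)) \<le> (2 * q) ^ CARD('n) * decay x"
proof -
  have d: "decay (q *\<^sub>R x) \<le> decay x"
    unfolding decay_def
  proof (intro prod_mono conjI)
    fix i
    have "1 * (x $ i)\<^sup>2 \<le> q\<^sup>2 * (x $ i)\<^sup>2" using assms by (intro mult_right_mono one_le_power) auto
    then show "1 / (1 + ((q *\<^sub>R x) $ i)\<^sup>2) \<le> 1 / (1 + (x $ i)\<^sup>2)"
      by (intro divide_left_mono) (auto simp: power_mult_distrib intro!: mult_pos_pos add_pos_nonneg)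
  qed auto
  have "norm (scaled_kernel q x) = q ^ CARD('n) * norm (kernel (q *\<^sub>R x))"
    using assms by (simp add: scaled_kernel_def norm_mult norm_power)
  also have "\<dots> \<le> q ^ CARD('n) * (2 ^ CARD('n) * decay x)"
    using assms d by (intro mult_left_mono order_trans[OF norm_kernel]) auto
  finally show ?thesis by (simp add: power_mult_distrib mult_ac)
qed

lemma fourier_R_scaled_kernel:
  fixes \<xi> :: "real^'n"
  assumes "q > 0" "\<And>i. \<bar>\<xi> $ i\<bar> < q / 8"
  shows "fourier_R (scaled_kernel q) \<xi> = 1"
proof -
  have "fourier_R (scaled_kernel q) \<xi> =
      (LINT x|lborel. of_real (q ^ CARD('n)) * (kernel (q *\<^sub>R x) * ee (- (((1 / q) *\<^sub>R \<xi>) \<bullet> (q *\<^sub>R x)))))"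
    unfolding fourier_R_eq scaled_kernel_def using assms by (simp add: mult.assoc)
  also have "\<dots> = fourier_R kernel ((1 / q) *\<^sub>R \<xi>)"
    unfolding fourier_R_eq
    by (rule integral_scale[OF assms(1), of "\<lambda>x. kernel x * ee (- (((1 / q) *\<^sub>R \<xi>) \<bullet> x))"]) measurable
  also have "\<dots> = 1"
    by (rule fourier_R_kernel) (use assms in \<open>simp add: abs_mult field_simps\<close>)
  finally show ?thesis .
qed

lemma scaled_sampling:
  fixes \<xi> x :: "real^'n"
  assumes "q > 0" "\<And>i. \<bar>\<xi> $ i\<bar> < q / 8"
  shows "(LINT m|lattice. kernel (q *\<^sub>R x - of_int_vec m) * ee (\<xi> \<bullet> ((1 / q) *\<^sub>R of_int_vec m))) = ee (\<xi> \<bullet> x)"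
proof -
  have "\<bar>((1 / q) *\<^sub>R \<xi>) $ i\<bar> < 1 / 8" for i using assms by (simp add: abs_mult field_simps)
  from kernel_sampling[OF this, of "q *\<^sub>R x"] show ?thesis using assms(1) by simp
qed

section \<open>Band-limited multipliers act on sequences\<close>

lemma integrable_lattice_bounded:
  fixes f :: "int^'n \<Rightarrow> real"
  assumes "\<And>k. f k \<ge> 0" "\<And>A. finite A \<Longrightarrow> sum f A \<le> C"
  shows "integrable lattice f" "(LINT k|lattice. f k) \<le> C"
proof -
  have sm: "f summable_on UNIV"
    by (rule nonneg_bdd_above_summable_on) (use assms in \<open>auto intro!: bdd_aboveI[of _ C]\<close>)
  have abs: "Infinite_Set_Sum.abs_summable_on f UNIV"
    using sm assms(1) by (subst abs_summable_equivalent[symmetric]) simp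
  then show "integrable lattice f" by (simp add: Infinite_Set_Sum.abs_summable_on_def)
  have "(LINT k|lattice. f k) = infsum f UNIV"
    using infsetsum_infsum[OF abs] by (simp add: infsetsum_def)
  then show "(LINT k|lattice. f k) \<le> C"
    using infsum_le_finite_sums[OF sm, of C] assms(2) by simp
qed

lemma finite_sum_le_lattice_integral:
  fixes f :: "int^'n \<Rightarrow> real"
  assumes "integrable lattice f" "\<And>k. f k \<ge> 0" "finite A"
  shows "sum f A \<le> (LINT k|lattice. f k)"
proof -
  have "sum f A = (LINT k|lattice. (if k \<in> A then f k else 0))"
    using assms(3) by (subst integral_lattice_finite(1)[of A]) auto
  also have "\<dots> \<le> (LINT k|lattice. f k)"
    using assms by (intro integral_mono integral_lattice_finite(2)[of A "\<lambda>k. if k \<in> A then f k else 0"]) auto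
  finally show ?thesis .
qed

lemma lattice_exhaustion_tendsto:
  fixes f :: "int^'n \<Rightarrow> complex"
  assumes "integrable lattice f"
  shows "(\<lambda>N. \<Sum>k | \<forall>i. \<bar>k $ i\<bar> \<le> int N. f k) \<longlonglongrightarrow> (LINT k|lattice. f k)"
proof -
  define g where "g N k = (if \<forall>i. \<bar>k $ i\<bar> \<le> int N then f k else 0)" for N k
  have "(\<lambda>N. LINT k|lattice. g N k) \<longlonglongrightarrow> (LINT k|lattice. f k)"
  proof (rule integral_dominated_convergence)
    show "integrable lattice (\<lambda>k. norm (f k))" using assms by simp
    show "AE k in lattice. (\<lambda>N. g N k) \<longlonglongrightarrow> f k"
    proof (rule AE_I2)
      fix k :: "int^'n"
      define N0 where "N0 = nat (Max (range (\<lambda>i. \<bar>k $ i\<bar>)))"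
      have "\<bar>k $ i\<bar> \<le> int N" if "N \<ge> N0" for N i
      proof -
        have "\<bar>k $ i\<bar> \<le> Max (range (\<lambda>i. \<bar>k $ i\<bar>))" by (rule Max_ge) auto
        then show ?thesis using that unfolding N0_def by linarith
      qed
      then have "\<forall>\<^sub>F N in sequentially. g N k = f k"
        by (intro eventually_sequentiallyI[of N0]) (simp add: g_def)
      then show "(\<lambda>N. g N k) \<longlonglongrightarrow> f k" by (rule tendsto_eventually)
    qed
  qed (auto simp: g_def)
  moreover have "(LINT k|lattice. g N k) = (\<Sum>k | \<forall>i. \<bar>k $ i\<bar> \<le> int N. f k)" for N
    by (subst integral_lattice_finite(1)[OF finite_lattice_box[of "int N"]]) (auto simp: g_def)
  ultimately show ?thesis by simp
qed

lemma finite_weighted_power_mean: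
  fixes w g :: "'b \<Rightarrow> real"
  assumes "finite A" "p \<ge> 1" "\<And>i. i \<in> A \<Longrightarrow> w i \<ge> 0" "\<And>i. i \<in> A \<Longrightarrow> g i \<ge> 0"
  shows "(\<Sum>i\<in>A. w i * g i) powr p \<le> (\<Sum>i\<in>A. w i) powr (p - 1) * (\<Sum>i\<in>A. w i * g i powr p)"
proof -
  have "(LINT i|count_space A. w i * g i) powr p \<le> (LINT i|count_space A. w i) powr (p - 1) * (LINT i|count_space A. w i * g i powr p)"
    using assms by (intro weighted_power_mean) (auto simp: integrable_count_space)
  then show ?thesis using assms(1) by (simp add: lebesgue_integral_count_space_finite)
qed

text \<open>A bounded function \<open>L\<close> that vanishes everywhere, not just almost everywhere, outside the cube. The integer \<open>q\<close> is the
  density of the sampling lattice; the condition on it places the cube inside the region where the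
  transform of the scaled kernel equals 1.\<close>

locale band_limited =
  fixes L :: "real^'n \<Rightarrow> complex" and M B :: real and q :: nat
  assumes L_measurable [measurable]: "L \<in> borel_measurable borel"
    and L_bound: "\<And>\<xi>. norm (L \<xi>) \<le> B"
    and L_support: "\<And>\<xi>. L \<xi> \<noteq> 0 \<Longrightarrow> \<bar>\<xi> $ i\<bar> \<le> M"
    and M_pos: "M > 0" and q_large: "8 * M < real q"
begin

lemma q_ge_1: "real q \<ge> 1" and q_pos: "real q > 0"
  using M_pos q_large by (cases q; simp)+

lemma B_nonneg: "B \<ge> 0"
  using L_bound[of 0] norm_ge_zero[of "L 0"] by linarith

definition radius :: real where
  "radius = M * CARD('n)"

lemma L_radius: "L \<xi> \<noteq> 0 \<Longrightarrow> norm \<xi> \<le> radius"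
proof -
  assume "L \<xi> \<noteq> 0"
  then have "(\<Sum>i\<in>UNIV. \<bar>\<xi> $ i\<bar>) \<le> (\<Sum>i\<in>(UNIV::'n set). M)" by (intro sum_mono L_support)
  then show ?thesis using norm_le_l1_cart[of \<xi>] by (simp add: radius_def mult.commute)
qed

lemma L_L2c: "L2c L"
proof -
  have *: "\<forall>\<xi>. norm \<xi> > radius \<longrightarrow> L \<xi> = 0" using L_radius by force
  then have "L \<in> Lp lborel 2" by (intro bounded_support_Lp[of _ B radius] L_measurable L_bound) auto
  then show ?thesis unfolding L2c_def using * by blast
qed

lemmas L_integrable = L2c_integrable[OF L_L2c]
lemmas L_L2 = L2c_Lp[OF L_L2c]

text \<open>The inverse Fourier transform of \<open>L\<close>.\<close>

definition \<kappa> :: "real^'n \<Rightarrow> complex" where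
  "\<kappa> x = (LINT \<xi>|lborel. L \<xi> * ee (\<xi> \<bullet> x))"

lemma \<kappa>_fourier: "\<kappa> x = fourier_R L (- x)"
  by (simp add: \<kappa>_def fourier_R_eq inner_commute)

lemma \<kappa>_measurable [measurable]: "\<kappa> \<in> borel_measurable borel"
  unfolding \<kappa>_fourier[abs_def] by measurable

lemma norm_\<kappa>: "norm (\<kappa> x) \<le> (LINT \<xi>|lborel. norm (L \<xi>))"
proof -
  have "norm (\<kappa> x) \<le> (LINT \<xi>|lborel. norm (L \<xi> * ee (\<xi> \<bullet> x)))" unfolding \<kappa>_def by (rule integral_norm_bound)
  then show ?thesis by (simp add: norm_mult)
qed

lemma \<kappa>_sub: "\<kappa> (x - y) = (LINT \<xi>|lborel. L \<xi> * ee (- (\<xi> \<bullet> y)) * ee (\<xi> \<bullet> x))"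
  unfolding \<kappa>_def by (simp add: inner_diff_right mult.assoc add.commute flip: ee_add)

definition \<Psi> :: "real^'n \<Rightarrow> complex" where
  "\<Psi> = scaled_kernel (real q)"

definition \<Psi>_bound :: real where
  "\<Psi>_bound = (2 * real q) ^ CARD('n)"

lemma \<Psi>_measurable [measurable]: "\<Psi> \<in> borel_measurable borel"
  by (simp add: \<Psi>_def)

lemma \<Psi>_bound_pos: "\<Psi>_bound > 0"
  unfolding \<Psi>_bound_def using q_pos by simp

lemma norm_\<Psi>: "norm (\<Psi> x) \<le> \<Psi>_bound * decay x"
  unfolding \<Psi>_def \<Psi>_bound_def by (rule norm_scaled_kernel[OF q_ge_1])

lemma norm_\<Psi>_le: "norm (\<Psi> x) \<le> \<Psi>_bound"
proof -
  have "\<Psi>_bound * decay x \<le> \<Psi>_bound * 1" using \<Psi>_bound_pos decay_le_1 by (intro mult_left_mono) auto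
  then show ?thesis using norm_\<Psi>[of x] by simp
qed

lemma \<Psi>_integrable: "integrable lborel \<Psi>"
proof (rule Bochner_Integration.integrable_bound)
  show "integrable lborel (\<lambda>x. \<Psi>_bound * decay (x::real^'n))"
    by (intro integrable_mult_right decay_integrable)
qed (auto intro!: order_trans[OF norm_\<Psi>])

lemma \<Psi>_lattice_sum:
  assumes "finite A" shows "(\<Sum>k\<in>A. norm (\<Psi> (x - of_int_vec k))) \<le> \<Psi>_bound * decay_sum TYPE('n)"
    "(\<Sum>k\<in>A. norm (\<Psi> (of_int_vec k + x))) \<le> \<Psi>_bound * decay_sum TYPE('n)"
proof -
  have *: "(\<Sum>k\<in>A. decay (y - of_int_vec k)) \<le> decay_sum TYPE('n)" for y :: "real^'n"
    using finite_sum_le_lattice_integral[OF decay_lattice_sum(1)[of y] less_imp_le[OF decay_pos] assms]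
      decay_lattice_sum(2)[of y] by linarith
  have "(\<Sum>k\<in>A. norm (\<Psi> (x - of_int_vec k))) \<le> (\<Sum>k\<in>A. \<Psi>_bound * decay (x - of_int_vec k))"
    by (intro sum_mono norm_\<Psi>)
  also have "\<dots> \<le> \<Psi>_bound * decay_sum TYPE('n)"
    unfolding sum_distrib_left[symmetric] using * \<Psi>_bound_pos by (intro mult_left_mono) auto
  finally show "(\<Sum>k\<in>A. norm (\<Psi> (x - of_int_vec k))) \<le> \<Psi>_bound * decay_sum TYPE('n)" .
  have "(\<Sum>k\<in>A. norm (\<Psi> (of_int_vec k + x))) \<le> (\<Sum>k\<in>A. \<Psi>_bound * decay (- x - of_int_vec k))"
  proof (intro sum_mono)
    fix k
    have "decay (of_int_vec k + x) = decay (- x - of_int_vec k)"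
      using decay_minus[of "of_int_vec k + x"] by (simp add: algebra_simps)
    then show "norm (\<Psi> (of_int_vec k + x)) \<le> \<Psi>_bound * decay (- x - of_int_vec k)"
      using norm_\<Psi>[of "of_int_vec k + x"] by simp
  qed
  also have "\<dots> \<le> \<Psi>_bound * decay_sum TYPE('n)"
    unfolding sum_distrib_left[symmetric] using * \<Psi>_bound_pos by (intro mult_left_mono) auto
  finally show "(\<Sum>k\<in>A. norm (\<Psi> (of_int_vec k + x))) \<le> \<Psi>_bound * decay_sum TYPE('n)" .
qed

lemma fourier_\<Psi>: "L \<xi> \<noteq> 0 \<Longrightarrow> fourier_R \<Psi> \<xi> = 1"
  unfolding \<Psi>_def
proof (rule fourier_R_scaled_kernel[OF q_pos])
  fix i assume "L \<xi> \<noteq> 0"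
  then show "\<bar>\<xi> $ i\<bar> < real q / 8" using L_support[of \<xi> i] q_large by simp
qed

text \<open>\<open>\<Psi>\<close> has Fourier transform 1 on the support of \<open>L\<close>, so convolution with it leaves \<open>\<kappa>\<close> unchanged.\<close>

lemma \<kappa>_reproduced: "\<kappa> x = (LINT y|lborel. \<kappa> (x - y) * \<Psi> y)"
proof -
  have "(LINT y|lborel. \<kappa> (x - y) * \<Psi> y) = (LINT y|lborel. LINT \<xi>|lborel. L \<xi> * ee (- (\<xi> \<bullet> y)) * ee (\<xi> \<bullet> x) * \<Psi> y)"
    unfolding \<kappa>_sub by simp
  also have "\<dots> = (LINT \<xi>|lborel. LINT y|lborel. L \<xi> * ee (- (\<xi> \<bullet> y)) * ee (\<xi> \<bullet> x) * \<Psi> y)"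
  proof (rule integral_swap[OF sigma_finite_lborel sigma_finite_lborel])
    show "(\<lambda>(y, \<xi>). L \<xi> * ee (- (\<xi> \<bullet> y)) * ee (\<xi> \<bullet> x) * \<Psi> y) \<in> borel_measurable (lborel \<Otimes>\<^sub>M lborel)" by measurable
    have "(\<integral>\<^sup>+y. \<integral>\<^sup>+\<xi>. ennreal (norm (L \<xi> * ee (- (\<xi> \<bullet> y)) * ee (\<xi> \<bullet> x) * \<Psi> y)) \<partial>lborel \<partial>lborel)
      = (\<integral>\<^sup>+\<xi>. ennreal (norm (L \<xi>)) \<partial>lborel) * (\<integral>\<^sup>+y. ennreal (norm (\<Psi> y)) \<partial>lborel)"
      by (simp add: norm_mult ennreal_mult nn_integral_multc nn_integral_cmult)
    also have "\<dots> < \<infinity>"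
      using L_integrable \<Psi>_integrable by (simp add: integrable_iff_bounded ennreal_mult_less_top)
    finally show "(\<integral>\<^sup>+y. \<integral>\<^sup>+\<xi>. ennreal (norm (L \<xi> * ee (- (\<xi> \<bullet> y)) * ee (\<xi> \<bullet> x) * \<Psi> y)) \<partial>lborel \<partial>lborel) < \<infinity>" .
  qed
  also have "\<dots> = (LINT \<xi>|lborel. L \<xi> * ee (\<xi> \<bullet> x) * fourier_R \<Psi> \<xi>)"
  proof (intro Bochner_Integration.integral_cong refl)
    fix \<xi>
    have "(LINT y|lborel. L \<xi> * ee (- (\<xi> \<bullet> y)) * ee (\<xi> \<bullet> x) * \<Psi> y) = (LINT y|lborel. (L \<xi> * ee (\<xi> \<bullet> x)) * (\<Psi> y * ee (- (\<xi> \<bullet> y))))"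
      by (simp add: mult_ac)
    then show "(LINT y|lborel. L \<xi> * ee (- (\<xi> \<bullet> y)) * ee (\<xi> \<bullet> x) * \<Psi> y) = L \<xi> * ee (\<xi> \<bullet> x) * fourier_R \<Psi> \<xi>"
      unfolding fourier_R_eq by simp
  qed
  also have "\<dots> = \<kappa> x"
    unfolding \<kappa>_def
  proof (intro Bochner_Integration.integral_cong refl)
    fix \<xi> show "L \<xi> * ee (\<xi> \<bullet> x) * fourier_R \<Psi> \<xi> = L \<xi> * ee (\<xi> \<bullet> x)"
      using fourier_\<Psi>[of \<xi>] by (cases "L \<xi> = 0") auto
  qed
  finally show ?thesis ..
qed

definition \<kappa>_comb :: "(int^'n) set \<Rightarrow> (int^'n \<Rightarrow> complex) \<Rightarrow> real^'n \<Rightarrow> complex" where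
  "\<kappa>_comb A a x = (\<Sum>k\<in>A. a k * \<kappa> (x - of_int_vec k))"

definition \<Psi>_comb :: "(int^'n) set \<Rightarrow> (int^'n \<Rightarrow> complex) \<Rightarrow> real^'n \<Rightarrow> complex" where
  "\<Psi>_comb A a x = (\<Sum>k\<in>A. a k * \<Psi> (x - of_int_vec k))"

lemma \<kappa>_comb_measurable [measurable]: "\<kappa>_comb A a \<in> borel_measurable borel"
  unfolding \<kappa>_comb_def[abs_def] by measurable

lemma \<kappa>_comb_bounded: "\<exists>C. \<forall>x. norm (\<kappa>_comb A a x) \<le> C"
proof -
  have "norm (\<kappa>_comb A a x) \<le> (\<Sum>k\<in>A. norm (a k) * (LINT \<xi>|lborel. norm (L \<xi>)))" for x
    unfolding \<kappa>_comb_def by (rule sum_norm_le) (auto simp: norm_mult intro!: mult_left_mono norm_\<kappa>)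
  then show ?thesis by blast
qed

lemma integral_reflect_translate:
  fixes f :: "real^'n \<Rightarrow> 'b::{banach, second_countable_topology}"
  assumes [measurable]: "f \<in> borel_measurable borel"
  shows "(LINT y|lborel. f (x - y)) = (LINT y|lborel. f y)" "integrable lborel (\<lambda>y. f (x - y)) \<longleftrightarrow> integrable lborel f"
proof -
  have l: "lborel = distr lborel borel (\<lambda>y::real^'n. x - y)"
    using lborel_affine[of "-1" x] by (simp add: density_1)
  show "(LINT y|lborel. f (x - y)) = (LINT y|lborel. f y)" by (subst (2) l) (simp add: integral_distr)
  show "integrable lborel (\<lambda>y. f (x - y)) \<longleftrightarrow> integrable lborel f" by (subst (2) l) (simp add: integrable_distr_eq)
qed

lemma \<kappa>_comb_reproduced: "\<kappa>_comb A a x = (LINT y|lborel. \<kappa>_comb A a (x - y) * \<Psi> y)"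
proof -
  have i: "integrable lborel (\<lambda>y. \<kappa> (x - of_int_vec k - y) * \<Psi> y)" for k
  proof (rule Bochner_Integration.integrable_bound)
    show "integrable lborel (\<lambda>y. (LINT \<xi>|lborel. norm (L \<xi>)) * norm (\<Psi> y))" using \<Psi>_integrable by simp
  qed (auto simp: norm_mult intro!: AE_I2 mult_right_mono order_trans[OF norm_\<kappa>])
  have "\<kappa>_comb A a (x - y) = (\<Sum>k\<in>A. a k * \<kappa> (x - of_int_vec k - y))" for y
    unfolding \<kappa>_comb_def
    by (intro sum.cong refl arg_cong2[where f = "(*)"] arg_cong[where f = \<kappa>]) (simp add: algebra_simps)
  then have "(LINT y|lborel. \<kappa>_comb A a (x - y) * \<Psi> y) = (LINT y|lborel. (\<Sum>k\<in>A. a k * (\<kappa> (x - of_int_vec k - y) * \<Psi> y)))"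
    by (simp add: sum_distrib_right mult.assoc)
  also have "\<dots> = (\<Sum>k\<in>A. a k * (LINT y|lborel. \<kappa> (x - of_int_vec k - y) * \<Psi> y))"
    using i by simp
  finally show ?thesis unfolding \<kappa>_comb_def \<kappa>_reproduced[symmetric] by simp
qed

lemma \<Psi>_Lp: assumes "r \<ge> 1" shows "\<Psi> \<in> Lp lborel r"
proof -
  have "integrable lborel (\<lambda>x. norm (\<Psi> x) powr r)"
  proof (rule Bochner_Integration.integrable_bound)
    show "integrable lborel (\<lambda>x. \<Psi>_bound powr (r - 1) * norm (\<Psi> x))" using \<Psi>_integrable by simp
    have "norm (\<Psi> x) powr r \<le> \<Psi>_bound powr (r - 1) * norm (\<Psi> x)" for x
    proof -
      have "norm (\<Psi> x) powr r = norm (\<Psi> x) powr (r - 1) * norm (\<Psi> x)"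
        by (simp add: mult.commute powr_mult_base)
      also have "\<dots> \<le> \<Psi>_bound powr (r - 1) * norm (\<Psi> x)"
        using assms norm_\<Psi>_le by (intro mult_right_mono powr_mono2) auto
      finally show ?thesis .
    qed
    then show "AE x in lborel. norm (norm (\<Psi> x) powr r) \<le> norm (\<Psi>_bound powr (r - 1) * norm (\<Psi> x))"
      by (auto simp: abs_mult)
  qed simp
  then show ?thesis by (simp add: Lp_def)
qed

lemma \<Psi>_comb_Lp: "finite A \<Longrightarrow> r \<ge> 1 \<Longrightarrow> \<Psi>_comb A a \<in> Lp lborel r"
  unfolding \<Psi>_comb_def[abs_def] by (intro Lp_sum Lp_cmult Lp_translate \<Psi>_Lp) auto

definition \<Psi>_mass :: real where
  "\<Psi>_mass = (LINT x|lborel. norm (\<Psi> x))"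

text \<open>A bound for \<open>\<Sum>k. \<bar>\<Psi>(x - k)\<bar>\<close>, uniform in \<open>x\<close>. Together with \<open>\<Psi>_mass\<close> it is all that enters the final
  constant from \<open>\<Psi>\<close>.\<close>

definition \<Psi>_sum :: real where
  "\<Psi>_sum = \<Psi>_bound * decay_sum TYPE('n)"

lemma \<Psi>_consts_nonneg: "\<Psi>_mass \<ge> 0" "\<Psi>_sum \<ge> 0"
  using \<Psi>_bound_pos decay_sum_nonneg[where 'n = 'n] by (auto simp: \<Psi>_mass_def \<Psi>_sum_def)

text \<open>Synthesis is bounded from \<open>\<ell>\<^sup>p\<close> to \<open>L\<^sup>p\<close>: the power mean inequality with the weights \<open>\<bar>\<Psi>(x - k)\<bar>\<close>, integrated
  over \<open>x\<close>.\<close>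

lemma \<Psi>_comb_norm:
  assumes A: "finite A" and p: "p \<ge> 1"
  shows "(LINT x|lborel. norm (\<Psi>_comb A a x) powr p) \<le> \<Psi>_sum powr (p - 1) * \<Psi>_mass * (\<Sum>k\<in>A. norm (a k) powr p)"
proof -
  have i: "integrable lborel (\<lambda>x. norm (\<Psi> (x - of_int_vec k)))" "(LINT x|lborel. norm (\<Psi> (x - of_int_vec k))) = \<Psi>_mass" for k
  proof -
    have "\<Psi> \<in> Lp lborel 1" by (rule \<Psi>_Lp) simp
    from Lp_translate[OF this, of "of_int_vec k"]
    show "integrable lborel (\<lambda>x. norm (\<Psi> (x - of_int_vec k)))" "(LINT x|lborel. norm (\<Psi> (x - of_int_vec k))) = \<Psi>_mass"
      by (simp_all add: Lp_def \<Psi>_mass_def)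
  qed
  have "(LINT x|lborel. norm (\<Psi>_comb A a x) powr p) \<le>
      (LINT x|lborel. \<Psi>_sum powr (p - 1) * (\<Sum>k\<in>A. norm (\<Psi> (x - of_int_vec k)) * norm (a k) powr p))"
  proof (rule integral_mono)
    show "integrable lborel (\<lambda>x. norm (\<Psi>_comb A a x) powr p)" using \<Psi>_comb_Lp[OF A p] by (rule Lp_integrable)
    show "integrable lborel (\<lambda>x. \<Psi>_sum powr (p - 1) * (\<Sum>k\<in>A. norm (\<Psi> (x - of_int_vec k)) * norm (a k) powr p))"
      using i(1) by (intro integrable_mult_right Bochner_Integration.integrable_sum integrable_mult_left) auto
    fix x
    have "norm (\<Psi>_comb A a x) powr p \<le> (\<Sum>k\<in>A. norm (\<Psi> (x - of_int_vec k)) * norm (a k)) powr p"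
      unfolding \<Psi>_comb_def using p
      by (intro powr_mono2 sum_norm_le) (auto simp: norm_mult mult.commute)
    also have "\<dots> \<le> (\<Sum>k\<in>A. norm (\<Psi> (x - of_int_vec k))) powr (p - 1) * (\<Sum>k\<in>A. norm (\<Psi> (x - of_int_vec k)) * norm (a k) powr p)"
      by (rule finite_weighted_power_mean[OF A p]) auto
    also have "\<dots> \<le> \<Psi>_sum powr (p - 1) * (\<Sum>k\<in>A. norm (\<Psi> (x - of_int_vec k)) * norm (a k) powr p)"
      using p \<Psi>_lattice_sum(1)[OF A, of x]
      by (intro mult_right_mono powr_mono2) (auto simp: \<Psi>_sum_def intro!: sum_nonneg)
    finally show "norm (\<Psi>_comb A a x) powr p \<le> \<Psi>_sum powr (p - 1) * (\<Sum>k\<in>A. norm (\<Psi> (x - of_int_vec k)) * norm (a k) powr p)" .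
  qed
  also have "\<dots> = \<Psi>_sum powr (p - 1) * (\<Sum>k\<in>A. \<Psi>_mass * norm (a k) powr p)"
    using i by simp
  finally show ?thesis by (simp add: sum_distrib_left mult.assoc)
qed

text \<open>Sampling a band-limited function on a translate of the lattice is bounded from \<open>L\<^sup>p\<close> to \<open>\<ell>\<^sup>p\<close>.\<close>

lemma \<kappa>_comb_sampling:
  assumes J: "finite J" and p: "p \<ge> 1" and L: "\<kappa>_comb A a \<in> Lp lborel p"
  shows "(\<Sum>j\<in>J. norm (\<kappa>_comb A a (s + of_int_vec j)) powr p) \<le> \<Psi>_mass powr (p - 1) * \<Psi>_sum * (LINT x|lborel. norm (\<kappa>_comb A a x) powr p)"
proof -
  define F where "F = \<kappa>_comb A a"
  have [measurable]: "F \<in> borel_measurable borel" by (simp add: F_def)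
  obtain C where C: "\<And>x. norm (F x) \<le> C" using \<kappa>_comb_bounded[of A a] by (auto simp: F_def)
  have Fi: "integrable lborel (\<lambda>z. norm (F z) powr p)" using Lp_integrable[OF L] by (simp add: F_def)
  have i1: "integrable lborel (\<lambda>z. norm (\<Psi> (x - z)) * norm (F z) powr p)" for x
  proof (rule Bochner_Integration.integrable_bound)
    show "integrable lborel (\<lambda>z. \<Psi>_bound * norm (F z) powr p)" using Fi by simp
  qed (use \<Psi>_bound_pos in \<open>auto intro!: AE_I2 mult_right_mono norm_\<Psi>_le simp: abs_mult\<close>)
  have i2: "integrable lborel (\<lambda>y. norm (\<Psi> y) * norm (F (x - y)) powr p)"
    "(LINT y|lborel. norm (\<Psi> y) * norm (F (x - y)) powr p) = (LINT z|lborel. norm (\<Psi> (x - z)) * norm (F z) powr p)" for x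
    using integral_reflect_translate[of "\<lambda>z. norm (\<Psi> (x - z)) * norm (F z) powr p" x] i1[of x] by simp_all
  have pt: "norm (F x) powr p \<le> \<Psi>_mass powr (p - 1) * (LINT z|lborel. norm (\<Psi> (x - z)) * norm (F z) powr p)" for x
  proof -
    have i3: "integrable lborel (\<lambda>y. norm (\<Psi> y) * norm (F (x - y)))"
    proof (rule Bochner_Integration.integrable_bound)
      show "integrable lborel (\<lambda>y. norm (\<Psi> y) * C)" using \<Psi>_integrable by simp
    qed (auto intro!: AE_I2 mult_left_mono order_trans[OF C] simp: abs_mult)
    have "norm (F x) \<le> (LINT y|lborel. norm (F (x - y) * \<Psi> y))"
      unfolding F_def by (subst \<kappa>_comb_reproduced) (rule integral_norm_bound)
    then have "norm (F x) powr p \<le> (LINT y|lborel. norm (\<Psi> y) * norm (F (x - y))) powr p"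
      using p by (intro powr_mono2) (auto simp: norm_mult mult.commute)
    also have "\<dots> \<le> (LINT y|lborel. norm (\<Psi> y)) powr (p - 1) * (LINT y|lborel. norm (\<Psi> y) * norm (F (x - y)) powr p)"
      by (rule weighted_power_mean[OF p]) (use \<Psi>_integrable i2 i3 in auto)
    finally show ?thesis by (simp add: i2 \<Psi>_mass_def)
  qed
  have e: "of_int_vec j + (s - z) = s + of_int_vec j - z" for j and z :: "real^'n" by (simp add: algebra_simps)
  have "(\<Sum>j\<in>J. norm (F (s + of_int_vec j)) powr p) \<le>
      (\<Sum>j\<in>J. \<Psi>_mass powr (p - 1) * (LINT z|lborel. norm (\<Psi> (s + of_int_vec j - z)) * norm (F z) powr p))"
    by (intro sum_mono pt)
  also have "\<dots> = \<Psi>_mass powr (p - 1) * (LINT z|lborel. (\<Sum>j\<in>J. norm (\<Psi> (of_int_vec j + (s - z)))) * norm (F z) powr p)"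
    unfolding e sum_distrib_right using i1 by (simp add: sum_distrib_left)
  also have "\<dots> \<le> \<Psi>_mass powr (p - 1) * (LINT z|lborel. \<Psi>_sum * norm (F z) powr p)"
  proof (intro mult_left_mono integral_mono)
    have "(\<lambda>z. (\<Sum>j\<in>J. norm (\<Psi> (of_int_vec j + (s - z)))) * norm (F z) powr p)
      = (\<lambda>z. \<Sum>j\<in>J. norm (\<Psi> (s + of_int_vec j - z)) * norm (F z) powr p)"
      unfolding e sum_distrib_right ..
    then show "integrable lborel (\<lambda>z. (\<Sum>j\<in>J. norm (\<Psi> (of_int_vec j + (s - z)))) * norm (F z) powr p)"
      using i1 by simp
    show "(\<Sum>j\<in>J. norm (\<Psi> (of_int_vec j + (s - z)))) * norm (F z) powr p \<le> \<Psi>_sum * norm (F z) powr p" for z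
      using \<Psi>_lattice_sum(2)[OF J] by (intro mult_right_mono) (auto simp: \<Psi>_sum_def)
  qed (use Fi in auto)
  finally show ?thesis by (simp add: F_def mult.assoc)
qed

lemma \<kappa>_comb_eq_fourier:
  "\<kappa>_comb A a x = fourier_R (\<lambda>\<xi>. L \<xi> * (\<Sum>k\<in>A. a k * ee (- (\<xi> \<bullet> of_int_vec k)))) (- x)"
proof -
  have i: "integrable lborel (\<lambda>\<xi>. L \<xi> * ee (- (\<xi> \<bullet> of_int_vec k)) * ee (\<xi> \<bullet> x))" for k
    by (intro integrable_mult_ee L_integrable) measurable
  have "fourier_R (\<lambda>\<xi>. L \<xi> * (\<Sum>k\<in>A. a k * ee (- (\<xi> \<bullet> of_int_vec k)))) (- x)
     = (LINT \<xi>|lborel. (\<Sum>k\<in>A. a k * (L \<xi> * ee (- (\<xi> \<bullet> of_int_vec k)) * ee (\<xi> \<bullet> x))))"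
    unfolding fourier_R_eq
    by (intro Bochner_Integration.integral_cong refl) (simp add: sum_distrib_left sum_distrib_right mult_ac inner_commute)
  also have "\<dots> = \<kappa>_comb A a x" unfolding \<kappa>_comb_def \<kappa>_sub using i by simp
  finally show ?thesis ..
qed

lemma fourier_\<Psi>_comb:
  assumes A: "finite A"
  shows "fourier_R (\<Psi>_comb A a) \<xi> = (\<Sum>k\<in>A. a k * ee (- (\<xi> \<bullet> of_int_vec k))) * fourier_R \<Psi> \<xi>"
proof -
  have i: "integrable lborel (\<lambda>x. \<Psi> (x - of_int_vec k) * ee (- (\<xi> \<bullet> x)))" for k
  proof (rule integrable_mult_ee)
    have "(\<lambda>x. \<Psi> (x - of_int_vec k)) \<in> Lp lborel 1" by (intro Lp_translate \<Psi>_Lp) simp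
    then show "integrable lborel (\<lambda>x. \<Psi> (x - of_int_vec k))" by (auto simp: Lp_def intro: integrable_norm_cancel)
  qed measurable
  have t: "(LINT x|lborel. \<Psi> (x - of_int_vec k) * ee (- (\<xi> \<bullet> x))) = ee (- (\<xi> \<bullet> of_int_vec k)) * fourier_R \<Psi> \<xi>" for k
  proof -
    have "fourier_R \<Psi> \<xi> = (LINT x|lborel. \<Psi> (x - of_int_vec k) * ee (- (\<xi> \<bullet> (x - of_int_vec k))))"
      unfolding fourier_R_eq by (rule integral_translate(1)[symmetric]) measurable
    also have "\<dots> = (LINT x|lborel. ee (\<xi> \<bullet> of_int_vec k) * (\<Psi> (x - of_int_vec k) * ee (- (\<xi> \<bullet> x))))"
      by (intro Bochner_Integration.integral_cong refl)
         (simp add: inner_diff_right mult.left_commute flip: ee_add)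
    also have "\<dots> = ee (\<xi> \<bullet> of_int_vec k) * (LINT x|lborel. \<Psi> (x - of_int_vec k) * ee (- (\<xi> \<bullet> x)))"
      by simp
    finally have "ee (- (\<xi> \<bullet> of_int_vec k)) * fourier_R \<Psi> \<xi> =
       (ee (- (\<xi> \<bullet> of_int_vec k)) * ee (\<xi> \<bullet> of_int_vec k)) * (LINT x|lborel. \<Psi> (x - of_int_vec k) * ee (- (\<xi> \<bullet> x)))"
      by simp
    then show ?thesis by (simp flip: ee_add)
  qed
  have "fourier_R (\<Psi>_comb A a) \<xi> = (LINT x|lborel. (\<Sum>k\<in>A. a k * (\<Psi> (x - of_int_vec k) * ee (- (\<xi> \<bullet> x)))))"
    unfolding fourier_R_eq \<Psi>_comb_def by (simp add: sum_distrib_right mult.assoc)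
  also have "\<dots> = (\<Sum>k\<in>A. a k * (LINT x|lborel. \<Psi> (x - of_int_vec k) * ee (- (\<xi> \<bullet> x))))"
    using i by simp
  finally show ?thesis unfolding t by (simp add: sum_distrib_right mult.assoc)
qed

text \<open>An operator with multiplier \<open>L\<close> maps the combination of translates of \<open>\<Psi>\<close> to the same combination of
  translates of \<open>\<kappa>\<close>. Together with the preceding estimates this bounds, on sequences, the
  convolution with any sampling of \<open>\<kappa>\<close>.\<close>

lemma multiplier_\<Psi>_comb:
  assumes AE: "AE \<xi> in lborel. \<Lambda> \<xi> = L \<xi>" and T: "realizes Euclid p \<Lambda> T"
    and p: "p \<ge> 1" and A: "finite A"
  shows "AE x in lborel. T (\<Psi>_comb A a) x = \<kappa>_comb A a x"
proof -
  define P where "P \<xi> = (\<Sum>k\<in>A. a k * ee (- (\<xi> \<bullet> of_int_vec k)))" for \<xi> :: "real^'n"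
  define v where "v \<xi> = L \<xi> * P \<xi>" for \<xi>
  have [measurable]: "P \<in> borel_measurable borel" unfolding P_def[abs_def] by measurable
  have [measurable]: "v \<in> borel_measurable borel" unfolding v_def[abs_def] by measurable
  have "\<Psi>_comb A a \<in> Lp lborel 2 \<inter> Lp lborel p" using A p by (auto intro: \<Psi>_comb_Lp)
  then obtain h where h: "plancherel_R (\<Psi>_comb A a) h" "plancherel_R (T (\<Psi>_comb A a)) (\<lambda>\<xi>. \<Lambda> \<xi> * h \<xi>)"
  proof -
    have "\<forall>f\<in>Lp lborel 2 \<inter> Lp lborel p. \<exists>h. plancherel_R f h \<and> plancherel_R (T f) (\<lambda>\<xi>. \<Lambda> \<xi> * h \<xi>)"
      using T by (simp add: realizes_def Euclid_def)
    then show ?thesis using that \<open>\<Psi>_comb A a \<in> Lp lborel 2 \<inter> Lp lborel p\<close> by blast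
  qed
  have "\<Psi>_comb A a \<in> Lp lborel 1" by (rule \<Psi>_comb_Lp[OF A]) simp
  then have "integrable lborel (\<Psi>_comb A a)" by (auto simp: Lp_def intro: integrable_norm_cancel)
  from plancherel_R_integrable[OF h(1) this] AE
  (* where \<open>L\<close> does not vanish the transform of \<open>\<Psi>\<close> is 1 *)
  have hv: "AE \<xi> in lborel. \<Lambda> \<xi> * h \<xi> = v \<xi>"
  proof eventually_elim
    case (elim \<xi>)
    then show ?case
      using fourier_\<Psi>_comb[OF A, of a \<xi>] fourier_\<Psi>[of \<xi>] by (cases "L \<xi> = 0") (auto simp: v_def P_def)
  qed
  have vi: "integrable lborel v"
  proof (rule Bochner_Integration.integrable_bound)
    show "integrable lborel (\<lambda>\<xi>. norm (L \<xi>) * (\<Sum>k\<in>A. norm (a k)))" using L_integrable by simp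
    have "norm (P \<xi>) \<le> (\<Sum>k\<in>A. norm (a k))" for \<xi> unfolding P_def by (rule sum_norm_le) (simp add: norm_mult)
    then show "AE \<xi> in lborel. norm (v \<xi>) \<le> norm (norm (L \<xi>) * (\<Sum>k\<in>A. norm (a k)))"
      by (auto simp: v_def norm_mult abs_mult sum_nonneg intro!: AE_I2 mult_left_mono)
  qed simp
  have TL: "T (\<Psi>_comb A a) \<in> Lp lborel 2" "(\<lambda>\<xi>. \<Lambda> \<xi> * h \<xi>) \<in> Lp lborel 2" using h(2) by (auto simp: plancherel_R_def)
  show ?thesis
  proof (rule weakly_equal_AE)
    show "trunc R (T (\<Psi>_comb A a)) \<in> Lp lborel 2" for R using TL(1) by (rule trunc_Lp) simp
    show "trunc R (\<kappa>_comb A a) \<in> Lp lborel 2" for R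
    proof -
      obtain C where C: "\<And>x. norm (\<kappa>_comb A a x) \<le> C" using \<kappa>_comb_bounded[of A a] by blast
      then show ?thesis
        by (intro bounded_support_Lp[of _ "max C 0" R]) (auto simp: trunc_def intro: order_trans[OF C])
    qed
    fix w :: "real^'n \<Rightarrow> complex" assume w: "L2c w"
    have [measurable]: "w \<in> borel_measurable borel" using w by (rule L2c_measurable)
    have [measurable]: "(\<lambda>\<xi>. \<Lambda> \<xi> * h \<xi>) \<in> borel_measurable borel" using Lp_measurable[OF TL(2)] by simp
    have "(LINT x|lborel. T (\<Psi>_comb A a) x * cnj (w x)) = (LINT \<xi>|lborel. \<Lambda> \<xi> * h \<xi> * cnj (fourier_R w \<xi>))"
      by (rule plancherel_pairing[OF h(2) w])
    also have "\<dots> = (LINT \<xi>|lborel. v \<xi> * cnj (fourier_R w \<xi>))"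
      by (rule integral_cong_AE) (use hv in auto)
    also have "\<dots> = (LINT x|lborel. fourier_R v (- x) * cnj (w x))"
      by (rule inverse_fourier_pairing[OF vi L2c_integrable[OF w], symmetric])
    also have "(\<lambda>x. fourier_R v (- x)) = \<kappa>_comb A a"
      unfolding \<kappa>_comb_eq_fourier v_def P_def ..
    finally show "(LINT x|lborel. T (\<Psi>_comb A a) x * cnj (w x)) = (LINT x|lborel. \<kappa>_comb A a x * cnj (w x))" .
  qed
qed

text \<open>Synthesis with \<open>\<Psi>\<close>, the operator \<open>T\<close>, and sampling are composed. The powers of the constants combine because
  synthesis contributes the exponents \<open>p - 1\<close> and 1, and sampling the same exponents in the opposite order.\<close>

lemma discrete_convolution_finite:
  assumes AE: "AE \<xi> in lborel. \<Lambda> \<xi> = L \<xi>" and T: "realizes Euclid p \<Lambda> T" "strong_bound Euclid p T K"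
    and p: "p \<ge> 1" and A: "finite A" and J: "finite J"
  shows "(\<Sum>j\<in>J. norm (\<kappa>_comb A a (s + of_int_vec j)) powr p) \<le> (\<Psi>_mass * \<Psi>_sum * K) powr p * (\<Sum>k\<in>A. norm (a k) powr p)"
proof -
  define S where "S = (\<Sum>k\<in>A. norm (a k) powr p)"
  have S0: "S \<ge> 0" by (simp add: S_def sum_nonneg)
  have \<Psi>L: "\<Psi>_comb A a \<in> Lp lborel p" by (rule \<Psi>_comb_Lp[OF A p])
  have K: "K \<ge> 0" and TL: "T (\<Psi>_comb A a) \<in> Lp lborel p"
    and Tn: "Lp_norm lborel p (T (\<Psi>_comb A a)) \<le> K * Lp_norm lborel p (\<Psi>_comb A a)"
    using T(2) \<Psi>L unfolding strong_bound_def Euclid_def by auto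
  note eq = multiplier_\<Psi>_comb[OF AE T(1) p A, of a]
  have [measurable]: "T (\<Psi>_comb A a) \<in> borel_measurable borel" using Lp_measurable[OF TL] by simp
  have \<kappa>L: "\<kappa>_comb A a \<in> Lp lborel p"
    by (rule Lp_bounded_by[OF TL]) (use eq p in \<open>auto elim!: eventually_mono\<close>)
  have "(LINT x|lborel. norm (\<kappa>_comb A a x) powr p) = (LINT x|lborel. norm (T (\<Psi>_comb A a) x) powr p)"
    by (rule integral_cong_AE) (use eq in \<open>auto elim!: eventually_mono\<close>)
  also have "\<dots> = Lp_norm lborel p (T (\<Psi>_comb A a)) powr p" using p by (simp add: Lp_norm_powr)
  also have "\<dots> \<le> (K * Lp_norm lborel p (\<Psi>_comb A a)) powr p"
    using p by (intro powr_mono2 Tn) (auto simp: Lp_norm_def)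
  also have "\<dots> = K powr p * (LINT x|lborel. norm (\<Psi>_comb A a x) powr p)"
    using K p by (simp add: powr_mult Lp_norm_def powr_powr Bochner_Integration.integral_nonneg)
  also have "\<dots> \<le> K powr p * (\<Psi>_sum powr (p - 1) * \<Psi>_mass * S)"
    unfolding S_def by (intro mult_left_mono \<Psi>_comb_norm A p) auto
  finally have n: "(LINT x|lborel. norm (\<kappa>_comb A a x) powr p) \<le> K powr p * (\<Psi>_sum powr (p - 1) * \<Psi>_mass * S)" .
  have "(\<Sum>j\<in>J. norm (\<kappa>_comb A a (s + of_int_vec j)) powr p) \<le> \<Psi>_mass powr (p - 1) * \<Psi>_sum * (LINT x|lborel. norm (\<kappa>_comb A a x) powr p)"
    by (rule \<kappa>_comb_sampling[OF J p \<kappa>L])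
  also have "\<dots> \<le> \<Psi>_mass powr (p - 1) * \<Psi>_sum * (K powr p * (\<Psi>_sum powr (p - 1) * \<Psi>_mass * S))"
    using \<Psi>_consts_nonneg by (intro mult_left_mono n) auto
  also have "\<dots> = (\<Psi>_mass * \<Psi>_mass powr (p - 1)) * (\<Psi>_sum * \<Psi>_sum powr (p - 1)) * K powr p * S" by (simp add: mult_ac)
  also have "\<dots> = (\<Psi>_mass * \<Psi>_sum * K) powr p * S"
    using \<Psi>_consts_nonneg K by (simp add: powr_mult_base powr_mult)
  finally show ?thesis by (simp add: S_def)
qed

text \<open>The values of \<open>\<kappa>\<close> on a translate of the lattice are Fourier coefficients of a bounded
  function on the torus, hence square summable.\<close>

lemma \<kappa>_square_summable: "\<exists>C\<ge>0. \<forall>z. integrable lattice (\<lambda>k. (norm (\<kappa> (z - of_int_vec k)))\<^sup>2) \<and>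
   (LINT k|lattice. (norm (\<kappa> (z - of_int_vec k)))\<^sup>2) \<le> C"
proof -
  define J where "J = {n :: int^'n. \<exists>u\<in>cell. norm (of_int_vec n + u) \<le> radius}"
  have J: "finite J" unfolding J_def by (rule finite_lattice_near)
  define C where "C = card J * B"
  have C0: "C \<ge> 0" using B_nonneg by (simp add: C_def)
  have "integrable lattice (\<lambda>k. (norm (\<kappa> (z - of_int_vec k)))\<^sup>2) \<and> (LINT k|lattice. (norm (\<kappa> (z - of_int_vec k)))\<^sup>2) \<le> C\<^sup>2" for z
  proof -
    (* the periodization of the function whose inverse transform is \<open>\<kappa>\<close> shifted by \<open>z\<close> *)
    define P where "P u = (LINT n|lattice. L (of_int_vec n + u) * ee ((of_int_vec n + u) \<bullet> z))" for u
    have Pm: "P \<in> borel_measurable borel" unfolding P_def[abs_def] by measurable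
    have Pb: "norm (P u) \<le> C" if "u \<in> cell" for u
    proof -
      have "P u = (\<Sum>n\<in>J. L (of_int_vec n + u) * ee ((of_int_vec n + u) \<bullet> z))"
        unfolding P_def using that L_radius by (intro integral_lattice_finite(1)[OF J]) (force simp: J_def)
      also have "norm \<dots> \<le> (\<Sum>n\<in>J. B)" by (rule sum_norm_le) (simp add: norm_mult L_bound)
      finally show ?thesis by (simp add: C_def)
    qed
    have PL: "P \<in> Lp torus_measure 2"
      by (rule torus_bounded_Lp[of _ C]) (auto intro!: measurable_torusI Pm AE_I2 Pb)
    have co: "\<kappa> (z - of_int_vec k) = fourier_T P k" for k
    proof -
      have "\<kappa> (z - of_int_vec k) = (LINT u|torus_measure. LINT n|lattice. L (of_int_vec n + u) * ee ((of_int_vec n + u) \<bullet> (z - of_int_vec k)))"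
        unfolding \<kappa>_def by (rule integral_unfold(1)) (intro integrable_mult_ee L_integrable, measurable)
      also have "\<dots> = (LINT u|torus_measure. LINT n|lattice. L (of_int_vec n + u) * ee ((of_int_vec n + u) \<bullet> z) * ee (- (of_int_vec k \<bullet> u)))"
      proof (intro Bochner_Integration.integral_cong refl)
        fix u :: "real^'n" and n :: "int^'n"
        have "ee ((of_int_vec n + u) \<bullet> (z - of_int_vec k)) = ee ((of_int_vec n + u) \<bullet> z + (- (of_int_vec k \<bullet> u) + of_int_vec (- n) \<bullet> of_int_vec k))"
          by (rule arg_cong[of _ _ ee]) (simp add: inner_simps inner_commute)
        also have "\<dots> = ee ((of_int_vec n + u) \<bullet> z) * ee (- (of_int_vec k \<bullet> u))"
          by (simp only: ee_add ee_lattice mult_1_right)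
        finally show "L (of_int_vec n + u) * ee ((of_int_vec n + u) \<bullet> (z - of_int_vec k)) =
          L (of_int_vec n + u) * ee ((of_int_vec n + u) \<bullet> z) * ee (- (of_int_vec k \<bullet> u))" by simp
      qed
      finally show ?thesis unfolding fourier_T_eq P_def by simp
    qed
    have "(LINT u|torus_measure. (norm (P u))\<^sup>2) \<le> (LINT u|(torus_measure::(real^'n) measure). C\<^sup>2)"
      using PL by (intro integral_mono) (auto simp: Lp_2_iff intro!: power_mono Pb)
    then show ?thesis using parseval_torus[OF PL] by (simp add: co Lp_2_iff)
  qed
  then show ?thesis using C0 by (intro exI[of _ "C\<^sup>2"]) auto
qed

end

text \<open>The same bounds for infinite sequences, by exhaustion. Summability of the convolution follows from the
  finite bound at a single point, applied to a sequence whose phases make all terms nonnegative.\<close>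

lemma discrete_convolution:
  fixes \<kappa> :: "real^'n \<Rightarrow> complex"
  assumes fin: "\<And>A J a s. finite A \<Longrightarrow> finite J \<Longrightarrow>
      (\<Sum>j\<in>J. norm (\<Sum>k\<in>A. a k * \<kappa> (s + of_int_vec j - of_int_vec k)) powr p) \<le> c powr p * (\<Sum>k\<in>A. norm (a k) powr p)"
    and p: "p \<ge> 1" and c: "c \<ge> 0" and a: "integrable lattice (\<lambda>k. norm (a k) powr p)"
  shows "integrable lattice (\<lambda>k. a k * \<kappa> (s - of_int_vec k))"
    and "(LINT k|lattice. norm (a k * \<kappa> (s - of_int_vec k))) \<le> c * (LINT k|lattice. norm (a k) powr p) powr (1 / p)"
    and "integrable lattice (\<lambda>j. norm (LINT k|lattice. a k * \<kappa> (s + of_int_vec j - of_int_vec k)) powr p)"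
    and "(LINT j|lattice. norm (LINT k|lattice. a k * \<kappa> (s + of_int_vec j - of_int_vec k)) powr p)
      \<le> c powr p * (LINT k|lattice. norm (a k) powr p)"
proof -
  define S where "S = (LINT k|lattice. norm (a k) powr p)"
  have S0: "S \<ge> 0" by (simp add: S_def)
  have SA: "(\<Sum>k\<in>A. norm (a k) powr p) \<le> S" if "finite A" for A
    unfolding S_def by (rule finite_sum_le_lattice_integral[OF a _ that]) simp
  have bd: "(\<Sum>k\<in>A. norm (a k * \<kappa> (s - of_int_vec k))) \<le> c * S powr (1 / p)" if A: "finite A" for A s
  proof -
    define b where "b k = norm (a k) * cnj (sgn (\<kappa> (s - of_int_vec k)))" for k
    have b: "b k * \<kappa> (s - of_int_vec k) = of_real (norm (a k * \<kappa> (s - of_int_vec k)))" for k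
    proof -
      have "cnj (sgn z) * z = of_real (norm z)" for z :: complex
        using complex_norm_square[of z]
        by (cases "z = 0") (simp_all add: sgn_div_norm scaleR_conv_of_real power2_eq_square mult.commute field_simps)
      then show ?thesis by (simp add: b_def norm_mult mult.assoc)
    qed
    have nb: "norm (b k) \<le> norm (a k)" for k by (simp add: b_def norm_mult norm_sgn)
    have "(\<Sum>k\<in>A. norm (a k * \<kappa> (s - of_int_vec k))) powr p = (\<Sum>j\<in>{0}. norm (\<Sum>k\<in>A. b k * \<kappa> (s + of_int_vec j - of_int_vec k)) powr p)"
      by (simp add: b sum_nonneg flip: of_real_sum)
    also have "\<dots> \<le> c powr p * (\<Sum>k\<in>A. norm (b k) powr p)" by (rule fin[OF A]) simp
    also have "\<dots> \<le> c powr p * S"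
      using p nb by (intro mult_left_mono order_trans[OF sum_mono SA[OF A]] powr_mono2) auto
    also have "\<dots> = (c * S powr (1 / p)) powr p" using p c S0 by (simp add: powr_mult powr_powr)
    finally have le: "(\<Sum>k\<in>A. norm (a k * \<kappa> (s - of_int_vec k))) powr p \<le> (c * S powr (1 / p)) powr p" .
    show ?thesis
    proof (rule ccontr)
      assume "\<not> ?thesis"
      then have "(c * S powr (1 / p)) powr p < (\<Sum>k\<in>A. norm (a k * \<kappa> (s - of_int_vec k))) powr p"
        using p c by (intro powr_less_mono2) auto
      then show False using le by simp
    qed
  qed
  have conv: "integrable lattice (\<lambda>k. a k * \<kappa> (s - of_int_vec k))" "(LINT k|lattice. norm (a k * \<kappa> (s - of_int_vec k))) \<le> c * S powr (1 / p)" for s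
  proof -
    note * = integrable_lattice_bounded[of "\<lambda>k. norm (a k * \<kappa> (s - of_int_vec k))", OF norm_ge_zero bd]
    show "integrable lattice (\<lambda>k. a k * \<kappa> (s - of_int_vec k))" by (rule integrable_norm_cancel[OF *(1)]) auto
    show "(LINT k|lattice. norm (a k * \<kappa> (s - of_int_vec k))) \<le> c * S powr (1 / p)" by (rule *(2))
  qed
  show "integrable lattice (\<lambda>k. a k * \<kappa> (s - of_int_vec k))"
    "(LINT k|lattice. norm (a k * \<kappa> (s - of_int_vec k))) \<le> c * (LINT k|lattice. norm (a k) powr p) powr (1 / p)"
    using conv by (simp_all add: S_def)
  have "(\<Sum>j\<in>J. norm (LINT k|lattice. a k * \<kappa> (s + of_int_vec j - of_int_vec k)) powr p) \<le> c powr p * S" if J: "finite J" for J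
  proof (rule LIMSEQ_le_const2)
    show "(\<lambda>N. \<Sum>j\<in>J. norm (\<Sum>k | \<forall>i. \<bar>k $ i\<bar> \<le> int N. a k * \<kappa> (s + of_int_vec j - of_int_vec k)) powr p)
      \<longlonglongrightarrow> (\<Sum>j\<in>J. norm (LINT k|lattice. a k * \<kappa> (s + of_int_vec j - of_int_vec k)) powr p)"
    proof (intro tendsto_sum tendsto_powr2 tendsto_norm lattice_exhaustion_tendsto conv tendsto_const)
    qed (use p in auto)
    have "(\<Sum>j\<in>J. norm (\<Sum>k | \<forall>i. \<bar>k $ i\<bar> \<le> int N. a k * \<kappa> (s + of_int_vec j - of_int_vec k)) powr p) \<le> c powr p * S" for N
      using fin[OF finite_lattice_box[of "int N"] J, of a s] SA[OF finite_lattice_box[of "int N"]]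
      by (meson order_trans mult_left_mono powr_ge_zero)
    then show "\<exists>N. \<forall>n\<ge>N. (\<Sum>j\<in>J. norm (\<Sum>k | \<forall>i. \<bar>k $ i\<bar> \<le> int n. a k * \<kappa> (s + of_int_vec j - of_int_vec k)) powr p) \<le> c powr p * S"
      by blast
  qed
  from integrable_lattice_bounded[of "\<lambda>j. norm (LINT k|lattice. a k * \<kappa> (s + of_int_vec j - of_int_vec k)) powr p", OF powr_ge_zero this]
  show "integrable lattice (\<lambda>j. norm (LINT k|lattice. a k * \<kappa> (s + of_int_vec j - of_int_vec k)) powr p)"
    "(LINT j|lattice. norm (LINT k|lattice. a k * \<kappa> (s + of_int_vec j - of_int_vec k)) powr p)
      \<le> c powr p * (LINT k|lattice. norm (a k) powr p)"
    by (simp_all add: S_def)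
qed

section \<open>The transferred operator and its weak-type bound\<close>

lemma Torus_simps: "haar Torus = torus_measure" "dual_haar Torus = count_space UNIV"
  "transform Torus f g \<longleftrightarrow> f \<in> Lp torus_measure 2 \<and> g = fourier_T f"
  by (simp_all add: Torus_def)

lemma Euclid_simps: "haar Euclid = lborel" "diff Euclid = (-)" "dual_haar Euclid = lborel"
  "transform Euclid = plancherel_R"
  by (simp_all add: Euclid_def)

text \<open>The strong multiplier bound for \<open>\<Lambda>\<close> enters only through its consequence for sequences, with constant \<open>c\<close>. The
  operator \<open>S\<close> of weak type on the torus has multiplier \<open>\<phi>\<close>.\<close>

locale transference = band_limited L M B q
  for L :: "real^'n \<Rightarrow> complex" and M B :: real and q :: nat +
  fixes p c K D :: real and \<phi> :: "int^'n \<Rightarrow> complex"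
    and S :: "(real^'n \<Rightarrow> complex) \<Rightarrow> real^'n \<Rightarrow> complex"
  assumes p_gt_1: "p > 1" and c_nonneg: "c \<ge> 0"
    and convolution_bound: "\<And>A J a s. finite A \<Longrightarrow> finite J \<Longrightarrow>
      (\<Sum>j\<in>J. norm (\<Sum>k\<in>A. a k * \<kappa> (s + of_int_vec j - of_int_vec k)) powr p) \<le> c powr p * (\<Sum>k\<in>A. norm (a k) powr p)"
    and S_realizes: "realizes Torus p \<phi> S" and S_weak_bound: "weak_bound Torus p S K"
    and \<phi>_bound: "\<And>n. norm (\<phi> n) \<le> D"
begin

lemma p_pos: "p > 0" and p_ge_1: "p \<ge> 1"
  using p_gt_1 by auto

lemma D_nonneg: "D \<ge> 0"
  using \<phi>_bound[of 0] norm_ge_zero[of "\<phi> 0"] by linarith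

lemma K_nonneg: "K \<ge> 0"
  using S_weak_bound by (simp add: weak_bound_def)

lemma S_linear:
  assumes "f \<in> Lp torus_measure p" "g \<in> Lp torus_measure p"
  shows "AE x in torus_measure. S (\<lambda>x. a * f x + b * g x) x = a * S f x + b * S g x"
  using S_realizes assms unfolding realizes_def Torus_simps by blast

lemma S_L2:
  assumes "f \<in> Lp torus_measure p" "f \<in> Lp torus_measure 2"
  shows "S f \<in> Lp torus_measure 2" "fourier_T (S f) n = \<phi> n * fourier_T f n"
proof -
  have *: "S f \<in> Lp torus_measure 2 \<and> (\<lambda>n. \<phi> n * fourier_T f n) = fourier_T (S f)"
    using S_realizes assms unfolding realizes_def Torus_simps by blast
  then show "S f \<in> Lp torus_measure 2" by simp
  show "fourier_T (S f) n = \<phi> n * fourier_T f n" using fun_cong[OF conjunct2[OF *], of n] by simp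
qed

lemma S_measurable: "f \<in> Lp torus_measure p \<Longrightarrow> S f \<in> borel_measurable torus_measure"
  using S_weak_bound by (simp add: weak_bound_def weak_Lp_def Torus_def)

lemma S_weak:
  assumes "f \<in> Lp torus_measure p" "t > 0"
  shows "emeasure torus_measure {x \<in> cell. norm (S f x) > t} \<le>
    ennreal (K powr p / t powr p * (LINT x|torus_measure. norm (f x) powr p))"
  using S_weak_bound assms by (simp add: weak_bound_def Torus_def Lp_norm_powr[OF p_pos])

lemma weak_zero_AE:
  assumes "g \<in> borel_measurable M'" "\<And>t. t > 0 \<Longrightarrow> emeasure M' {x \<in> space M'. norm (g x :: complex) > t} = 0"
  shows "AE x in M'. g x = 0"
proof -
  note [measurable] = assms(1)
  have "AE x in M'. \<forall>n::nat. \<not> norm (g x) > inverse (real (Suc n))"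
    unfolding AE_all_countable
  proof
    fix n :: nat
    have "{x \<in> space M'. norm (g x) > inverse (real (Suc n))} \<in> null_sets M'"
      using assms(2)[of "inverse (real (Suc n))"] by (auto intro!: null_setsI)
    then show "AE x in M'. \<not> norm (g x) > inverse (real (Suc n))"
      by (rule AE_I') auto
  qed
  then show ?thesis
  proof eventually_elim
    fix x assume *: "\<forall>n::nat. \<not> norm (g x) > inverse (real (Suc n))"
    show "g x = 0"
    proof (rule ccontr)
      assume "g x \<noteq> 0"
      then obtain n where "inverse (real (Suc n)) < norm (g x)" using reals_Archimedean[of "norm (g x)"] by auto
      then show False using * by blast
    qed
  qed
qed

text \<open>Operators are only given on functions, not on classes; the weak bound makes \<open>S\<close> compatible with
  equality almost everywhere.\<close>

lemma S_cong:
  assumes f: "f \<in> Lp torus_measure p" and g: "g \<in> Lp torus_measure p" and eq: "AE x in torus_measure. f x = g x"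
  shows "AE x in torus_measure. S f x = S g x"
proof -
  define d where "d x = 1 * f x + (- 1) * g x" for x
  have d: "d \<in> Lp torus_measure p" unfolding d_def[abs_def] by (rule Lp_lincomb[OF f g p_pos])
  have "(LINT x|torus_measure. norm (d x) powr p) = 0"
    by (rule integral_eq_zero_AE) (use eq in \<open>auto simp: d_def elim!: eventually_mono\<close>)
  then have "AE x in torus_measure. S d x = 0"
    using S_weak[OF d] by (intro weak_zero_AE S_measurable d) simp
  moreover have "AE x in torus_measure. S d x = 1 * S f x + (- 1) * S g x"
    unfolding d_def[abs_def] by (rule S_linear[OF f g])
  ultimately show ?thesis by eventually_elim simp
qed

text \<open>Convolution of \<open>f\<close> with \<open>\<kappa>\<close>, evaluated at \<open>y\<close>, but with the sum over each coset \<open>\<theta> + \<int>\<^sup>N\<close> kept separate: the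
  integral of \<open>F f y\<close> over the torus is the convolution at \<open>y\<close>.\<close>

definition F :: "(real^'n \<Rightarrow> complex) \<Rightarrow> real^'n \<Rightarrow> real^'n \<Rightarrow> complex" where
  "F f y \<theta> = (LINT k|lattice. f (of_int_vec k + \<theta>) * \<kappa> (y - \<theta> - of_int_vec k))"

lemma F_measurable [measurable (raw)]:
  assumes [measurable]: "f \<in> borel_measurable borel"
  shows "F f y \<in> borel_measurable borel"
  unfolding F_def[abs_def] by measurable

lemma Lp_borel: "f \<in> Lp lborel r \<Longrightarrow> f \<in> borel_measurable borel"
  using Lp_measurable[of f lborel r] by simp

lemma AE_slices_Lp:
  assumes f: "f \<in> Lp lborel p"
  shows "AE \<theta> in torus_measure. integrable lattice (\<lambda>k. norm (f (of_int_vec k + \<theta>)) powr p)"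
  using integral_unfold(3)[OF Lp_integrable[OF f]] .

lemma convolution:
  assumes "integrable lattice (\<lambda>k. norm (a k) powr p)"
  shows "integrable lattice (\<lambda>k. a k * \<kappa> (s - of_int_vec k))"
    and "(LINT k|lattice. norm (a k * \<kappa> (s - of_int_vec k))) \<le> c * (LINT k|lattice. norm (a k) powr p) powr (1 / p)"
    and "integrable lattice (\<lambda>j. norm (LINT k|lattice. a k * \<kappa> (s + of_int_vec j - of_int_vec k)) powr p)"
    and "(LINT j|lattice. norm (LINT k|lattice. a k * \<kappa> (s + of_int_vec j - of_int_vec k)) powr p)
      \<le> c powr p * (LINT k|lattice. norm (a k) powr p)"
  by (rule discrete_convolution[where c = c, OF convolution_bound p_ge_1 c_nonneg assms]; assumption)+

lemma nn_integral_powr_unfold: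
  assumes f: "f \<in> Lp lborel p"
  shows "(\<integral>\<^sup>+\<theta>. ennreal (LINT k|lattice. norm (f (of_int_vec k + \<theta>)) powr p) \<partial>torus_measure) = ennreal (LINT x|lborel. norm (f x) powr p)"
proof -
  have "(\<integral>\<^sup>+\<theta>. ennreal (LINT k|lattice. norm (f (of_int_vec k + \<theta>)) powr p) \<partial>torus_measure)
     = ennreal (LINT \<theta>|torus_measure. LINT k|lattice. norm (f (of_int_vec k + \<theta>)) powr p)"
    by (rule nn_integral_eq_integral[OF integral_unfold(4)[OF Lp_integrable[OF f]]]) simp
  then show ?thesis using integral_unfold(1)[OF Lp_integrable[OF f]] by simp
qed

text \<open>On the coset of \<open>\<theta>\<close> the function \<open>j \<mapsto> F f (y + j) \<theta>\<close> is the convolution of the sequence of values of \<open>f\<close> with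
  samples of \<open>\<kappa>\<close>; the bound for sequences is integrated over \<open>\<theta>\<close>.\<close>

lemma F_lattice_norm:
  assumes f: "f \<in> Lp lborel p"
  shows "(\<integral>\<^sup>+j. \<integral>\<^sup>+\<theta>. ennreal (norm (F f (y + of_int_vec j) \<theta>) powr p) \<partial>torus_measure \<partial>lattice)
    \<le> ennreal (c powr p * (LINT x|lborel. norm (f x) powr p))"
proof -
  have [measurable]: "f \<in> borel_measurable borel" using f by (rule Lp_borel)
  have "(\<integral>\<^sup>+j. \<integral>\<^sup>+\<theta>. ennreal (norm (F f (y + of_int_vec j) \<theta>) powr p) \<partial>torus_measure \<partial>lattice)
    = (\<integral>\<^sup>+\<theta>. \<integral>\<^sup>+j. ennreal (norm (F f (y + of_int_vec j) \<theta>) powr p) \<partial>lattice \<partial>torus_measure)"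
    by (rule nn_integral_lattice_swap[OF torus.sigma_finite_measure_axioms], rule measurable_torusI) measurable
  also have "\<dots> \<le> (\<integral>\<^sup>+\<theta>. ennreal (c powr p) * ennreal (LINT k|lattice. norm (f (of_int_vec k + \<theta>)) powr p) \<partial>torus_measure)"
  proof (rule nn_integral_mono_AE)
    show "AE \<theta> in torus_measure. (\<integral>\<^sup>+j. ennreal (norm (F f (y + of_int_vec j) \<theta>) powr p) \<partial>lattice)
      \<le> ennreal (c powr p) * ennreal (LINT k|lattice. norm (f (of_int_vec k + \<theta>)) powr p)"
      using AE_slices_Lp[OF f]
    proof eventually_elim
      case (elim \<theta>)
      have e: "y + of_int_vec j - \<theta> = y - \<theta> + of_int_vec j" for j by (simp add: algebra_simps)
      have "(\<integral>\<^sup>+j. ennreal (norm (F f (y + of_int_vec j) \<theta>) powr p) \<partial>lattice)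
         = ennreal (LINT j|lattice. norm (F f (y + of_int_vec j) \<theta>) powr p)"
        unfolding F_def e by (rule nn_integral_eq_integral[OF convolution(3)[OF elim]]) simp
      also have "\<dots> \<le> ennreal (c powr p * (LINT k|lattice. norm (f (of_int_vec k + \<theta>)) powr p))"
        unfolding F_def e by (rule ennreal_leI[OF convolution(4)[OF elim]])
      finally show ?case by (simp add: ennreal_mult)
    qed
  qed
  also have "\<dots> = ennreal (c powr p) * ennreal (LINT x|lborel. norm (f x) powr p)"
    unfolding nn_integral_powr_unfold[OF f, symmetric]
    by (rule nn_integral_cmult) (intro measurable_torusI, measurable)
  finally show ?thesis by (simp add: ennreal_mult)
qed

lemma F_Lp:
  assumes f: "f \<in> Lp lborel p"
  shows "F f y \<in> Lp torus_measure p"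
proof -
  have fm: "f \<in> borel_measurable borel" using f by (rule Lp_borel)
  have "(\<integral>\<^sup>+\<theta>. ennreal (norm (F f (y + of_int_vec 0) \<theta>) powr p) \<partial>torus_measure)
     \<le> (\<integral>\<^sup>+j. \<integral>\<^sup>+\<theta>. ennreal (norm (F f (y + of_int_vec j) \<theta>) powr p) \<partial>torus_measure \<partial>lattice)"
    by (rule nn_integral_ge_point) simp
  also have "\<dots> < \<infinity>" by (rule le_less_trans[OF F_lattice_norm[OF f]]) simp
  finally have "(\<integral>\<^sup>+\<theta>. ennreal (norm (norm (F f y \<theta>) powr p)) \<partial>torus_measure) < \<infinity>" by simp
  moreover have m: "F f y \<in> borel_measurable torus_measure" by (rule measurable_torusI[OF F_measurable[OF fm]])
  ultimately have "integrable torus_measure (\<lambda>\<theta>. norm (F f y \<theta>) powr p)" by (intro integrableI_bounded) measurable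
  then show ?thesis using m by (simp add: Lp_def)
qed

lemma F_linear:
  assumes f: "f \<in> Lp lborel p" and g: "g \<in> Lp lborel p"
  shows "AE \<theta> in torus_measure. F (\<lambda>x. a * f x + b * g x) y \<theta> = a * F f y \<theta> + b * F g y \<theta>"
  using AE_slices_Lp[OF f] AE_slices_Lp[OF g]
proof eventually_elim
  case (elim \<theta>)
  have "F (\<lambda>x. a * f x + b * g x) y \<theta> =
     (LINT k|lattice. a * (f (of_int_vec k + \<theta>) * \<kappa> (y - \<theta> - of_int_vec k)) + b * (g (of_int_vec k + \<theta>) * \<kappa> (y - \<theta> - of_int_vec k)))"
    unfolding F_def by (simp add: algebra_simps)
  then show ?case unfolding F_def using convolution(1)[OF elim(1), of "y - \<theta>"] convolution(1)[OF elim(2), of "y - \<theta>"] by simp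
qed

definition V :: "(real^'n \<Rightarrow> complex) \<Rightarrow> int^'n \<Rightarrow> real^'n \<Rightarrow> complex" where
  "V f m = S (F f ((1 / real q) *\<^sub>R of_int_vec m))"

lemma V_measurable: "f \<in> Lp lborel p \<Longrightarrow> V f m \<in> borel_measurable torus_measure"
  unfolding V_def by (intro S_measurable F_Lp)

lemma V_linear:
  assumes f: "f \<in> Lp lborel p" and g: "g \<in> Lp lborel p"
  shows "AE u in torus_measure. V (\<lambda>x. a * f x + b * g x) m u = a * V f m u + b * V g m u"
proof -
  have "AE u in torus_measure. V (\<lambda>x. a * f x + b * g x) m u = S (\<lambda>x. a * F f ((1 / real q) *\<^sub>R of_int_vec m) x + b * F g ((1 / real q) *\<^sub>R of_int_vec m) x) u"
    unfolding V_def by (intro S_cong F_Lp Lp_lincomb f g p_pos F_linear)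
  then show ?thesis
    using S_linear[OF F_Lp[OF f] F_Lp[OF g], of a "(1 / real q) *\<^sub>R of_int_vec m" b "(1 / real q) *\<^sub>R of_int_vec m"]
    unfolding V_def by eventually_elim simp
qed

text \<open>The operator with multiplier \<open>W\<close>. On the diagonal the periodic variable of \<open>S (F f y)\<close> is identified with the point
  \<open>x\<close> itself; the sampling kernel recovers the value at \<open>y = x\<close> from those at \<open>y = m / q\<close>.\<close>

definition TW :: "(real^'n \<Rightarrow> complex) \<Rightarrow> real^'n \<Rightarrow> complex" where
  "TW f x = (LINT m|lattice. kernel (real q *\<^sub>R x - of_int_vec m) * V f m (frac_vec x))"

lemma V_frac_measurable:
  "f \<in> Lp lborel p \<Longrightarrow> (\<lambda>x. V f m (frac_vec x)) \<in> borel_measurable borel"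
  by (rule measurable_compose[OF frac_vec_measurable_torus V_measurable])

lemma TW_measurable:
  assumes "f \<in> Lp lborel p" shows "TW f \<in> borel_measurable borel"
proof -
  note [measurable] = V_frac_measurable[OF assms]
  show ?thesis unfolding TW_def[abs_def] by measurable
qed

text \<open>The first factor bounds the kernel by \<open>decay\<close>; the second pays for the shift by \<open>q u\<close> with \<open>u\<close> in the cell.\<close>

definition kernel_const :: real where
  "kernel_const = 2 ^ CARD('n) * (2 * (1 + (real q)\<^sup>2)) ^ CARD('n)"

lemma kernel_const_pos: "kernel_const > 0"
  unfolding kernel_const_def by (intro mult_pos_pos zero_less_power) (auto intro: add_pos_nonneg)

lemma kernel_cell_bound:
  fixes u :: "real^'n"
  assumes "u \<in> cell"
  shows "norm (kernel (real q *\<^sub>R u - of_int_vec l)) \<le> kernel_const * decay (of_int_vec l)"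
proof -
  have "norm (kernel (real q *\<^sub>R u - of_int_vec l)) \<le> 2 ^ CARD('n) * decay (real q *\<^sub>R u - of_int_vec l)"
    by (rule norm_kernel)
  also have "\<dots> \<le> 2 ^ CARD('n) * ((2 * (1 + (real q)\<^sup>2)) ^ CARD('n) * decay (of_int_vec l))"
  proof (intro mult_left_mono decay_shift)
    fix i
    have "0 \<le> u $ i" "u $ i \<le> 1" using assms by (auto simp: cell_def less_imp_le)
    then show "\<bar>(real q *\<^sub>R u) $ i\<bar> \<le> real q" by (simp add: abs_mult mult_left_le)
  qed simp
  finally show ?thesis by (simp add: kernel_const_def mult_ac)
qed

text \<open>The midpoint of \<open>1/2\<close> and \<open>1 - 1/(2p)\<close>, an interval that is not empty because \<open>p > 1\<close>. Above the lower end the powers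
  of \<open>decay\<close> used as weights are summable; below the upper end so are the \<open>p\<close>-th powers of the quotients of \<open>decay\<close> by
  the weights.\<close>

definition weight_exp :: real where
  "weight_exp = 3 / 4 - 1 / (4 * p)"

definition weight_mass :: real where
  "weight_mass = (LINT l|(lattice :: (int^'n) measure). decay (of_int_vec l) powr weight_exp)"

definition weight :: "int^'n \<Rightarrow> real" where
  "weight l = decay (of_int_vec l) powr weight_exp / weight_mass"

definition tail_sum :: real where
  "tail_sum = (LINT l|(lattice :: (int^'n) measure). decay (of_int_vec l) powr ((1 - weight_exp) * p))"

lemma weight_exp_bounds: "weight_exp > 1 / 2" "(1 - weight_exp) * p > 1 / 2"
proof -
  have "1 / (4 * p) < 1 / 4" using p_gt_1 by (simp add: field_simps)
  then show "weight_exp > 1 / 2" by (simp add: weight_exp_def)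
  have "(1 - weight_exp) * p = (p + 1) / 4" using p_gt_1 by (simp add: weight_exp_def field_simps)
  then show "(1 - weight_exp) * p > 1 / 2" using p_gt_1 by simp
qed

lemma weight_mass_pos: "weight_mass > 0"
proof -
  have "0 < sum (\<lambda>l. decay (of_int_vec l) powr weight_exp) {0 :: int^'n}"
    using less_imp_neq[OF decay_pos[of "0 :: real^'n"]] by simp
  also have "\<dots> \<le> weight_mass"
    unfolding weight_mass_def by (rule finite_sum_le_lattice_integral[OF integrable_decay_powr[OF weight_exp_bounds(1)]]) auto
  finally show ?thesis .
qed

lemma weight_props: "weight l > 0" "integrable lattice weight" "(LINT l|lattice. weight l) = 1"
proof -
  show "weight l > 0" unfolding weight_def by (intro divide_pos_pos weight_mass_pos) (simp add: less_imp_neq[OF decay_pos, symmetric])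
  show "integrable lattice weight" unfolding weight_def[abs_def] by (intro integrable_divide integrable_decay_powr weight_exp_bounds)
  show "(LINT l|lattice. weight l) = 1" unfolding weight_def using weight_mass_pos by (simp add: weight_mass_def)
qed

lemma tail_sum_nonneg: "tail_sum \<ge> 0"
  by (simp add: tail_sum_def)

text \<open>The event on which every term of the series for \<open>TW f x\<close>, rewritten with \<open>m = l + q \<lfloor>x\<rfloor>\<close>, is at most \<open>t\<close> times the
  weight. As the weights have sum 1, the whole series is then at most \<open>t\<close>. This takes the place of the triangle
  inequality, as the quantity that defines weak \<open>L\<^sup>p\<close> is not subadditive.\<close>

definition dominated :: "(real^'n \<Rightarrow> complex) \<Rightarrow> real \<Rightarrow> real^'n \<Rightarrow> bool" where
  "dominated f t x \<longleftrightarrow> (\<forall>l. kernel_const * decay (of_int_vec l) * norm (V f (l + of_nat q * floor_vec x) (frac_vec x)) \<le> t * weight l)"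

lemma of_int_vec_q: "of_int_vec (of_nat q * j) = real q *\<^sub>R of_int_vec j"
  by (simp add: vec_eq_iff of_nat_index)

lemma TW_shift:
  "TW f x = (LINT l|lattice. kernel (real q *\<^sub>R frac_vec x - of_int_vec l) * V f (l + of_nat q * floor_vec x) (frac_vec x))"
  "integrable lattice (\<lambda>m. kernel (real q *\<^sub>R x - of_int_vec m) * V f m (frac_vec x)) \<longleftrightarrow>
   integrable lattice (\<lambda>l. kernel (real q *\<^sub>R frac_vec x - of_int_vec l) * V f (l + of_nat q * floor_vec x) (frac_vec x))"
proof -
  define a where "a = of_nat q * floor_vec x"
  have b: "bij_betw (\<lambda>l. a + l) UNIV UNIV" by (rule bij_lattice_shift)
  have e: "kernel (real q *\<^sub>R x - of_int_vec (a + l)) * V f (a + l) (frac_vec x) =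
     kernel (real q *\<^sub>R frac_vec x - of_int_vec l) * V f (l + of_nat q * floor_vec x) (frac_vec x)" for l
  proof -
    have "real q *\<^sub>R x = real q *\<^sub>R of_int_vec (floor_vec x) + real q *\<^sub>R frac_vec x"
      using floor_plus_frac[of x] by (metis scaleR_add_right)
    then have "real q *\<^sub>R x - of_int_vec (a + l) = real q *\<^sub>R frac_vec x - of_int_vec l"
      unfolding a_def of_int_vec_simps(2) of_int_vec_q by simp
    then show ?thesis by (simp only: a_def add.commute)
  qed
  show "TW f x = (LINT l|lattice. kernel (real q *\<^sub>R frac_vec x - of_int_vec l) * V f (l + of_nat q * floor_vec x) (frac_vec x))"
    unfolding TW_def
    using integral_bij_count_space[OF b, of "\<lambda>m. kernel (real q *\<^sub>R x - of_int_vec m) * V f m (frac_vec x)"]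
    unfolding e by simp
  show "integrable lattice (\<lambda>m. kernel (real q *\<^sub>R x - of_int_vec m) * V f m (frac_vec x)) \<longleftrightarrow>
   integrable lattice (\<lambda>l. kernel (real q *\<^sub>R frac_vec x - of_int_vec l) * V f (l + of_nat q * floor_vec x) (frac_vec x))"
    using integrable_bij_count_space[OF b, of "\<lambda>m. kernel (real q *\<^sub>R x - of_int_vec m) * V f m (frac_vec x)"]
    unfolding e by simp
qed

lemma dominated_imp:
  assumes "dominated f t x" "t \<ge> 0"
  shows "integrable lattice (\<lambda>m. kernel (real q *\<^sub>R x - of_int_vec m) * V f m (frac_vec x))" "norm (TW f x) \<le> t"
proof -
  have le: "norm (kernel (real q *\<^sub>R frac_vec x - of_int_vec l) * V f (l + of_nat q * floor_vec x) (frac_vec x)) \<le> t * weight l" for l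
  proof -
    have "norm (kernel (real q *\<^sub>R frac_vec x - of_int_vec l) * V f (l + of_nat q * floor_vec x) (frac_vec x))
       \<le> kernel_const * decay (of_int_vec l) * norm (V f (l + of_nat q * floor_vec x) (frac_vec x))"
      unfolding norm_mult by (intro mult_right_mono kernel_cell_bound frac_vec_in_cell) simp
    also have "\<dots> \<le> t * weight l" using assms(1) by (simp add: dominated_def)
    finally show ?thesis .
  qed
  have tw: "integrable lattice (\<lambda>l. t * weight l)" using weight_props(2) by simp
  have i: "integrable lattice (\<lambda>l. kernel (real q *\<^sub>R frac_vec x - of_int_vec l) * V f (l + of_nat q * floor_vec x) (frac_vec x))"
    by (rule Bochner_Integration.integrable_bound[OF tw])
       (use le assms(2) weight_props(1) in \<open>auto intro!: AE_I2 order_trans[OF le] simp: abs_mult less_imp_le\<close>)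
  then show "integrable lattice (\<lambda>m. kernel (real q *\<^sub>R x - of_int_vec m) * V f m (frac_vec x))" by (simp add: TW_shift(2))
  have "norm (TW f x) \<le> (LINT l|lattice. norm (kernel (real q *\<^sub>R frac_vec x - of_int_vec l) * V f (l + of_nat q * floor_vec x) (frac_vec x)))"
    unfolding TW_shift(1) by (rule integral_norm_bound)
  also have "\<dots> \<le> (LINT l|lattice. t * weight l)"
    using i tw by (intro integral_mono le) auto
  finally show "norm (TW f x) \<le> t" using weight_props(3) by simp
qed

text \<open>The factor of the weak-type bound that depends only on the dimension, \<open>p\<close> and \<open>q\<close>.\<close>

definition weak_const :: real where
  "weak_const = kernel_const * weight_mass * tail_sum powr (1 / p)"

lemma weak_const_nonneg: "weak_const \<ge> 0"
  unfolding weak_const_def using kernel_const_pos weight_mass_pos by simp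

text \<open>The exceptional set is a union over \<open>j\<close> and \<open>l\<close> of sets to which the weak type of \<open>S\<close> applies. For fixed \<open>l\<close> the sum over \<open>j\<close>
  is \<^verbatim>\<open>F_lattice_norm\<close>, and what remains is a convergent sum over \<open>l\<close>.\<close>

lemma not_dominated_measure:
  assumes f: "f \<in> Lp lborel p" and t: "t > 0"
  shows "{x. \<not> dominated f t x} \<in> sets borel"
    "emeasure lborel {x. \<not> dominated f t x} \<le> ennreal ((weak_const * c * K) powr p / t powr p * (LINT x|lborel. norm (f x) powr p))"
proof -
  define I where "I = (LINT x|lborel. norm (f x) powr p)"
  have I0: "I \<ge> 0" by (simp add: I_def)
  (* the size of \<open>V\<close> at which the term of index \<open>l\<close> exceeds its share of \<open>t\<close> *)
  define r where "r l = t * weight l / (kernel_const * decay (of_int_vec l))" for l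
  have r: "r l > 0" for l unfolding r_def by (intro divide_pos_pos mult_pos_pos t weight_props(1) kernel_const_pos decay_pos)
  have rle: "kernel_const * decay (of_int_vec l) * z \<le> t * weight l \<longleftrightarrow> z \<le> r l" for l z
    unfolding r_def using mult_pos_pos[OF kernel_const_pos decay_pos[of "of_int_vec l"]] by (simp add: pos_le_divide_eq mult.commute)
  have gu: "dominated f t x \<longleftrightarrow> (\<forall>l. norm (V f (l + of_nat q * floor_vec x) (frac_vec x)) \<le> r l)" for x
    by (simp add: dominated_def rle)
  have gu': "dominated f t x \<longleftrightarrow> (\<forall>j l. floor_vec x = j \<longrightarrow> norm (V f (l + of_nat q * j) (frac_vec x)) \<le> r l)" for x
    by (simp add: gu)
  show gm: "{x. \<not> dominated f t x} \<in> sets borel"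
  proof -
    note [measurable] = V_frac_measurable[OF f]
    have [measurable]: "(\<lambda>x. of_int_vec (floor_vec x)) \<in> borel_measurable (borel :: (real^'n) measure)" by (rule floor_vec_measurable)
    have fl: "floor_vec x = j \<longleftrightarrow> of_int_vec (floor_vec x) = (of_int_vec j :: real^'n)" for x :: "real^'n" and j
      by (auto simp: vec_eq_iff)
    have "Measurable.pred borel (dominated f t)" unfolding gu'[abs_def] fl by measurable
    then have "{x. dominated f t x} \<in> sets borel" by (simp add: pred_def)
    moreover have "{x. \<not> dominated f t x} = - {x. dominated f t x}" by auto
    ultimately show ?thesis using borel_comp by metis
  qed
  define A where "A j l = {u \<in> cell. norm (V f (l + of_nat q * j) u) > r l}" for j l
  have Am: "A j l \<in> sets torus_measure" for j l
  proof -
    note [measurable] = V_measurable[OF f]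
    have "{u \<in> space torus_measure. norm (V f (l + of_nat q * j) u) > r l} \<in> sets torus_measure" by measurable
    then show ?thesis by (simp add: A_def)
  qed
  have "emeasure lborel {x. \<not> dominated f t x} = (\<integral>\<^sup>+x. indicator {x. \<not> dominated f t x} x \<partial>lborel)"
    using gm by simp
  also have "\<dots> = (\<integral>\<^sup>+j. \<integral>\<^sup>+u. indicator {x. \<not> dominated f t x} (of_int_vec j + u) \<partial>torus_measure \<partial>lattice)"
    using gm by (intro nn_integral_unfold) simp
  also have "\<dots> \<le> (\<integral>\<^sup>+j. \<integral>\<^sup>+u. \<integral>\<^sup>+l. indicator (A j l) u \<partial>lattice \<partial>torus_measure \<partial>lattice)"
  proof (intro nn_integral_mono)
    fix j and u :: "real^'n" assume u: "u \<in> space torus_measure"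
    show "indicator {x. \<not> dominated f t x} (of_int_vec j + u) \<le> (\<integral>\<^sup>+l. indicator (A j l) u \<partial>lattice :: ennreal)"
    proof (cases "dominated f t (of_int_vec j + u)")
      case False
      then obtain l where "u \<in> A j l" using u by (auto simp: gu floor_frac_unique A_def not_le)
      then have "1 \<le> (indicator (A j l) u :: ennreal)" by simp
      also have "\<dots> \<le> (\<integral>\<^sup>+l. indicator (A j l) u \<partial>lattice)" by (rule nn_integral_ge_point) simp
      finally show ?thesis using False by simp
    qed simp
  qed
  also have "\<dots> = (\<integral>\<^sup>+j. \<integral>\<^sup>+l. emeasure torus_measure (A j l) \<partial>lattice \<partial>lattice)"
  proof (intro nn_integral_cong)
    fix j
    have "(\<integral>\<^sup>+u. \<integral>\<^sup>+l. indicator (A j l) u \<partial>lattice \<partial>torus_measure) = (\<integral>\<^sup>+l. \<integral>\<^sup>+u. indicator (A j l) u \<partial>torus_measure \<partial>(lattice :: (int^'n) measure) :: ennreal)"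
      by (rule nn_integral_lattice_swap[OF torus.sigma_finite_measure_axioms, symmetric]) (use Am in auto)
    then show "(\<integral>\<^sup>+u. \<integral>\<^sup>+l. indicator (A j l) u \<partial>lattice \<partial>torus_measure) = (\<integral>\<^sup>+l. emeasure torus_measure (A j l) \<partial>lattice)"
      using Am by simp
  qed
  also have "\<dots> = (\<integral>\<^sup>+l. \<integral>\<^sup>+j. emeasure torus_measure (A j l) \<partial>lattice \<partial>lattice)"
    by (rule nn_integral_lattice_swap[OF lattice.sigma_finite_measure_axioms]) simp
  also have "\<dots> \<le> (\<integral>\<^sup>+l. ennreal (K powr p / r l powr p) * ennreal (c powr p * I) \<partial>lattice)"
  proof (rule nn_integral_mono)
    fix l :: "int^'n"
    have eq: "(1 / real q) *\<^sub>R of_int_vec (l + of_nat q * j) = (1 / real q) *\<^sub>R of_int_vec l + of_int_vec j" for j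
      using q_pos by (simp add: of_int_vec_q scaleR_add_right)
    have "emeasure torus_measure (A j l) \<le> ennreal (K powr p / r l powr p) *
        (\<integral>\<^sup>+\<theta>. ennreal (norm (F f ((1 / real q) *\<^sub>R of_int_vec l + of_int_vec j) \<theta>) powr p) \<partial>torus_measure)" for j
    proof -
      have L: "F f ((1 / real q) *\<^sub>R of_int_vec l + of_int_vec j) \<in> Lp torus_measure p" by (rule F_Lp[OF f])
      have "emeasure torus_measure (A j l) \<le> ennreal (K powr p / r l powr p * (LINT \<theta>|torus_measure. norm (F f ((1 / real q) *\<^sub>R of_int_vec l + of_int_vec j) \<theta>) powr p))"
        unfolding A_def V_def eq by (rule S_weak[OF L r])
      also have "\<dots> = ennreal (K powr p / r l powr p) * ennreal (LINT \<theta>|torus_measure. norm (F f ((1 / real q) *\<^sub>R of_int_vec l + of_int_vec j) \<theta>) powr p)"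
        by (rule ennreal_mult) auto
      also have "ennreal (LINT \<theta>|torus_measure. norm (F f ((1 / real q) *\<^sub>R of_int_vec l + of_int_vec j) \<theta>) powr p)
        = (\<integral>\<^sup>+\<theta>. ennreal (norm (F f ((1 / real q) *\<^sub>R of_int_vec l + of_int_vec j) \<theta>) powr p) \<partial>torus_measure)"
        by (rule nn_integral_eq_integral[OF Lp_integrable[OF L], symmetric]) simp
      finally show ?thesis .
    qed
    then have "(\<integral>\<^sup>+j. emeasure torus_measure (A j l) \<partial>lattice) \<le> (\<integral>\<^sup>+j. ennreal (K powr p / r l powr p) *
        (\<integral>\<^sup>+\<theta>. ennreal (norm (F f ((1 / real q) *\<^sub>R of_int_vec l + of_int_vec j) \<theta>) powr p) \<partial>torus_measure) \<partial>lattice)"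
      by (intro nn_integral_mono)
    also have "\<dots> = ennreal (K powr p / r l powr p) * (\<integral>\<^sup>+j. \<integral>\<^sup>+\<theta>. ennreal (norm (F f ((1 / real q) *\<^sub>R of_int_vec l + of_int_vec j) \<theta>) powr p) \<partial>torus_measure \<partial>lattice)"
      by (rule nn_integral_cmult) simp
    also have "\<dots> \<le> ennreal (K powr p / r l powr p) * ennreal (c powr p * I)"
      unfolding I_def by (intro mult_left_mono F_lattice_norm[OF f]) simp
    finally show "(\<integral>\<^sup>+j. emeasure torus_measure (A j l) \<partial>lattice) \<le> ennreal (K powr p / r l powr p) * ennreal (c powr p * I)" .
  qed
  also have "\<dots> = (\<integral>\<^sup>+l. ennreal ((kernel_const * weight_mass * c * K) powr p / t powr p * I * decay (of_int_vec l) powr ((1 - weight_exp) * p)) \<partial>(lattice :: (int^'n) measure))"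
  proof (intro nn_integral_cong)
    fix l :: "int^'n"
    define d where "d = decay (of_int_vec l)"
    have d: "d > 0" by (simp add: d_def decay_pos)
    have "r l = t / (kernel_const * weight_mass * d powr (1 - weight_exp))"
      using d kernel_const_pos weight_mass_pos by (simp add: r_def weight_def d_def[symmetric] powr_diff field_simps)
    then have "r l powr p = t powr p / ((kernel_const * weight_mass) powr p * d powr ((1 - weight_exp) * p))"
      using t kernel_const_pos weight_mass_pos d by (simp add: powr_divide powr_mult powr_powr)
    then have "K powr p / r l powr p * (c powr p * I) = (kernel_const * weight_mass * c * K) powr p / t powr p * I * d powr ((1 - weight_exp) * p)"
      using kernel_const_pos weight_mass_pos c_nonneg K_nonneg by (simp add: powr_mult)
    then show "ennreal (K powr p / r l powr p) * ennreal (c powr p * I) = ennreal ((kernel_const * weight_mass * c * K) powr p / t powr p * I * decay (of_int_vec l) powr ((1 - weight_exp) * p))"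
      using I0 by (simp add: d_def flip: ennreal_mult)
  qed
  also have "\<dots> = ennreal ((kernel_const * weight_mass * c * K) powr p / t powr p * I * tail_sum)"
    using integrable_decay_powr[OF weight_exp_bounds(2), where 'n = 'n] I0
    by (subst nn_integral_eq_integral) (auto simp: tail_sum_def)
  also have "(kernel_const * weight_mass * c * K) powr p / t powr p * I * tail_sum = (weak_const * c * K) powr p / t powr p * I"
    using kernel_const_pos weight_mass_pos c_nonneg K_nonneg tail_sum_nonneg p_pos by (simp add: weak_const_def powr_mult powr_powr)
  finally show "emeasure lborel {x. \<not> dominated f t x} \<le> ennreal ((weak_const * c * K) powr p / t powr p * (LINT x|lborel. norm (f x) powr p))"
    by (simp add: I_def)
qed

lemma TW_weak:
  assumes f: "f \<in> Lp lborel p" and t: "t > 0"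
  shows "emeasure lborel {x. norm (TW f x) > t} \<le> ennreal ((weak_const * c * K) powr p / t powr p * (LINT x|lborel. norm (f x) powr p))"
proof -
  have "{x. norm (TW f x) > t} \<subseteq> {x. \<not> dominated f t x}"
    using dominated_imp(2)[of f t] t by force
  then have "emeasure lborel {x. norm (TW f x) > t} \<le> emeasure lborel {x. \<not> dominated f t x}"
    using not_dominated_measure(1)[OF f t] by (intro emeasure_mono) auto
  also note not_dominated_measure(2)[OF f t]
  finally show ?thesis .
qed

text \<open>Almost every point is dominated for some \<open>t\<close>, since the exceptional sets shrink to a null set as \<open>t\<close> grows.\<close>

lemma AE_TW_integrable:
  assumes f: "f \<in> Lp lborel p"
  shows "AE x in lborel. integrable lattice (\<lambda>m. kernel (real q *\<^sub>R x - of_int_vec m) * V f m (frac_vec x))"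
proof -
  define C where "C = (weak_const * c * K) powr p * (LINT x|lborel. norm (f x) powr p)"
  define N where "N = (\<Inter>n::nat. {x. \<not> dominated f (real (Suc n)) x})"
  have Nm: "N \<in> sets lborel" unfolding N_def using not_dominated_measure(1)[OF f] by (intro sets.countable_INT) auto
  have le: "emeasure lborel N \<le> ennreal (C / real (Suc n) powr p)" for n
  proof -
    have "emeasure lborel N \<le> emeasure lborel {x. \<not> dominated f (real (Suc n)) x}"
      using not_dominated_measure(1)[OF f, of "real (Suc n)"] by (intro emeasure_mono) (auto simp: N_def)
    also have "\<dots> \<le> ennreal (C / real (Suc n) powr p)" using not_dominated_measure(2)[OF f, of "real (Suc n)"] by (simp add: C_def)
    finally show ?thesis .
  qed
  have "(\<lambda>n. C * real (Suc n) powr (- p)) \<longlonglongrightarrow> C * 0"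
    using p_pos by (intro tendsto_mult tendsto_const tendsto_neg_powr filterlim_compose[OF filterlim_real_sequentially filterlim_Suc]) auto
  then have "(\<lambda>n. C / real (Suc n) powr p) \<longlonglongrightarrow> 0"
    by (simp add: powr_minus_divide)
  then have "(\<lambda>n. ennreal (C / real (Suc n) powr p)) \<longlonglongrightarrow> ennreal 0" by (rule tendsto_ennrealI)
  then have "emeasure lborel N \<le> ennreal 0" using le by (intro LIMSEQ_le_const) auto
  then have "N \<in> null_sets lborel" using Nm by auto
  then have "AE x in lborel. x \<notin> N" by (rule AE_not_in)
  then show ?thesis
  proof eventually_elim
    case (elim x)
    then obtain n where "dominated f (real (Suc n)) x" by (auto simp: N_def)
    then show ?case by (rule dominated_imp(1)) simp
  qed
qed

lemma TW_linear:
  assumes f: "f \<in> Lp lborel p" and g: "g \<in> Lp lborel p"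
  shows "AE x in lborel. TW (\<lambda>x. a * f x + b * g x) x = a * TW f x + b * TW g x"
proof -
  have "AE x in lborel. \<forall>m. V (\<lambda>x. a * f x + b * g x) m (frac_vec x) = a * V f m (frac_vec x) + b * V g m (frac_vec x)"
  proof (rule AE_foldI)
    have "AE u in torus_measure. \<forall>m. V (\<lambda>x. a * f x + b * g x) m u = a * V f m u + b * V g m u"
      unfolding AE_all_countable using V_linear[OF f g] by blast
    moreover have "AE u in (torus_measure :: (real^'n) measure). u \<in> cell" using AE_space[of torus_measure] by simp
    ultimately show "AE u in torus_measure. \<forall>k m. V (\<lambda>x. a * f x + b * g x) m (frac_vec (of_int_vec k + u)) =
        a * V f m (frac_vec (of_int_vec k + u)) + b * V g m (frac_vec (of_int_vec k + u))"
      by eventually_elim (simp add: floor_frac_unique)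
  qed
  then show ?thesis using AE_TW_integrable[OF f] AE_TW_integrable[OF g]
  proof eventually_elim
    case (elim x)
    have "TW (\<lambda>x. a * f x + b * g x) x = (LINT m|lattice. a * (kernel (real q *\<^sub>R x - of_int_vec m) * V f m (frac_vec x))
        + b * (kernel (real q *\<^sub>R x - of_int_vec m) * V g m (frac_vec x)))"
      unfolding TW_def using elim(1) by (simp add: algebra_simps)
    then show ?case unfolding TW_def using elim(2,3) by simp
  qed
qed

end

section \<open>The multiplier of the transferred operator\<close>

lemma Lp_2_translate:
  fixes f :: "real^'n \<Rightarrow> complex"
  assumes "f \<in> Lp lborel 2"
  shows "(\<lambda>x. f (x - y)) \<in> Lp lborel 2"
    "(LINT x|lborel. (norm (f (x - y)))\<^sup>2) = (LINT x|lborel. (norm (f x))\<^sup>2)"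
proof -
  have [measurable]: "f \<in> borel_measurable borel" using Lp_measurable[OF assms] by simp
  show "(\<lambda>x. f (x - y)) \<in> Lp lborel 2"
    "(LINT x|lborel. (norm (f (x - y)))\<^sup>2) = (LINT x|lborel. (norm (f x))\<^sup>2)"
    using integral_translate[of "\<lambda>x. (norm (f x))\<^sup>2" y] assms by (simp_all add: Lp_2_iff)
qed

text \<open>The translation is moved to the test function, where the transform is an integral.\<close>

lemma plancherel_R_translate:
  fixes f h :: "real^'n \<Rightarrow> complex"
  assumes P: "plancherel_R f h"
  shows "plancherel_R (\<lambda>x. f (x - y)) (\<lambda>\<xi>. ee (- (\<xi> \<bullet> y)) * h \<xi>)"
proof (rule plancherel_R_from_pairing)
  have L: "f \<in> Lp lborel 2" "h \<in> Lp lborel 2" using P by (auto simp: plancherel_R_def)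
  have [measurable]: "f \<in> borel_measurable borel" "h \<in> borel_measurable borel" using L[THEN Lp_measurable] by auto
  show "(\<lambda>x. f (x - y)) \<in> borel_measurable borel" by measurable
  show "(\<lambda>\<xi>. ee (- (\<xi> \<bullet> y)) * h \<xi>) \<in> Lp lborel 2"
    by (rule Lp_bounded_by[OF L(2)]) (auto simp: norm_mult)
  fix w :: "real^'n \<Rightarrow> complex" assume w: "L2c w"
  have [measurable]: "w \<in> borel_measurable borel" using w by (rule L2c_measurable)
  have n: "L2c (\<lambda>x. w (x + y))"
  proof -
    obtain R where R: "\<And>x. norm x > R \<Longrightarrow> w x = 0" using w by (auto simp: L2c_def)
    have "w (x + y) = 0" if "norm x > R + norm y" for x
    proof (rule R)
      have "norm x \<le> norm (x + y) + norm y" using norm_triangle_ineq4[of "x + y" y] by simp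
      then show "norm (x + y) > R" using that by simp
    qed
    moreover have "(\<lambda>x. w (x + y)) \<in> Lp lborel 2" using Lp_2_translate(1)[OF L2c_Lp[OF w], of "- y"] by simp
    ultimately show ?thesis unfolding L2c_def by blast
  qed
  have F: "fourier_R (\<lambda>x. w (x + y)) \<xi> = ee (\<xi> \<bullet> y) * fourier_R w \<xi>" for \<xi>
  proof -
    have "fourier_R (\<lambda>x. w (x + y)) \<xi> = (LINT x|lborel. w (x - y + y) * ee (- (\<xi> \<bullet> (x - y))))"
      unfolding fourier_R_eq by (rule integral_translate(1)[symmetric]) measurable
    also have "\<dots> = (LINT x|lborel. ee (\<xi> \<bullet> y) * (w x * ee (- (\<xi> \<bullet> x))))"
      by (intro Bochner_Integration.integral_cong refl) (simp add: inner_diff_right mult.left_commute flip: ee_add)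
    finally show ?thesis unfolding fourier_R_eq by simp
  qed
  have "(LINT x|lborel. f (x - y) * cnj (w x)) = (LINT x|lborel. f x * cnj (w (x + y)))"
    using integral_translate(1)[of "\<lambda>x. f x * cnj (w (x + y))" y] by simp
  also have "\<dots> = (LINT \<xi>|lborel. h \<xi> * cnj (fourier_R (\<lambda>x. w (x + y)) \<xi>))"
    by (rule plancherel_pairing[OF P n])
  also have "\<dots> = (LINT \<xi>|lborel. ee (- (\<xi> \<bullet> y)) * h \<xi> * cnj (fourier_R w \<xi>))"
    unfolding F by (simp add: mult_ac)
  finally show "(LINT x|lborel. f (x - y) * cnj (w x)) = (LINT \<xi>|lborel. ee (- (\<xi> \<bullet> y)) * h \<xi> * cnj (fourier_R w \<xi>))" .
qed

lemma nn_integral_L2_product: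
  assumes "f \<in> Lp M 2" "g \<in> Lp M 2"
  shows "(\<integral>\<^sup>+x. ennreal (norm (f x) * norm (g x)) \<partial>M) \<le>
    ennreal (sqrt (LINT x|M. (norm (f x))\<^sup>2) * sqrt (LINT x|M. (norm (g x))\<^sup>2))"
proof -
  have "(\<integral>\<^sup>+x. ennreal (norm (f x) * norm (g x)) \<partial>M) = ennreal (LINT x|M. norm (f x) * norm (g x))"
    by (rule nn_integral_eq_integral[OF Lp_2_mult_integrable(1)[OF assms]]) simp
  then show ?thesis using Cauchy_Schwarz_norm_integral[OF assms] by (simp add: ennreal_leI)
qed

context transference
begin

text \<open>The Cauchy-Schwarz inequality on each coset, with the uniform square summability of the samples of \<open>\<kappa>\<close>.\<close>

lemma F_L2: "\<exists>C\<ge>0. \<forall>f y. f \<in> Lp lborel 2 \<longrightarrow> F f y \<in> Lp torus_measure 2 \<and>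
   (LINT \<theta>|torus_measure. (norm (F f y \<theta>))\<^sup>2) \<le> C * (LINT x|lborel. (norm (f x))\<^sup>2)"
proof -
  obtain C where C: "C \<ge> 0" "\<And>z. integrable lattice (\<lambda>k. (norm (\<kappa> (z - of_int_vec k)))\<^sup>2)"
    "\<And>z. (LINT k|lattice. (norm (\<kappa> (z - of_int_vec k)))\<^sup>2) \<le> C" using \<kappa>_square_summable by blast
  have "F f y \<in> Lp torus_measure 2 \<and> (LINT \<theta>|torus_measure. (norm (F f y \<theta>))\<^sup>2) \<le> C * (LINT x|lborel. (norm (f x))\<^sup>2)"
    if f: "f \<in> Lp lborel 2" for f y
  proof -
    have fm: "f \<in> borel_measurable borel" using f by (rule Lp_borel)
    have fi: "integrable lborel (\<lambda>x. (norm (f x))\<^sup>2)" using f by (simp add: Lp_2_iff)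
    define N where "N \<theta> = (LINT k|lattice. (norm (f (of_int_vec k + \<theta>)))\<^sup>2)" for \<theta>
    have Ni: "integrable torus_measure N" "(LINT \<theta>|torus_measure. N \<theta>) = (LINT x|lborel. (norm (f x))\<^sup>2)"
      unfolding N_def[abs_def] using integral_unfold(4)[OF fi] integral_unfold(1)[OF fi] by simp_all
    have le: "AE \<theta> in torus_measure. (norm (F f y \<theta>))\<^sup>2 \<le> C * N \<theta>"
      using integral_unfold(3)[OF fi]
    proof eventually_elim
      case (elim \<theta>)
      have 1: "(\<lambda>k. f (of_int_vec k + \<theta>)) \<in> Lp lattice 2" using elim by (simp add: Lp_2_iff)
      have 2: "(\<lambda>k. \<kappa> (y - \<theta> - of_int_vec k)) \<in> Lp lattice 2" using C(2) by (simp add: Lp_2_iff)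
      have N0: "N \<theta> \<ge> 0" by (simp add: N_def)
      have "norm (F f y \<theta>) \<le> (LINT k|lattice. norm (f (of_int_vec k + \<theta>) * \<kappa> (y - \<theta> - of_int_vec k)))"
        unfolding F_def by (rule integral_norm_bound)
      also have "\<dots> \<le> sqrt (N \<theta>) * sqrt (LINT k|lattice. (norm (\<kappa> (y - \<theta> - of_int_vec k)))\<^sup>2)"
        using Cauchy_Schwarz_norm_integral[OF 1 2] by (simp add: norm_mult N_def)
      also have "\<dots> \<le> sqrt (N \<theta>) * sqrt C" using C(3) N0 by (intro mult_left_mono) auto
      finally have "(norm (F f y \<theta>))\<^sup>2 \<le> (sqrt (N \<theta>) * sqrt C)\<^sup>2" by (intro power_mono) auto
      also have "\<dots> = C * N \<theta>" using N0 C(1) by (simp add: power_mult_distrib mult.commute)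
      finally show ?case .
    qed
    have Fm: "F f y \<in> borel_measurable torus_measure" by (rule measurable_torusI[OF F_measurable[OF fm]])
    have i: "integrable torus_measure (\<lambda>\<theta>. (norm (F f y \<theta>))\<^sup>2)"
    proof (rule Bochner_Integration.integrable_bound)
      show "integrable torus_measure (\<lambda>\<theta>. C * N \<theta>)" using Ni(1) by simp
      show "AE \<theta> in torus_measure. norm ((norm (F f y \<theta>))\<^sup>2) \<le> norm (C * N \<theta>)"
        using le by eventually_elim auto
    qed (use Fm in measurable)
    have "(LINT \<theta>|torus_measure. (norm (F f y \<theta>))\<^sup>2) \<le> (LINT \<theta>|torus_measure. C * N \<theta>)"
      using i Ni(1) le by (intro integral_mono_AE) auto
    then show ?thesis using i Fm Ni(2) by (simp add: Lp_2_iff)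
  qed
  then show ?thesis using C(1) by blast
qed

text \<open>Hoelder's inequality would need \<open>\<kappa>\<close> in the dual Lebesgue space. The bound for sequences gives absolute convergence
  on each coset, and the resulting bound is integrable over the cosets.\<close>

lemma f_\<kappa>_integrable:
  assumes f: "f \<in> Lp lborel p"
  shows "integrable lborel (\<lambda>x. f x * \<kappa> (y - x))"
proof (rule integrableI_bounded)
  have [measurable]: "f \<in> borel_measurable borel" using f by (rule Lp_borel)
  show "(\<lambda>x. f x * \<kappa> (y - x)) \<in> borel_measurable lborel" by measurable
  define N where "N \<theta> = (LINT k|lattice. norm (f (of_int_vec k + \<theta>)) powr p)" for \<theta>
  have Ni: "integrable torus_measure N" unfolding N_def[abs_def] by (rule integral_unfold(4)[OF Lp_integrable[OF f]])
  have e: "y - (of_int_vec k + u) = y - u - of_int_vec k" for k u by (simp add: algebra_simps)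
  have "(\<integral>\<^sup>+x. ennreal (norm (f x * \<kappa> (y - x))) \<partial>lborel) =
      (\<integral>\<^sup>+k. \<integral>\<^sup>+u. ennreal (norm (f (of_int_vec k + u) * \<kappa> (y - (of_int_vec k + u)))) \<partial>torus_measure \<partial>lattice)"
    by (rule nn_integral_unfold) measurable
  also have "\<dots> = (\<integral>\<^sup>+u. \<integral>\<^sup>+k. ennreal (norm (f (of_int_vec k + u) * \<kappa> (y - (of_int_vec k + u)))) \<partial>lattice \<partial>torus_measure)"
    by (rule nn_integral_lattice_swap[OF torus.sigma_finite_measure_axioms], rule measurable_torusI) measurable
  (* the bound for sequences involves \<open>N u powr (1 / p)\<close>, which is at most \<open>1 + N u\<close>, and \<open>N\<close> is integrable *)
  also have "\<dots> \<le> (\<integral>\<^sup>+u. ennreal (c * (1 + N u)) \<partial>torus_measure)"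
  proof (rule nn_integral_mono_AE)
    show "AE u in torus_measure. (\<integral>\<^sup>+k. ennreal (norm (f (of_int_vec k + u) * \<kappa> (y - (of_int_vec k + u)))) \<partial>lattice) \<le> ennreal (c * (1 + N u))"
      using AE_slices_Lp[OF f]
    proof eventually_elim
      case (elim u)
      have N0: "N u \<ge> 0" by (simp add: N_def)
      have "(\<integral>\<^sup>+k. ennreal (norm (f (of_int_vec k + u) * \<kappa> (y - (of_int_vec k + u)))) \<partial>lattice)
        = ennreal (LINT k|lattice. norm (f (of_int_vec k + u) * \<kappa> (y - u - of_int_vec k)))"
        unfolding e by (rule nn_integral_eq_integral[OF integrable_norm[OF convolution(1)[OF elim]]]) simp
      also have "\<dots> \<le> ennreal (c * N u powr (1 / p))"
        unfolding N_def by (rule ennreal_leI[OF convolution(2)[OF elim]])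
      also have "\<dots> \<le> ennreal (c * (1 + N u))"
      proof (intro ennreal_leI mult_left_mono c_nonneg)
        show "N u powr (1 / p) \<le> 1 + N u"
        proof (cases "N u \<le> 1")
          case True
          then have "N u powr (1 / p) \<le> 1 powr (1 / p)" using N0 p_pos by (intro powr_mono2) auto
          then show ?thesis using N0 by simp
        next
          case False
          then have "N u powr (1 / p) \<le> N u powr 1" using p_gt_1 by (intro powr_mono) auto
          then show ?thesis using False by simp
        qed
      qed
      finally show ?case .
    qed
  qed
  also have "\<dots> < \<infinity>"
  proof -
    have "integrable torus_measure (\<lambda>u. c * (1 + N u))" using Ni by simp
    moreover have "AE u in torus_measure. 0 \<le> c * (1 + N u)" using c_nonneg by (auto simp: N_def)
    ultimately show ?thesis by (simp add: nn_integral_eq_integral)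
  qed
  finally show "(\<integral>\<^sup>+x. ennreal (norm (f x * \<kappa> (y - x))) \<partial>lborel) < \<infinity>" .
qed

text \<open>Unfolding: lattice frequencies do not see the shift by \<open>k\<close>.\<close>

lemma fourier_T_F:
  assumes f: "f \<in> Lp lborel p"
  shows "fourier_T (F f y) n = (LINT x|lborel. f x * \<kappa> (y - x) * ee (- (of_int_vec n \<bullet> x)))"
proof -
  have [measurable]: "f \<in> borel_measurable borel" using f by (rule Lp_borel)
  have "(LINT x|lborel. f x * \<kappa> (y - x) * ee (- (of_int_vec n \<bullet> x))) = (LINT u|torus_measure. LINT k|lattice.
      f (of_int_vec k + u) * \<kappa> (y - (of_int_vec k + u)) * ee (- (of_int_vec n \<bullet> (of_int_vec k + u))))"
    by (rule integral_unfold(1)) (intro integrable_mult_ee f_\<kappa>_integrable f, measurable)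
  also have "\<dots> = (LINT u|torus_measure. LINT k|lattice. f (of_int_vec k + u) * \<kappa> (y - u - of_int_vec k) * ee (- (of_int_vec n \<bullet> u)))"
  proof (intro Bochner_Integration.integral_cong refl)
    fix u :: "real^'n" and k :: "int^'n"
    have "ee (- (of_int_vec n \<bullet> (of_int_vec k + u))) = ee (of_int_vec (- n) \<bullet> of_int_vec k + - (of_int_vec n \<bullet> u))"
      by (rule arg_cong[of _ _ ee]) (simp add: inner_simps)
    also have "\<dots> = ee (- (of_int_vec n \<bullet> u))" by (simp only: ee_add ee_lattice mult_1)
    finally show "f (of_int_vec k + u) * \<kappa> (y - (of_int_vec k + u)) * ee (- (of_int_vec n \<bullet> (of_int_vec k + u))) =
      f (of_int_vec k + u) * \<kappa> (y - u - of_int_vec k) * ee (- (of_int_vec n \<bullet> u))" by (simp add: diff_diff_eq add.commute)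
  qed
  finally show ?thesis unfolding fourier_T_eq F_def by simp
qed

lemma fourier_T_F_L2c:
  assumes f: "L2c f"
  shows "(LINT x|lborel. f x * \<kappa> (y - x) * ee (- (of_int_vec n \<bullet> x))) =
    (LINT \<xi>|lborel. fourier_R f (\<xi> + of_int_vec n) * (L \<xi> * ee (\<xi> \<bullet> y)))"
proof -
  have [measurable]: "f \<in> borel_measurable borel" using f by (rule L2c_measurable)
  have e: "f x * ee (- (of_int_vec n \<bullet> x)) * (L \<xi> * ee (\<xi> \<bullet> (y - x))) = f x * ee (- ((\<xi> + of_int_vec n) \<bullet> x)) * (L \<xi> * ee (\<xi> \<bullet> y))" for x \<xi>
  proof -
    have "ee (- (of_int_vec n \<bullet> x)) * ee (\<xi> \<bullet> (y - x)) = ee (- ((\<xi> + of_int_vec n) \<bullet> x)) * ee (\<xi> \<bullet> y)"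
      by (simp add: inner_simps algebra_simps flip: ee_add)
    then show ?thesis by (simp add: mult_ac)
  qed
  have "(LINT x|lborel. f x * \<kappa> (y - x) * ee (- (of_int_vec n \<bullet> x))) =
      (LINT x|lborel. LINT \<xi>|lborel. f x * ee (- (of_int_vec n \<bullet> x)) * (L \<xi> * ee (\<xi> \<bullet> (y - x))))"
    unfolding integral_mult_right_zero \<kappa>_def[symmetric] by (simp only: mult_ac)
  also have "\<dots> = (LINT \<xi>|lborel. LINT x|lborel. f x * ee (- (of_int_vec n \<bullet> x)) * (L \<xi> * ee (\<xi> \<bullet> (y - x))))"
  proof (rule integral_swap[OF sigma_finite_lborel sigma_finite_lborel])
    show "(\<lambda>(x, \<xi>). f x * ee (- (of_int_vec n \<bullet> x)) * (L \<xi> * ee (\<xi> \<bullet> (y - x)))) \<in> borel_measurable (lborel \<Otimes>\<^sub>M lborel)" by measurable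
    have "(\<integral>\<^sup>+x. \<integral>\<^sup>+\<xi>. ennreal (norm (f x * ee (- (of_int_vec n \<bullet> x)) * (L \<xi> * ee (\<xi> \<bullet> (y - x))))) \<partial>lborel \<partial>lborel)
      = (\<integral>\<^sup>+x. ennreal (norm (f x)) \<partial>lborel) * (\<integral>\<^sup>+\<xi>. ennreal (norm (L \<xi>)) \<partial>lborel)"
      by (simp add: norm_mult ennreal_mult nn_integral_multc nn_integral_cmult)
    also have "\<dots> < \<infinity>"
      using L_integrable L2c_integrable[OF f] by (simp add: integrable_iff_bounded ennreal_mult_less_top)
    finally show "(\<integral>\<^sup>+x. \<integral>\<^sup>+\<xi>. ennreal (norm (f x * ee (- (of_int_vec n \<bullet> x)) * (L \<xi> * ee (\<xi> \<bullet> (y - x))))) \<partial>lborel \<partial>lborel) < \<infinity>" .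
  qed
  finally show ?thesis unfolding e fourier_R_eq by simp
qed

text \<open>The formula for test functions passes to the limit along truncations of \<open>f\<close>: by dominated convergence on the left, and
  by convergence in \<open>L\<^sup>2\<close> on the right, where \<open>L\<close> is square integrable.\<close>

lemma fourier_T_F_plancherel:
  assumes f: "f \<in> Lp lborel p" and P: "plancherel_R f h"
  shows "fourier_T (F f y) n = (LINT \<xi>|lborel. h (\<xi> + of_int_vec n) * (L \<xi> * ee (\<xi> \<bullet> y)))"
proof -
  define lim where "lim = (LINT x|lborel. f x * \<kappa> (y - x) * ee (- (of_int_vec n \<bullet> x)))"
  define a where "a N = (LINT x|lborel. trunc (real N) f x * \<kappa> (y - x) * ee (- (of_int_vec n \<bullet> x)))" for N
  define G where "G \<xi> = L \<xi> * ee (\<xi> \<bullet> y)" for \<xi>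
  have L2: "f \<in> Lp lborel 2" "h \<in> Lp lborel 2"
    and Plim: "((\<lambda>R. LINT \<xi>|lborel. (norm (fourier_R (trunc R f) \<xi> - h \<xi>))\<^sup>2) \<longlongrightarrow> 0) at_top"
    using P by (auto simp: plancherel_R_eq)
  have [measurable]: "f \<in> borel_measurable borel" "h \<in> borel_measurable borel" using L2 by (auto intro: Lp_borel)
  have GL: "(\<lambda>\<xi>. cnj (G \<xi>)) \<in> Lp lborel 2"
    by (rule Lp_bounded_by[OF L_L2]) (auto simp: G_def norm_mult)
  have "a \<longlonglongrightarrow> lim"
    unfolding a_def[abs_def] lim_def
  proof (rule integral_dominated_convergence)
    show "integrable lborel (\<lambda>x. norm (f x * \<kappa> (y - x)))" by (intro integrable_norm f_\<kappa>_integrable f)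
    show "AE x in lborel. norm (trunc (real N) f x * \<kappa> (y - x) * ee (- (of_int_vec n \<bullet> x))) \<le> norm (f x * \<kappa> (y - x))" for N
      by (auto simp: trunc_def norm_mult)
    show "AE x in lborel. (\<lambda>N. trunc (real N) f x * \<kappa> (y - x) * ee (- (of_int_vec n \<bullet> x))) \<longlonglongrightarrow> f x * \<kappa> (y - x) * ee (- (of_int_vec n \<bullet> x))"
    proof (rule AE_I2)
      fix x :: "real^'n"
      obtain N0 :: nat where N0: "norm x \<le> real N0" using real_arch_simple by blast
      have "\<forall>\<^sub>F N in sequentially. trunc (real N) f x * \<kappa> (y - x) * ee (- (of_int_vec n \<bullet> x)) = f x * \<kappa> (y - x) * ee (- (of_int_vec n \<bullet> x))"
        using N0 by (intro eventually_sequentiallyI[of N0]) (auto simp: trunc_def)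
      then show "(\<lambda>N. trunc (real N) f x * \<kappa> (y - x) * ee (- (of_int_vec n \<bullet> x))) \<longlonglongrightarrow> f x * \<kappa> (y - x) * ee (- (of_int_vec n \<bullet> x))"
        by (rule tendsto_eventually)
    qed
  qed measurable
  moreover have "a \<longlonglongrightarrow> (LINT \<xi>|lborel. h (\<xi> + of_int_vec n) * G \<xi>)"
  proof -
    define b where "b R = (LINT \<xi>|lborel. fourier_R (trunc R f) (\<xi> + of_int_vec n) * G \<xi>) - (LINT \<xi>|lborel. h (\<xi> + of_int_vec n) * G \<xi>)" for R
    have "(b \<longlongrightarrow> 0) at_top"
    proof (rule tendsto_zero_by_square[OF _ Plim])
      fix R
      have F1: "fourier_R (trunc R f) \<in> Lp lborel 2" by (rule plancherel_L2c(1)[OF L2c_trunc[OF L2(1)]])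
      have F2: "(\<lambda>\<xi>. fourier_R (trunc R f) (\<xi> + of_int_vec n)) \<in> Lp lborel 2"
        using Lp_2_translate(1)[OF F1, of "- of_int_vec n"] by simp
      have F3: "(\<lambda>\<xi>. h (\<xi> + of_int_vec n)) \<in> Lp lborel 2"
        using Lp_2_translate(1)[OF L2(2), of "- of_int_vec n"] by simp
      have "b R = (LINT \<xi>|lborel. (fourier_R (trunc R f) (\<xi> + of_int_vec n) - h (\<xi> + of_int_vec n)) * cnj (cnj (G \<xi>)))"
        unfolding b_def using Lp_2_mult_integrable(2)[OF F2 GL] Lp_2_mult_integrable(2)[OF F3 GL]
        by (simp add: left_diff_distrib)
      then have "norm (b R) \<le> sqrt (LINT \<xi>|lborel. (norm (fourier_R (trunc R f) (\<xi> + of_int_vec n) - h (\<xi> + of_int_vec n)))\<^sup>2)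
          * sqrt (LINT \<xi>|lborel. (norm (cnj (G \<xi>)))\<^sup>2)"
        using Cauchy_Schwarz_integral[OF Lp_diff[OF F2 F3] GL] by simp
      also have "(LINT \<xi>|lborel. (norm (fourier_R (trunc R f) (\<xi> + of_int_vec n) - h (\<xi> + of_int_vec n)))\<^sup>2)
         = (LINT \<xi>|lborel. (norm (fourier_R (trunc R f) \<xi> - h \<xi>))\<^sup>2)"
        using Lp_2_translate(2)[OF Lp_diff[OF F1 L2(2)], of "- of_int_vec n"] by simp
      finally show "norm (b R) \<le> sqrt (LINT \<xi>|lborel. (norm (fourier_R (trunc R f) \<xi> - h \<xi>))\<^sup>2) * sqrt (LINT \<xi>|lborel. (norm (cnj (G \<xi>)))\<^sup>2)" .
    qed
    then have "(\<lambda>N. b (real N)) \<longlonglongrightarrow> 0" by (rule filterlim_compose[OF _ filterlim_real_sequentially])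
    moreover have "a N = b (real N) + (LINT \<xi>|lborel. h (\<xi> + of_int_vec n) * G \<xi>)" for N
      unfolding a_def b_def G_def fourier_T_F_L2c[OF L2c_trunc[OF L2(1)]] by simp
    then have "a = (\<lambda>N. b (real N) + (LINT \<xi>|lborel. h (\<xi> + of_int_vec n) * G \<xi>))" by (simp add: fun_eq_iff)
    ultimately show ?thesis
      using tendsto_add[of "\<lambda>N. b (real N)" 0 sequentially, OF _ tendsto_const[of "LINT \<xi>|lborel. h (\<xi> + of_int_vec n) * G \<xi>"]] by simp
  qed
  ultimately have "lim = (LINT \<xi>|lborel. h (\<xi> + of_int_vec n) * G \<xi>)" by (rule LIMSEQ_unique)
  then show ?thesis unfolding fourier_T_F[OF f] lim_def G_def .
qed

lemma V_L2: "\<exists>C\<ge>0. \<forall>f m. f \<in> Lp lborel 2 \<longrightarrow> f \<in> Lp lborel p \<longrightarrow> V f m \<in> Lp torus_measure 2 \<and>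
   (LINT \<theta>|torus_measure. (norm (V f m \<theta>))\<^sup>2) \<le> C * (LINT x|lborel. (norm (f x))\<^sup>2)"
proof -
  obtain C where C: "C \<ge> 0" "\<And>f y. f \<in> Lp lborel 2 \<Longrightarrow> F f y \<in> Lp torus_measure 2"
    "\<And>f y. f \<in> Lp lborel 2 \<Longrightarrow> (LINT \<theta>|torus_measure. (norm (F f y \<theta>))\<^sup>2) \<le> C * (LINT x|lborel. (norm (f x))\<^sup>2)" using F_L2 by blast
  have "V f m \<in> Lp torus_measure 2 \<and> (LINT \<theta>|torus_measure. (norm (V f m \<theta>))\<^sup>2) \<le> D\<^sup>2 * C * (LINT x|lborel. (norm (f x))\<^sup>2)"
    if f: "f \<in> Lp lborel 2" "f \<in> Lp lborel p" for f m
  proof -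
    define y where "y = (1 / real q) *\<^sub>R of_int_vec m"
    note S2 = S_L2[OF F_Lp[OF f(2)] C(2)[OF f(1)], of y]
    have "(LINT \<theta>|torus_measure. (norm (S (F f y) \<theta>))\<^sup>2) = (LINT n|lattice. (norm (\<phi> n * fourier_T (F f y) n))\<^sup>2)"
      unfolding parseval_torus(2)[OF S2(1), symmetric] S2(2) ..
    also have "\<dots> \<le> (LINT n|lattice. D\<^sup>2 * (norm (fourier_T (F f y) n))\<^sup>2)"
    proof (rule integral_mono)
      show "integrable lattice (\<lambda>n. (norm (\<phi> n * fourier_T (F f y) n))\<^sup>2)"
        using parseval_torus(1)[OF S2(1)] by (simp add: Lp_2_iff S2(2))
      show "integrable lattice (\<lambda>n. D\<^sup>2 * (norm (fourier_T (F f y) n))\<^sup>2)"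
        using parseval_torus(1)[OF C(2)[OF f(1), of y]] by (simp add: Lp_2_iff)
      show "(norm (\<phi> n * fourier_T (F f y) n))\<^sup>2 \<le> D\<^sup>2 * (norm (fourier_T (F f y) n))\<^sup>2" for n
        unfolding norm_mult power_mult_distrib by (intro mult_right_mono power_mono \<phi>_bound) auto
    qed
    also have "\<dots> = D\<^sup>2 * (LINT \<theta>|torus_measure. (norm (F f y \<theta>))\<^sup>2)"
      using parseval_torus(2)[OF C(2)[OF f(1), of y]] by simp
    also have "\<dots> \<le> D\<^sup>2 * (C * (LINT x|lborel. (norm (f x))\<^sup>2))" by (intro mult_left_mono C(3) f) simp
    finally show ?thesis using S2(1) by (simp add: V_def y_def mult.assoc)
  qed
  then show ?thesis using C(1) by (intro exI[of _ "D\<^sup>2 * C"]) auto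
qed

text \<open>The multiplier \<open>W\<close>, formed with the representative \<open>L\<close> of \<open>\<Lambda>\<close>.\<close>

definition WL :: "real^'n \<Rightarrow> complex" where
  "WL \<xi> = (LINT n|lattice. \<phi> n * L (\<xi> - of_int_vec n))"

lemma WL_measurable [measurable]: "WL \<in> borel_measurable borel"
  unfolding WL_def[abs_def] by measurable

lemma L_lattice_sum: "\<exists>C\<ge>0. \<forall>\<xi>. integrable lattice (\<lambda>n. norm (L (\<xi> - of_int_vec n))) \<and> (LINT n|lattice. norm (L (\<xi> - of_int_vec n))) \<le> C"
proof -
  define J where "J = {n :: int^'n. \<exists>u\<in>cell. norm (of_int_vec n + u) \<le> radius}"
  have J: "finite J" unfolding J_def by (rule finite_lattice_near)
  have "integrable lattice (\<lambda>n. norm (L (\<xi> - of_int_vec n))) \<and> (LINT n|lattice. norm (L (\<xi> - of_int_vec n))) \<le> card J * B" for \<xi>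
  proof -
    define c where "c = floor_vec \<xi>"
    have e: "\<xi> - of_int_vec (c - n) = of_int_vec n + frac_vec \<xi>" for n
      using floor_plus_frac[of \<xi>] by (simp add: c_def algebra_simps)
    have z: "norm (L (of_int_vec n + frac_vec \<xi>)) = 0" if "n \<notin> J" for n
      using that L_radius[of "of_int_vec n + frac_vec \<xi>"] frac_vec_in_cell[of \<xi>] by (force simp: J_def)
    note I = integral_lattice_finite[of J "\<lambda>n. norm (L (of_int_vec n + frac_vec \<xi>))", OF J z]
    have "(LINT n|lattice. norm (L (\<xi> - of_int_vec n))) = (LINT n|lattice. norm (L (of_int_vec n + frac_vec \<xi>)))"
      using integral_bij_count_space[OF bij_lattice_shift(2)[of c], of "\<lambda>n. norm (L (\<xi> - of_int_vec n))"] unfolding e by simp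
    also have "\<dots> = (\<Sum>n\<in>J. norm (L (of_int_vec n + frac_vec \<xi>)))" by (rule I(1))
    also have "\<dots> \<le> card J * B" by (rule sum_bounded_above) (rule L_bound)
    finally have "(LINT n|lattice. norm (L (\<xi> - of_int_vec n))) \<le> card J * B" .
    moreover have "integrable lattice (\<lambda>n. norm (L (\<xi> - of_int_vec n)))"
      using integrable_bij_count_space[OF bij_lattice_shift(2)[of c], of "\<lambda>n. norm (L (\<xi> - of_int_vec n))"] I(2) unfolding e by simp
    ultimately show ?thesis by simp
  qed
  then show ?thesis using B_nonneg by (intro exI[of _ "card J * B"]) auto
qed

lemma WL_bounded: "\<exists>C\<ge>0. \<forall>\<xi>. norm (WL \<xi>) \<le> C"
proof -
  obtain C where C: "C \<ge> 0" "\<And>\<xi>. integrable lattice (\<lambda>n. norm (L (\<xi> - of_int_vec n)))"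
    "\<And>\<xi>. (LINT n|lattice. norm (L (\<xi> - of_int_vec n))) \<le> C" using L_lattice_sum by blast
  have "norm (WL \<xi>) \<le> D * C" for \<xi>
  proof -
    have i: "integrable lattice (\<lambda>n. D * norm (L (\<xi> - of_int_vec n)))" using C(2) by simp
    have le: "norm (\<phi> n * L (\<xi> - of_int_vec n)) \<le> D * norm (L (\<xi> - of_int_vec n))" for n
      unfolding norm_mult by (intro mult_right_mono \<phi>_bound) simp
    have i2: "integrable lattice (\<lambda>n. norm (\<phi> n * L (\<xi> - of_int_vec n)))"
      by (rule Bochner_Integration.integrable_bound[OF i]) (use le D_nonneg in \<open>auto simp: abs_mult\<close>)
    have "norm (WL \<xi>) \<le> (LINT n|lattice. norm (\<phi> n * L (\<xi> - of_int_vec n)))" unfolding WL_def by (rule integral_norm_bound)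
    also have "\<dots> \<le> (LINT n|lattice. D * norm (L (\<xi> - of_int_vec n)))" by (rule integral_mono[OF i2 i le])
    also have "\<dots> \<le> D * C" using C(3) D_nonneg by (simp add: mult_left_mono)
    finally show ?thesis .
  qed
  then show ?thesis using C(1) D_nonneg by (intro exI[of _ "D * C"]) auto
qed

text \<open>The heart of the identification of the multiplier. Each term of \<open>TW f\<close> is paired with a test function by
  Parseval's identity on the torus; summing over \<open>m\<close> with the sampling formula then turns the sample points \<open>m / q\<close>
  back into the point \<open>x\<close>.\<close>

lemma TW_pairing:
  assumes f2: "f \<in> Lp lborel 2" and fp: "f \<in> Lp lborel p" and P: "plancherel_R f h" and w: "L2c w"
  shows "(LINT x|lborel. TW f x * cnj (w x)) = (LINT \<xi>|lborel. WL \<xi> * h \<xi> * cnj (fourier_R w \<xi>))"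
proof -
  obtain R where R: "\<And>x. norm x > R \<Longrightarrow> w x = 0" using w by (auto simp: L2c_def)
  (* only finitely many cells meet the support of the test function, and on these the kernels are bounded
     by a summable sequence \<open>b\<close> *)
  define J where "J = {k :: int^'n. \<exists>u\<in>cell. norm (of_int_vec k + u) \<le> R}"
  have fJ: "finite J" unfolding J_def by (rule finite_lattice_near)
  have w0: "w (of_int_vec j + u) = 0" if "j \<notin> J" "u \<in> cell" for j u
    using that R[of "of_int_vec j + u"] by (force simp: J_def)
  have h2: "h \<in> Lp lborel 2" using P by (simp add: plancherel_R_def)
  have [measurable]: "h \<in> borel_measurable borel" "w \<in> borel_measurable borel"
    using h2 w by (auto intro: Lp_borel L2c_measurable)
  note [measurable] = V_frac_measurable[OF fp]
  define U where "U m x = kernel (real q *\<^sub>R x - of_int_vec m)" for m and x :: "real^'n"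
  have Um [measurable]: "U m \<in> borel_measurable borel" for m unfolding U_def[abs_def] by measurable
  define b where "b m = (\<Sum>j\<in>J. kernel_const * decay (of_int_vec (m - of_nat q * j) :: real^'n))" for m
  have b0: "b m \<ge> 0" for m unfolding b_def using kernel_const_pos by (intro sum_nonneg mult_nonneg_nonneg less_imp_le[OF decay_pos]) auto
  have bi: "integrable lattice b"
    unfolding b_def[abs_def]
  proof (intro Bochner_Integration.integrable_sum integrable_mult_right)
    fix j
    show "integrable lattice (\<lambda>m. decay (of_int_vec (m - of_nat q * j) :: real^'n))"
      using integrable_bij_count_space[OF bij_lattice_shift(1)[of "of_nat q * j"], of "\<lambda>k. decay (of_int_vec k :: real^'n)"] integrable_decay
      by simp
  qed
  have Ub: "norm (U m (of_int_vec j + u)) \<le> b m" if "u \<in> cell" "j \<in> J" for m j u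
  proof -
    have eq: "real q *\<^sub>R (of_int_vec j + u) - of_int_vec m = real q *\<^sub>R u - of_int_vec (m - of_nat q * j)"
      unfolding of_int_vec_simps(4) of_int_vec_q by (simp add: scaleR_add_right)
    have "norm (U m (of_int_vec j + u)) \<le> kernel_const * decay (of_int_vec (m - of_nat q * j) :: real^'n)"
      unfolding U_def eq by (rule kernel_cell_bound[OF that(1)])
    also have "\<dots> \<le> b m"
      unfolding b_def using kernel_const_pos fJ that(2)
      by (intro member_le_sum[where f = "\<lambda>j. kernel_const * decay (of_int_vec (m - of_nat q * j) :: real^'n)"])
         (auto intro!: mult_nonneg_nonneg less_imp_le[OF decay_pos])
    finally show ?thesis .
  qed
  define \<omega> where "\<omega> u = (\<Sum>j\<in>J. norm (w (of_int_vec j + u)))" for u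
  have \<omega>0: "\<omega> u \<ge> 0" for u by (simp add: \<omega>_def sum_nonneg)
  have \<omega>L: "(\<lambda>u. complex_of_real (\<omega> u)) \<in> Lp torus_measure 2"
    unfolding \<omega>_def of_real_sum
  proof (intro Lp_sum fJ)
    fix j
    show "(\<lambda>u. complex_of_real (norm (w (of_int_vec j + u)))) \<in> Lp torus_measure 2"
    proof (rule Lp_bounded_by[OF torus_translate_Lp[OF L2c_Lp[OF w], of j]])
      show "(\<lambda>u. complex_of_real (norm (w (of_int_vec j + u)))) \<in> borel_measurable torus_measure"
        by (rule measurable_torusI) measurable
    qed auto
  qed simp
  define A where "A = (LINT u|torus_measure. (\<omega> u)\<^sup>2)"
  have A0: "A \<ge> 0" by (simp add: A_def)
  have b\<omega>L: "(\<lambda>u. of_real (b m) * complex_of_real (\<omega> u)) \<in> Lp torus_measure 2" for m by (rule Lp_cmult[OF \<omega>L])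
  have b\<omega>n: "(LINT u|torus_measure. (norm (of_real (b m) * complex_of_real (\<omega> u)))\<^sup>2) = (b m)\<^sup>2 * A" for m
    by (simp add: A_def norm_mult power_mult_distrib)
  (* the periodization of the test function multiplied by the conjugate of the kernel *)
  define wm where "wm m u = (LINT j|lattice. cnj (U m (of_int_vec j + u)) * w (of_int_vec j + u))" for m u
  have wm_le: "norm (wm m u) \<le> b m * \<omega> u" if u: "u \<in> cell" for m u
  proof -
    have "wm m u = (\<Sum>j\<in>J. cnj (U m (of_int_vec j + u)) * w (of_int_vec j + u))"
      unfolding wm_def by (rule integral_lattice_finite(1)[OF fJ]) (simp add: w0 u)
    also have "norm \<dots> \<le> (\<Sum>j\<in>J. b m * norm (w (of_int_vec j + u)))"
      by (rule sum_norm_le) (auto simp: norm_mult intro!: mult_right_mono Ub u)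
    finally show ?thesis by (simp add: \<omega>_def sum_distrib_left)
  qed
  have wmL: "wm m \<in> Lp torus_measure 2" for m
  proof (rule Lp_bounded_by[OF b\<omega>L[of m]])
    have "wm m \<in> borel_measurable borel" unfolding wm_def[abs_def] by measurable
    then show "wm m \<in> borel_measurable torus_measure" by (rule measurable_torusI)
    show "AE u in torus_measure. norm (wm m u) \<le> norm (of_real (b m) * complex_of_real (\<omega> u))"
      using wm_le b0 \<omega>0 by (auto intro!: AE_I2 simp: norm_mult)
  qed simp
  have wmn: "sqrt (LINT u|torus_measure. (norm (wm m u))\<^sup>2) \<le> b m * sqrt A" for m
  proof -
    have "(LINT u|torus_measure. (norm (wm m u))\<^sup>2) \<le> (LINT u|torus_measure. (norm (of_real (b m) * complex_of_real (\<omega> u)))\<^sup>2)"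
      using wmL b\<omega>L wm_le b0 \<omega>0 by (intro integral_mono) (auto simp: Lp_2_iff norm_mult intro!: power_mono)
    then have "sqrt (LINT u|torus_measure. (norm (wm m u))\<^sup>2) \<le> sqrt ((b m)\<^sup>2 * A)" unfolding b\<omega>n by (rule real_sqrt_le_mono)
    then show ?thesis using b0 by (simp add: real_sqrt_mult)
  qed
  obtain E where E: "E \<ge> 0" "\<And>m. V f m \<in> Lp torus_measure 2" "\<And>m. sqrt (LINT u|torus_measure. (norm (V f m u))\<^sup>2) \<le> E"
  proof -
    obtain C where C: "C \<ge> 0" "\<And>m. V f m \<in> Lp torus_measure 2"
      "\<And>m. (LINT u|torus_measure. (norm (V f m u))\<^sup>2) \<le> C * (LINT x|lborel. (norm (f x))\<^sup>2)" using V_L2 f2 fp by blast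
    show ?thesis by (rule that[of "sqrt (C * (LINT x|lborel. (norm (f x))\<^sup>2))"]) (use C in auto)
  qed
  have sumb: "(\<integral>\<^sup>+m. ennreal (E * (b m * sqrt A)) \<partial>lattice) < \<infinity>"
  proof -
    have "integrable lattice (\<lambda>m. E * (b m * sqrt A))" using bi by simp
    moreover have "AE m in lattice. 0 \<le> E * (b m * sqrt A)" using E(1) b0 A0 by (auto intro!: AE_I2)
    ultimately show ?thesis by (simp add: nn_integral_eq_integral)
  qed
  define Q where "Q m x = U m x * V f m (frac_vec x) * cnj (w x)" for m x
  have Qm [measurable]: "Q m \<in> borel_measurable borel" for m unfolding Q_def[abs_def] by measurable
  have Qfin: "(\<integral>\<^sup>+x. ennreal (norm (Q m x)) \<partial>lborel) \<le> ennreal (E * (b m * sqrt A))" for m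
  proof -
    have "(\<integral>\<^sup>+x. ennreal (norm (Q m x)) \<partial>lborel) = (\<integral>\<^sup>+j. \<integral>\<^sup>+u. ennreal (norm (Q m (of_int_vec j + u))) \<partial>torus_measure \<partial>lattice)"
      by (rule nn_integral_unfold) measurable
    also have "\<dots> = (\<integral>\<^sup>+u. \<integral>\<^sup>+j. ennreal (norm (Q m (of_int_vec j + u))) \<partial>lattice \<partial>torus_measure)"
      by (rule nn_integral_lattice_swap[OF torus.sigma_finite_measure_axioms], rule measurable_torusI) measurable
    also have "\<dots> \<le> (\<integral>\<^sup>+u. ennreal (norm (V f m u) * norm (of_real (b m) * complex_of_real (\<omega> u))) \<partial>torus_measure)"
    proof (rule nn_integral_mono)
      fix u :: "real^'n" assume "u \<in> space torus_measure"
      then have u: "u \<in> cell" by simp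
      have "(\<integral>\<^sup>+j. ennreal (norm (Q m (of_int_vec j + u))) \<partial>lattice) = (\<Sum>j\<in>J. ennreal (norm (Q m (of_int_vec j + u))))"
        by (rule nn_integral_lattice_finite[OF fJ]) (simp add: Q_def w0 u)
      also have "\<dots> = ennreal (\<Sum>j\<in>J. norm (Q m (of_int_vec j + u)))" by (simp add: sum_ennreal)
      also have "\<dots> \<le> ennreal (\<Sum>j\<in>J. b m * norm (V f m u) * norm (w (of_int_vec j + u)))"
        by (intro ennreal_leI sum_mono)
           (auto simp: Q_def norm_mult floor_frac_unique u intro!: mult_right_mono Ub)
      also have "(\<Sum>j\<in>J. b m * norm (V f m u) * norm (w (of_int_vec j + u))) = norm (V f m u) * norm (of_real (b m) * complex_of_real (\<omega> u))"
        unfolding norm_mult norm_of_real abs_of_nonneg[OF b0] abs_of_nonneg[OF \<omega>0] by (simp add: \<omega>_def sum_distrib_left mult_ac)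
      finally show "(\<integral>\<^sup>+j. ennreal (norm (Q m (of_int_vec j + u))) \<partial>lattice) \<le> ennreal (norm (V f m u) * norm (of_real (b m) * complex_of_real (\<omega> u)))" .
    qed
    also have "\<dots> \<le> ennreal (sqrt (LINT u|torus_measure. (norm (V f m u))\<^sup>2) * sqrt ((b m)\<^sup>2 * A))"
      using nn_integral_L2_product[OF E(2) b\<omega>L] unfolding b\<omega>n .
    also have "\<dots> \<le> ennreal (E * (b m * sqrt A))"
      using E(3) b0 A0 by (intro ennreal_leI mult_mono) (auto simp: real_sqrt_mult E(1))
    finally show ?thesis .
  qed
  have Qi: "integrable lborel (Q m)" for m
    by (rule integrableI_bounded) (use Qfin[of m] in \<open>auto intro: le_less_trans\<close>)
  have "(LINT x|lborel. TW f x * cnj (w x)) = (LINT x|lborel. LINT m|lattice. Q m x)"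
    unfolding TW_def Q_def U_def by simp
  also have "\<dots> = (LINT m|lattice. LINT x|lborel. Q m x)"
  proof (rule integral_swap[OF lattice.sigma_finite_measure_axioms sigma_finite_lborel, symmetric])
    show "(\<lambda>(m, x). Q m x) \<in> borel_measurable (lattice \<Otimes>\<^sub>M lborel)" by (intro measurable_lattice_split) simp
    show "(\<integral>\<^sup>+m. \<integral>\<^sup>+x. ennreal (norm (Q m x)) \<partial>lborel \<partial>lattice) < \<infinity>"
      by (rule le_less_trans[OF nn_integral_mono[OF Qfin] sumb])
  qed
  also have "\<dots> = (LINT m|lattice. LINT n|lattice. fourier_T (V f m) n * cnj (fourier_T (wm m) n))"
  proof (intro Bochner_Integration.integral_cong refl)
    fix m
    have "(LINT x|lborel. Q m x) = (LINT u|torus_measure. LINT j|lattice. Q m (of_int_vec j + u))"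
      by (rule integral_unfold(1)[OF Qi])
    also have "\<dots> = (LINT u|torus_measure. V f m u * cnj (wm m u))"
    proof (intro Bochner_Integration.integral_cong refl)
      fix u :: "real^'n" assume "u \<in> space torus_measure"
      then have u: "u \<in> cell" by simp
      have "(LINT j|lattice. Q m (of_int_vec j + u)) = (LINT j|lattice. V f m u * cnj (cnj (U m (of_int_vec j + u)) * w (of_int_vec j + u)))"
        by (intro Bochner_Integration.integral_cong refl) (simp add: Q_def floor_frac_unique u mult_ac)
      also have "\<dots> = V f m u * cnj (wm m u)" unfolding wm_def by (simp del: complex_cnj_mult)
      finally show "(LINT j|lattice. Q m (of_int_vec j + u)) = V f m u * cnj (wm m u)" .
    qed
    also have "\<dots> = (LINT n|lattice. fourier_T (V f m) n * cnj (fourier_T (wm m) n))"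
      by (rule parseval_torus_inner[OF E(2) wmL, symmetric])
    finally show "(LINT x|lborel. Q m x) = (LINT n|lattice. fourier_T (V f m) n * cnj (fourier_T (wm m) n))" .
  qed
  also have "\<dots> = (LINT n|lattice. LINT m|lattice. fourier_T (V f m) n * cnj (fourier_T (wm m) n))"
  proof (rule integral_swap[OF lattice.sigma_finite_measure_axioms lattice.sigma_finite_measure_axioms])
    show "(\<lambda>(m, n). fourier_T (V f m) n * cnj (fourier_T (wm m) n)) \<in> borel_measurable (lattice \<Otimes>\<^sub>M lattice)"
      by (intro measurable_lattice_split) simp
    have "(\<integral>\<^sup>+n. ennreal (norm (fourier_T (V f m) n * cnj (fourier_T (wm m) n))) \<partial>lattice) \<le> ennreal (E * (b m * sqrt A))" for m
    proof -
      have "(\<integral>\<^sup>+n. ennreal (norm (fourier_T (V f m) n * cnj (fourier_T (wm m) n))) \<partial>lattice) \<le>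
         ennreal (sqrt (LINT u|torus_measure. (norm (V f m u))\<^sup>2) * sqrt (LINT u|torus_measure. (norm (wm m u))\<^sup>2))"
        using nn_integral_L2_product[OF parseval_torus(1)[OF E(2)[of m]] parseval_torus(1)[OF wmL[of m]]]
        unfolding parseval_torus(2)[OF E(2)[of m]] parseval_torus(2)[OF wmL[of m]] by (simp add: norm_mult)
      also have "\<dots> \<le> ennreal (E * (b m * sqrt A))"
        using E(3) wmn E(1) by (intro ennreal_leI mult_mono) auto
      finally show ?thesis .
    qed
    then show "(\<integral>\<^sup>+m. \<integral>\<^sup>+n. ennreal (norm (fourier_T (V f m) n * cnj (fourier_T (wm m) n))) \<partial>lattice \<partial>lattice) < \<infinity>"
      by (rule le_less_trans[OF nn_integral_mono sumb])
  qed
  also have "\<dots> = (LINT n|lattice. \<phi> n * (LINT \<xi>|lborel. h (\<xi> + of_int_vec n) * L \<xi> * cnj (fourier_R w (\<xi> + of_int_vec n))))"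
  proof (intro Bochner_Integration.integral_cong refl)
    fix n
    define Y where "Y x = cnj (w x) * ee (of_int_vec n \<bullet> x)" for x
    have [measurable]: "Y \<in> borel_measurable borel" unfolding Y_def[abs_def] by measurable
    have Yn: "norm (Y x) = norm (w x)" for x by (simp add: Y_def norm_mult)
    define X where "X m = (LINT x|lborel. U m x * Y x)" for m
    define cf where "cf m = (LINT \<xi>|lborel. h (\<xi> + of_int_vec n) * (L \<xi> * ee (\<xi> \<bullet> ((1 / real q) *\<^sub>R of_int_vec m))))" for m
    have V: "fourier_T (V f m) n = \<phi> n * cf m" for m
    proof -
      have F2: "F f y \<in> Lp torus_measure 2" for y using F_L2 f2 by blast
      show ?thesis
        unfolding V_def cf_def S_L2(2)[OF F_Lp[OF fp] F2] fourier_T_F_plancherel[OF fp P] ..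
    qed
    have X: "cnj (fourier_T (wm m) n) = X m" for m
    proof -
      have i: "integrable lborel (\<lambda>x. cnj (U m x) * w x)"
      proof (rule Bochner_Integration.integrable_bound)
        show "integrable lborel (\<lambda>x. 2 ^ CARD('n) * norm (w x))" using L2c_integrable[OF w] by simp
        have "norm (U m x) \<le> 2 ^ CARD('n)" for x
          unfolding U_def using norm_kernel[of "real q *\<^sub>R x - of_int_vec m"] decay_le_1[of "real q *\<^sub>R x - of_int_vec m"]
          by (meson mult_left_le order_trans zero_le_numeral zero_le_power)
        then show "AE x in lborel. norm (cnj (U m x) * w x) \<le> norm (2 ^ CARD('n) * norm (w x))"
          by (auto intro!: AE_I2 mult_right_mono simp: norm_mult)
      qed measurable
      have "(LINT x|lborel. cnj (U m x) * w x * ee (- (of_int_vec n \<bullet> x))) =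
        (LINT u|torus_measure. LINT j|lattice. cnj (U m (of_int_vec j + u)) * w (of_int_vec j + u) * ee (- (of_int_vec n \<bullet> (of_int_vec j + u))))"
        by (rule integral_unfold(1)) (intro integrable_mult_ee i, measurable)
      also have "\<dots> = (LINT u|torus_measure. LINT j|lattice. cnj (U m (of_int_vec j + u)) * w (of_int_vec j + u) * ee (- (of_int_vec n \<bullet> u)))"
      proof (intro Bochner_Integration.integral_cong refl)
        fix u :: "real^'n" and j :: "int^'n"
        have "ee (- (of_int_vec n \<bullet> (of_int_vec j + u))) = ee (of_int_vec (- n) \<bullet> of_int_vec j + - (of_int_vec n \<bullet> u))"
          by (rule arg_cong[of _ _ ee]) (simp add: inner_simps)
        also have "\<dots> = ee (- (of_int_vec n \<bullet> u))" by (simp only: ee_add ee_lattice mult_1)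
        finally show "cnj (U m (of_int_vec j + u)) * w (of_int_vec j + u) * ee (- (of_int_vec n \<bullet> (of_int_vec j + u))) =
          cnj (U m (of_int_vec j + u)) * w (of_int_vec j + u) * ee (- (of_int_vec n \<bullet> u))" by simp
      qed
      also have "\<dots> = fourier_T (wm m) n" unfolding fourier_T_eq wm_def by simp
      finally have "cnj (fourier_T (wm m) n) = cnj (LINT x|lborel. cnj (U m x) * w x * ee (- (of_int_vec n \<bullet> x)))" by simp
      also have "\<dots> = (LINT x|lborel. cnj (cnj (U m x) * w x * ee (- (of_int_vec n \<bullet> x))))"
        by (rule Bochner_Integration.integral_cnj[symmetric])
      finally show ?thesis unfolding X_def Y_def by (simp add: mult.assoc)
    qed
    have UY: "(\<integral>\<^sup>+m. \<integral>\<^sup>+x. ennreal (norm (U m x * Y x)) \<partial>lborel \<partial>lattice) < \<infinity>"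
    proof -
      define k0 where "k0 = 2 ^ CARD('n) * decay_sum TYPE('n)"
      have "(\<integral>\<^sup>+m. \<integral>\<^sup>+x. ennreal (norm (U m x * Y x)) \<partial>lborel \<partial>lattice) = (\<integral>\<^sup>+x. \<integral>\<^sup>+m. ennreal (norm (U m x * Y x)) \<partial>lattice \<partial>lborel)"
        by (rule nn_integral_lattice_swap[OF sigma_finite_lborel]) measurable
      also have "\<dots> \<le> (\<integral>\<^sup>+x. ennreal (k0 * norm (w x)) \<partial>lborel)"
      proof (rule nn_integral_mono)
        fix x :: "real^'n"
        have "(\<integral>\<^sup>+m. ennreal (norm (U m x * Y x)) \<partial>lattice) = ennreal (LINT m|lattice. norm (U m x) * norm (w x))"
          unfolding norm_mult Yn
          by (rule nn_integral_eq_integral) (use kernel_lattice_sum(1)[of "real q *\<^sub>R x"] in \<open>auto simp: U_def\<close>)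
        also have "\<dots> \<le> ennreal (k0 * norm (w x))"
          using kernel_lattice_sum(2)[of "real q *\<^sub>R x"] by (auto intro!: ennreal_leI mult_right_mono simp: U_def k0_def)
        finally show "(\<integral>\<^sup>+m. ennreal (norm (U m x * Y x)) \<partial>lattice) \<le> ennreal (k0 * norm (w x))" .
      qed
      also have "\<dots> < \<infinity>"
      proof -
        have "integrable lborel (\<lambda>x. k0 * norm (w x))" using L2c_integrable[OF w] by simp
        moreover have "AE x in lborel. 0 \<le> k0 * norm (w x)" using decay_sum_nonneg[where 'n = 'n] by (auto simp: k0_def)
        ultimately show ?thesis by (simp add: nn_integral_eq_integral)
      qed
      finally show ?thesis .
    qed
    have Xs: "(\<integral>\<^sup>+m. ennreal (norm (X m)) \<partial>lattice) < \<infinity>"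
    proof (rule le_less_trans[OF nn_integral_mono UY])
      fix m
      have i: "integrable lborel (\<lambda>x. U m x * Y x) \<or> X m = 0" unfolding X_def using not_integrable_integral_eq by blast
      then show "ennreal (norm (X m)) \<le> (\<integral>\<^sup>+x. ennreal (norm (U m x * Y x)) \<partial>lborel)"
        unfolding X_def using integral_norm_bound_ennreal by fastforce
    qed
    (* summing over \<open>m\<close> replaces the sampled character by the character at \<open>x\<close> *)
    have sampled: "(LINT m|lattice. ee (\<xi> \<bullet> ((1 / real q) *\<^sub>R of_int_vec m)) * X m) = cnj (fourier_R w (\<xi> + of_int_vec n))" if "L \<xi> \<noteq> 0" for \<xi>
    proof -
      have \<xi>: "\<bar>\<xi> $ i\<bar> < real q / 8" for i using L_support[OF that, of i] q_large by simp
      have "(LINT m|lattice. ee (\<xi> \<bullet> ((1 / real q) *\<^sub>R of_int_vec m)) * X m) =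
          (LINT m|lattice. LINT x|lborel. ee (\<xi> \<bullet> ((1 / real q) *\<^sub>R of_int_vec m)) * (U m x * Y x))"
        unfolding X_def by simp
      also have "\<dots> = (LINT x|lborel. LINT m|lattice. ee (\<xi> \<bullet> ((1 / real q) *\<^sub>R of_int_vec m)) * (U m x * Y x))"
      proof (rule integral_swap[OF lattice.sigma_finite_measure_axioms sigma_finite_lborel])
        show "(\<lambda>(m, x). ee (\<xi> \<bullet> ((1 / real q) *\<^sub>R of_int_vec m)) * (U m x * Y x)) \<in> borel_measurable (lattice \<Otimes>\<^sub>M lborel)"
          by (intro measurable_lattice_split) measurable
      qed (use UY in \<open>simp add: norm_mult\<close>)
      also have "\<dots> = (LINT x|lborel. ee (\<xi> \<bullet> x) * Y x)"
      proof (intro Bochner_Integration.integral_cong refl)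
        fix x :: "real^'n"
        have "(LINT m|lattice. ee (\<xi> \<bullet> ((1 / real q) *\<^sub>R of_int_vec m)) * (U m x * Y x)) =
          (LINT m|lattice. (kernel (real q *\<^sub>R x - of_int_vec m) * ee (\<xi> \<bullet> ((1 / real q) *\<^sub>R of_int_vec m))) * Y x)"
          by (intro Bochner_Integration.integral_cong refl) (simp only: U_def mult_ac)
        also have "\<dots> = (LINT m|lattice. kernel (real q *\<^sub>R x - of_int_vec m) * ee (\<xi> \<bullet> ((1 / real q) *\<^sub>R of_int_vec m))) * Y x"
          by (rule integral_mult_left_zero)
        also have "\<dots> = ee (\<xi> \<bullet> x) * Y x" unfolding scaled_sampling[OF q_pos \<xi>] ..
        finally show "(LINT m|lattice. ee (\<xi> \<bullet> ((1 / real q) *\<^sub>R of_int_vec m)) * (U m x * Y x)) = ee (\<xi> \<bullet> x) * Y x" .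
      qed
      also have "\<dots> = (LINT x|lborel. cnj (w x * ee (- ((\<xi> + of_int_vec n) \<bullet> x))))"
        by (intro Bochner_Integration.integral_cong refl) (simp add: Y_def inner_add_left ee_add mult_ac)
      also have "\<dots> = cnj (fourier_R w (\<xi> + of_int_vec n))"
        unfolding fourier_R_eq by (rule Bochner_Integration.integral_cnj)
      finally show ?thesis .
    qed
    have hn: "(\<lambda>\<xi>. h (\<xi> + of_int_vec n)) \<in> Lp lborel 2" using Lp_2_translate(1)[OF h2, of "- of_int_vec n"] by simp
    have hL: "integrable lborel (\<lambda>\<xi>. h (\<xi> + of_int_vec n) * L \<xi>)" by (rule Lp_2_mult_integrable(3)[OF hn L_L2])
    have "(LINT m|lattice. fourier_T (V f m) n * cnj (fourier_T (wm m) n)) = (LINT m|lattice. \<phi> n * (cf m * X m))"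
      unfolding V X by (simp only: mult.assoc)
    also have "\<dots> = \<phi> n * (LINT m|lattice. cf m * X m)" by simp
    also have "(LINT m|lattice. cf m * X m) = (LINT m|lattice. LINT \<xi>|lborel. h (\<xi> + of_int_vec n) * L \<xi> * (ee (\<xi> \<bullet> ((1 / real q) *\<^sub>R of_int_vec m)) * X m))"
    proof (intro Bochner_Integration.integral_cong refl)
      fix m
      have "cf m * X m = (LINT \<xi>|lborel. h (\<xi> + of_int_vec n) * (L \<xi> * ee (\<xi> \<bullet> ((1 / real q) *\<^sub>R of_int_vec m))) * X m)"
        unfolding cf_def by (rule integral_mult_left_zero[symmetric])
      then show "cf m * X m = (LINT \<xi>|lborel. h (\<xi> + of_int_vec n) * L \<xi> * (ee (\<xi> \<bullet> ((1 / real q) *\<^sub>R of_int_vec m)) * X m))"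
        by (simp only: mult.assoc)
    qed
    also have "\<dots> = (LINT \<xi>|lborel. LINT m|lattice. h (\<xi> + of_int_vec n) * L \<xi> * (ee (\<xi> \<bullet> ((1 / real q) *\<^sub>R of_int_vec m)) * X m))"
    proof (rule integral_swap[OF lattice.sigma_finite_measure_axioms sigma_finite_lborel])
      show "(\<lambda>(m, \<xi>). h (\<xi> + of_int_vec n) * L \<xi> * (ee (\<xi> \<bullet> ((1 / real q) *\<^sub>R of_int_vec m)) * X m)) \<in> borel_measurable (lattice \<Otimes>\<^sub>M lborel)"
        by (intro measurable_lattice_split) measurable
      have "(\<integral>\<^sup>+m. \<integral>\<^sup>+\<xi>. ennreal (norm (h (\<xi> + of_int_vec n) * L \<xi> * (ee (\<xi> \<bullet> ((1 / real q) *\<^sub>R of_int_vec m)) * X m))) \<partial>lborel \<partial>lattice)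
         = (\<integral>\<^sup>+\<xi>. ennreal (norm (h (\<xi> + of_int_vec n) * L \<xi>)) \<partial>lborel) * (\<integral>\<^sup>+m. ennreal (norm (X m)) \<partial>lattice)"
        by (simp add: norm_mult ennreal_mult nn_integral_multc nn_integral_cmult)
      also have "\<dots> < \<infinity>" using hL Xs by (simp add: integrable_iff_bounded ennreal_mult_less_top)
      finally show "(\<integral>\<^sup>+m. \<integral>\<^sup>+\<xi>. ennreal (norm (h (\<xi> + of_int_vec n) * L \<xi> * (ee (\<xi> \<bullet> ((1 / real q) *\<^sub>R of_int_vec m)) * X m))) \<partial>lborel \<partial>lattice) < \<infinity>" .
    qed
    also have "\<dots> = (LINT \<xi>|lborel. h (\<xi> + of_int_vec n) * L \<xi> * cnj (fourier_R w (\<xi> + of_int_vec n)))"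
    proof (intro Bochner_Integration.integral_cong refl)
      fix \<xi> :: "real^'n"
      have "(LINT m|lattice. h (\<xi> + of_int_vec n) * L \<xi> * (ee (\<xi> \<bullet> ((1 / real q) *\<^sub>R of_int_vec m)) * X m)) =
         h (\<xi> + of_int_vec n) * L \<xi> * (LINT m|lattice. ee (\<xi> \<bullet> ((1 / real q) *\<^sub>R of_int_vec m)) * X m)"
        by (rule integral_mult_right_zero)
      then show "(LINT m|lattice. h (\<xi> + of_int_vec n) * L \<xi> * (ee (\<xi> \<bullet> ((1 / real q) *\<^sub>R of_int_vec m)) * X m)) =
         h (\<xi> + of_int_vec n) * L \<xi> * cnj (fourier_R w (\<xi> + of_int_vec n))"
        using sampled[of \<xi>] by (cases "L \<xi> = 0") auto
    qed
    finally show "(LINT m|lattice. fourier_T (V f m) n * cnj (fourier_T (wm m) n)) =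
      \<phi> n * (LINT \<xi>|lborel. h (\<xi> + of_int_vec n) * L \<xi> * cnj (fourier_R w (\<xi> + of_int_vec n)))" .
  qed
  also have "\<dots> = (LINT n|lattice. LINT \<xi>|lborel. \<phi> n * L (\<xi> - of_int_vec n) * (h \<xi> * cnj (fourier_R w \<xi>)))"
  proof (intro Bochner_Integration.integral_cong refl)
    fix n
    have "(LINT \<xi>|lborel. h (\<xi> + of_int_vec n) * L \<xi> * cnj (fourier_R w (\<xi> + of_int_vec n))) =
       (LINT \<xi>|lborel. h \<xi> * L (\<xi> - of_int_vec n) * cnj (fourier_R w \<xi>))"
      using integral_translate(1)[of "\<lambda>\<xi>. h (\<xi> + of_int_vec n) * L \<xi> * cnj (fourier_R w (\<xi> + of_int_vec n))" "of_int_vec n"] by simp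
    then have "\<phi> n * (LINT \<xi>|lborel. h (\<xi> + of_int_vec n) * L \<xi> * cnj (fourier_R w (\<xi> + of_int_vec n))) =
       (LINT \<xi>|lborel. \<phi> n * (h \<xi> * L (\<xi> - of_int_vec n) * cnj (fourier_R w \<xi>)))" by simp
    then show "\<phi> n * (LINT \<xi>|lborel. h (\<xi> + of_int_vec n) * L \<xi> * cnj (fourier_R w (\<xi> + of_int_vec n))) =
       (LINT \<xi>|lborel. \<phi> n * L (\<xi> - of_int_vec n) * (h \<xi> * cnj (fourier_R w \<xi>)))" by (simp only: mult_ac)
  qed
  also have "\<dots> = (LINT \<xi>|lborel. LINT n|lattice. \<phi> n * L (\<xi> - of_int_vec n) * (h \<xi> * cnj (fourier_R w \<xi>)))"
  proof (rule integral_swap[OF lattice.sigma_finite_measure_axioms sigma_finite_lborel])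
    show "(\<lambda>(n, \<xi>). \<phi> n * L (\<xi> - of_int_vec n) * (h \<xi> * cnj (fourier_R w \<xi>))) \<in> borel_measurable (lattice \<Otimes>\<^sub>M lborel)"
      by (intro measurable_lattice_split) measurable
    obtain C where C: "C \<ge> 0" "\<And>\<xi>. integrable lattice (\<lambda>n. norm (L (\<xi> - of_int_vec n)))"
      "\<And>\<xi>. (LINT n|lattice. norm (L (\<xi> - of_int_vec n))) \<le> C" using L_lattice_sum by blast
    have g: "integrable lborel (\<lambda>\<xi>. h \<xi> * cnj (fourier_R w \<xi>))"
      by (rule Lp_2_mult_integrable(2)[OF h2 plancherel_L2c(1)[OF w]])
    have "(\<integral>\<^sup>+n. \<integral>\<^sup>+\<xi>. ennreal (norm (\<phi> n * L (\<xi> - of_int_vec n) * (h \<xi> * cnj (fourier_R w \<xi>)))) \<partial>lborel \<partial>lattice)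
       = (\<integral>\<^sup>+\<xi>. \<integral>\<^sup>+n. ennreal (norm (\<phi> n * L (\<xi> - of_int_vec n) * (h \<xi> * cnj (fourier_R w \<xi>)))) \<partial>lattice \<partial>lborel)"
      by (rule nn_integral_lattice_swap[OF sigma_finite_lborel]) measurable
    also have "\<dots> \<le> (\<integral>\<^sup>+\<xi>. ennreal (D * C * norm (h \<xi> * cnj (fourier_R w \<xi>))) \<partial>lborel)"
    proof (rule nn_integral_mono)
      fix \<xi> :: "real^'n"
      have "(\<integral>\<^sup>+n. ennreal (norm (\<phi> n * L (\<xi> - of_int_vec n) * (h \<xi> * cnj (fourier_R w \<xi>)))) \<partial>lattice)
         \<le> (\<integral>\<^sup>+n. ennreal (norm (L (\<xi> - of_int_vec n)) * (D * norm (h \<xi> * cnj (fourier_R w \<xi>)))) \<partial>lattice)"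
      proof (intro nn_integral_mono ennreal_leI)
        fix n
        have "norm (\<phi> n) * (norm (L (\<xi> - of_int_vec n)) * norm (h \<xi> * cnj (fourier_R w \<xi>))) \<le> D * (norm (L (\<xi> - of_int_vec n)) * norm (h \<xi> * cnj (fourier_R w \<xi>)))"
          by (intro mult_right_mono \<phi>_bound) simp
        then show "norm (\<phi> n * L (\<xi> - of_int_vec n) * (h \<xi> * cnj (fourier_R w \<xi>))) \<le> norm (L (\<xi> - of_int_vec n)) * (D * norm (h \<xi> * cnj (fourier_R w \<xi>)))"
          by (simp add: norm_mult mult_ac)
      qed
      also have "\<dots> = ennreal (LINT n|lattice. norm (L (\<xi> - of_int_vec n)) * (D * norm (h \<xi> * cnj (fourier_R w \<xi>))))"
        by (rule nn_integral_eq_integral) (use C(2) D_nonneg in auto)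
      also have "\<dots> \<le> ennreal (D * C * norm (h \<xi> * cnj (fourier_R w \<xi>)))"
      proof (rule ennreal_leI)
        have "(LINT n|lattice. norm (L (\<xi> - of_int_vec n)) * (D * norm (h \<xi> * cnj (fourier_R w \<xi>)))) =
          (LINT n|lattice. norm (L (\<xi> - of_int_vec n))) * (D * norm (h \<xi> * cnj (fourier_R w \<xi>)))" by (rule integral_mult_left_zero)
        also have "\<dots> \<le> C * (D * norm (h \<xi> * cnj (fourier_R w \<xi>)))" using D_nonneg by (intro mult_right_mono C(3)) auto
        finally show "(LINT n|lattice. norm (L (\<xi> - of_int_vec n)) * (D * norm (h \<xi> * cnj (fourier_R w \<xi>)))) \<le> D * C * norm (h \<xi> * cnj (fourier_R w \<xi>))"
          by (simp only: mult_ac)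
      qed
      finally show "(\<integral>\<^sup>+n. ennreal (norm (\<phi> n * L (\<xi> - of_int_vec n) * (h \<xi> * cnj (fourier_R w \<xi>)))) \<partial>lattice)
         \<le> ennreal (D * C * norm (h \<xi> * cnj (fourier_R w \<xi>)))" .
    qed
    also have "\<dots> < \<infinity>"
    proof -
      have "integrable lborel (\<lambda>\<xi>. D * C * norm (h \<xi> * cnj (fourier_R w \<xi>)))" by (intro integrable_mult_right integrable_norm g)
      moreover have "AE \<xi> in lborel. 0 \<le> D * C * norm (h \<xi> * cnj (fourier_R w \<xi>))" using D_nonneg C(1) by simp
      ultimately show ?thesis by (simp add: nn_integral_eq_integral)
    qed
    finally show "(\<integral>\<^sup>+n. \<integral>\<^sup>+\<xi>. ennreal (norm (\<phi> n * L (\<xi> - of_int_vec n) * (h \<xi> * cnj (fourier_R w \<xi>)))) \<partial>lborel \<partial>lattice) < \<infinity>" .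
  qed
  also have "\<dots> = (LINT \<xi>|lborel. WL \<xi> * h \<xi> * cnj (fourier_R w \<xi>))"
    unfolding WL_def integral_mult_left_zero by (simp only: mult.assoc)
  finally show ?thesis .
qed

lemma TW_plancherel:
  assumes f2: "f \<in> Lp lborel 2" and fp: "f \<in> Lp lborel p" and P: "plancherel_R f h"
  shows "plancherel_R (TW f) (\<lambda>\<xi>. WL \<xi> * h \<xi>)"
proof (rule plancherel_R_from_pairing[OF TW_measurable[OF fp] _ TW_pairing[OF f2 fp P]])
  obtain C where C: "C \<ge> 0" "\<And>\<xi>. norm (WL \<xi>) \<le> C" using WL_bounded by blast
  have h2: "h \<in> Lp lborel 2" using P by (simp add: plancherel_R_def)
  have [measurable]: "h \<in> borel_measurable borel" using h2 by (rule Lp_borel)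
  show "(\<lambda>\<xi>. WL \<xi> * h \<xi>) \<in> Lp lborel 2"
    by (rule Lp_bounded_by[OF Lp_cmult[OF h2, of "of_real C"]])
       (use C in \<open>auto simp: norm_mult intro!: mult_right_mono\<close>)
qed

end

section \<open>Translation invariance\<close>

text \<open>Bounding the values as well as the support puts the cut-off function into all Lebesgue spaces at once.\<close>

definition cutoff :: "real \<Rightarrow> (real^'n \<Rightarrow> complex) \<Rightarrow> real^'n \<Rightarrow> complex" where
  "cutoff R f x = (if norm x \<le> R \<and> norm (f x) \<le> R then f x else 0)"

lemma cutoff_Lp:
  fixes f :: "real^'n \<Rightarrow> complex"
  assumes "f \<in> borel_measurable borel" "r > 0"
  shows "cutoff R f \<in> Lp lborel r"
proof -
  note [measurable] = assms(1)
  have "cutoff R f \<in> borel_measurable borel" unfolding cutoff_def[abs_def] by measurable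
  then show ?thesis by (rule bounded_support_Lp[of _ "max R 0" R]) (auto simp: cutoff_def assms(2))
qed

lemma cutoff_tendsto:
  fixes f :: "real^'n \<Rightarrow> complex"
  assumes f: "f \<in> Lp lborel r" and r: "r > 0"
  shows "(\<lambda>N. LINT x|lborel. norm (f x - cutoff (real N) f x) powr r) \<longlonglongrightarrow> 0"
proof -
  have [measurable]: "f \<in> borel_measurable borel" using Lp_measurable[OF f] by simp
  have m [measurable]: "cutoff R f \<in> borel_measurable borel" for R unfolding cutoff_def[abs_def] by measurable
  have "(\<lambda>N. LINT x|lborel. norm (f x - cutoff (real N) f x) powr r) \<longlonglongrightarrow> (LINT x|(lborel :: (real^'n) measure). 0)"
  proof (rule integral_dominated_convergence)
    show "integrable lborel (\<lambda>x. norm (f x) powr r)" by (rule Lp_integrable[OF f])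
    show "AE x in lborel. norm (norm (f x - cutoff (real N) f x) powr r) \<le> norm (f x) powr r" for N
      by (auto simp: cutoff_def)
    show "AE x in lborel. (\<lambda>N. norm (f x - cutoff (real N) f x) powr r) \<longlonglongrightarrow> 0"
    proof (rule AE_I2)
      fix x :: "real^'n"
      obtain N0 :: nat where N0: "max (norm x) (norm (f x)) \<le> real N0" using real_arch_simple by blast
      have "\<forall>\<^sub>F N in sequentially. norm (f x - cutoff (real N) f x) powr r = 0"
        using N0 by (intro eventually_sequentiallyI[of N0]) (auto simp: cutoff_def)
      then show "(\<lambda>N. norm (f x - cutoff (real N) f x) powr r) \<longlonglongrightarrow> 0" by (rule tendsto_eventually)
    qed
  qed measurable
  then show ?thesis by simp
qed

lemma plancherel_R_cong_target:
  assumes P: "plancherel_R u v" and eq: "AE \<xi> in lborel. v \<xi> = v' \<xi>" and m: "v' \<in> borel_measurable borel"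
  shows "plancherel_R u v'"
proof -
  have L: "u \<in> Lp lborel 2" "v \<in> Lp lborel 2" using P by (auto simp: plancherel_R_eq)
  have [measurable]: "u \<in> borel_measurable borel" "v \<in> borel_measurable borel" using L[THEN Lp_measurable] by auto
  note [measurable] = m
  have L': "v' \<in> Lp lborel 2" by (rule Lp_bounded_by[OF L(2)]) (use eq in \<open>auto elim!: eventually_mono\<close>)
  have "(LINT \<xi>|lborel. (norm (fourier_R (trunc R u) \<xi> - v \<xi>))\<^sup>2) = (LINT \<xi>|lborel. (norm (fourier_R (trunc R u) \<xi> - v' \<xi>))\<^sup>2)" for R
    by (rule integral_cong_AE) (use eq in \<open>auto elim!: eventually_mono\<close>)
  then show ?thesis using P L L' by (simp add: plancherel_R_eq)
qed

context transference
begin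

text \<open>Both sides have the same transform.\<close>

lemma TW_translate_L2:
  assumes f2: "f \<in> Lp lborel 2" and fp: "f \<in> Lp lborel p" and P: "plancherel_R f h"
  shows "AE x in lborel. TW (\<lambda>x. f (x - y)) x = TW f (x - y)"
proof (rule plancherel_R_unique_source)
  show "plancherel_R (TW (\<lambda>x. f (x - y))) (\<lambda>\<xi>. WL \<xi> * (ee (- (\<xi> \<bullet> y)) * h \<xi>))"
    by (rule TW_plancherel[OF Lp_translate(1)[OF f2] Lp_translate(1)[OF fp] plancherel_R_translate[OF P]])
  show "plancherel_R (\<lambda>x. TW f (x - y)) (\<lambda>\<xi>. ee (- (\<xi> \<bullet> y)) * (WL \<xi> * h \<xi>))"
    by (rule plancherel_R_translate[OF TW_plancherel[OF f2 fp P]])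
qed (simp add: mult_ac)

text \<open>Both sides of the identity depend continuously, in measure, on \<open>f\<close> in \<open>L\<^sup>p\<close>, so the case of
  square-integrable functions suffices. Existence of Plancherel transforms is assumed here because it is part of what it
  means for \<open>\<Lambda>\<close> to be a multiplier.\<close>

lemma TW_translate:
  assumes ex: "\<And>f :: real^'n \<Rightarrow> complex. f \<in> Lp lborel 2 \<Longrightarrow> f \<in> Lp lborel p \<Longrightarrow> \<exists>h. plancherel_R f h"
    and f: "f \<in> Lp lborel p"
  shows "AE x in lborel. TW (\<lambda>x. f (x - y)) x = TW f (x - y)"
proof -
  have fm: "f \<in> borel_measurable borel" using f by (rule Lp_borel)
  have fy: "(\<lambda>x. f (x - y)) \<in> Lp lborel p" by (rule Lp_translate(1)[OF f])
  define d where "d x = TW (\<lambda>x. f (x - y)) x - TW f (x - y)" for x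
  have shm [measurable]: "(\<lambda>x. x - y) \<in> borel_measurable (borel :: (real^'n) measure)" by measurable
  have dm [measurable]: "d \<in> borel_measurable borel"
    unfolding d_def[abs_def]
    by (intro borel_measurable_diff TW_measurable fy measurable_compose[OF shm TW_measurable[OF f]])
  define C where "C t = (weak_const * c * K) powr p / (t / 2) powr p" for t
  define \<rho> where "\<rho> N = (LINT x|lborel. norm (f x - cutoff (real N) f x) powr p)" for N
  have le: "emeasure lborel {x. norm (d x) > t} \<le> ennreal (2 * (C t * \<rho> N))" if t: "t > 0" for t N
  proof -
    define g r where "g = cutoff (real N) f" and "r = (\<lambda>x. f x - g x)"
    have g: "g \<in> Lp lborel 2" "g \<in> Lp lborel p" unfolding g_def by (auto intro!: cutoff_Lp fm p_pos)
    have r: "r \<in> Lp lborel p" unfolding r_def by (rule Lp_diff[OF f g(2) p_pos])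
    have gy: "(\<lambda>x. g (x - y)) \<in> Lp lborel p" and ry: "(\<lambda>x. r (x - y)) \<in> Lp lborel p"
      by (intro Lp_translate g r)+
    have e1: "(\<lambda>x. 1 * g (x - y) + 1 * r (x - y)) = (\<lambda>x. f (x - y))" and e2: "(\<lambda>x. 1 * g x + 1 * r x) = f"
      by (simp_all add: r_def fun_eq_iff)
    obtain h where h: "plancherel_R g h" using ex[OF g] by blast
    have "AE x in lborel. d x = TW (\<lambda>x. r (x - y)) x - TW r (x - y)"
      using TW_linear[OF gy ry, of 1 1, unfolded e1] AE_translate[OF TW_linear[OF g(2) r, of 1 1, unfolded e2], of y]
        TW_translate_L2[OF g h, of y]
      by eventually_elim (simp add: d_def)
    then have "emeasure lborel {x. norm (d x) > t} \<le> emeasure lborel ({x. norm (TW (\<lambda>x. r (x - y)) x) > t / 2} \<union> {x. norm (TW r (x - y)) > t / 2})"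
    proof (intro emeasure_mono_AE)
      note [measurable] = TW_measurable[OF ry] measurable_compose[OF shm TW_measurable[OF r]]
      show "{x. norm (TW (\<lambda>x. r (x - y)) x) > t / 2} \<union> {x. norm (TW r (x - y)) > t / 2} \<in> sets lborel" by measurable
      assume "AE x in lborel. d x = TW (\<lambda>x. r (x - y)) x - TW r (x - y)"
      then show "AE x in lborel. x \<in> {x. norm (d x) > t} \<longrightarrow> x \<in> {x. norm (TW (\<lambda>x. r (x - y)) x) > t / 2} \<union> {x. norm (TW r (x - y)) > t / 2}"
      proof eventually_elim
        case (elim x)
        then show ?case using norm_triangle_ineq4[of "TW (\<lambda>x. r (x - y)) x" "TW r (x - y)"] by auto
      qed
    qed
    also have "\<dots> \<le> emeasure lborel {x. norm (TW (\<lambda>x. r (x - y)) x) > t / 2} + emeasure lborel {x. norm (TW r (x - y)) > t / 2}"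
    proof (rule emeasure_subadditive)
      note [measurable] = TW_measurable[OF ry] measurable_compose[OF shm TW_measurable[OF r]]
      show "{x. norm (TW (\<lambda>x. r (x - y)) x) > t / 2} \<in> sets lborel" "{x. norm (TW r (x - y)) > t / 2} \<in> sets lborel"
        by measurable
    qed
    also have "\<dots> \<le> ennreal (C t * \<rho> N) + ennreal (C t * \<rho> N)"
    proof (rule add_mono)
      show "emeasure lborel {x. norm (TW (\<lambda>x. r (x - y)) x) > t / 2} \<le> ennreal (C t * \<rho> N)"
        using TW_weak[OF ry, of "t / 2"] t Lp_translate(2)[OF r, of y] by (simp add: C_def \<rho>_def r_def g_def)
      have "emeasure lborel {x. norm (TW r (x - y)) > t / 2} = emeasure lborel {x. norm (TW r x) > t / 2}"
      proof -
        note [measurable] = TW_measurable[OF r]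
        have "emeasure (distr lborel borel (\<lambda>x::real^'n. x - y)) {x. norm (TW r x) > t / 2} = emeasure lborel {x. norm (TW r (x - y)) > t / 2}"
          by (subst emeasure_distr) (auto simp: vimage_def)
        then show ?thesis unfolding distr_lborel_minus by simp
      qed
      then show "emeasure lborel {x. norm (TW r (x - y)) > t / 2} \<le> ennreal (C t * \<rho> N)"
        using TW_weak[OF r, of "t / 2"] t by (simp add: C_def \<rho>_def r_def g_def)
    qed
    also have "\<dots> = ennreal (2 * (C t * \<rho> N))"
      by (subst ennreal_plus[symmetric]) (auto simp: C_def \<rho>_def)
    finally show ?thesis .
  qed
  have "AE x in lborel. d x = 0"
  proof (rule weak_zero_AE)
    fix t :: real assume t: "t > 0"
    have "\<rho> \<longlonglongrightarrow> 0" unfolding \<rho>_def[abs_def] by (rule cutoff_tendsto[OF f p_pos])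
    then have "(\<lambda>N. 2 * (C t * \<rho> N)) \<longlonglongrightarrow> 2 * (C t * 0)" by (intro tendsto_intros)
    then have "(\<lambda>N. ennreal (2 * (C t * \<rho> N))) \<longlonglongrightarrow> ennreal (2 * (C t * 0))" by (rule tendsto_ennrealI)
    then have "emeasure lborel {x. norm (d x) > t} \<le> ennreal (2 * (C t * 0))"
      using le[OF t] by (intro LIMSEQ_le_const) auto
    then show "emeasure lborel {x \<in> space lborel. norm (d x) > t} = 0" by simp
  qed simp
  then show ?thesis by eventually_elim (simp add: d_def)
qed

theorem TW_admissible:
  assumes ex: "\<And>f :: real^'n \<Rightarrow> complex. f \<in> Lp lborel 2 \<Longrightarrow> f \<in> Lp lborel p \<Longrightarrow> \<exists>h. plancherel_R f h"
    and W: "W' \<in> borel_measurable borel" "AE \<xi> in lborel. WL \<xi> = W' \<xi>"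
  shows "realizes Euclid p W' TW" "translation_invariant Euclid p TW" "weak_bound Euclid p TW (weak_const * c * K)"
proof -
  note [measurable] = W(1)
  show "realizes Euclid p W' TW"
    unfolding realizes_def Euclid_simps
  proof (intro conjI ballI allI)
    fix f g :: "real^'n \<Rightarrow> complex" and a b assume "f \<in> Lp lborel p" "g \<in> Lp lborel p"
    then show "AE x in lborel. TW (\<lambda>x. a * f x + b * g x) x = a * TW f x + b * TW g x" by (rule TW_linear)
  next
    fix f :: "real^'n \<Rightarrow> complex" assume "f \<in> Lp lborel 2 \<inter> Lp lborel p"
    then have f: "f \<in> Lp lborel 2" "f \<in> Lp lborel p" by auto
    then obtain h where h: "plancherel_R f h" using ex by blast
    have [measurable]: "h \<in> borel_measurable borel" using h by (auto simp: plancherel_R_def intro: Lp_borel)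
    have "plancherel_R (TW f) (\<lambda>\<xi>. W' \<xi> * h \<xi>)"
      by (rule plancherel_R_cong_target[OF TW_plancherel[OF f h]]) (use W(2) in \<open>auto elim!: eventually_mono\<close>)
    then show "\<exists>h. plancherel_R f h \<and> plancherel_R (TW f) (\<lambda>\<xi>. W' \<xi> * h \<xi>)" using h by blast
  qed
  show "translation_invariant Euclid p TW"
    unfolding translation_invariant_def Euclid_simps using TW_translate[OF ex] by blast
  have cK: "weak_const * c * K \<ge> 0" using weak_const_nonneg c_nonneg K_nonneg by simp
  have w: "emeasure lborel {x. norm (TW f x) > t} \<le> ennreal ((weak_const * c * K) powr p / t powr p * Lp_norm lborel p f powr p)"
    if "f \<in> Lp lborel p" "t > 0" for f t
    using TW_weak[OF that] by (simp add: Lp_norm_powr[OF p_pos])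
  show "weak_bound Euclid p TW (weak_const * c * K)"
    unfolding weak_bound_def Euclid_simps
  proof (intro conjI ballI allI impI cK)
    fix f :: "real^'n \<Rightarrow> complex" assume f: "f \<in> Lp lborel p"
    define A where "A = weak_const * c * K * Lp_norm lborel p f"
    have n0: "Lp_norm lborel p f \<ge> 0" by (simp add: Lp_norm_def)
    have "A \<ge> 0" unfolding A_def using cK n0 by simp
    moreover have "A powr p = (weak_const * c * K) powr p * Lp_norm lborel p f powr p"
      unfolding A_def using cK n0 by (simp add: powr_mult)
    ultimately show "TW f \<in> weak_Lp lborel p"
      unfolding weak_Lp_def using TW_measurable[OF f] w[OF f]
      by (auto intro!: exI[of _ A] simp: times_divide_eq_left)
  next
    fix f :: "real^'n \<Rightarrow> complex" and t :: real assume "f \<in> Lp lborel p" "t > 0"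
    then show "emeasure lborel {x \<in> space lborel. norm (TW f x) > t} \<le> ennreal ((weak_const * c * K) powr p / t powr p * Lp_norm lborel p f powr p)"
      using w by simp
  qed
qed

end

section \<open>The transference theorem\<close>

text \<open>Unconditional and absolute summability coincide for complex series. Where they fail, both sides are 0 by convention.\<close>

lemma infsum_lattice_eq_integral:
  fixes f :: "int^'n \<Rightarrow> complex"
  shows "(\<Sum>\<^sub>\<infinity>n\<in>UNIV. f n) = (LINT n|lattice. f n)"
proof (cases "f summable_on UNIV")
  case True
  then have "(\<lambda>n. norm (f n)) summable_on UNIV" by (simp add: summable_on_iff_abs_summable_on_complex)
  then have "Infinite_Set_Sum.abs_summable_on f UNIV" by (simp add: abs_summable_equivalent)
  from infsetsum_infsum[OF this] show ?thesis by (simp add: infsetsum_def)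
next
  case False
  have "\<not> integrable lattice f"
  proof
    assume "integrable lattice f"
    then have "Infinite_Set_Sum.abs_summable_on f UNIV" by (simp add: Infinite_Set_Sum.abs_summable_on_def)
    then have "(\<lambda>n. norm (f n)) summable_on UNIV" by (simp add: abs_summable_equivalent)
    then show False using False by (simp add: summable_on_iff_abs_summable_on_complex)
  qed
  then show ?thesis using False by (simp add: infsum_not_exists not_integrable_integral_eq)
qed

text \<open>By the Lindelof property countably many of the open sets in the definition of the support cover its complement.\<close>

lemma ess_support_AE:
  fixes f :: "real^'n \<Rightarrow> complex"
  assumes "ess_support f \<subseteq> S"
  shows "AE x in lborel. x \<notin> S \<longrightarrow> f x = 0"
proof -
  define \<U> where "\<U> = {U. open U \<and> (AE x in lborel. x \<in> U \<longrightarrow> f x = 0)}"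
  obtain \<V> where V: "\<V> \<subseteq> \<U>" "countable \<V>" "\<Union>\<V> = \<Union>\<U>"
    by (rule Lindelof[of \<U>]) (auto simp: \<U>_def)
  have "AE x in lborel. \<forall>U\<in>\<V>. x \<in> U \<longrightarrow> f x = 0"
    using V by (subst AE_ball_countable) (auto simp: \<U>_def)
  then show ?thesis
  proof eventually_elim
    case (elim x)
    have "- S \<subseteq> \<Union>\<V>" using assms V(3) by (auto simp: ess_support_def \<U>_def)
    then show ?case using elim by blast
  qed
qed

text \<open>Infima are taken one factor at a time; a factor 0 needs separate treatment since it cannot be divided out.\<close>

lemma le_mult_Inf_Inf:
  fixes x C :: real
  assumes "A \<noteq> {}" "B \<noteq> {}" "\<And>a. a \<in> A \<Longrightarrow> 0 \<le> a" "\<And>b. b \<in> B \<Longrightarrow> 0 \<le> b" "C \<ge> 0"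
    and le: "\<And>a b. a \<in> A \<Longrightarrow> b \<in> B \<Longrightarrow> x \<le> C * a * b"
  shows "x \<le> C * Inf A * Inf B"
proof -
  have one: "y \<le> k * Inf E" if "E \<noteq> {}" "k \<ge> 0" "\<And>e. e \<in> E \<Longrightarrow> y \<le> k * e" for y k and E :: "real set"
  proof (cases "k = 0")
    case True
    then show ?thesis using that by auto
  next
    case False
    then have k: "k > 0" using that by simp
    have "y / k \<le> Inf E" using that k by (intro cInf_greatest) (auto simp: field_simps)
    then show ?thesis using k by (simp add: field_simps)
  qed
  have "x \<le> (C * Inf B) * Inf A"
  proof (rule one[OF assms(1)])
    show "C * Inf B \<ge> 0" using assms(2,4,5) by (intro mult_nonneg_nonneg cInf_greatest) auto
    fix a assume a: "a \<in> A"
    have "x \<le> (C * a) * Inf B" using assms(3,5) a le by (intro one assms(2)) auto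
    then show "x \<le> C * Inf B * a" by (simp only: mult_ac)
  qed
  then show ?thesis by (simp only: mult_ac)
qed

theorem theorem3p1:
  fixes p M :: real and \<Lambda> :: "real^'n \<Rightarrow> complex"
  assumes "1 < p"
    and "\<Lambda> \<in> Mp Euclid p"
    and "M > 0"
    and "ess_support \<Lambda> \<subseteq> cbox (\<chi> i. - M) (\<chi> i. M)"
  shows "\<exists>C::real. \<forall>\<phi> \<in> Mpw Torus p.
           W \<phi> \<Lambda> \<in> Mpw Euclid p \<and>
           Mpw_norm Euclid p (W \<phi> \<Lambda>) \<le> C * Mpw_norm Torus p \<phi> * Mp_norm Euclid p \<Lambda>"
proof -
  have "\<Lambda> \<in> Linf lborel" using assms(2) by (simp add: Mp_def Euclid_simps)
  then obtain B0 where \<Lambda>m [measurable]: "\<Lambda> \<in> borel_measurable borel" and B0: "AE \<xi> in lborel. norm (\<Lambda> \<xi>) \<le> B0"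
    by (auto simp: Linf_def)
  obtain T0 K0 where T0: "realizes Euclid p \<Lambda> T0" "strong_bound Euclid p T0 K0" using assms(2) by (auto simp: Mp_def)
  define Q where "Q = (cbox (\<chi> i. - M) (\<chi> i. M) :: (real^'n) set)"
  have [measurable]: "Q \<in> sets borel" by (simp add: Q_def)
  (* a representative of \<open>\<Lambda>\<close> for which boundedness and support hold at every point *)
  define L where "L \<xi> = (if \<xi> \<in> Q \<and> norm (\<Lambda> \<xi>) \<le> max B0 0 then \<Lambda> \<xi> else 0)" for \<xi>
  have Lm [measurable]: "L \<in> borel_measurable borel" unfolding L_def[abs_def] by measurable
  have AE: "AE \<xi> in lborel. \<Lambda> \<xi> = L \<xi>"
    using B0 ess_support_AE[OF assms(4)] by eventually_elim (auto simp: L_def Q_def)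
  obtain q :: nat where q: "8 * M < real q" using reals_Archimedean2 by blast
  interpret bl: band_limited L M "max B0 0" q
  proof
    show "norm (L \<xi>) \<le> max B0 0" for \<xi> by (auto simp: L_def)
    show "\<bar>\<xi> $ i\<bar> \<le> M" if "L \<xi> \<noteq> 0" for \<xi> i
    proof -
      have "\<xi> \<in> Q" using that by (auto simp: L_def split: if_splits)
      then have "- M \<le> \<xi> $ i" "\<xi> $ i \<le> M" by (auto simp: Q_def mem_box_cart)
      then show ?thesis by (simp add: abs_le_iff)
    qed
  qed (use assms q in auto)
  define C where "C = transference.weak_const TYPE('n) q p * (bl.\<Psi>_mass * bl.\<Psi>_sum)"
  have W_eq: "W \<phi> \<Lambda> = (\<lambda>\<xi>. LINT n|lattice. \<phi> n * \<Lambda> (\<xi> - of_int_vec n))" for \<phi>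
    unfolding W_def[abs_def] infsum_lattice_eq_integral ..
  have Wm: "W \<phi> \<Lambda> \<in> borel_measurable borel" for \<phi> unfolding W_eq by measurable
  have AE_shift: "AE \<xi> in lborel. \<forall>n. \<Lambda> (\<xi> - of_int_vec n) = L (\<xi> - of_int_vec n)"
    unfolding AE_all_countable by (intro allI AE_translate[OF AE])
  (* the bound for arbitrary admissible operators \<open>T\<close> and \<open>S\<close>; the constant involves neither of them *)
  have key: "W \<phi> \<Lambda> \<in> Linf lborel \<and> 0 \<le> C \<and> (\<exists>T'. realizes Euclid p (W \<phi> \<Lambda>) T' \<and> translation_invariant Euclid p T' \<and> weak_bound Euclid p T' (C * K' * K))"
    if T: "realizes Euclid p \<Lambda> T" "strong_bound Euclid p T K"
      and \<phi>: "\<phi> \<in> Linf (dual_haar Torus)" and S: "realizes Torus p \<phi> S" "weak_bound Torus p S K'" for T K \<phi> S K'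
  proof -
    obtain D where D: "\<And>n. norm (\<phi> n) \<le> D" using \<phi> by (auto simp: Linf_def Torus_simps AE_count_space)
    have K0: "K \<ge> 0" using T(2) by (simp add: strong_bound_def)
    interpret tr: transference L M "max B0 0" q p "bl.\<Psi>_mass * bl.\<Psi>_sum * K" K' D \<phi> S
    proof
      show "bl.\<Psi>_mass * bl.\<Psi>_sum * K \<ge> 0" using bl.\<Psi>_consts_nonneg K0 by simp
      show "(\<Sum>j\<in>J. norm (\<Sum>k\<in>A. a k * bl.\<kappa> (s + of_int_vec j - of_int_vec k)) powr p) \<le> (bl.\<Psi>_mass * bl.\<Psi>_sum * K) powr p * (\<Sum>k\<in>A. norm (a k) powr p)"
        if "finite A" "finite J" for A J a s
        using bl.discrete_convolution_finite[OF AE T less_imp_le[OF assms(1)] that] by (simp add: bl.\<kappa>_comb_def)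
    qed (use assms S D in auto)
    have ex: "\<exists>h. plancherel_R f h" if "f \<in> Lp lborel 2" "f \<in> Lp lborel p" for f :: "real^'n \<Rightarrow> complex"
      using T(1) that unfolding realizes_def Euclid_simps by blast
    have WL: "AE \<xi> in lborel. tr.WL \<xi> = W \<phi> \<Lambda> \<xi>"
      using AE_shift by eventually_elim (simp add: W_eq tr.WL_def)
    obtain CW where CW: "\<And>\<xi>. norm (tr.WL \<xi>) \<le> CW" using tr.WL_bounded by blast
    have "AE \<xi> in lborel. norm (W \<phi> \<Lambda> \<xi>) \<le> CW" using WL by eventually_elim (metis CW)
    then have "W \<phi> \<Lambda> \<in> Linf lborel" using Wm by (auto simp: Linf_def)
    moreover have "0 \<le> C" unfolding C_def using tr.weak_const_nonneg bl.\<Psi>_consts_nonneg by simp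
    moreover have "tr.weak_const * (bl.\<Psi>_mass * bl.\<Psi>_sum * K) * K' = C * K' * K" unfolding C_def by (simp only: mult_ac)
    ultimately show ?thesis using tr.TW_admissible[OF ex Wm WL] by metis
  qed
  show ?thesis
  proof (intro exI[of _ C] ballI conjI)
    fix \<phi> :: "int^'n \<Rightarrow> complex" assume "\<phi> \<in> Mpw Torus p"
    then obtain S0 K1 where \<phi>: "\<phi> \<in> Linf (dual_haar Torus)"
      and S0: "realizes Torus p \<phi> S0" "translation_invariant Torus p S0" "weak_bound Torus p S0 K1" by (auto simp: Mpw_def)
    note k0 = key[OF T0 \<phi> S0(1,3)]
    show "W \<phi> \<Lambda> \<in> Mpw Euclid p" using k0 by (auto simp: Mpw_def Euclid_simps)
    define AW where "AW = {K. \<exists>T. realizes Euclid p (W \<phi> \<Lambda>) T \<and> translation_invariant Euclid p T \<and> weak_bound Euclid p T K}"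
    have "Inf AW \<le> C * Inf {K. \<exists>S. realizes Torus p \<phi> S \<and> translation_invariant Torus p S \<and> weak_bound Torus p S K}
        * Inf {K. \<exists>T. realizes Euclid p \<Lambda> T \<and> strong_bound Euclid p T K}"
    proof (rule le_mult_Inf_Inf)
      fix a b assume "a \<in> {K. \<exists>S. realizes Torus p \<phi> S \<and> translation_invariant Torus p S \<and> weak_bound Torus p S K}"
        and "b \<in> {K. \<exists>T. realizes Euclid p \<Lambda> T \<and> strong_bound Euclid p T K}"
      then have "C * a * b \<in> AW" using key[OF _ _ \<phi>] unfolding AW_def by blast
      then show "Inf AW \<le> C * a * b"
        by (rule cInf_lower) (auto intro!: bdd_belowI[of _ 0] simp: AW_def weak_bound_def)
    qed (use T0 S0 k0 in \<open>auto simp: weak_bound_def strong_bound_def\<close>)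
    then show "Mpw_norm Euclid p (W \<phi> \<Lambda>) \<le> C * Mpw_norm Torus p \<phi> * Mp_norm Euclid p \<Lambda>"
      by (simp add: Mpw_norm_def Mp_norm_def AW_def)
  qed
qed

end
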